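(* Let $d\ge 2$ and let $s$ be an integer with $0<s<d$. Let $\mu\in\mathcal{M}_s$, let $K$ be an $s$-dimensional Calderón-Zygmund kernel on $\mathbb{R}^d$, and let $T$ be the Calderón-Zygmund operator associated to $K$. Suppose that $T$ is bounded in $L^2(\mu)$ and that $$\lim_{r\to 0}\alpha_{\mu,s}^{\mathrm{flat}}(B(x,r))=0\quad\text{for }\mu\text{-almost every }x\in\mathbb{R}^d.$$ Then $T$ exists in the sense of principal value, i.e. for every (finite) complex measure $\nu$ on $\mathbb{R}^d$, the limit $$\lim_{r\to 0}\int_{|x-y|>r}K(x-y)\,d\nu(y)$$ exists for $\mu$-almost every $x\in\mathbb{R}^d$.
   Context: "Measure" means a locally finite non-negative Borel measure on $\mathbb{R}^d$; $B(x,r)$ is the open ball. $\mathcal{M}_s$ is the set of measures $\mu$ with $\mu(B(x,r))\le r^s$ for all $x\in\mathbb{R}^d$, $r>0$. $s$-dimensional Calderón-Zygmund kernel: a function $K:\mathbb{R}^d\setminus\{0\}\to\mathbb{C}^d$ for which there is a constant $C_K>0$ such that for all $x,x'\in\mathbb{R}^d\setminus\{0\}$: (i) $|K(x)|\le C_K|x|^{-s}$; (ii) $K(-x)=-K(x)$; (iii) if $|x-x'|\le |x|/2$ then $|K(x)-K(x')|\le C_K|x-x'|/|x|^{s+1}$. $T$ is bounded in $L^2(\mu)$ if there is $C>0$ such that for all $f\in L^2(\mu)$, $$\sup_{\varepsilon>0}\int_{\mathbb{R}^d}\Bigl|\int_{\mathbb{R}^d\setminus B(x,\varepsilon)}K(x-y)f(y)\,d\mu(y)\Bigr|^2d\mu(x)\le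 C\|f\|_{L^2(\mu)}^2.$$ Fix a function $\varphi:[0,\infty)\to[0,\infty)$, $\varphi\in C^\infty$, with $\varphi\equiv 1$ on $[0,3)$ and $\operatorname{supp}\varphi\subset[0,4)$. $\mathrm{Lip}_0(U)$ is the set of Lipschitz functions with compact support in the open set $U$, and $\|f\|_{\mathrm{Lip}}=\sup_{x\ne y}|f(x)-f(y)|/|x-y|$. $\mathcal{G}(s,d)$ is the set of $s$-dimensional linear subspaces of $\mathbb{R}^d$, and $\mathcal{H}^s_{x+L}$ is $s$-dimensional Hausdorff measure restricted to the affine plane $x+L$. For $x\in\mathbb{R}^d$, $r>0$, $L\in\mathcal{G}(s,d)$ put $$\alpha_{\mu,L}(B(x,r))=\sup_{\substack{f\in\mathrm{Lip}_0(B(x,4r))\\ \|f\|_{\mathrm{Lip}}\le 1/r}}\Bigl|\frac1{r^s}\int_{\mathbb{R}^d}\varphi\Bigl(\frac{|y-x|}{r}\Bigr)f(y)\,d(\mu-c_{\mu,L}\mathcal{H}^s_{x+L})(y)\Bigr|,$$ where $c_{\mu,L}=\int\varphi(|y-x|/r)\,d\mu(y)\,\bigl[\int\varphi(|y-x|/r)\,d\mathcal{H}^s_{x+L}(y)\bigr]^{-1}$, and $$\alpha_{\mu,s}^{\mathrm{flat}}(B(x,r))=\inf_{L\in\mathcal{G}(s,d)}\alpha_{\mu,L}(B(x,r)).$$ *)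

theory Defs
  imports "HOL-Analysis.Analysis"
begin

section \<open>Measures of growth \<open>s\<close>\<close>

definition locally_finite_borel_measure :: "'a::euclidean_space measure \<Rightarrow> bool" where
  "locally_finite_borel_measure \<mu> \<longleftrightarrow>
     sets \<mu> = sets borel \<and> (\<forall>x. \<exists>r>0. emeasure \<mu> (ball x r) < \<infinity>)"

definition growth_measures :: "nat \<Rightarrow> 'a::euclidean_space measure set" where
  "growth_measures s = {\<mu>. locally_finite_borel_measure \<mu> \<and>
     (\<forall>x. \<forall>r>0. emeasure \<mu> (ball x r) \<le> ennreal (r ^ s))}"


section \<open>Calderon-Zygmund kernels and operators\<close>

text \<open>Kernels are total functions; the value at \<open>0\<close> is unconstrained and never used.\<close>

definition CZ_kernel :: "nat \<Rightarrow> (real^'n \<Rightarrow> complex^'n) \<Rightarrow> bool" where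
  "CZ_kernel s K \<longleftrightarrow> (\<exists>C>0. \<forall>x x'. x \<noteq> 0 \<longrightarrow> x' \<noteq> 0 \<longrightarrow>
     norm (K x) \<le> C / norm x ^ s \<and>
     K (- x) = - K x \<and>
     (norm (x - x') \<le> norm x / 2 \<longrightarrow>
        norm (K x - K x') \<le> C * norm (x - x') / norm x ^ (s + 1)))"

definition L2_functions :: "'a measure \<Rightarrow> ('a \<Rightarrow> complex) set" where
  "L2_functions \<mu> = {f \<in> borel_measurable \<mu>. integrable \<mu> (\<lambda>x. (norm (f x))\<^sup>2)}"

definition truncated_CZ ::
  "(real^'n \<Rightarrow> complex^'n) \<Rightarrow> (real^'n) measure \<Rightarrow> real \<Rightarrow> (real^'n \<Rightarrow> complex) \<Rightarrow> real^'n \<Rightarrow> complex^'n"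
where
  "truncated_CZ K \<mu> \<epsilon> f x = (LINT y:(- ball x \<epsilon>)|\<mu>. f y *s K (x - y))"

definition CZ_bounded_in_L2 :: "(real^'n \<Rightarrow> complex^'n) \<Rightarrow> (real^'n) measure \<Rightarrow> bool" where
  "CZ_bounded_in_L2 K \<mu> \<longleftrightarrow> (\<exists>C>0. \<forall>f\<in>L2_functions \<mu>.
     (SUP \<epsilon>\<in>{0<..}. \<integral>\<^sup>+x. ennreal ((norm (truncated_CZ K \<mu> \<epsilon> f x))\<^sup>2) \<partial>\<mu>)
       \<le> ennreal (C * (\<integral>y. (norm (f y))\<^sup>2 \<partial>\<mu>)))"


section \<open>Hausdorff measure\<close>

text \<open>
  The normalization is the one without a dimensional constant, so for integer \<open>s\<close> this is a
  constant multiple of the normalization agreeing with Lebesgue measure; below, Hausdorff measure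
  only occurs in an expression that is invariant under such scaling. Boundedness of the covering
  sets has to be required because \<^const>\<open>diameter\<close> is \<open>0\<close> on unbounded sets. The definition is
  meant for \<open>s > 0\<close> (for \<open>s = 0\<close> the empty covering sets would be counted).
\<close>

definition hausdorff_content :: "nat \<Rightarrow> real \<Rightarrow> 'a::euclidean_space set \<Rightarrow> ennreal" where
  "hausdorff_content s \<delta> A =
     (INF E\<in>{E :: nat \<Rightarrow> 'a set. A \<subseteq> (\<Union>i. E i) \<and> (\<forall>i. bounded (E i) \<and> diameter (E i) \<le> \<delta>)}.
        \<Sum>i. ennreal (diameter (E i) ^ s))"

definition hausdorff_outer :: "nat \<Rightarrow> 'a::euclidean_space set \<Rightarrow> ennreal" where
  "hausdorff_outer s A = (SUP \<delta>\<in>{0<..}. hausdorff_content s \<delta> A)"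

definition hausdorff_measure :: "nat \<Rightarrow> 'a::euclidean_space measure" where
  "hausdorff_measure s = measure_of UNIV (sets borel) (hausdorff_outer s)"

definition hausdorff_on :: "nat \<Rightarrow> 'a::euclidean_space set \<Rightarrow> 'a measure" where
  "hausdorff_on s A = density (hausdorff_measure s) (indicator A)"


section \<open>The flat transportation coefficients\<close>

text \<open>
  A cutoff lives on \<open>[0,\<infinity>)\<close>; its values at negative arguments are irrelevant. Smoothness on
  \<open>[0,\<infinity>)\<close> is expressed by a sequence \<open>D\<close> of successive derivatives, one-sided at \<open>0\<close>.
\<close>

definition smooth_cutoff :: "(real \<Rightarrow> real) \<Rightarrow> bool" where
  "smooth_cutoff \<phi> \<longleftrightarrow>
     (\<forall>t\<ge>0. \<phi> t \<ge> 0) \<and>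
     (\<exists>D :: nat \<Rightarrow> real \<Rightarrow> real. (\<forall>t\<ge>0. D 0 t = \<phi> t) \<and>
        (\<forall>n. \<forall>t\<ge>0. (D n has_real_derivative D (Suc n) t) (at t within {0..}))) \<and>
     (\<forall>t\<in>{0..<3}. \<phi> t = 1) \<and>
     closure {t. 0 \<le> t \<and> \<phi> t \<noteq> 0} \<subseteq> {0..<4}"

definition Lip0 :: "'a::euclidean_space set \<Rightarrow> ('a \<Rightarrow> real) set" where
  "Lip0 U = {f. (\<exists>C. C-lipschitz_on UNIV f) \<and>
     compact (closure {x. f x \<noteq> 0}) \<and> closure {x. f x \<noteq> 0} \<subseteq> U}"

definition lip_norm :: "('a::euclidean_space \<Rightarrow> real) \<Rightarrow> real" where
  "lip_norm f = (SUP (x, y)\<in>{(x, y). x \<noteq> y}. \<bar>f x - f y\<bar> / norm (x - y))"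

definition grassmannian :: "nat \<Rightarrow> 'a::euclidean_space set set" where
  "grassmannian s = {L. subspace L \<and> dim L = s}"

definition flat_density ::
  "(real \<Rightarrow> real) \<Rightarrow> nat \<Rightarrow> 'a::euclidean_space measure \<Rightarrow> 'a set \<Rightarrow> 'a \<Rightarrow> real \<Rightarrow> real"
where
  "flat_density \<phi> s \<mu> L x r =
     (\<integral>y. \<phi> (norm (y - x) / r) \<partial>\<mu>) /
     (\<integral>y. \<phi> (norm (y - x) / r) \<partial>hausdorff_on s ((+) x ` L))"

definition alpha_plane ::
  "(real \<Rightarrow> real) \<Rightarrow> nat \<Rightarrow> 'a::euclidean_space measure \<Rightarrow> 'a set \<Rightarrow> 'a \<Rightarrow> real \<Rightarrow> ennreal"
where
  "alpha_plane \<phi> s \<mu> L x r =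
     (SUP f\<in>{f \<in> Lip0 (ball x (4 * r)). lip_norm f \<le> 1 / r}.
        ennreal \<bar>1 / r ^ s *
          ((\<integral>y. \<phi> (norm (y - x) / r) * f y \<partial>\<mu>) -
           flat_density \<phi> s \<mu> L x r *
             (\<integral>y. \<phi> (norm (y - x) / r) * f y \<partial>hausdorff_on s ((+) x ` L)))\<bar>)"

definition alpha_flat ::
  "(real \<Rightarrow> real) \<Rightarrow> nat \<Rightarrow> 'a::euclidean_space measure \<Rightarrow> 'a \<Rightarrow> real \<Rightarrow> ennreal"
where
  "alpha_flat \<phi> s \<mu> x r = (INF L\<in>grassmannian s. alpha_plane \<phi> s \<mu> L x r)"


section \<open>Complex measures and principal values\<close>

text \<open>
  A complex measure is a countably additive complex-valued set function on the Borel sets; it is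
  automatically finite. Values on non-Borel sets are irrelevant.
\<close>

definition complex_measure :: "('a::topological_space set \<Rightarrow> complex) \<Rightarrow> bool" where
  "complex_measure \<nu> \<longleftrightarrow> \<nu> {} = 0 \<and>
     (\<forall>A :: nat \<Rightarrow> 'a set. range A \<subseteq> sets borel \<longrightarrow> disjoint_family A \<longrightarrow>
        (\<lambda>i. \<nu> (A i)) sums \<nu> (\<Union>i. A i))"

text \<open>
  The positive variation of a signed measure \<open>\<rho>\<close>; applied to \<open>- \<rho>\<close> it yields the negative one.
  Integration against a complex measure uses the Jordan decompositions of its real and imaginary
  parts.
\<close>

definition positive_variation :: "('a::topological_space set \<Rightarrow> real) \<Rightarrow> 'a measure" where
  "positive_variation \<rho> =
     measure_of UNIV (sets borel) (\<lambda>A. SUP B\<in>{B \<in> sets borel. B \<subseteq> A}. ennreal (\<rho> B))"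

definition complex_measure_integral ::
  "('a::topological_space set \<Rightarrow> complex) \<Rightarrow> ('a \<Rightarrow> complex^'m) \<Rightarrow> complex^'m"
where
  "complex_measure_integral \<nu> f =
     ((\<integral>y. f y \<partial>positive_variation (\<lambda>A. Re (\<nu> A))) -
      (\<integral>y. f y \<partial>positive_variation (\<lambda>A. - Re (\<nu> A)))) +
     \<i> *s ((\<integral>y. f y \<partial>positive_variation (\<lambda>A. Im (\<nu> A))) -
           (\<integral>y. f y \<partial>positive_variation (\<lambda>A. - Im (\<nu> A))))"

definition exists_principal_value :: "(real^'n \<Rightarrow> complex^'n) \<Rightarrow> (real^'n) measure \<Rightarrow> bool" where
  "exists_principal_value K \<mu> \<longleftrightarrow>
     (\<forall>\<nu>. complex_measure \<nu> \<longrightarrow>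
        (AE x in \<mu>. \<exists>l. ((\<lambda>r. complex_measure_integral \<nu>
             (\<lambda>y. indicator {y. norm (x - y) > r} y *\<^sub>R K (x - y))) \<longlongrightarrow> l) (at_right 0)))"


section \<open>Well-definedness\<close>

text \<open>
  \<^const>\<open>measure_of\<close> yields the zero measure when its argument is not countably additive. This
  does not happen here: \<open>emeasure_hausdorff_measure\<close> (a Caratheodory argument for metric outer
  measures) and \<open>emeasure_positive_variation\<close> show that the two measures introduced with it have
  the intended values on all Borel sets. Likewise the supremum in \<^const>\<open>lip_norm\<close> is over a
  bounded set for Lipschitz functions.
\<close>

lemma lip_norm_le_iff:
  fixes f :: "'a::euclidean_space \<Rightarrow> real"
  assumes "D-lipschitz_on UNIV f" "C \<ge> 0"
  shows "lip_norm f \<le> C \<longleftrightarrow> C-lipschitz_on UNIV f"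
proof -
  let ?S = "{(x, y). x \<noteq> (y::'a)}" and ?q = "\<lambda>(x, y). \<bar>f x - f y\<bar> / norm (x - y)"
  have *: "E-lipschitz_on UNIV f \<longleftrightarrow> (\<forall>p\<in>?S. ?q p \<le> E)" if "E \<ge> 0" for E
    using that by (auto simp: lipschitz_on_def dist_norm divide_le_eq; metis abs_zero cancel_comm_monoid_add_class.diff_cancel mult_zero_right norm_zero order_refl)
  have "bdd_above (?q ` ?S)"
    using assms(1) * [of D] lipschitz_on_nonneg[OF assms(1)] by (auto simp: bdd_above_def)
  moreover obtain b :: 'a where "b \<in> Basis" using nonempty_Basis by blast
  then have "(b, 0) \<in> ?S" by auto
  then have "?S \<noteq> {}" by blast
  ultimately show ?thesis unfolding lip_norm_def *[OF assms(2)] by (subst cSUP_le_iff) auto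
qed

lemma emeasure_positive_variation:
  fixes \<rho> :: "'a::topological_space set \<Rightarrow> real"
  assumes "\<rho> {} = 0"
    and ca: "\<And>A :: nat \<Rightarrow> 'a set. range A \<subseteq> sets borel \<Longrightarrow> disjoint_family A \<Longrightarrow>
               (\<lambda>i. \<rho> (A i)) sums \<rho> (\<Union>i. A i)"
    and "A \<in> sets borel"
  shows "emeasure (positive_variation \<rho>) A = (SUP B\<in>{B \<in> sets borel. B \<subseteq> A}. ennreal (\<rho> B))"
proof -
  define f where "f A = (SUP B\<in>{B \<in> sets borel. B \<subseteq> A}. ennreal (\<rho> B))" for A
  have fU: "ennreal (\<rho> B) \<le> f A" if "B \<in> sets borel" "B \<subseteq> A" for A B
    unfolding f_def using that by (auto intro: SUP_upper)
  have fmono: "f A \<le> f B" if "A \<subseteq> B" for A B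
    unfolding f_def using that by (auto intro!: SUP_subset_mono)
  have add: "\<rho> (A \<union> B) = \<rho> A + \<rho> B"
    if "A \<in> sets borel" "B \<in> sets borel" "A \<inter> B = {}" for A B
  proof -
    have "(\<lambda>i. \<rho> (binaryset A B i)) sums \<rho> (\<Union>i. binaryset A B i)"
      using that by (intro ca) (auto simp: binaryset_def disjoint_family_on_def)
    moreover have "(\<lambda>i. \<rho> (binaryset A B i)) sums (\<rho> A + \<rho> B)"
      using assms(1) by (intro binaryset_sums) auto
    ultimately show ?thesis by (simp add: sums_unique2 UN_binaryset_eq)
  qed
  have sup2: "f A + f B \<le> f (A \<union> B)" if "A \<inter> B = {}" for A B
  proof -
    have *: "ennreal (\<rho> A') + ennreal (\<rho> B') \<le> f (A \<union> B)"
      if "A' \<in> sets borel" "A' \<subseteq> A" "B' \<in> sets borel" "B' \<subseteq> B" for A' B'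
    proof -
      have "A' \<inter> B' = {}" using that \<open>A \<inter> B = {}\<close> by blast
      then have "ennreal (\<rho> A' + \<rho> B') \<le> f (A \<union> B)"
        using that add[of A' B'] fU[of "A' \<union> B'" "A \<union> B"] by auto
      moreover have "ennreal (\<rho> A') \<le> f (A \<union> B)" "ennreal (\<rho> B') \<le> f (A \<union> B)"
        using that by (auto intro!: fU)
      ultimately show ?thesis
        by (cases "\<rho> A' \<ge> 0"; cases "\<rho> B' \<ge> 0") (auto simp: ennreal_neg)
    qed
    have "f A + ennreal (\<rho> B') \<le> f (A \<union> B)" if "B' \<in> sets borel" "B' \<subseteq> B" for B'
      unfolding f_def[of A] using that
      by (subst ennreal_SUP_add_left[symmetric]) (auto intro!: SUP_least *)
    then show ?thesis unfolding f_def[of B]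
      by (subst add.commute, subst ennreal_SUP_add_left[symmetric])
        (auto intro!: SUP_least simp: add.commute)
  qed
  have f0: "f {} = 0" unfolding f_def using assms(1)
    by (intro antisym SUP_least) auto
  have "measure_space UNIV (sets borel) f"
    unfolding measure_space_def
  proof (intro conjI)
    show "sigma_algebra UNIV (sets (borel :: 'a measure))"
      using sets.sigma_algebra_axioms[of "borel :: 'a measure"] by simp
    show "positive (sets borel) f" using f0 by (simp add: positive_def)
    show "countably_additive (sets borel) f"
    proof (rule countably_additiveI)
      fix A :: "nat \<Rightarrow> 'a set"
      assume A: "range A \<subseteq> sets borel" "disjoint_family A" 
      have "(\<Sum>i<n. f (A i)) \<le> f (\<Union>i<n. A i)" for n
      proof (induction n)
        case (Suc n)
        have "(\<Sum>i<Suc n. f (A i)) \<le> f (\<Union>i<n. A i) + f (A n)"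
          using Suc by (auto intro: add_right_mono)
        also have "\<dots> \<le> f ((\<Union>i<n. A i) \<union> A n)"
        proof (rule sup2)
          have "A i \<inter> A n = {}" if "i < n" for i
            using A(2) that by (auto simp: disjoint_family_on_def)
          then show "(\<Union>i<n. A i) \<inter> A n = {}" by blast
        qed
        finally show ?case by (simp add: lessThan_Suc Un_commute)
      qed (simp add: f0)
      then have "(\<Sum>i<n. f (A i)) \<le> f (\<Union>i. A i)" for n
        by (rule order_trans) (auto intro: fmono)
      then have 1: "(\<Sum>i. f (A i)) \<le> f (\<Union>i. A i)"
        by (intro suminf_le_const) auto
      have "ennreal (\<rho> B) \<le> (\<Sum>i. f (A i))" if B: "B \<in> sets borel" "B \<subseteq> (\<Union>i. A i)" for B
      proof -
        have "(\<lambda>i. \<rho> (B \<inter> A i)) sums \<rho> (\<Union>i. B \<inter> A i)"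
          using A B by (intro ca) (auto simp: disjoint_family_on_def)
        moreover have "(\<Union>i. B \<inter> A i) = B" using B by blast
        ultimately have "(\<lambda>n. ennreal (\<Sum>i<n. \<rho> (B \<inter> A i))) \<longlonglongrightarrow> ennreal (\<rho> B)"
          by (auto simp: sums_def intro: tendsto_ennrealI)
        moreover have "ennreal (\<Sum>i<n. \<rho> (B \<inter> A i)) \<le> (\<Sum>i. f (A i))" for n
        proof -
          have "ennreal (\<Sum>i<n. \<rho> (B \<inter> A i)) \<le> ennreal (\<Sum>i<n. max 0 (\<rho> (B \<inter> A i)))"
            by (intro ennreal_leI sum_mono) auto
          also have "\<dots> = (\<Sum>i<n. ennreal (\<rho> (B \<inter> A i)))"
            by (subst sum_ennreal[symmetric]) (auto simp: ennreal_max_0 intro!: sum.cong)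
          also have "\<dots> \<le> (\<Sum>i<n. f (A i))"
            using A B by (intro sum_mono fU) auto
          also have "\<dots> \<le> (\<Sum>i. f (A i))" by (rule sum_le_suminf) auto
          finally show ?thesis .
        qed
        ultimately show ?thesis by (meson LIMSEQ_le_const2)
      qed
      then have "f (\<Union>i. A i) \<le> (\<Sum>i. f (A i))" unfolding f_def[of "\<Union>i. A i"]
        by (auto intro: SUP_least)
      then show "(\<Sum>i. f (A i)) = f (\<Union>i. A i)" using 1 by simp
    qed
  qed
  then have "emeasure (positive_variation \<rho>) A = f A"
    unfolding positive_variation_def f_def[symmetric, abs_def]
    using assms(3) by (intro emeasure_measure_of_sigma) (auto simp: measure_space_def)
  then show ?thesis by (simp add: f_def)
qed

lemma hausdorff_content_antimono:
  "\<delta> \<le> \<delta>' \<Longrightarrow> hausdorff_content s \<delta>' A \<le> hausdorff_content s \<delta> A"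
  unfolding hausdorff_content_def by (rule INF_superset_mono) (auto intro: order_trans)

lemma hausdorff_content_mono:
  "A \<subseteq> B \<Longrightarrow> hausdorff_content s \<delta> A \<le> hausdorff_content s \<delta> B"
  unfolding hausdorff_content_def by (rule INF_superset_mono) auto

lemma hausdorff_outer_mono: "A \<subseteq> B \<Longrightarrow> hausdorff_outer s A \<le> hausdorff_outer s B"
  unfolding hausdorff_outer_def by (intro SUP_mono') (rule hausdorff_content_mono)

lemma hausdorff_content_le_outer: "\<delta> > 0 \<Longrightarrow> hausdorff_content s \<delta> A \<le> hausdorff_outer s A"
  unfolding hausdorff_outer_def by (auto intro: SUP_upper)

lemma hausdorff_content_UN:
  fixes A :: "nat \<Rightarrow> 'a::euclidean_space set"
  shows "hausdorff_content s \<delta> (\<Union>i. A i) \<le> (\<Sum>i. hausdorff_content s \<delta> (A i))"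
proof (rule ennreal_le_epsilon)
  fix e :: real
  assume e: "0 < e" "(\<Sum>i. hausdorff_content s \<delta> (A i)) < top"
  let ?f = "\<lambda>E :: 'a set. ennreal (diameter E ^ s)"
  have "\<exists>E. A n \<subseteq> (\<Union>i. E i) \<and> (\<forall>i. bounded (E i) \<and> diameter (E i) \<le> \<delta>) \<and>
          (\<Sum>i. ?f (E i)) < hausdorff_content s \<delta> (A n) + ennreal (e * (1/2) ^ Suc n)" for n
  proof -
    have fin: "hausdorff_content s \<delta> (A n) \<noteq> \<infinity>"
      using e(2) ennreal_suminf_lessD[of "\<lambda>i. hausdorff_content s \<delta> (A i)" top n] by simp
    have pos: "0 < e * (1/2) ^ Suc n" using e(1) by simp
    show ?thesis
      using INF_approx_ennreal[OF pos hausdorff_content_def fin] unfolding Bex_def mem_Collect_eq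
      by (simp only: conj_assoc)
  qed
  then obtain E where E: "\<And>n. A n \<subseteq> (\<Union>i. E n i)"
    "\<And>n i. bounded (E n i) \<and> diameter (E n i) \<le> \<delta>"
    "\<And>n. (\<Sum>i. ?f (E n i)) < hausdorff_content s \<delta> (A n) + ennreal (e * (1/2) ^ Suc n)"
    by metis
  define C where "C = case_prod E o prod_decode"
  have "(\<Union>i. A i) \<subseteq> (\<Union>i. C i)"
  proof safe
    fix n x assume "x \<in> A n"
    then obtain i where "x \<in> E n i" using E(1) by blast
    then have "x \<in> C (prod_encode (n, i))" by (simp add: C_def)
    then show "x \<in> (\<Union>i. C i)" by blast
  qed
  moreover have "bounded (C i) \<and> diameter (C i) \<le> \<delta>" for i
    using E(2) by (simp add: C_def split: prod.split)
  ultimately have "hausdorff_content s \<delta> (\<Union>i. A i) \<le> (\<Sum>i. ?f (C i))"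
    unfolding hausdorff_content_def by (intro INF_lower) auto
  also have "\<dots> = (\<Sum>i. (\<lambda>(m, n). ?f (E m n)) (prod_decode i))"
    by (simp add: C_def split_def)
  also have "\<dots> = (\<Sum>n. \<Sum>i. ?f (E n i))"
    by (intro suminf_ennreal_2dimen) auto
  also have "\<dots> \<le> (\<Sum>n. hausdorff_content s \<delta> (A n) + ennreal (e * (1/2) ^ Suc n))"
    by (intro suminf_le less_imp_le[OF E(3)]) auto
  also have "\<dots> = (\<Sum>n. hausdorff_content s \<delta> (A n)) +
                   (\<Sum>n. ennreal e * ennreal ((1/2) ^ Suc n))"
    using e(1) by (subst suminf_add[symmetric])
      (auto simp del: ennreal_suminf_cmult simp add: ennreal_mult[symmetric])
  also have "\<dots> = (\<Sum>n. hausdorff_content s \<delta> (A n)) + ennreal e"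
    unfolding ennreal_suminf_cmult
    by (subst suminf_ennreal_eq[OF zero_le_power power_half_series]) auto
  finally show "hausdorff_content s \<delta> (\<Union>i. A i) \<le> (\<Sum>i. hausdorff_content s \<delta> (A i)) + ennreal e" .
qed

lemma hausdorff_outer_UN:
  fixes A :: "nat \<Rightarrow> 'a::euclidean_space set"
  shows "hausdorff_outer s (\<Union>i. A i) \<le> (\<Sum>i. hausdorff_outer s (A i))"
  unfolding hausdorff_outer_def[of s "\<Union>i. A i"]
proof (rule SUP_least)
  fix \<delta> :: real assume "\<delta> \<in> {0<..}"
  then have "(\<Sum>i. hausdorff_content s \<delta> (A i)) \<le> (\<Sum>i. hausdorff_outer s (A i))"
    by (intro suminf_le hausdorff_content_le_outer) auto
  then show "hausdorff_content s \<delta> (\<Union>i. A i) \<le> (\<Sum>i. hausdorff_outer s (A i))"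
    using hausdorff_content_UN order_trans by blast
qed

lemma hausdorff_outer_empty: "0 < s \<Longrightarrow> hausdorff_outer s ({} :: 'a::euclidean_space set) = 0"
proof -
  assume s: "0 < s"
  have "hausdorff_content s \<delta> ({} :: 'a set) = 0" if "\<delta> > 0" for \<delta>
  proof -
    have "hausdorff_content s \<delta> ({} :: 'a set) \<le> (\<Sum>i::nat. ennreal (diameter ({}::'a set) ^ s))"
      unfolding hausdorff_content_def using that by (intro INF_lower2[of "\<lambda>_. {}"]) auto
    then show ?thesis using s by (simp add: zero_power)
  qed
  then have "hausdorff_outer s ({} :: 'a set) \<le> 0"
    unfolding hausdorff_outer_def by (intro SUP_least) auto
  then show ?thesis by simp
qed

lemma hausdorff_outer_Un:
  assumes "0 < s" shows "hausdorff_outer s (A \<union> B) \<le> hausdorff_outer s A + hausdorff_outer s B"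
proof -
  have "hausdorff_outer s (\<Union>i. binaryset A B i) \<le> (\<Sum>i. hausdorff_outer s (binaryset A B i))"
    by (rule hausdorff_outer_UN)
  also have "\<dots> = hausdorff_outer s A + hausdorff_outer s B"
    using assms by (intro suminf_binaryset_eq hausdorff_outer_empty)
  finally show ?thesis by (simp add: UN_binaryset_eq)
qed

lemma hausdorff_outer_separated:
  assumes s: "0 < s" and e: "e > 0" and sep: "\<And>x y. x \<in> A \<Longrightarrow> y \<in> B \<Longrightarrow> e \<le> dist x y"
  shows "hausdorff_outer s A + hausdorff_outer s B \<le> hausdorff_outer s (A \<union> B)"
proof -
  have small: "hausdorff_content s \<delta> A + hausdorff_content s \<delta> B \<le> hausdorff_content s \<delta> (A \<union> B)"
    if "0 < \<delta>" "\<delta> < e" for \<delta>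
    unfolding hausdorff_content_def[of s \<delta> "A \<union> B"]
  proof (rule INF_greatest)
    fix E :: "nat \<Rightarrow> 'a set"
    assume "E \<in> {E. A \<union> B \<subseteq> (\<Union>i. E i) \<and> (\<forall>i. bounded (E i) \<and> diameter (E i) \<le> \<delta>)}"
    then have E: "A \<union> B \<subseteq> (\<Union>i. E i)" "\<And>i. bounded (E i)" "\<And>i. diameter (E i) \<le> \<delta>" by auto
    define EA where "EA i = (if E i \<inter> A = {} then {} else E i)" for i
    define EB where "EB i = (if E i \<inter> A = {} then E i else {})" for i
    have "A \<subseteq> (\<Union>i. EA i)"
    proof
      fix x assume "x \<in> A"
      moreover from this obtain i where "x \<in> E i" using E(1) by blast
      ultimately have "x \<in> EA i" by (auto simp: EA_def)
      then show "x \<in> (\<Union>i. EA i)" by blast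
    qed
    then have "hausdorff_content s \<delta> A \<le> (\<Sum>i. ennreal (diameter (EA i) ^ s))"
      unfolding hausdorff_content_def
      using E that by (intro INF_lower) (auto simp: EA_def)
    moreover have "B \<subseteq> (\<Union>i. EB i)"
    proof
      fix y assume y: "y \<in> B"
      then obtain i where i: "y \<in> E i" using E(1) by blast
      have "E i \<inter> A = {}"
      proof (rule ccontr)
        assume "E i \<inter> A \<noteq> {}"
        then obtain x where x: "x \<in> E i" "x \<in> A" by blast
        have "dist x y \<le> diameter (E i)"
          using E(2) x(1) i by (rule diameter_bounded_bound)
        then show False using sep[OF x(2) y] E(3)[of i] that by simp
      qed
      then show "y \<in> (\<Union>i. EB i)" using i by (auto simp: EB_def)
    qed
    then have "hausdorff_content s \<delta> B \<le> (\<Sum>i. ennreal (diameter (EB i) ^ s))"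
      unfolding hausdorff_content_def
      using E that by (intro INF_lower) (auto simp: EB_def)
    moreover have "(\<Sum>i. ennreal (diameter (EA i) ^ s)) + (\<Sum>i. ennreal (diameter (EB i) ^ s)) =
        (\<Sum>i. ennreal (diameter (E i) ^ s))"
      using s by (subst suminf_add) (auto simp: EA_def EB_def intro!: suminf_cong)
    ultimately show "hausdorff_content s \<delta> A + hausdorff_content s \<delta> B \<le>
        (\<Sum>i. ennreal (diameter (E i) ^ s))"
      by (metis add_mono)
  qed
  have le: "hausdorff_content s a A + hausdorff_content s b B \<le> hausdorff_outer s (A \<union> B)"
    if "a > 0" "b > 0" for a b
  proof -
    define m where "m = min (min a b) (e / 2)"
    have m: "0 < m" "m \<le> a" "m \<le> b" "m < e" using that e by (auto simp: m_def)
    have "hausdorff_content s a A + hausdorff_content s b B \<le>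
          hausdorff_content s m A + hausdorff_content s m B"
      using m by (intro add_mono hausdorff_content_antimono)
    also have "\<dots> \<le> hausdorff_content s m (A \<union> B)" using m by (intro small)
    also have "\<dots> \<le> hausdorff_outer s (A \<union> B)" using m by (intro hausdorff_content_le_outer)
    finally show ?thesis .
  qed
  have "hausdorff_outer s A + hausdorff_content s b B \<le> hausdorff_outer s (A \<union> B)" if "b > 0" for b
    unfolding hausdorff_outer_def[of s A] using that
    by (subst ennreal_SUP_add_left[symmetric]) (auto intro!: SUP_least le)
  then show ?thesis unfolding hausdorff_outer_def[of s B]
    by (subst add.commute, subst ennreal_SUP_add_left[symmetric])
      (auto intro!: SUP_least simp: add.commute)
qed

lemma hausdorff_outer_closed_split:
  fixes A F :: "'a::euclidean_space set"
  assumes s: "0 < s" and F: "closed F"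
  shows "hausdorff_outer s (A \<inter> F) + hausdorff_outer s (A - F) \<le> hausdorff_outer s A"
proof (cases "F = {} \<or> hausdorff_outer s A = top")
  case True
  then show ?thesis using hausdorff_outer_empty[OF s] by auto
next
  case False
  let ?H = "hausdorff_outer s :: 'a set \<Rightarrow> ennreal"
  have "F \<noteq> {}" and fin: "?H A < top" using False by (auto simp: less_top)
  define d where "d x = infdist x F" for x
  have dl: "d x - d y \<le> dist x y" for x y
    unfolding d_def using infdist_triangle[of x F y] by simp
  define P where "P n = {x \<in> A. 1 / real (n + 1) < d x}" for n :: nat
  define R where "R n = {x \<in> A. 1 / real (n + 2) < d x \<and> d x \<le> 1 / real (n + 1)}" for n :: nat
  have pos: "d x > 0" if "x \<notin> F" for x
    unfolding d_def using that F \<open>F \<noteq> {}\<close> by (metis infdist_pos_not_in_closed)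
  have near: "?H (A \<inter> F) + ?H (P n) \<le> ?H A" for n
  proof -
    have "?H (A \<inter> F) + ?H (P n) \<le> ?H (A \<inter> F \<union> P n)"
    proof (rule hausdorff_outer_separated[OF s, of "1 / real (n + 1)"])
      fix x y assume "x \<in> A \<inter> F" "y \<in> P n"
      then have "d x = 0" "1 / real (n + 1) < d y" by (auto simp: d_def P_def)
      then show "1 / real (n + 1) \<le> dist x y" using dl[of y x] by (simp add: dist_commute)
    qed auto
    also have "\<dots> \<le> ?H A" by (rule hausdorff_outer_mono) (auto simp: P_def)
    finally show ?thesis .
  qed
  have alt: "(\<Sum>k<n. ?H (R (2 * k + j))) \<le> ?H (\<Union>k<n. R (2 * k + j))" for n j
  proof (induction n)
    case (Suc n)
    have "(\<Sum>k<Suc n. ?H (R (2 * k + j))) \<le> ?H (\<Union>k<n. R (2 * k + j)) + ?H (R (2 * n + j))"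
      using Suc by (auto intro: add_right_mono)
    also have "\<dots> \<le> ?H ((\<Union>k<n. R (2 * k + j)) \<union> R (2 * n + j))"
    proof (cases "n = 0")
      case False
      show ?thesis
      proof (rule hausdorff_outer_separated[OF s, of "1 / real (2 * n + j) - 1 / real (2 * n + j + 1)"])
        show "0 < 1 / real (2 * n + j) - 1 / real (2 * n + j + 1)"
          using False by (simp add: divide_strict_left_mono)
        fix x y assume "x \<in> (\<Union>k<n. R (2 * k + j))" and y: "y \<in> R (2 * n + j)"
        then obtain k where k: "k < n" "1 / real (2 * k + j + 2) < d x" by (auto simp: R_def)
        have "1 / real (2 * n + j) \<le> 1 / real (2 * k + j + 2)"
          using k(1) by (intro divide_left_mono) auto
        then show "1 / real (2 * n + j) - 1 / real (2 * n + j + 1) \<le> dist x y"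
          using k(2) y dl[of x y] by (simp add: R_def)
      qed
    qed (simp add: hausdorff_outer_empty[OF s])
    finally show ?case by (simp add: lessThan_Suc Un_commute)
  qed (simp add: hausdorff_outer_empty[OF s])
  have alt': "(\<Sum>k<n. ?H (R (2 * k + j))) \<le> ?H A" for n j
    using alt[of j n] by (rule order_trans) (auto intro!: hausdorff_outer_mono simp: R_def)
  have "(\<Sum>k<2 * n. ?H (R k)) = (\<Sum>k<n. ?H (R (2 * k + 0))) + (\<Sum>k<n. ?H (R (2 * k + 1)))" for n
    by (induction n) (auto simp: ac_simps)
  then have "(\<Sum>k<2 * n. ?H (R k)) \<le> ?H A + ?H A" for n
    using add_mono[OF alt' alt'] by metis
  moreover have "(\<Sum>k<n. ?H (R k)) \<le> (\<Sum>k<2 * n. ?H (R k))" for n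
    by (rule sum_mono2) auto
  ultimately have "(\<Sum>k. ?H (R k)) \<le> ?H A + ?H A"
    by (intro suminf_le_const) (auto intro: order_trans)
  also have "\<dots> < top" using fin by simp
  finally have tot: "(\<Sum>k. ?H (R k)) < top" .
  have cover: "A - F \<subseteq> P n \<union> (\<Union>k. R (k + n))" for n
  proof
    fix x assume x: "x \<in> A - F"
    then have "d x > 0" using pos by auto
    then obtain m0 where m0: "1 / real (m0 + 1) < d x"
      using nat_approx_posE by (metis Suc_eq_plus1)
    define m where "m = (LEAST m. 1 / real (m + 1) < d x)"
    have m: "1 / real (m + 1) < d x" unfolding m_def by (rule LeastI, rule m0)
    show "x \<in> P n \<union> (\<Union>k. R (k + n))"
    proof (cases "1 / real (n + 1) < d x")
      case False
      then have "n < m"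
      proof -
        have "\<not> m \<le> n"
        proof
          assume "m \<le> n"
          then have "1 / real (n + 1) \<le> 1 / real (m + 1)" by (intro divide_left_mono) auto
          then show False using m False by simp
        qed
        then show ?thesis by simp
      qed
      then obtain k where k: "m = Suc (k + n)" by (metis less_iff_Suc_add add.commute)
      have "\<not> 1 / real (k + n + 1) < d x"
        using not_less_Least[of "k + n" "\<lambda>m. 1 / real (m + 1) < d x"] k unfolding m_def by simp
      then have "x \<in> R (k + n)" using m k x by (simp add: R_def)
      then show ?thesis by blast
    qed (use x in \<open>simp add: P_def\<close>)
  qed
  have "?H (A \<inter> F) + ?H (A - F) + (\<Sum>k<n. ?H (R k)) \<le> ?H A + (\<Sum>k. ?H (R k))" for n
  proof -
    have "?H (A - F) \<le> ?H (P n) + (\<Sum>k. ?H (R (k + n)))"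
    proof -
      have "?H (A - F) \<le> ?H (P n \<union> (\<Union>k. R (k + n)))" by (rule hausdorff_outer_mono[OF cover])
      also have "\<dots> \<le> ?H (P n) + ?H (\<Union>k. R (k + n))" by (rule hausdorff_outer_Un[OF s])
      also have "\<dots> \<le> ?H (P n) + (\<Sum>k. ?H (R (k + n)))"
        by (intro add_left_mono hausdorff_outer_UN)
      finally show ?thesis .
    qed
    then have "?H (A \<inter> F) + ?H (A - F) + (\<Sum>k<n. ?H (R k)) \<le>
       (?H (A \<inter> F) + ?H (P n)) + ((\<Sum>k. ?H (R (k + n))) + (\<Sum>k<n. ?H (R k)))"
      unfolding add.assoc by (intro add_left_mono) (simp only: add.assoc[symmetric] add_right_mono)
    also have "(\<Sum>k. ?H (R (k + n))) + (\<Sum>k<n. ?H (R k)) = (\<Sum>k. ?H (R k))"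
      by (rule suminf_offset[symmetric]) auto
    also have "(?H (A \<inter> F) + ?H (P n)) + (\<Sum>k. ?H (R k)) \<le> ?H A + (\<Sum>k. ?H (R k))"
      by (intro add_right_mono near)
    finally show ?thesis .
  qed
  moreover have "(\<lambda>n. \<Sum>k<n. ?H (R k)) \<longlonglongrightarrow> (\<Sum>k. ?H (R k))" by (intro summable_LIMSEQ) auto
  then have "(\<lambda>n. ?H (A \<inter> F) + ?H (A - F) + (\<Sum>k<n. ?H (R k))) \<longlonglongrightarrow>
     ?H (A \<inter> F) + ?H (A - F) + (\<Sum>k. ?H (R k))" by (intro tendsto_add) auto
  ultimately have "?H (A \<inter> F) + ?H (A - F) + (\<Sum>k. ?H (R k)) \<le> ?H A + (\<Sum>k. ?H (R k))"
    by (intro LIMSEQ_le_const2) auto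
  then have "(\<Sum>k. ?H (R k)) + (?H (A \<inter> F) + ?H (A - F)) \<le> (\<Sum>k. ?H (R k)) + ?H A"
    by (simp only: add.commute)
  then show ?thesis using tot by (auto simp: ennreal_add_left_cancel_le)
qed

lemma emeasure_hausdorff_measure:
  fixes A :: "'a::euclidean_space set"
  assumes s: "0 < s" and A: "A \<in> sets borel"
  shows "emeasure (hausdorff_measure s) A = hausdorff_outer s A"
proof -
  let ?H = "hausdorff_outer s :: 'a set \<Rightarrow> ennreal"
  define L where "L = lambda_system UNIV (Pow UNIV) ?H"
  have "outer_measure_space (Pow UNIV) ?H"
    unfolding outer_measure_space_def
    by (auto simp: positive_def increasing_def countably_subadditive_def hausdorff_outer_empty[OF s]
        intro: hausdorff_outer_mono hausdorff_outer_UN)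
  then have L: "measure_space UNIV L ?H"
    unfolding L_def by (intro sigma_algebra.caratheodory_lemma sigma_algebra_Pow)
  then interpret sigma_algebra UNIV L by (simp add: measure_space_def)
  have "F \<in> L" if "closed F" for F
  proof -
    have "?H (X \<inter> F) + ?H (X - F) = ?H X" for X
      using hausdorff_outer_closed_split[OF s that, of X] hausdorff_outer_Un[OF s, of "X \<inter> F" "X - F"]
      by (simp add: Int_Diff_Un antisym)
    then show ?thesis
      unfolding L_def algebra.lambda_system_eq[OF algebra_Pow] by blast
  qed
  then have "sigma_sets UNIV {S :: 'a set. closed S} \<subseteq> L" by (intro sigma_sets_subset) auto
  then have sub: "sets (borel :: 'a measure) \<subseteq> L" by (simp add: borel_eq_closed sets_measure_of)
  have "sigma_algebra UNIV (sets (borel :: 'a measure))"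
    using sets.sigma_algebra_axioms[of "borel :: 'a measure"] by simp
  from measure_down[OF L this sub] A show ?thesis
    unfolding hausdorff_measure_def
    by (intro emeasure_measure_of_sigma) (auto simp: measure_space_def)
qed

end

theory Submission
  imports Defs
begin

text \<open>
  Vanishing of the flat coefficients enters only through two consequences. Testing against the
  components of an odd Lipschitz function and using that the Hausdorff measure of a plane is
  symmetric under reflection, one sees that truncations at comparable scales differ by \<open>o(1)\<close>.
  Testing against Lipschitz cutoffs of thin annuli, and using that the Hausdorff measure of a plane
  is homogeneous, one sees that thin annuli carry little mass, so that smooth truncations can be
  exchanged for sharp ones.

  Non-doubling harmonic analysis yields the weak type \<open>(1,1)\<close> bound for the maximal truncations of
  finite measures. For a Lipschitz density \<open>f\<close> the smooth truncations \<open>u\<^sub>i\<close> at the scales \<open>q\<^sup>i\<close> are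
  bounded in \<open>L\<^sup>2\<close>; let \<open>h\<close> be a weak limit point. By antisymmetry of the kernel, averages of \<open>u\<^sub>i\<close>
  over a ball are nearly independent of \<open>i\<close> once the scale is much smaller than the ball, while \<open>u\<^sub>i\<close>
  oscillates little on balls much smaller than its scale. Since the increments of \<open>u\<^sub>i\<close> tend to \<open>0\<close>,
  the two regimes can be joined at doubling scales, which gives \<open>u\<^sub>i(x) \<rightarrow> h(x)\<close> along them at Lebesgue
  points; between doubling scales the increments are controlled by geometrically decaying densities.
  Lebesgue decomposition and the weak type bound then pass from Lipschitz densities to arbitrary
  finite measures.
\<close>

section \<open>Measures of growth \<open>s\<close>\<close>

text \<open>The measure need not be doubling, so averages over a ball cannot be normalised by the
  mass of that ball. Every covering argument compares \<open>ball x R\<close> for an auxiliary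
  measure with \<open>ball x (5 * R)\<close> for \<mu>, 5 being the Vitali factor, and the loss is
  recovered only at doubling radii. The ratio \<open>Q\<close> has to absorb the dilations met along
  the way, the largest being 20 = 4 * 5 in \<open>cotlar_point\<close>. The exponent
  \<open>s + 1\<close> in the doubling condition, instead of \<open>s\<close>, is what makes the
  density of a ball, its mass over the s-th power of its radius, shrink by a factor
  \<open>1/Q\<close> whenever a non-doubling step divides the radius by \<open>Q\<close>. Sums over
  the shells between doubling scales are then geometric, whatever their number. Small increments are
  known at single points, whereas joining the two regimes requires them on average over a ball.
  Tails of increments are therefore replaced by their suprema, to which differentiation applies.
  Exceptional sets are covered by Borel sets of small measure instead of being shown
  measurable.\<close>

locale growth_measure =
  fixes \<mu> :: "'a::euclidean_space measure" and s :: nat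
  assumes sets_mu [measurable_cong, simp]: "sets \<mu> = sets borel"
    and s_pos: "0 < s"
    and growth: "r > 0 \<Longrightarrow> emeasure \<mu> (ball x r) \<le> ennreal (r ^ s)"
begin

lemma space_mu [simp]: "space \<mu> = UNIV"
  using sets_eq_imp_space_eq[OF sets_mu] by simp

lemma emeasure_bounded_finite: "bounded A \<Longrightarrow> emeasure \<mu> A < \<infinity>"
proof -
  assume "bounded A"
  then obtain r where r: "r > 0" "A \<subseteq> ball 0 r"
    by (metis bounded_subset_ballD)
  then have "emeasure \<mu> A \<le> emeasure \<mu> (ball 0 r)" by (intro emeasure_mono) auto
  also have "\<dots> \<le> ennreal (r ^ s)" using growth r by simp
  finally show ?thesis by (simp add: le_less_trans)
qed

lemma emeasure_ball_eq: "emeasure \<mu> (ball x r) = ennreal (measure \<mu> (ball x r))"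
  using emeasure_bounded_finite[of "ball x r"] by (simp add: emeasure_eq_ennreal_measure)

lemma measure_ball_le: "r \<ge> 0 \<Longrightarrow> measure \<mu> (ball x r) \<le> r ^ s"
  using growth[of r x] s_pos by (cases "r = 0") (auto simp: emeasure_ball_eq)

lemma measure_ball_mono: "r \<le> r' \<Longrightarrow> measure \<mu> (ball x r) \<le> measure \<mu> (ball x r')"
  using emeasure_bounded_finite[of "ball x r'"]
  by (intro measure_mono_fmeasurable) (auto simp: fmeasurable_def)

sublocale sigma_finite_measure \<mu>
proof
  show "\<exists>A. countable A \<and> A \<subseteq> sets \<mu> \<and> \<Union>A = space \<mu> \<and> (\<forall>a\<in>A. emeasure \<mu> a \<noteq> \<infinity>)"
  proof (intro exI[of _ "range (\<lambda>n::nat. ball 0 (real n))"] conjI)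
    show "\<Union> (range (\<lambda>n::nat. ball (0::'a) (real n))) = space \<mu>"
      by (auto simp: reals_Archimedean2)
  qed (use emeasure_bounded_finite in \<open>auto simp: less_top[symmetric]\<close>)
qed

end

section \<open>Decomposition into geometric shells\<close>

lemma geometric_index:
  fixes b d R :: real
  assumes "b > 1" "R > 0" "R \<le> d"
  obtains k where "b ^ k * R \<le> d" "d < b ^ Suc k * R"
proof -
  obtain n where n: "d / R < b ^ n" using real_arch_pow[OF assms(1)] by blast
  define m where "m = (LEAST n. d / R < b ^ n)"
  have m: "d / R < b ^ m" unfolding m_def by (rule LeastI, rule n)
  have "m \<noteq> 0" using m assms by (auto simp: field_simps intro!: Nat.gr0I)
  then obtain k where k: "m = Suc k" using not0_implies_Suc by blast
  have "\<not> d / R < b ^ k" using not_less_Least[of k "\<lambda>n. d / R < b ^ n"] k unfolding m_def by simp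
  then show ?thesis using that[of k] m k assms by (auto simp: field_simps)
qed

lemma geometric_index_down:
  fixes b d R :: real
  assumes "b > 1" "0 < d" "d < R"
  obtains k where "(1/b) ^ Suc k * R \<le> d" "d < (1/b) ^ k * R"
proof -
  obtain n where n: "R / d < b ^ n" using real_arch_pow[OF assms(1)] by blast
  define m where "m = (LEAST n. R / d \<le> b ^ n)"
  have m: "R / d \<le> b ^ m" unfolding m_def by (rule LeastI[of _ n]) (use n in simp)
  have "m \<noteq> 0" using m assms by (auto simp: field_simps intro!: Nat.gr0I)
  then obtain k where k: "m = Suc k" using not0_implies_Suc by blast
  have "\<not> R / d \<le> b ^ k" using not_less_Least[of k "\<lambda>n. R / d \<le> b ^ n"] k unfolding m_def by simp
  then show ?thesis using that[of k] m k assms by (auto simp: field_simps power_divide)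
qed

lemma ennreal_le_suminf:
  fixes f :: "nat \<Rightarrow> ennreal"
  shows "f k \<le> (\<Sum>k. f k)"
  using sum_le_suminf[of f "{k}"] by simp

lemma half_sums: "(\<lambda>n. (1/2::real) ^ n) sums 2"
  using geometric_sums[of "1/2::real"] by simp

text \<open>The shell between the radii \<open>2 ^ k * R\<close> and \<open>2 ^ Suc k * R\<close>
  contributes at most \<open>c * 2 ^ s / R * (1/2) ^ k\<close>, because the integrand decays by one
  power more than the mass may grow.\<close>

lemma tail_integral:
  fixes \<sigma> :: "'a::euclidean_space measure" and c R :: real
  assumes [measurable_cong]: "sets \<sigma> = sets borel" and R: "R > 0" and c: "c \<ge> 0"
    and gr: "\<And>t. t \<ge> R \<Longrightarrow> emeasure \<sigma> (ball x t) \<le> ennreal (c * t ^ s)"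
  shows "(\<integral>\<^sup>+y. indicator {y. R \<le> dist x y} y * ennreal (1 / dist x y ^ (s + 1)) \<partial>\<sigma>)
           \<le> ennreal (c * 2 ^ (s + 1) / R)"
proof -
  have [measurable]: "ball x a \<in> sets \<sigma>" for a using assms(1) by simp
  have "(\<integral>\<^sup>+y. indicator {y. R \<le> dist x y} y * ennreal (1 / dist x y ^ (s + 1)) \<partial>\<sigma>) \<le>
    (\<integral>\<^sup>+y. (\<Sum>k. indicator (ball x (2 ^ Suc k * R)) y * ennreal (1 / (2 ^ k * R) ^ (s + 1))) \<partial>\<sigma>)"
  proof (intro nn_integral_mono)
    fix y
    show "indicator {y. R \<le> dist x y} y * ennreal (1 / dist x y ^ (s + 1)) \<le>
      (\<Sum>k. indicator (ball x (2 ^ Suc k * R)) y * ennreal (1 / (2 ^ k * R) ^ (s + 1)))"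
    proof (cases "R \<le> dist x y")
      case True
      then obtain k where k: "2 ^ k * R \<le> dist x y" "dist x y < 2 ^ Suc k * R"
        using geometric_index[of 2 R "dist x y"] R by auto
      have "0 < 2 ^ k * R" using R by simp
      then have "0 < dist x y" using k by linarith
      then have "1 / dist x y ^ (s + 1) \<le> 1 / (2 ^ k * R) ^ (s + 1)"
        using k R by (intro divide_left_mono power_mono mult_pos_pos zero_less_power) auto
      then have "indicator {y. R \<le> dist x y} y * ennreal (1 / dist x y ^ (s + 1)) \<le>
         indicator (ball x (2 ^ Suc k * R)) y * ennreal (1 / (2 ^ k * R) ^ (s + 1))"
        using k True by (auto intro!: ennreal_leI)
      also have "\<dots> \<le> (\<Sum>k. indicator (ball x (2 ^ Suc k * R)) y * ennreal (1 / (2 ^ k * R) ^ (s + 1)))"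
        by (rule ennreal_le_suminf)
      finally show ?thesis .
    qed simp
  qed
  also have "\<dots> = (\<Sum>k. emeasure \<sigma> (ball x (2 ^ Suc k * R)) * ennreal (1 / (2 ^ k * R) ^ (s + 1)))"
    by (subst nn_integral_suminf) (auto simp: nn_integral_multc)
  also have "\<dots> \<le> (\<Sum>k. ennreal (c * 2 ^ s / R * (1/2) ^ k))"
  proof (intro suminf_le)
    fix k
    have "emeasure \<sigma> (ball x (2 ^ Suc k * R)) * ennreal (1 / (2 ^ k * R) ^ (s + 1))
      \<le> ennreal (c * (2 ^ Suc k * R) ^ s) * ennreal (1 / (2 ^ k * R) ^ (s + 1))"
    proof (intro mult_right_mono gr)
      have "1 * R \<le> 2 ^ Suc k * R" using R by (intro mult_right_mono one_le_power) auto
      then show "R \<le> 2 ^ Suc k * R" by simp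
    qed auto
    also have "\<dots> = ennreal (c * 2 ^ s / R * (1/2) ^ k)"
      using R c by (simp add: ennreal_mult[symmetric] power_mult_distrib field_simps)
    finally show "emeasure \<sigma> (ball x (2 ^ Suc k * R)) * ennreal (1 / (2 ^ k * R) ^ (s + 1)) \<le>
      ennreal (c * 2 ^ s / R * (1/2) ^ k)" .
  qed auto
  also have "\<dots> = ennreal (c * 2 ^ s / R * 2)"
    using R c by (intro suminf_ennreal_eq sums_mult half_sums) auto
  finally show ?thesis by (simp add: field_simps)
qed

text \<open>The integrand has order \<open>s - 1\<close>, one power below the critical one, so the
  shells shrinking to \<open>x\<close> give a geometric series. At \<open>y = x\<close> the
  integrand is 0 by the convention for division.\<close>

lemma near_integral:
  fixes \<sigma> :: "'a::euclidean_space measure" and c R :: real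
  assumes [measurable_cong]: "sets \<sigma> = sets borel" and R: "R > 0" and c: "c \<ge> 0"
    and gr: "\<And>t. 0 < t \<Longrightarrow> t \<le> R \<Longrightarrow> emeasure \<sigma> (ball x t) \<le> ennreal (c * t ^ s)"
  shows "(\<integral>\<^sup>+y. indicator (ball x R) y * ennreal (dist x y / dist x y ^ s) \<partial>\<sigma>)
           \<le> ennreal (c * 2 ^ (s + 1) * R)"
proof -
  let ?t = "\<lambda>k. (1/2) ^ k * R"
  have [measurable]: "ball x a \<in> sets \<sigma>" for a using assms(1) by simp
  have "(\<integral>\<^sup>+y. indicator (ball x R) y * ennreal (dist x y / dist x y ^ s) \<partial>\<sigma>) \<le>
    (\<integral>\<^sup>+y. (\<Sum>k. indicator (ball x (?t k)) y * ennreal (?t k / ?t (Suc k) ^ s)) \<partial>\<sigma>)"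
  proof (intro nn_integral_mono)
    fix y
    show "indicator (ball x R) y * ennreal (dist x y / dist x y ^ s) \<le>
      (\<Sum>k. indicator (ball x (?t k)) y * ennreal (?t k / ?t (Suc k) ^ s))"
    proof (cases "dist x y < R \<and> y \<noteq> x")
      case True
      then obtain k where k: "?t (Suc k) \<le> dist x y" "dist x y < ?t k"
        using geometric_index_down[of 2 "dist x y" R] by auto
      have "dist x y / dist x y ^ s \<le> ?t k / ?t (Suc k) ^ s"
        using k R True by (intro frac_le power_mono) auto
      then have "indicator (ball x R) y * ennreal (dist x y / dist x y ^ s) \<le>
         indicator (ball x (?t k)) y * ennreal (?t k / ?t (Suc k) ^ s)"
        using k True by (auto intro!: ennreal_leI)
      also have "\<dots> \<le> (\<Sum>k. indicator (ball x (?t k)) y * ennreal (?t k / ?t (Suc k) ^ s))"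
        by (rule ennreal_le_suminf)
      finally show ?thesis .
    qed auto
  qed
  also have "\<dots> = (\<Sum>k. emeasure \<sigma> (ball x (?t k)) * ennreal (?t k / ?t (Suc k) ^ s))"
    by (subst nn_integral_suminf) (auto simp: nn_integral_multc)
  also have "\<dots> \<le> (\<Sum>k. ennreal (c * 2 ^ s * R * (1/2) ^ k))"
  proof (intro suminf_le)
    fix k
    have "emeasure \<sigma> (ball x (?t k)) * ennreal (?t k / ?t (Suc k) ^ s)
      \<le> ennreal (c * ?t k ^ s) * ennreal (?t k / ?t (Suc k) ^ s)"
    proof (intro mult_right_mono gr)
      show "?t k \<le> R" using R by (simp add: power_le_one mult_left_le_one_le)
    qed (use R in auto)
    also have "\<dots> = ennreal (c * 2 ^ s * R * (1/2) ^ k)"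
      using R c by (simp add: ennreal_mult[symmetric] power_mult_distrib field_simps)
    finally show "emeasure \<sigma> (ball x (?t k)) * ennreal (?t k / ?t (Suc k) ^ s) \<le>
      ennreal (c * 2 ^ s * R * (1/2) ^ k)" .
  qed auto
  also have "\<dots> = ennreal (c * 2 ^ s * R * 2)"
    using R c by (intro suminf_ennreal_eq sums_mult half_sums) auto
  finally show ?thesis by (simp add: field_simps)
qed

text \<open>
  The ratio of consecutive scales; any sufficiently large constant works. A radius \<open>R\<close> is doubling
  at \<open>x\<close> if \<open>measure \<mu> (ball x (Q * R)) \<le> Q ^ (s + 1) * measure \<mu> (ball x R)\<close>; because of the
  growth condition the mass cannot keep increasing by a factor larger than \<open>Q ^ (s + 1)\<close>.
\<close>

abbreviation Q :: real where "Q \<equiv> 32"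

section \<open>Doubling radii and coverings for a non-doubling measure\<close>

context growth_measure
begin

text \<open>\<open>k\<close> is the first doubling index. Each earlier step multiplies the mass by
  at least \<open>Q ^ (s + 1)\<close>, while growth at index \<open>k\<close> caps it by the s-th
  power of the radius; dividing back gives a decay of the density by \<open>1/Q\<close> per step. If
  doubling never happened, the same estimate with arbitrarily many steps would make every ball null,
  against \<open>pos\<close>.\<close>

lemma doubling_radius:
  assumes r: "r > 0" and pos: "measure \<mu> (ball x t0) > 0"
  obtains k :: nat where
    "measure \<mu> (ball x (Q * (Q ^ k * r))) \<le> Q ^ (s + 1) * measure \<mu> (ball x (Q ^ k * r))"
    "measure \<mu> (ball x (Q ^ k * r)) > 0"
    "\<And>i. i \<le> k \<Longrightarrow> measure \<mu> (ball x (Q ^ i * r)) \<le> (1/Q) ^ (k - i) * (Q ^ i * r) ^ s"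
proof -
  define m where "m i = measure \<mu> (ball x (Q ^ i * r))" for i
  have mle: "m i \<le> (Q ^ i * r) ^ s" for i unfolding m_def using r by (intro measure_ball_le) auto
  have m0: "m i \<ge> 0" for i by (simp add: m_def)
  \<comment> \<open>Positivity is included because a null ball would otherwise count as doubling
    whenever the next ball is null too.\<close>
  define P where "P i \<longleftrightarrow> m (Suc i) \<le> Q ^ (s + 1) * m i \<and> m i > 0" for i
  have grow: "Q ^ ((s + 1) * n) * m i \<le> m (i + n)" if "\<And>j. i \<le> j \<Longrightarrow> j < i + n \<Longrightarrow> \<not> P j" for i n
    using that
  proof (induction n)
    case (Suc n)
    have "Q ^ ((s + 1) * Suc n) * m i = Q ^ (s + 1) * (Q ^ ((s + 1) * n) * m i)"
      by (simp add: power_add algebra_simps)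
    also have "\<dots> \<le> Q ^ (s + 1) * m (i + n)" using Suc by (intro mult_left_mono) auto
    also have "\<dots> \<le> m (i + Suc n)"
      using Suc.prems[of "i + n"] m0[of "i + n"] m0[of "Suc (i + n)"] by (auto simp: P_def not_le)
    finally show ?case .
  qed simp
  have decay: "m i \<le> (1/Q) ^ n * (Q ^ i * r) ^ s" if "\<And>j. i \<le> j \<Longrightarrow> j < i + n \<Longrightarrow> \<not> P j" for i n
  proof -
    have "Q ^ ((s + 1) * n) * m i \<le> (Q ^ (i + n) * r) ^ s"
      using grow[OF that] mle order_trans by blast
    also have "\<dots> = Q ^ (s * n) * (Q ^ i * r) ^ s"
      by (simp add: power_mult_distrib power_add power_mult[symmetric] algebra_simps)
    finally have "Q ^ (s * n) * (Q ^ n * m i) \<le> Q ^ (s * n) * (Q ^ i * r) ^ s"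
      by (simp add: power_add algebra_simps)
    then have "Q ^ n * m i \<le> (Q ^ i * r) ^ s" by simp
    then show ?thesis by (simp add: field_simps power_divide)
  qed
  have "\<exists>k. P k"
  proof (rule ccontr)
    assume no: "\<nexists>k. P k"
    have z: "m i = 0" for i
    proof -
      have "(\<lambda>n. (1/Q) ^ n * (Q ^ i * r) ^ s) \<longlonglongrightarrow> 0 * (Q ^ i * r) ^ s"
        by (intro tendsto_intros LIMSEQ_realpow_zero) auto
      then have "m i \<le> 0 * (Q ^ i * r) ^ s"
        using decay no by (intro LIMSEQ_le_const) blast+
      then show ?thesis using m0[of i] by simp
    qed
    obtain n where "t0 / r < Q ^ n" using real_arch_pow[of Q] by auto
    then have "t0 \<le> Q ^ n * r" using r by (simp add: field_simps)
    then have "measure \<mu> (ball x t0) \<le> m n" unfolding m_def by (rule measure_ball_mono)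
    then show False using z pos by simp
  qed
  define k where "k = (LEAST k. P k)"
  have k: "P k" unfolding k_def using \<open>\<exists>k. P k\<close> LeastI_ex by blast
  have nk: "\<not> P j" if "j < k" for j using that not_less_Least unfolding k_def by blast
  show ?thesis
  proof (rule that[of k])
    show "measure \<mu> (ball x (Q * (Q ^ k * r))) \<le> Q ^ (s + 1) * measure \<mu> (ball x (Q ^ k * r))"
      using k by (simp add: P_def m_def mult.assoc)
    show "measure \<mu> (ball x (Q ^ k * r)) > 0" using k by (simp add: P_def m_def)
    fix i assume "i \<le> k"
    then show "measure \<mu> (ball x (Q ^ i * r)) \<le> (1/Q) ^ (k - i) * (Q ^ i * r) ^ s"
      using decay[of i "k - i"] nk unfolding m_def by simp
  qed
qed

text \<open>By size alone each shell contributes a bounded amount, and their number grows with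
  \<open>k\<close>; the decay of the density towards small radii turns the sum into a geometric one,
  so the bound is free of \<open>k\<close>. It is applied with \<sigma> = \<mu> to atoms, and with a
  finite measure \<sigma> at points where its maximal function is small.\<close>

lemma gap_integral:
  fixes \<sigma> :: "'a measure" and c r :: real
  assumes [measurable_cong]: "sets \<sigma> = sets borel" and r: "r > 0" and c: "c \<ge> 0"
    and dec: "\<And>i. i \<le> k \<Longrightarrow> measure \<mu> (ball x (Q ^ i * r)) \<le> (1/Q) ^ (k - i) * (Q ^ i * r) ^ s"
    and gr: "\<And>t. t \<ge> r \<Longrightarrow> emeasure \<sigma> (ball x t) \<le> ennreal (c * measure \<mu> (ball x (5 * t)))"
  shows "(\<integral>\<^sup>+y. indicator {y. r \<le> dist x y \<and> dist x y < Q * (Q ^ k * r)} y * ennreal (1 / dist x y ^ s) \<partial>\<sigma>)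
           \<le> ennreal (c * 2 * Q ^ (2 * s + 2))"
proof -
  have [measurable]: "ball x a \<in> sets \<sigma>" for a using assms(1) by simp
  define t where "t j = Q ^ j * r" for j
  have t0: "t j > 0" for j using r by (simp add: t_def)
  have "(\<integral>\<^sup>+y. indicator {y. r \<le> dist x y \<and> dist x y < Q * (Q ^ k * r)} y * ennreal (1 / dist x y ^ s) \<partial>\<sigma>) \<le>
    (\<integral>\<^sup>+y. (\<Sum>j\<le>k. indicator (ball x (t (Suc j))) y * ennreal (1 / t j ^ s)) \<partial>\<sigma>)"
  proof (intro nn_integral_mono)
    fix y
    show "indicator {y. r \<le> dist x y \<and> dist x y < Q * (Q ^ k * r)} y * ennreal (1 / dist x y ^ s) \<le>
      (\<Sum>j\<le>k. indicator (ball x (t (Suc j))) y * ennreal (1 / t j ^ s))"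
    proof (cases "r \<le> dist x y \<and> dist x y < Q * (Q ^ k * r)")
      case True
      then obtain j where j: "t j \<le> dist x y" "dist x y < t (Suc j)"
        using geometric_index[of Q r "dist x y"] r by (auto simp: t_def)
      have "j \<le> k"
      proof (rule ccontr)
        assume "\<not> j \<le> k"
        then have "Q ^ Suc k * r \<le> Q ^ j * r" using r by (intro mult_right_mono power_increasing) auto
        then show False using True j by (simp add: t_def)
      qed
      have "1 / dist x y ^ s \<le> 1 / t j ^ s"
        using j t0[of j] by (intro divide_left_mono power_mono mult_pos_pos zero_less_power) linarith+
      then have "indicator {y. r \<le> dist x y \<and> dist x y < Q * (Q ^ k * r)} y * ennreal (1 / dist x y ^ s) \<le>
         indicator (ball x (t (Suc j))) y * ennreal (1 / t j ^ s)"
        using j True by (auto intro!: ennreal_leI)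
      also have "\<dots> \<le> (\<Sum>j\<le>k. indicator (ball x (t (Suc j))) y * ennreal (1 / t j ^ s))"
        using \<open>j \<le> k\<close> by (intro member_le_sum) auto
      finally show ?thesis .
    qed simp
  qed
  also have "\<dots> = (\<Sum>j\<le>k. emeasure \<sigma> (ball x (t (Suc j))) * ennreal (1 / t j ^ s))"
    by (subst nn_integral_sum) (auto simp: nn_integral_multc)
  also have "\<dots> \<le> (\<Sum>j\<le>k. ennreal (c * Q ^ (2 * s + 2) * (1/Q) ^ (k - j)))"
  proof (intro sum_mono)
    fix j assume "j \<in> {..k}"
    then have jk: "j \<le> k" by simp
    \<comment> \<open>The factor 5 costs one index and the outer radius of the shell another one,
      whence \<open>Q ^ 2\<close> from the decay and \<open>Q ^ (2 * s)\<close> from the radius. If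
      \<open>j + 2\<close> exceeds \<open>k\<close>, then \<open>Q ^ 2\<close> outweighs the power
      of \<open>1/Q\<close> and plain growth is enough.\<close>
    have "measure \<mu> (ball x (5 * t (Suc j))) \<le> measure \<mu> (ball x (t (Suc (Suc j))))"
      using r by (intro measure_ball_mono) (simp add: t_def)
    also have "\<dots> \<le> Q ^ 2 * (1/Q) ^ (k - j) * t (Suc (Suc j)) ^ s"
    proof (cases "Suc (Suc j) \<le> k")
      case True
      then have "k - j = 2 + (k - Suc (Suc j))" by simp
      then have "(1/Q) ^ (k - Suc (Suc j)) = Q ^ 2 * (1/Q) ^ (k - j)" by (simp only: power_add) (simp add: power2_eq_square)
      then show ?thesis using dec[OF True] by (simp add: t_def)
    next
      case False
      then have "k = j \<or> k = Suc j" using jk by auto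
      then have "1 \<le> Q ^ 2 * (1/Q) ^ (k - j)" by auto
      then have "1 * t (Suc (Suc j)) ^ s \<le> Q ^ 2 * (1/Q) ^ (k - j) * t (Suc (Suc j)) ^ s"
        by (rule mult_right_mono) (use t0[of "Suc (Suc j)"] in simp)
      then show ?thesis using measure_ball_le[OF less_imp_le[OF t0], of x "Suc (Suc j)"] by linarith
    qed
    also have "t (Suc (Suc j)) ^ s = Q ^ (2 * s) * t j ^ s"
      by (simp add: t_def power_mult_distrib power_mult)
    finally have m: "measure \<mu> (ball x (5 * t (Suc j))) \<le> Q ^ 2 * (1/Q) ^ (k - j) * (Q ^ (2 * s) * t j ^ s)" .
    have "emeasure \<sigma> (ball x (t (Suc j))) * ennreal (1 / t j ^ s) \<le>
       ennreal (c * measure \<mu> (ball x (5 * t (Suc j)))) * ennreal (1 / t j ^ s)"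
    proof (intro mult_right_mono gr)
      have "1 * r \<le> Q ^ Suc j * r" using r by (intro mult_right_mono one_le_power) auto
      then show "r \<le> t (Suc j)" by (simp add: t_def)
    qed auto
    also have "\<dots> = ennreal (c * measure \<mu> (ball x (5 * t (Suc j))) * (1 / t j ^ s))"
      using c t0[of j] by (intro ennreal_mult[symmetric]) auto
    also have "\<dots> \<le> ennreal (c * (Q ^ 2 * (1/Q) ^ (k - j) * (Q ^ (2 * s) * t j ^ s)) * (1 / t j ^ s))"
      using m c t0[of j] by (intro ennreal_leI mult_right_mono mult_left_mono) auto
    also have "c * (Q ^ 2 * (1/Q) ^ (k - j) * (Q ^ (2 * s) * t j ^ s)) * (1 / t j ^ s) =
      c * Q ^ (2 * s + 2) * (1/Q) ^ (k - j)"
      using t0[of j] by (simp add: power_add)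
    finally show "emeasure \<sigma> (ball x (t (Suc j))) * ennreal (1 / t j ^ s) \<le>
      ennreal (c * Q ^ (2 * s + 2) * (1/Q) ^ (k - j))" .
  qed
  also have "\<dots> = ennreal (c * Q ^ (2 * s + 2) * (\<Sum>j\<le>k. (1/Q) ^ (k - j)))"
    using c by (simp add: sum_ennreal sum_distrib_left)
  also have "(\<Sum>j\<le>k. (1/Q) ^ (k - j)) = (\<Sum>j\<le>k. (1/Q) ^ j)"
    by (rule sum.reindex_bij_witness[of _ "\<lambda>j. k - j" "\<lambda>j. k - j"]) auto
  also have "ennreal (c * Q ^ (2 * s + 2) * (\<Sum>j\<le>k. (1/Q) ^ j)) \<le> ennreal (c * Q ^ (2 * s + 2) * 2)"
  proof (intro ennreal_leI mult_left_mono)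
    have "(\<Sum>j\<le>k. (1/Q) ^ j) \<le> (\<Sum>j. (1/Q) ^ j)"
      by (intro sum_le_suminf summable_geometric) auto
    also have "\<dots> \<le> 2" by (subst suminf_geometric) auto
    finally show "(\<Sum>j\<le>k. (1/Q) ^ j) \<le> 2" .
  qed (use c in auto)
  finally show ?thesis by (simp add: mult_ac)
qed

text \<open>The disjoint balls selected by Vitali's lemma add up in \<sigma>, and their 5-fold
  dilates, whose \<mu>-mass is what the hypothesis bounds, form the cover. This is the weak type
  bound for the maximal function that puts the enlarged ball on the side of \<mu>.\<close>

lemma maximal_cover_balls:
  fixes \<sigma> :: "'a measure" and l :: real
  assumes [measurable_cong]: "sets \<sigma> = sets borel" and l: "l > 0" and S: "bounded S"
    and R: "\<And>x. x \<in> S \<Longrightarrow> R x > 0"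
     "\<And>x. x \<in> S \<Longrightarrow> ennreal l * emeasure \<mu> (ball x (5 * R x)) \<le> emeasure \<sigma> (ball x (R x))"
  shows "\<exists>U\<in>sets borel. (\<Union>x\<in>S. ball x (R x)) \<subseteq> U \<and> ennreal l * emeasure \<mu> U \<le> emeasure \<sigma> UNIV"
proof -
  have sigle: "emeasure \<sigma> A \<le> emeasure \<sigma> UNIV" for A
    using sets_eq_imp_space_eq[OF assms(1)] emeasure_space[of \<sigma> A] by simp
  show ?thesis
  proof (cases "\<exists>B. \<forall>x\<in>S. R x \<le> B")
    case True
    then obtain B where B: "\<And>x. x \<in> S \<Longrightarrow> R x \<le> B" by blast
    obtain C where C: "countable C" "C \<subseteq> S"
        "pairwise (\<lambda>i j. disjnt (ball i (R i)) (ball j (R j))) C"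
        "(\<Union>x\<in>S. ball x (R x)) \<subseteq> (\<Union>i\<in>C. ball i (5 * R i))"
    proof (rule Vitali_covering_lemma_balls[where S="\<Union>x\<in>S. ball x (R x)" and K=S and a="\<lambda>x. x" and r=R and B=B])
      show "0 < R i \<and> R i \<le> B" if "i \<in> S" for i using R(1) B that by simp
    qed (rule order_refl that)+
    let ?U = "\<Union>i\<in>C. ball i (5 * R i)"
    \<comment> \<open>Countable subadditivity over the index set \<open>C\<close>, expressed by
      integration against counting measure.\<close>
    have "emeasure \<mu> ?U \<le> (\<integral>\<^sup>+i. emeasure \<mu> (ball i (5 * R i)) \<partial>count_space C)"
    proof -
      have "emeasure \<mu> ?U = (\<integral>\<^sup>+y. indicator ?U y \<partial>\<mu>)"
        using C(1) by (intro nn_integral_indicator[symmetric]) (auto intro!: sets.countable_UN')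
      also have "\<dots> \<le> (\<integral>\<^sup>+y. (\<integral>\<^sup>+i. indicator (ball i (5 * R i)) y \<partial>count_space C) \<partial>\<mu>)"
      proof (intro nn_integral_mono)
        fix y
        show "indicator ?U y \<le> (\<integral>\<^sup>+i. indicator (ball i (5 * R i)) y \<partial>count_space C)"
        proof (cases "y \<in> ?U")
          case True
          then obtain i where i: "i \<in> C" "y \<in> ball i (5 * R i)" by blast
          then have "indicator ?U y = (indicator (ball i (5 * R i)) y :: ennreal)" using True by (simp only: indicator_simps)
          also have "\<dots> \<le> (\<integral>\<^sup>+i. indicator (ball i (5 * R i)) y \<partial>count_space C)"
            using i(1) by (rule nn_integral_ge_point)
          finally show ?thesis .
        next
          case False
          then have "indicator ?U y = (0::ennreal)" by (rule indicator_simps(2))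
          then show ?thesis by (simp only: zero_le)
        qed
      qed
      also have "\<dots> = (\<integral>\<^sup>+i. (\<integral>\<^sup>+y. indicator (ball i (5 * R i)) y \<partial>\<mu>) \<partial>count_space C)"
        using C(1) by (intro nn_integral_count_space_nn_integral) (auto intro!: borel_measurable_indicator)
      finally show ?thesis by simp
    qed
    then have "ennreal l * emeasure \<mu> ?U \<le> ennreal l * (\<integral>\<^sup>+i. emeasure \<mu> (ball i (5 * R i)) \<partial>count_space C)"
      by (rule mult_left_mono) simp
    also have "\<dots> = (\<integral>\<^sup>+i. ennreal l * emeasure \<mu> (ball i (5 * R i)) \<partial>count_space C)"
      by (subst nn_integral_cmult) auto
    also have "\<dots> \<le> (\<integral>\<^sup>+i. emeasure \<sigma> (ball i (R i)) \<partial>count_space C)"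
      using C(2) R(2) by (intro nn_integral_mono) auto
    also have "\<dots> = emeasure \<sigma> (\<Union>i\<in>C. ball i (R i))"
      using C(1,3) by (intro emeasure_UN_countable[symmetric])
        (auto simp: disjoint_family_on_def pairwise_def disjnt_def)
    also have "\<dots> \<le> emeasure \<sigma> UNIV" by (rule sigle)
    finally have "ennreal l * emeasure \<mu> ?U \<le> emeasure \<sigma> UNIV" .
    moreover have "?U \<in> sets borel" using C(1) by (intro sets.countable_UN') auto
    ultimately show ?thesis using C(4) by blast
  next
    \<comment> \<open>Unbounded radii, outside the scope of Vitali's lemma: as \<open>S\<close> is
      bounded, the dilated balls swallow every ball about 0, and the whole space is an admissible
      cover.\<close>
    case False
    obtain P where P: "\<And>x. x \<in> S \<Longrightarrow> norm x \<le> P" using S by (auto simp: bounded_iff)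
    have "ennreal l * emeasure \<mu> (ball 0 (real n)) \<le> emeasure \<sigma> UNIV" for n
    proof -
      obtain x where x: "x \<in> S" "R x > P + real n" using False by (auto simp: not_le)
      have "ball 0 (real n) \<subseteq> ball x (5 * R x)"
      proof
        fix y :: 'a assume "y \<in> ball 0 (real n)"
        then have "dist x y < R x" using P[OF x(1)] x(2) norm_triangle_ineq4[of x y] by (simp add: dist_norm)
        then show "y \<in> ball x (5 * R x)" using R(1)[OF x(1)] by simp
      qed
      then have "ennreal l * emeasure \<mu> (ball 0 (real n)) \<le> ennreal l * emeasure \<mu> (ball x (5 * R x))"
        by (intro mult_left_mono emeasure_mono) auto
      also have "\<dots> \<le> emeasure \<sigma> (ball x (R x))" using R(2)[OF x(1)] .
      finally show ?thesis using sigle order_trans by blast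
    qed
    moreover have "(SUP n. ennreal l * emeasure \<mu> (ball 0 (real n))) = ennreal l * emeasure \<mu> (\<Union>n. ball 0 (real n))"
      by (subst SUP_emeasure_incseq[symmetric]) (auto simp: incseq_def SUP_mult_left_ennreal)
    moreover have "(\<Union>n. ball (0::'a) (real n)) = UNIV" by (auto simp: reals_Archimedean2)
    ultimately have "ennreal l * emeasure \<mu> UNIV \<le> emeasure \<sigma> UNIV"
      by (metis SUP_least)
    then show ?thesis by (intro bexI[of _ UNIV]) auto
  qed
qed

lemma maximal_cover:
  fixes \<sigma> :: "'a measure" and l :: real
  assumes "sets \<sigma> = sets borel" and "l > 0" and "bounded S"
    and ex: "\<And>x. x \<in> S \<Longrightarrow> \<exists>R>0. ennreal l * emeasure \<mu> (ball x (5 * R)) \<le> emeasure \<sigma> (ball x R)"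
  shows "\<exists>U\<in>sets borel. S \<subseteq> U \<and> ennreal l * emeasure \<mu> U \<le> emeasure \<sigma> UNIV"
proof -
  obtain R where R: "\<And>x. x \<in> S \<Longrightarrow> R x > 0"
     "\<And>x. x \<in> S \<Longrightarrow> ennreal l * emeasure \<mu> (ball x (5 * R x)) \<le> emeasure \<sigma> (ball x (R x))"
    using ex by metis
  have "S \<subseteq> (\<Union>x\<in>S. ball x (R x))" using R(1) by force
  then show ?thesis using maximal_cover_balls[OF assms(1-3) R] by blast
qed

lemma integrable_bounded_support:
  fixes f :: "'a \<Rightarrow> 'c::{banach, second_countable_topology}"
  assumes f [measurable]: "f \<in> borel_measurable borel" and B: "\<And>y. norm (f y) \<le> B"
    and supp: "\<And>y. f y \<noteq> 0 \<Longrightarrow> y \<in> ball x r"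
  shows "integrable \<mu> f"
proof (rule Bochner_Integration.integrable_bound)
  show "integrable \<mu> (\<lambda>y. B * indicator (ball x r) y)"
    using emeasure_bounded_finite[of "ball x r"] by simp
  show "AE y in \<mu>. norm (f y) \<le> norm (B * indicator (ball x r) y)"
  proof (intro AE_I2)
    fix y
    show "norm (f y) \<le> norm (B * indicator (ball x r) y)"
      using B[of y] norm_ge_zero[of "f y"] supp[of y] by (cases "f y = 0") auto
  qed
qed simp

end

section \<open>Truncated kernels\<close>

text \<open>Piecewise linear rather than smooth: the test functions of the flat coefficients are
  required to be Lipschitz, nothing more.\<close>

definition ramp :: "real \<Rightarrow> real" where "ramp t = max 0 (min 1 (t - 1))"

lemma ramp_bounds: "0 \<le> ramp t" "ramp t \<le> 1" "\<bar>ramp t\<bar> \<le> 1"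
  by (auto simp: ramp_def)

lemma ramp_eq_0: "t \<le> 1 \<Longrightarrow> ramp t = 0" and ramp_eq_1: "2 \<le> t \<Longrightarrow> ramp t = 1"
  by (auto simp: ramp_def)

lemma ramp_lipschitz: "\<bar>ramp t - ramp u\<bar> \<le> \<bar>t - u\<bar>"
  by (auto simp: ramp_def max_def min_def)

lemma (in growth_measure) measurable_ball_mu [measurable]: "ball x r \<in> sets \<mu>"
  by simp

section \<open>Estimates for truncated kernels, uniform in the truncation radius\<close>

locale cz_kernel =
  fixes K :: "'a::euclidean_space \<Rightarrow> 'b::euclidean_space" and s :: nat and C0 :: real
  assumes C0_pos: "C0 > 0"
    and K_bound: "x \<noteq> 0 \<Longrightarrow> norm (K x) \<le> C0 / norm x ^ s"
    and K_odd: "x \<noteq> 0 \<Longrightarrow> K (- x) = - K x"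
    and K_smooth: "x \<noteq> 0 \<Longrightarrow> x' \<noteq> 0 \<Longrightarrow> norm (x - x') \<le> norm x / 2 \<Longrightarrow>
        norm (K x - K x') \<le> C0 * norm (x - x') / norm x ^ (s + 1)"
begin

lemma radial_bound:
  assumes "\<rho> > 0" and "\<And>t. \<bar>c t\<bar> \<le> 1" and "\<And>t. 0 \<le> t \<Longrightarrow> t \<le> \<rho> \<Longrightarrow> c t = 0"
  shows "norm (c (norm z) *\<^sub>R K z) \<le> C0 / \<rho> ^ s"
proof (cases "norm z \<le> \<rho>")
  case False
  then have z: "norm z > \<rho>" "z \<noteq> 0" using assms(1) by auto
  have "norm (c (norm z) *\<^sub>R K z) \<le> 1 * (C0 / norm z ^ s)"
    unfolding norm_scaleR using assms(2) K_bound[OF z(2)] by (intro mult_mono) auto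
  also have "\<dots> \<le> C0 / \<rho> ^ s"
    using z assms(1) C0_pos by (auto intro!: divide_left_mono power_mono mult_pos_pos)
  finally show ?thesis .
qed (use assms C0_pos in simp)

text \<open>By symmetry \<open>z'\<close> may be taken as the shorter vector. If it is close to
  \<open>z\<close>, the product rule applies with the smoothness of \<open>K\<close>; otherwise the
  two points are at least \<rho>/2 apart and the size bound at both is enough. The profile
  \<open>c\<close> is general because both \<open>ramp\<close> and the steeper layer of relative
  width \<kappa> in \<open>sharp_increments_vanish\<close> are of this kind.\<close>

lemma radial_lipschitz:
  assumes \<rho>: "\<rho> > 0" and c1: "\<And>t. \<bar>c t\<bar> \<le> 1" and c0: "\<And>t. 0 \<le> t \<Longrightarrow> t \<le> \<rho> \<Longrightarrow> c t = 0"
    and cl: "\<And>t u. 0 \<le> t \<Longrightarrow> 0 \<le> u \<Longrightarrow> \<bar>c t - c u\<bar> \<le> P * \<bar>t - u\<bar>" and P: "P \<ge> 0"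
  shows "norm (c (norm z) *\<^sub>R K z - c (norm z') *\<^sub>R K z') \<le> C0 * (2 ^ s * P / \<rho> ^ s + 4 / \<rho> ^ (s + 1)) * norm (z - z')"
proof -
  have *: "norm (c (norm z) *\<^sub>R K z - c (norm z') *\<^sub>R K z') \<le> C0 * (2 ^ s * P / \<rho> ^ s + 4 / \<rho> ^ (s + 1)) * norm (z - z')"
    if le: "norm z' \<le> norm z" for z z'
  proof (cases "norm z \<le> \<rho>")
    case True
    then show ?thesis using le c0[of "norm z"] c0[of "norm z'"] C0_pos P \<rho> by simp
  next
    case False
    then have z: "norm z > \<rho>" "z \<noteq> 0" using \<rho> by auto
    show ?thesis
    proof (cases "norm (z - z') \<le> norm z / 2")
      case True
      have z'2: "norm z / 2 \<le> norm z'" using True norm_triangle_ineq2[of z z'] by linarith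
      then have z': "z' \<noteq> 0" "norm z' > 0" using z \<rho> by (auto simp del: norm_le_zero_iff)
      have Kz': "norm (K z') \<le> C0 * 2 ^ s / \<rho> ^ s"
      proof -
        have "norm (K z') \<le> C0 / norm z' ^ s" by (rule K_bound[OF z'(1)])
        also have "\<dots> \<le> C0 / (\<rho> / 2) ^ s"
          using z z' z'2 \<rho> C0_pos by (intro divide_left_mono power_mono mult_pos_pos zero_less_power) auto
        finally show ?thesis by (simp add: power_divide)
      qed
      have "c (norm z) *\<^sub>R K z - c (norm z') *\<^sub>R K z' = c (norm z) *\<^sub>R (K z - K z') + (c (norm z) - c (norm z')) *\<^sub>R K z'"
        by (simp add: algebra_simps)
      also have "norm \<dots> \<le> \<bar>c (norm z)\<bar> * norm (K z - K z') + \<bar>c (norm z) - c (norm z')\<bar> * norm (K z')"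
        by (metis norm_scaleR norm_triangle_ineq)
      also have "\<dots> \<le> 1 * (C0 * norm (z - z') / norm z ^ (s + 1)) + (P * \<bar>norm z - norm z'\<bar>) * (C0 * 2 ^ s / \<rho> ^ s)"
        using c1 cl[of "norm z" "norm z'"] K_smooth[OF z(2) z'(1) True] Kz' P
        by (intro add_mono mult_mono) auto
      also have "\<dots> \<le> C0 * norm (z - z') / \<rho> ^ (s + 1) + (P * norm (z - z')) * (C0 * 2 ^ s / \<rho> ^ s)"
      proof (intro add_mono)
        show "1 * (C0 * norm (z - z') / norm z ^ (s + 1)) \<le> C0 * norm (z - z') / \<rho> ^ (s + 1)"
          unfolding mult_1 using z \<rho> C0_pos by (intro divide_left_mono power_mono mult_pos_pos zero_less_power) auto
        show "(P * \<bar>norm z - norm z'\<bar>) * (C0 * 2 ^ s / \<rho> ^ s) \<le> (P * norm (z - z')) * (C0 * 2 ^ s / \<rho> ^ s)"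
          using P \<rho> C0_pos norm_triangle_ineq3[of z z'] by (intro mult_right_mono mult_left_mono) auto
      qed
      also have "\<dots> \<le> C0 * (2 ^ s * P / \<rho> ^ s + 4 / \<rho> ^ (s + 1)) * norm (z - z')"
      proof -
        have "C0 * norm (z - z') / \<rho> ^ (s + 1) \<ge> 0" using C0_pos \<rho> by simp
        then have "C0 * norm (z - z') / \<rho> ^ (s + 1) \<le> 4 * (C0 * norm (z - z') / \<rho> ^ (s + 1))" by linarith
        then show ?thesis by (simp add: algebra_simps)
      qed
      finally show ?thesis .
    next
      case False
      then have "norm (z - z') \<ge> \<rho> / 2" using z by simp
      then have n: "1 \<le> 2 * norm (z - z') / \<rho>" using \<rho> by (simp add: field_simps)
      have "norm (c (norm z) *\<^sub>R K z - c (norm z') *\<^sub>R K z') \<le> C0 / \<rho> ^ s + C0 / \<rho> ^ s"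
        using radial_bound[OF \<rho> c1 c0] by (intro order_trans[OF norm_triangle_ineq4 add_mono]) auto
      also have "\<dots> = 2 * C0 / \<rho> ^ s * 1" by simp
      also have "\<dots> \<le> 2 * C0 / \<rho> ^ s * (2 * norm (z - z') / \<rho>)"
        using n C0_pos \<rho> by (intro mult_left_mono) auto
      also have "\<dots> = C0 * (4 / \<rho> ^ (s + 1)) * norm (z - z')" by (simp add: field_simps)
      also have "\<dots> \<le> C0 * (2 ^ s * P / \<rho> ^ s + 4 / \<rho> ^ (s + 1)) * norm (z - z')"
        using C0_pos \<rho> P by (intro mult_right_mono mult_left_mono) auto
      finally show ?thesis .
    qed
  qed
  show ?thesis
  proof (cases "norm z' \<le> norm z")
    case False
    then show ?thesis using *[of z z'] by (simp add: norm_minus_commute)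
  qed (rule *)
qed

definition kr :: "real \<Rightarrow> 'a \<Rightarrow> 'b" where "kr r z = ramp (norm z / r) *\<^sub>R K z"

lemma kr_eq_0: "r > 0 \<Longrightarrow> norm z \<le> r \<Longrightarrow> kr r z = 0"
  by (simp add: kr_def ramp_eq_0)

lemma kr_eq_K: "r > 0 \<Longrightarrow> 2 * r \<le> norm z \<Longrightarrow> kr r z = K z"
  by (simp add: kr_def ramp_eq_1 field_simps)

lemma kr_odd: "kr r (- z) = - kr r z"
  by (cases "z = 0") (simp_all add: kr_def K_odd ramp_eq_0)

lemma kr_norm: "norm (kr r z) \<le> C0 / norm z ^ s"
proof (cases "z = 0")
  case False
  have "norm (kr r z) \<le> 1 * (C0 / norm z ^ s)"
    unfolding kr_def norm_scaleR using ramp_bounds K_bound[OF False] by (intro mult_mono) auto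
  then show ?thesis by simp
qed (use C0_pos in \<open>simp add: kr_def ramp_eq_0\<close>)

lemma kr_bounded: "r > 0 \<Longrightarrow> norm (kr r z) \<le> C0 / r ^ s"
  unfolding kr_def by (rule radial_bound[of r "\<lambda>t. ramp (t / r)"]) (auto simp: ramp_bounds ramp_eq_0)

lemma kr_lipschitz:
  assumes "r > 0"
  shows "norm (kr r z - kr r z') \<le> C0 * (2 ^ s + 4) / r ^ (s + 1) * norm (z - z')"
proof -
  have l: "\<bar>ramp (t / r) - ramp (u / r)\<bar> \<le> 1 / r * \<bar>t - u\<bar>" for t u
    using ramp_lipschitz[of "t / r" "u / r"] assms
    by (simp add: diff_divide_distrib[symmetric] abs_divide)
  have "norm (kr r z - kr r z') \<le> C0 * (2 ^ s * (1 / r) / r ^ s + 4 / r ^ (s + 1)) * norm (z - z')"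
    unfolding kr_def using assms l by (intro radial_lipschitz) (auto simp: ramp_bounds ramp_eq_0)
  then show ?thesis by (simp add: add_divide_distrib field_simps)
qed

lemma continuous_kr: "r > 0 \<Longrightarrow> continuous_on UNIV (kr r)"
  by (rule lipschitz_on_continuous_on[of "C0 * (2 ^ s + 4) / r ^ (s + 1)"])
     (use kr_lipschitz C0_pos in \<open>auto simp: lipschitz_on_def dist_norm\<close>)

lemma measurable_kr [measurable]: "r > 0 \<Longrightarrow> kr r \<in> borel_measurable borel"
  by (intro borel_measurable_continuous_onI continuous_kr)

definition C1 :: real where "C1 = C0 * (1 + 4 * 2 ^ s)"

lemma C1_pos: "C1 > 0" using C0_pos by (simp add: C1_def add_pos_pos)

text \<open>The ramp can differ at the two points only if \<open>norm z\<close> is below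
  \<open>4 * r\<close>, since otherwise both lie beyond \<open>2 * r\<close>; there its slope
  \<open>1 / r\<close> is at most \<open>4 / norm z\<close>. Hence the constant does not depend on
  \<open>r\<close>.\<close>

lemma kr_smooth:
  assumes r: "r > 0" and zz: "norm (z - z') \<le> norm z / 2"
  shows "norm (kr r z - kr r z') \<le> C1 * norm (z - z') / norm z ^ (s + 1)"
proof (cases "z = 0")
  case False
  have z'2: "norm z / 2 \<le> norm z'" using zz norm_triangle_ineq2[of z z'] by linarith
  then have z': "z' \<noteq> 0" "norm z' > 0" using False by auto
  have Kz': "norm (K z') \<le> C0 * 2 ^ s / norm z ^ s"
  proof -
    have "norm (K z') \<le> C0 / norm z' ^ s" by (rule K_bound[OF z'(1)])
    also have "\<dots> \<le> C0 / (norm z / 2) ^ s"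
      using False z' z'2 C0_pos by (intro divide_left_mono power_mono mult_pos_pos zero_less_power) auto
    finally show ?thesis by (simp add: power_divide)
  qed
  have cc: "\<bar>ramp (norm z / r) - ramp (norm z' / r)\<bar> \<le> 4 * norm (z - z') / norm z"
  proof (cases "norm z \<ge> 4 * r")
    case True
    then have "2 \<le> norm z / r" "2 \<le> norm z' / r" using z'2 r by (auto simp: field_simps)
    then show ?thesis by (simp add: ramp_eq_1)
  next
    case f: False
    have "\<bar>ramp (norm z / r) - ramp (norm z' / r)\<bar> \<le> \<bar>norm z - norm z'\<bar> / r"
      using ramp_lipschitz[of "norm z / r" "norm z' / r"] r
      by (simp add: diff_divide_distrib[symmetric] abs_divide)
    also have "\<dots> \<le> norm (z - z') / r"
      using r norm_triangle_ineq3[of z z'] by (intro divide_right_mono) auto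
    also have "\<dots> \<le> norm (z - z') / (norm z / 4)"
      using r f False by (intro divide_left_mono) auto
    finally show ?thesis by (simp add: mult.commute)
  qed
  have "kr r z - kr r z' = ramp (norm z / r) *\<^sub>R (K z - K z') + (ramp (norm z / r) - ramp (norm z' / r)) *\<^sub>R K z'"
    by (simp add: kr_def algebra_simps)
  also have "norm \<dots> \<le> \<bar>ramp (norm z / r)\<bar> * norm (K z - K z') + \<bar>ramp (norm z / r) - ramp (norm z' / r)\<bar> * norm (K z')"
    by (metis norm_scaleR norm_triangle_ineq)
  also have "\<dots> \<le> 1 * (C0 * norm (z - z') / norm z ^ (s + 1)) + (4 * norm (z - z') / norm z) * (C0 * 2 ^ s / norm z ^ s)"
    using K_smooth[OF False z'(1) zz] Kz' cc ramp_bounds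
    by (intro add_mono mult_mono) auto
  also have "\<dots> = C1 * norm (z - z') / norm z ^ (s + 1)"
    using False by (simp add: C1_def field_simps)
  finally show ?thesis .
next
  case True
  then show ?thesis using zz by simp
qed

end

section \<open>Truncated operators, and the passage from sharp to smooth truncations in L^2\<close>

locale cz = growth_measure \<mu> s + cz_kernel K s C0
  for \<mu> :: "'a::euclidean_space measure" and s :: nat and K :: "'a \<Rightarrow> 'b::euclidean_space" and C0 :: real
begin

definition Tm :: "'a measure \<Rightarrow> real \<Rightarrow> 'a \<Rightarrow> 'b" where
  "Tm \<nu> r x = (\<integral>y. kr r (x - y) \<partial>\<nu>)"

definition Tf :: "('a \<Rightarrow> real) \<Rightarrow> real \<Rightarrow> 'a \<Rightarrow> 'b" where
  "Tf f r x = (\<integral>y. f y *\<^sub>R kr r (x - y) \<partial>\<mu>)"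

lemma integrable_Tf:
  assumes r: "r > 0" and f: "integrable \<mu> f"
  shows "integrable \<mu> (\<lambda>y. f y *\<^sub>R kr r (x - y))"
proof (rule Bochner_Integration.integrable_bound[where f="\<lambda>y. C0 / r ^ s * f y"])
  have [measurable]: "f \<in> borel_measurable borel" using borel_measurable_integrable[OF f] by simp
  have [measurable]: "kr r \<in> borel_measurable borel" using r by simp
  show "(\<lambda>y. f y *\<^sub>R kr r (x - y)) \<in> borel_measurable \<mu>" by measurable
  have "\<bar>f y\<bar> * norm (kr r (x - y)) \<le> \<bar>f y\<bar> * (C0 / r ^ s)" for y
    by (intro mult_left_mono kr_bounded r) auto
  then show "AE y in \<mu>. norm (f y *\<^sub>R kr r (x - y)) \<le> norm (C0 / r ^ s * f y)"
    using C0_pos r by (auto simp: abs_mult mult_ac)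
qed (use f in simp)

lemma measurable_Tf [measurable]:
  assumes [measurable]: "f \<in> borel_measurable borel" and r: "r > 0"
  shows "Tf f r \<in> borel_measurable borel"
proof -
  have [measurable]: "kr r \<in> borel_measurable borel" using r by simp
  have "(\<lambda>x. \<integral>y. f y *\<^sub>R kr r (x - y) \<partial>\<mu>) \<in> borel_measurable borel"
    by measurable
  then show ?thesis by (simp add: Tf_def[abs_def])
qed

text \<open>Cauchy-Schwarz in \<open>y\<close>, then Tonelli: growth is used once for each variable,
  which gives the square of \<open>r ^ s\<close>. This is the L^2 bound for the unnormalised
  averaging operator.\<close>

lemma ball_square_bound:
  assumes [measurable]: "f \<in> borel_measurable borel" and r: "r > 0"
  shows "(\<integral>\<^sup>+x. (\<integral>\<^sup>+y. indicator (ball x r) y * ennreal \<bar>f y\<bar> \<partial>\<mu>)\<^sup>2 \<partial>\<mu>) \<le>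
     ennreal ((r ^ s)\<^sup>2) * (\<integral>\<^sup>+y. ennreal ((f y)\<^sup>2) \<partial>\<mu>)"
proof -
  have ind: "indicator (ball x r) y = (indicator {p. dist (fst p) (snd p) < r} (x, y) :: ennreal)" for x y
    by (auto simp: indicator_def)
  have "(\<integral>\<^sup>+x. (\<integral>\<^sup>+y. indicator (ball x r) y * ennreal \<bar>f y\<bar> \<partial>\<mu>)\<^sup>2 \<partial>\<mu>) \<le>
    (\<integral>\<^sup>+x. ennreal (r ^ s) * (\<integral>\<^sup>+y. indicator (ball x r) y * ennreal ((f y)\<^sup>2) \<partial>\<mu>) \<partial>\<mu>)"
  proof (intro nn_integral_mono)
    fix x
    have "(\<integral>\<^sup>+y. indicator (ball x r) y * ennreal \<bar>f y\<bar> \<partial>\<mu>)\<^sup>2 =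
       (\<integral>\<^sup>+y. indicator (ball x r) y * (indicator (ball x r) y * ennreal \<bar>f y\<bar>) \<partial>\<mu>)\<^sup>2"
      by (intro arg_cong[where f="\<lambda>z. z\<^sup>2"] nn_integral_cong) (auto simp: indicator_def)
    also have "\<dots> \<le> (\<integral>\<^sup>+y. (indicator (ball x r) y)\<^sup>2 \<partial>\<mu>) * (\<integral>\<^sup>+y. (indicator (ball x r) y * ennreal \<bar>f y\<bar>)\<^sup>2 \<partial>\<mu>)"
      by (intro Cauchy_Schwarz_nn_integral) auto
    also have "(\<integral>\<^sup>+y. (indicator (ball x r) y)\<^sup>2 \<partial>\<mu>) = (\<integral>\<^sup>+y. indicator (ball x r) y \<partial>\<mu>)"
      by (intro nn_integral_cong) (auto simp: indicator_def)
    also have "\<dots> = emeasure \<mu> (ball x r)" by simp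
    also have "(\<integral>\<^sup>+y. (indicator (ball x r) y * ennreal \<bar>f y\<bar>)\<^sup>2 \<partial>\<mu>) = (\<integral>\<^sup>+y. indicator (ball x r) y * ennreal ((f y)\<^sup>2) \<partial>\<mu>)"
      by (intro nn_integral_cong) (auto simp: indicator_def ennreal_power)
    finally show "(\<integral>\<^sup>+y. indicator (ball x r) y * ennreal \<bar>f y\<bar> \<partial>\<mu>)\<^sup>2 \<le> ennreal (r ^ s) * (\<integral>\<^sup>+y. indicator (ball x r) y * ennreal ((f y)\<^sup>2) \<partial>\<mu>)"
      using mult_right_mono[OF growth[OF r, of x]] by (meson order_trans zero_le)
  qed
  also have "\<dots> = ennreal (r ^ s) * (\<integral>\<^sup>+x. (\<integral>\<^sup>+y. indicator {p. dist (fst p) (snd p) < r} (x, y) * ennreal ((f y)\<^sup>2) \<partial>\<mu>) \<partial>\<mu>)"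
    unfolding ind by (intro nn_integral_cmult) measurable
  also have "(\<integral>\<^sup>+x. (\<integral>\<^sup>+y. indicator {p. dist (fst p) (snd p) < r} (x, y) * ennreal ((f y)\<^sup>2) \<partial>\<mu>) \<partial>\<mu>) =
     (\<integral>\<^sup>+y. (\<integral>\<^sup>+x. indicator {p. dist (fst p) (snd p) < r} (x, y) * ennreal ((f y)\<^sup>2) \<partial>\<mu>) \<partial>\<mu>)"
  proof -
    interpret P: pair_sigma_finite \<mu> \<mu> ..
    show ?thesis by (rule P.Fubini'[symmetric]) measurable
  qed
  also have "\<dots> \<le> (\<integral>\<^sup>+y. ennreal (r ^ s) * ennreal ((f y)\<^sup>2) \<partial>\<mu>)"
  proof (intro nn_integral_mono)
    fix y
    have "(\<integral>\<^sup>+x. indicator {p. dist (fst p) (snd p) < r} (x, y) * ennreal ((f y)\<^sup>2) \<partial>\<mu>) =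
      (\<integral>\<^sup>+x. indicator (ball y r) x * ennreal ((f y)\<^sup>2) \<partial>\<mu>)"
      by (intro nn_integral_cong) (auto simp: indicator_def dist_commute)
    also have "\<dots> = emeasure \<mu> (ball y r) * ennreal ((f y)\<^sup>2)" by (simp add: nn_integral_multc)
    also have "\<dots> \<le> ennreal (r ^ s) * ennreal ((f y)\<^sup>2)" by (intro mult_right_mono growth r) simp
    finally show "(\<integral>\<^sup>+x. indicator {p. dist (fst p) (snd p) < r} (x, y) * ennreal ((f y)\<^sup>2) \<partial>\<mu>) \<le> ennreal (r ^ s) * ennreal ((f y)\<^sup>2)" .
  qed
  also have "\<dots> = ennreal (r ^ s) * (\<integral>\<^sup>+y. ennreal ((f y)\<^sup>2) \<partial>\<mu>)" by (intro nn_integral_cmult) simp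
  finally show ?thesis
    using r by (simp add: mult.assoc[symmetric] ennreal_mult[symmetric] power2_eq_square mult_left_mono)
qed

text \<open>The two truncations agree off the shell \<open>r \<le> dist x y < 2 * r\<close>, where
  the kernel is at most \<open>C0 / r ^ s\<close>. Their difference is dominated by the averaging
  operator at scale \<open>2 * r\<close>, and the powers of \<open>r\<close> cancel to leave
  \<open>4 ^ s\<close>.\<close>

lemma smooth_truncation_L2:
  assumes [measurable]: "f \<in> borel_measurable borel" and f: "integrable \<mu> f" and r: "r > 0"
    and B: "(\<integral>\<^sup>+x. ennreal ((norm (\<integral>y. indicator (- ball x r) y *\<^sub>R (f y *\<^sub>R K (x - y)) \<partial>\<mu>))\<^sup>2) \<partial>\<mu>)
       \<le> ennreal C * (\<integral>\<^sup>+y. ennreal ((f y)\<^sup>2) \<partial>\<mu>)" and C: "C \<ge> 0"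
  shows "(\<integral>\<^sup>+x. ennreal ((norm (Tf f r x))\<^sup>2) \<partial>\<mu>) \<le> ennreal (2 * C + 2 * C0\<^sup>2 * 4 ^ s) * (\<integral>\<^sup>+y. ennreal ((f y)\<^sup>2) \<partial>\<mu>)"
proof -
  define S where "S x = (\<integral>y. indicator (- ball x r) y *\<^sub>R (f y *\<^sub>R K (x - y)) \<partial>\<mu>)" for x
  have [measurable]: "kr r \<in> borel_measurable borel" "kr (r/2) \<in> borel_measurable borel" using r by auto
  \<comment> \<open>\<open>kr (r/2)\<close> coincides with \<open>K\<close> off
    \<open>ball x r\<close> but is continuous and bounded; measurability and integrability of the
    sharp truncation come from this.\<close>
  have Seq: "S x = (\<integral>y. indicator (- ball x r) y *\<^sub>R (f y *\<^sub>R kr (r/2) (x - y)) \<partial>\<mu>)" for x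
    unfolding S_def using r
    by (intro Bochner_Integration.integral_cong) (auto simp: indicator_def dist_norm not_less kr_eq_K[of "r/2", simplified])
  have ind: "indicator (- ball x r) y = (indicator {p. \<not> dist (fst p) (snd p) < r} (x, y) :: real)" for x y
    by (auto simp: indicator_def)
  have [measurable]: "S \<in> borel_measurable borel"
    unfolding Seq[abs_def] ind by measurable
  have iS: "integrable \<mu> (\<lambda>y. indicator (- ball x r) y *\<^sub>R (f y *\<^sub>R kr (r/2) (x - y)))" for x
    using r by (intro integrable_mult_indicator integrable_Tf f) auto
  have diff: "ennreal (norm (Tf f r x - S x)) \<le> ennreal (C0 / r ^ s) * (\<integral>\<^sup>+y. indicator (ball x (2 * r)) y * ennreal \<bar>f y\<bar> \<partial>\<mu>)" for x
  proof -
    have "Tf f r x - S x = (\<integral>y. f y *\<^sub>R kr r (x - y) - indicator (- ball x r) y *\<^sub>R (f y *\<^sub>R kr (r/2) (x - y)) \<partial>\<mu>)"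
      unfolding Tf_def Seq by (intro Bochner_Integration.integral_diff[symmetric] integrable_Tf f r iS)
    also have "ennreal (norm \<dots>) \<le> (\<integral>\<^sup>+y. norm (f y *\<^sub>R kr r (x - y) - indicator (- ball x r) y *\<^sub>R (f y *\<^sub>R kr (r/2) (x - y))) \<partial>\<mu>)"
      by (rule integral_norm_bound_ennreal[OF Bochner_Integration.integrable_diff[OF integrable_Tf[OF r f] iS]])
    also have "\<dots> \<le> (\<integral>\<^sup>+y. ennreal (C0 / r ^ s) * (indicator (ball x (2 * r)) y * ennreal \<bar>f y\<bar>) \<partial>\<mu>)"
    proof (intro nn_integral_mono)
      fix y
      consider "dist x y < r" | "r \<le> dist x y" "dist x y < 2 * r" | "2 * r \<le> dist x y" by linarith
      then show "ennreal (norm (f y *\<^sub>R kr r (x - y) - indicator (- ball x r) y *\<^sub>R (f y *\<^sub>R kr (r/2) (x - y))))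
        \<le> ennreal (C0 / r ^ s) * (indicator (ball x (2 * r)) y * ennreal \<bar>f y\<bar>)"
      proof cases
        case 1
        then show ?thesis using r by (simp add: kr_eq_0 dist_norm)
      next
        case 2
        have k: "kr (r/2) (x - y) = K (x - y)" using 2 r by (simp add: kr_eq_K dist_norm)
        have z: "x - y \<noteq> 0" using 2 r by auto
        have "norm (kr r (x - y) - K (x - y)) = (1 - ramp (norm (x - y) / r)) * norm (K (x - y))"
          unfolding kr_def using ramp_bounds[of "norm (x - y) / r"]
          by (metis (no_types, lifting) abs_minus_commute abs_of_nonneg diff_ge_0_iff_ge norm_scaleR scaleR_left_diff_distrib scaleR_one)
        also have "\<dots> \<le> 1 * (C0 / norm (x - y) ^ s)"
          using ramp_bounds[of "norm (x - y) / r"] K_bound[OF z] by (intro mult_mono) auto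
        also have "\<dots> \<le> C0 / r ^ s"
          using 2 r z C0_pos by (auto simp: dist_norm intro!: divide_left_mono power_mono mult_pos_pos)
        finally have n: "norm (kr r (x - y) - K (x - y)) \<le> C0 / r ^ s" .
        have "norm (f y *\<^sub>R kr r (x - y) - indicator (- ball x r) y *\<^sub>R (f y *\<^sub>R kr (r/2) (x - y))) = \<bar>f y\<bar> * norm (kr r (x - y) - K (x - y))"
          using 2 by (simp add: k scaleR_diff_right[symmetric])
        also have "\<dots> \<le> \<bar>f y\<bar> * (C0 / r ^ s)" by (intro mult_left_mono n) auto
        finally have "ennreal (norm (f y *\<^sub>R kr r (x - y) - indicator (- ball x r) y *\<^sub>R (f y *\<^sub>R kr (r/2) (x - y)))) \<le> ennreal (\<bar>f y\<bar> * (C0 / r ^ s))"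
          by (rule ennreal_leI)
        also have "\<dots> = ennreal (C0 / r ^ s) * (indicator (ball x (2 * r)) y * ennreal \<bar>f y\<bar>)"
          using 2 C0_pos r by (simp add: ennreal_mult[symmetric] mult_ac)
        finally show ?thesis .
      next
        case 3
        then show ?thesis using r by (simp add: kr_eq_K dist_norm)
      qed
    qed
    also have "\<dots> = ennreal (C0 / r ^ s) * (\<integral>\<^sup>+y. indicator (ball x (2 * r)) y * ennreal \<bar>f y\<bar> \<partial>\<mu>)"
      by (intro nn_integral_cmult) auto
    finally show ?thesis .
  qed
  have "(\<integral>\<^sup>+x. ennreal ((norm (Tf f r x))\<^sup>2) \<partial>\<mu>) \<le>
    (\<integral>\<^sup>+x. 2 * ennreal ((norm (S x))\<^sup>2) + ennreal (2 * (C0 / r ^ s)\<^sup>2) * (\<integral>\<^sup>+y. indicator (ball x (2 * r)) y * ennreal \<bar>f y\<bar> \<partial>\<mu>)\<^sup>2 \<partial>\<mu>)"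
  proof (intro nn_integral_mono)
    fix x
    have "norm (Tf f r x) \<le> norm (S x) + norm (Tf f r x - S x)"
      by (metis add.commute norm_triangle_sub)
    then have "(norm (Tf f r x))\<^sup>2 \<le> (norm (S x) + norm (Tf f r x - S x))\<^sup>2" by (intro power_mono) auto
    also have "\<dots> \<le> 2 * (norm (S x))\<^sup>2 + 2 * (norm (Tf f r x - S x))\<^sup>2"
      using sum_squares_bound[of "norm (S x)" "norm (Tf f r x - S x)"] by (simp add: power2_sum)
    finally have "ennreal ((norm (Tf f r x))\<^sup>2) \<le> 2 * ennreal ((norm (S x))\<^sup>2) + 2 * (ennreal (norm (Tf f r x - S x)))\<^sup>2"
      by (simp add: ennreal_power ennreal_plus[symmetric] ennreal_mult[symmetric] ennreal_leI flip: ennreal_numeral del: ennreal_plus)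
    also have "\<dots> \<le> 2 * ennreal ((norm (S x))\<^sup>2) + 2 * (ennreal (C0 / r ^ s) * (\<integral>\<^sup>+y. indicator (ball x (2 * r)) y * ennreal \<bar>f y\<bar> \<partial>\<mu>))\<^sup>2"
      using diff by (intro add_left_mono mult_left_mono power_mono) auto
    also have "\<dots> = 2 * ennreal ((norm (S x))\<^sup>2) + ennreal (2 * (C0 / r ^ s)\<^sup>2) * (\<integral>\<^sup>+y. indicator (ball x (2 * r)) y * ennreal \<bar>f y\<bar> \<partial>\<mu>)\<^sup>2"
      using C0_pos r by (simp add: power_mult_distrib ennreal_mult ennreal_power mult.assoc)
    finally show "ennreal ((norm (Tf f r x))\<^sup>2) \<le> 2 * ennreal ((norm (S x))\<^sup>2) + ennreal (2 * (C0 / r ^ s)\<^sup>2) * (\<integral>\<^sup>+y. indicator (ball x (2 * r)) y * ennreal \<bar>f y\<bar> \<partial>\<mu>)\<^sup>2" .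
  qed
  also have "\<dots> = 2 * (\<integral>\<^sup>+x. ennreal ((norm (S x))\<^sup>2) \<partial>\<mu>) + ennreal (2 * (C0 / r ^ s)\<^sup>2) * (\<integral>\<^sup>+x. (\<integral>\<^sup>+y. indicator (ball x (2 * r)) y * ennreal \<bar>f y\<bar> \<partial>\<mu>)\<^sup>2 \<partial>\<mu>)"
  proof -
    have ind: "indicator (ball x (2*r)) y = (indicator {p. dist (fst p) (snd p) < 2*r} (x, y) :: ennreal)" for x y
      by (auto simp: indicator_def)
    have [measurable]: "(\<lambda>x. (\<integral>\<^sup>+y. indicator (ball x (2 * r)) y * ennreal \<bar>f y\<bar> \<partial>\<mu>)) \<in> borel_measurable \<mu>"
      unfolding ind by measurable
    show ?thesis by (subst nn_integral_add) (auto simp: nn_integral_cmult)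
  qed
  also have "\<dots> \<le> 2 * (ennreal C * (\<integral>\<^sup>+y. ennreal ((f y)\<^sup>2) \<partial>\<mu>)) + ennreal (2 * (C0 / r ^ s)\<^sup>2) * (ennreal (((2 * r) ^ s)\<^sup>2) * (\<integral>\<^sup>+y. ennreal ((f y)\<^sup>2) \<partial>\<mu>))"
    using r B[folded S_def] by (intro add_mono mult_left_mono ball_square_bound) auto
  also have "\<dots> = (2 * ennreal C + ennreal (2 * (C0 / r ^ s)\<^sup>2) * ennreal (((2 * r) ^ s)\<^sup>2)) * (\<integral>\<^sup>+y. ennreal ((f y)\<^sup>2) \<partial>\<mu>)"
    by (simp add: distrib_right mult.assoc)
  also have "2 * ennreal C + ennreal (2 * (C0 / r ^ s)\<^sup>2) * ennreal (((2 * r) ^ s)\<^sup>2) = ennreal (2 * C + 2 * C0\<^sup>2 * 4 ^ s)"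
  proof -
    have "2 * (C0 / r ^ s)\<^sup>2 * ((2 * r) ^ s)\<^sup>2 = 2 * C0\<^sup>2 * 4 ^ s"
      using r by (simp add: power_mult_distrib power_divide power_mult[symmetric] mult.commute[of s]) (simp add: power_mult)
    then have "ennreal (2 * (C0 / r ^ s)\<^sup>2) * ennreal (((2 * r) ^ s)\<^sup>2) = ennreal (2 * C0\<^sup>2 * 4 ^ s)"
      by (subst ennreal_mult[symmetric]) auto
    moreover have "2 * ennreal C = ennreal (2 * C)" using C by (simp add: ennreal_mult)
    ultimately show ?thesis using C by simp
  qed
  finally show ?thesis .
qed

end

section \<open>The weak type inequality for smooth truncations\<close>

context growth_measure
begin

text \<open>
  The point masses of a Calderon-Zygmund decomposition are spread over doubling balls in order of
  increasing radius, each one where the density accumulated so far is at most \<open>2 * L\<close>; by Markov's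
  inequality this is at least half of the ball.
\<close>

lemma spread_masses:
  fixes p :: "'i \<Rightarrow> 'a" and R \<alpha> :: "'i \<Rightarrow> real"
  assumes "finite I" and L: "L \<ge> 0"
    and "\<And>i. i \<in> I \<Longrightarrow> R i > 0" and "\<And>i. i \<in> I \<Longrightarrow> \<alpha> i \<ge> 0"
    and "\<And>i. i \<in> I \<Longrightarrow> measure \<mu> (ball (p i) (R i)) > 0"
    and "\<And>i. i \<in> I \<Longrightarrow> (\<Sum>j\<in>{j\<in>I. dist (p i) (p j) < 3 * R i}. \<alpha> j) \<le> L * measure \<mu> (ball (p i) (R i))"
  shows "\<exists>w :: 'i \<Rightarrow> 'a \<Rightarrow> real.
    (\<forall>i\<in>I. w i \<in> borel_measurable borel \<and>
       (\<forall>y. 0 \<le> w i y \<and> w i y \<le> 2 * \<alpha> i / measure \<mu> (ball (p i) (R i))) \<and>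
       (\<forall>y. w i y \<noteq> 0 \<longrightarrow> y \<in> ball (p i) (R i)) \<and> (\<integral>y. w i y \<partial>\<mu>) = \<alpha> i) \<and>
    (\<forall>y. (\<Sum>i\<in>I. w i y) \<le> 4 * L)"
  using assms(1,3-)
proof (induction I rule: finite_ranking_induct[where f=R])
  case empty
  then show ?case using L by simp
next
  case (insert i I)
  show ?case
  proof (cases "i \<in> I")
    case True
    then show ?thesis using insert.IH insert.prems by (simp add: insert_absorb)
  next
    case False
    let ?m = "\<lambda>i. measure \<mu> (ball (p i) (R i))"
    have sub: "(\<Sum>j\<in>{j\<in>I. dist (p k) (p j) < 3 * R k}. \<alpha> j) \<le> L * ?m k" if "k \<in> I" for k
    proof -
      have "(\<Sum>j\<in>{j\<in>I. dist (p k) (p j) < 3 * R k}. \<alpha> j) \<le> (\<Sum>j\<in>{j\<in>insert i I. dist (p k) (p j) < 3 * R k}. \<alpha> j)"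
        using insert by (intro sum_mono2) auto
      also have "\<dots> \<le> L * ?m k" using insert.prems that by auto
      finally show ?thesis .
    qed
    have "\<exists>w :: 'i \<Rightarrow> 'a \<Rightarrow> real. (\<forall>i\<in>I. w i \<in> borel_measurable borel \<and>
       (\<forall>y. 0 \<le> w i y \<and> w i y \<le> 2 * \<alpha> i / ?m i) \<and>
       (\<forall>y. w i y \<noteq> 0 \<longrightarrow> y \<in> ball (p i) (R i)) \<and> (\<integral>y. w i y \<partial>\<mu>) = \<alpha> i) \<and> (\<forall>y. (\<Sum>i\<in>I. w i y) \<le> 4 * L)"
      by (rule insert.IH[OF _ _ _ sub]) (use insert.prems in blast)+
    then obtain w :: "'i \<Rightarrow> 'a \<Rightarrow> real" where
      W: "\<forall>i\<in>I. w i \<in> borel_measurable borel \<and>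
       (\<forall>y. 0 \<le> w i y \<and> w i y \<le> 2 * \<alpha> i / ?m i) \<and>
       (\<forall>y. w i y \<noteq> 0 \<longrightarrow> y \<in> ball (p i) (R i)) \<and> (\<integral>y. w i y \<partial>\<mu>) = \<alpha> i"
       "\<forall>y. (\<Sum>i\<in>I. w i y) \<le> 4 * L" by blast
    have w: "\<And>k. k \<in> I \<Longrightarrow> w k \<in> borel_measurable borel"
         "\<And>k y. k \<in> I \<Longrightarrow> 0 \<le> w k y" "\<And>k y. k \<in> I \<Longrightarrow> w k y \<le> 2 * \<alpha> k / ?m k"
         "\<And>k y. k \<in> I \<Longrightarrow> w k y \<noteq> 0 \<Longrightarrow> y \<in> ball (p k) (R k)"
         "\<And>k. k \<in> I \<Longrightarrow> (\<integral>y. w k y \<partial>\<mu>) = \<alpha> k"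
         "\<And>y. (\<Sum>k\<in>I. w k y) \<le> 4 * L"
      using W by blast+
    have int: "integrable \<mu> (w k)" if "k \<in> I" for k
      by (rule integrable_bounded_support[where B="2 * \<alpha> k / ?m k" and x="p k" and r="R k"])
         (use w that in auto)
    \<comment> \<open>Earlier balls have radius at most \<open>R i\<close>, so one that meets the
      new ball has its centre within \<open>2 * R i\<close>. On the new ball only \<open>J\<close>
      matters, and the hypothesis limits the total mass of \<open>J\<close>.\<close>
    define J where "J = {j\<in>I. dist (p i) (p j) < 3 * R i}"
    have J: "finite J" "J \<subseteq> I" using insert by (auto simp: J_def)
    define S where "S y = (\<Sum>k\<in>J. w k y)" for y
    have [measurable]: "S \<in> borel_measurable borel"
      unfolding S_def[abs_def] using w J by (intro borel_measurable_sum) auto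
    have S0: "S y \<ge> 0" for y unfolding S_def using w J by (intro sum_nonneg) auto
    have Seq: "S y = (\<Sum>k\<in>I. w k y)" if "y \<in> ball (p i) (R i)" for y
      unfolding S_def
    proof (rule sum.mono_neutral_left)
      show "\<forall>k\<in>I - J. w k y = 0"
      proof (rule ballI, rule ccontr)
        fix k assume k: "k \<in> I - J" "w k y \<noteq> 0"
        then have "dist (p k) y < R k" "R k \<le> R i" "dist (p i) y < R i" using w insert.hyps that by auto
        then have "dist (p i) (p k) < 3 * R i"
          using dist_triangle2[of "p i" "p k" y] insert.prems(1)[of i] by (auto simp: dist_commute)
        then show False using k by (auto simp: J_def)
      qed
    qed (use insert J in auto)
    have Sint: "integrable \<mu> S" unfolding S_def[abs_def] using int J by (intro Bochner_Integration.integrable_sum) auto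
    have "(\<integral>y. S y \<partial>\<mu>) = (\<Sum>k\<in>J. \<alpha> k)"
      unfolding S_def using J w int by (subst Bochner_Integration.integral_sum) (auto intro!: sum.cong)
    also have "\<dots> \<le> (\<Sum>j\<in>{j\<in>insert i I. dist (p i) (p j) < 3 * R i}. \<alpha> j)"
      unfolding J_def using insert by (intro sum_mono2) auto
    also have "\<dots> \<le> L * ?m i" using insert.prems by auto
    finally have Sle: "(\<integral>y. S y \<partial>\<mu>) \<le> L * ?m i" .
    have mi: "?m i > 0" and ai: "\<alpha> i \<ge> 0" using insert.prems by auto
    define A where "A = {y \<in> ball (p i) (R i). S y \<le> 2 * L}"
    have [measurable]: "A \<in> sets borel" unfolding A_def by measurable
    have Afin: "emeasure \<mu> A < \<infinity>"
      by (rule emeasure_bounded_finite, rule bounded_subset[OF bounded_ball[of "p i" "R i"]]) (auto simp: A_def)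
    have mA: "?m i / 2 \<le> measure \<mu> A"
    \<comment> \<open>Markov's inequality at level \<open>2 * L\<close> says nothing for
      \<open>L = 0\<close>; in that case \<open>S\<close> vanishes almost everywhere and
      \<open>A\<close> is the whole ball up to a null set.\<close>
    proof (cases "L = 0")
      case True
      have "AE y in \<mu>. S y = 0"
        using Sle True S0 Sint integral_nonneg_eq_0_iff_AE[of \<mu> S]
        by (metis (mono_tags, lifting) AE_I2 antisym integral_nonneg_AE mult_zero_left)
      then have "AE y in \<mu>. y \<in> ball (p i) (R i) \<longleftrightarrow> y \<in> A" by (rule eventually_mono) (auto simp: A_def True)
      then have "?m i = measure \<mu> A" by (intro measure_eq_AE) auto
      then show ?thesis using mi by simp
    next
      case False
      then have L: "L > 0" using L by simp
      have "measure \<mu> {y \<in> space \<mu>. 2 * L \<le> S y} \<le> (\<integral>y. S y \<partial>\<mu>) / (2 * L)"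
        by (rule integral_Markov_inequality_measure[where A="{}"]) (use Sint S0 L in auto)
      also have "\<dots> \<le> ?m i / 2" using Sle L by (simp add: field_simps)
      finally have M: "measure \<mu> {y. 2 * L \<le> S y} \<le> ?m i / 2" by simp
      have "?m i = measure \<mu> (A \<union> {y \<in> ball (p i) (R i). 2 * L < S y})"
        by (rule arg_cong[where f="measure \<mu>"]) (auto simp: A_def)
      also have "\<dots> \<le> measure \<mu> A + measure \<mu> {y \<in> ball (p i) (R i). 2 * L < S y}"
        by (rule measure_Un_le) auto
      also have "measure \<mu> {y \<in> ball (p i) (R i). 2 * L < S y} \<le> measure \<mu> {y. 2 * L \<le> S y}"
      proof (rule measure_mono_fmeasurable)
        have "emeasure \<mu> {y \<in> space \<mu>. 2 * L \<le> S y} < \<infinity>"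
          using integral_Markov_inequality[OF Sint _ , of "2 * L"] L S0 by (auto simp: less_top[symmetric] top_unique)
        then show "{y. 2 * L \<le> S y} \<in> fmeasurable \<mu>" by (auto simp: fmeasurable_def)
      qed auto
      finally show ?thesis using M by simp
    qed
    define v where "v y = \<alpha> i / measure \<mu> A * indicator A y" for y
    have mA0: "measure \<mu> A > 0" using mA mi by simp
    have vle: "\<alpha> i / measure \<mu> A \<le> 2 * \<alpha> i / ?m i"
    proof -
      have "\<alpha> i / measure \<mu> A \<le> \<alpha> i / (?m i / 2)" using mA mi ai mA0 by (intro divide_left_mono) auto
      then show ?thesis by (simp add: mult.commute)
    qed
    have v: "v \<in> borel_measurable borel" "\<And>y. 0 \<le> v y" "\<And>y. v y \<le> 2 * \<alpha> i / ?m i"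
      "\<And>y. v y \<noteq> 0 \<Longrightarrow> y \<in> A"
      using vle ai mi mA0 unfolding v_def[abs_def] by (auto simp: indicator_def split: if_splits)
    have v5: "(\<integral>y. v y \<partial>\<mu>) = \<alpha> i"
      using mA0 Afin unfolding v_def[abs_def] by simp
    have aiL: "\<alpha> i \<le> L * ?m i"
    proof -
      have "\<alpha> i \<le> (\<Sum>j\<in>{j\<in>insert i I. dist (p i) (p j) < 3 * R i}. \<alpha> j)"
        using insert by (intro member_le_sum) auto
      also have "\<dots> \<le> L * ?m i" using insert.prems by auto
      finally show ?thesis .
    qed
    \<comment> \<open>On \<open>A\<close> the older densities total at most \<open>2 * L\<close>,
      and the new one is at most twice \<open>\<alpha> i\<close> over the mass of the ball, again
      \<open>2 * L\<close>; off \<open>A\<close> nothing is added.\<close>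
    have tot: "(\<Sum>k\<in>I. w k y) + v y \<le> 4 * L" for y
    proof (cases "y \<in> A")
      case True
      then have "(\<Sum>k\<in>I. w k y) \<le> 2 * L" using Seq by (auto simp: A_def)
      moreover have "\<alpha> i / ?m i \<le> L" using aiL mi by (simp add: field_simps)
      then have "v y \<le> 2 * L" using v(3)[of y] by simp
      ultimately show ?thesis by simp
    next
      case False
      then have "v y = 0" using v(4) by blast
      then show ?thesis using w(6)[of y] by simp
    qed
    show ?thesis
    proof (intro exI[of _ "\<lambda>k. if k = i then v else w k"] conjI)
      show "\<forall>y. (\<Sum>k\<in>insert i I. (if k = i then v else w k) y) \<le> 4 * L"
      proof
        fix y
        have "(\<Sum>k\<in>I. (if k = i then v else w k) y) = (\<Sum>k\<in>I. w k y)"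
          using False by (intro sum.cong) auto
        then show "(\<Sum>k\<in>insert i I. (if k = i then v else w k) y) \<le> 4 * L"
          using insert(1) False tot[of y] by simp
      qed
    qed (use v v5 w False in \<open>auto simp: A_def\<close>)
  qed
qed

end

lemma nn_integral_lincomb4:
  assumes [measurable]: "f1 \<in> borel_measurable M" "f2 \<in> borel_measurable M" "f3 \<in> borel_measurable M" "f4 \<in> borel_measurable M"
  shows "(\<integral>\<^sup>+x. a1 * f1 x + (a2 * f2 x + (a3 * f3 x + a4 * f4 x)) \<partial>M) =
    a1 * (\<integral>\<^sup>+x. f1 x \<partial>M) + (a2 * (\<integral>\<^sup>+x. f2 x \<partial>M) + (a3 * (\<integral>\<^sup>+x. f3 x \<partial>M) + a4 * (\<integral>\<^sup>+x. f4 x \<partial>M)))"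
  by (simp add: nn_integral_add nn_integral_cmult)

section \<open>Calderon-Zygmund decomposition of finite sums of point masses\<close>

locale cz_L2 = cz \<mu> s K C0 for \<mu> :: "'a::euclidean_space measure" and s :: nat and K :: "'a \<Rightarrow> 'b::euclidean_space" and C0 :: real +
  fixes C2 :: real
  assumes C2_pos: "C2 > 0"
    and L2_bound: "r > 0 \<Longrightarrow> f \<in> borel_measurable borel \<Longrightarrow> integrable \<mu> f \<Longrightarrow> integrable \<mu> (\<lambda>y. (f y)\<^sup>2) \<Longrightarrow>
      (\<integral>\<^sup>+x. ennreal ((norm (Tf f r x))\<^sup>2) \<partial>\<mu>) \<le> ennreal (C2 * (\<integral>y. (f y)\<^sup>2 \<partial>\<mu>))"
begin

text \<open>The summands come from the far part, from the shells up to the doubling scale, and from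
  the two halves of the estimate for the spread-out density.\<close>

definition Cb :: real where "Cb = C1 * 2 ^ s + C0 * 2 * Q ^ (2 * s + 2) + Q ^ (s + 1) / 2 + C2"

text \<open>The point mass and the subtracted density have equal total mass. Far from
  \<open>p\<close> this cancellation and \<open>kr_smooth\<close> give an integrable tail; up to the
  doubling scale the kernel is integrated by \<open>gap_integral\<close>; the contribution of
  \<open>w\<close> near \<open>p\<close> is bounded through its L^2 norm together with doubling. The
  inner ball is left out because the point mass is singular there.\<close>

lemma cz_atom:
  fixes p :: 'a and w :: "'a \<Rightarrow> real"
  assumes \<epsilon>: "\<epsilon> > 0" and r: "r > 0" and a: "a > 0" and l: "l > 0"
    and doubling: "measure \<mu> (ball p (Q * (Q ^ k * r))) \<le> Q ^ (s + 1) * measure \<mu> (ball p (Q ^ k * r))"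
    and mpos: "measure \<mu> (ball p (Q ^ k * r)) > 0"
    and dec: "\<And>i. i \<le> k \<Longrightarrow> measure \<mu> (ball p (Q ^ i * r)) \<le> (1/Q) ^ (k - i) * (Q ^ i * r) ^ s"
    and w [measurable]: "w \<in> borel_measurable borel" and w0: "\<And>y. 0 \<le> w y"
    and w1: "\<And>y. w y \<le> 2 * (a / l) / measure \<mu> (ball p (Q ^ k * r))"
    and ws: "\<And>y. w y \<noteq> 0 \<Longrightarrow> y \<in> ball p (Q ^ k * r)" and wi: "(\<integral>y. w y \<partial>\<mu>) = a / l"
  shows "(\<integral>\<^sup>+x. indicator (- ball p r) x * ennreal (norm (a *\<^sub>R kr \<epsilon> (x - p) - l *\<^sub>R Tf w \<epsilon> x)) \<partial>\<mu>) \<le> ennreal (Cb * a)"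
proof -
  define R where "R = Q ^ k * r"
  define m where "m = measure \<mu> (ball p R)"
  have R: "R > 0" "r \<le> R" using r by (auto simp: R_def mult_ge1_I)
  have m: "m > 0" using mpos by (simp add: m_def R_def)
  have iw: "integrable \<mu> w"
    by (rule integrable_bounded_support[where B="2 * (a / l) / m" and x=p and r=R]) (use w0 w1 ws in \<open>auto simp: m_def R_def\<close>)
  have [measurable]: "kr \<epsilon> \<in> borel_measurable borel" using \<epsilon> by simp
  have [measurable]: "Tf w \<epsilon> \<in> borel_measurable borel" using \<epsilon> by measurable
  have w2le: "(w y)\<^sup>2 \<le> 2 * (a / l) / m * w y" for y
    unfolding power2_eq_square using w0 w1 by (intro mult_right_mono) (auto simp: m_def R_def)
  have iw2: "integrable \<mu> (\<lambda>y. (w y)\<^sup>2)"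
    by (rule Bochner_Integration.integrable_bound[where f="\<lambda>y. 2 * (a / l) / m * w y"])
       (use iw in \<open>simp, simp, auto simp only: real_norm_def abs_power2 intro!: order_trans[OF w2le abs_ge_self]\<close>)
  have w2: "(\<integral>y. (w y)\<^sup>2 \<partial>\<mu>) \<le> 2 * (a / l)\<^sup>2 / m"
  proof -
    have "(\<integral>y. (w y)\<^sup>2 \<partial>\<mu>) \<le> (\<integral>y. 2 * (a / l) / m * w y \<partial>\<mu>)"
      using iw iw2 w2le by (intro integral_mono) auto
    also have "\<dots> = 2 * (a / l)\<^sup>2 / m" by (simp add: wi power2_eq_square)
    finally show ?thesis .
  qed
  let ?b = "\<lambda>x. norm (a *\<^sub>R kr \<epsilon> (x - p) - l *\<^sub>R Tf w \<epsilon> x)"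
  let ?I1 = "\<lambda>x. indicator {x. 2 * R \<le> dist p x} x * ennreal (1 / dist p x ^ (s + 1))"
  let ?I2 = "\<lambda>x. indicator {x. r \<le> dist p x \<and> dist p x < Q * (Q ^ k * r)} x * ennreal (1 / dist p x ^ s)"
  let ?I3 = "\<lambda>x. indicator (ball p (Q * R)) x :: ennreal"
  let ?I4 = "\<lambda>x. ennreal ((norm (Tf w \<epsilon> x))\<^sup>2)"
  have far: "?b x \<le> a * C1 * R / dist p x ^ (s + 1)" if x: "2 * R \<le> dist p x" for x
  proof -
    have "a *\<^sub>R kr \<epsilon> (x - p) - l *\<^sub>R Tf w \<epsilon> x = l *\<^sub>R ((\<integral>y. w y \<partial>\<mu>) *\<^sub>R kr \<epsilon> (x - p) - Tf w \<epsilon> x)"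
      using l by (simp add: wi algebra_simps)
    also have "(\<integral>y. w y \<partial>\<mu>) *\<^sub>R kr \<epsilon> (x - p) = (\<integral>y. w y *\<^sub>R kr \<epsilon> (x - p) \<partial>\<mu>)"
      using iw by (intro integral_scaleR_left[symmetric])
    also have "\<dots> - Tf w \<epsilon> x = (\<integral>y. w y *\<^sub>R kr \<epsilon> (x - p) - w y *\<^sub>R kr \<epsilon> (x - y) \<partial>\<mu>)"
      unfolding Tf_def by (intro Bochner_Integration.integral_diff[symmetric] integrable_Tf \<epsilon> iw integrable_scaleR_left)
    also have "norm (l *\<^sub>R \<dots>) \<le> l * (\<integral>y. w y * (C1 * R / dist p x ^ (s + 1)) \<partial>\<mu>)"
    proof -
      have "norm (\<integral>y. w y *\<^sub>R kr \<epsilon> (x - p) - w y *\<^sub>R kr \<epsilon> (x - y) \<partial>\<mu>) \<le> (\<integral>y. w y * (C1 * R / dist p x ^ (s + 1)) \<partial>\<mu>)"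
      proof (rule Bochner_Integration.integral_norm_bound_integral)
        show "integrable \<mu> (\<lambda>y. w y *\<^sub>R kr \<epsilon> (x - p) - w y *\<^sub>R kr \<epsilon> (x - y))"
          by (intro Bochner_Integration.integrable_diff integrable_Tf \<epsilon> iw integrable_scaleR_left)
        show "integrable \<mu> (\<lambda>y. w y * (C1 * R / dist p x ^ (s + 1)))" using iw by simp
        fix y
        show "norm (w y *\<^sub>R kr \<epsilon> (x - p) - w y *\<^sub>R kr \<epsilon> (x - y)) \<le> w y * (C1 * R / dist p x ^ (s + 1))"
        proof (cases "w y = 0")
          case False
          then have y: "norm (y - p) < R" using ws[of y] by (simp add: R_def dist_norm norm_minus_commute)
          have "norm (kr \<epsilon> (x - p) - kr \<epsilon> (x - y)) \<le> C1 * norm ((x - p) - (x - y)) / norm (x - p) ^ (s + 1)"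
            using y x by (intro kr_smooth \<epsilon>) (auto simp: dist_norm norm_minus_commute)
          also have "\<dots> \<le> C1 * R / norm (x - p) ^ (s + 1)"
            using y C1_pos by (intro divide_right_mono mult_left_mono) auto
          finally have "norm (kr \<epsilon> (x - p) - kr \<epsilon> (x - y)) \<le> C1 * R / dist p x ^ (s + 1)" by (simp add: dist_norm norm_minus_commute)
          then have "w y * norm (kr \<epsilon> (x - p) - kr \<epsilon> (x - y)) \<le> w y * (C1 * R / dist p x ^ (s + 1))"
            using w0 by (intro mult_left_mono) auto
          then show ?thesis using w0[of y] by (simp add: scaleR_diff_right[symmetric])
        qed simp
      qed
      from mult_left_mono[OF this, of l] show ?thesis using l by (simp only: norm_scaleR abs_of_pos less_imp_le)
    qed
    also have "\<dots> = a * C1 * R / dist p x ^ (s + 1)" using l by (simp add: wi)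
    finally show ?thesis .
  qed
  have near: "?b x \<le> a * C0 * (1 / dist p x ^ s) + (a / m / 2 + l\<^sup>2 * m / (2 * a) * (norm (Tf w \<epsilon> x))\<^sup>2)" for x
  proof -
    have dpx: "dist p x = norm (x - p)" by (metis dist_commute dist_norm)
    have "?b x \<le> norm (a *\<^sub>R kr \<epsilon> (x - p)) + norm (l *\<^sub>R Tf w \<epsilon> x)" by (rule norm_triangle_ineq4)
    also have "\<dots> \<le> a * (C0 / dist p x ^ s) + l * norm (Tf w \<epsilon> x)"
      using mult_left_mono[OF kr_norm[of \<epsilon> "x - p"], of a] a l by (simp add: dpx)
    \<comment> \<open>Cauchy-Schwarz in the form of the arithmetic-geometric mean inequality. The
      weight \<open>a / m\<close> is chosen so that integrating the constant over
      \<open>ball p (Q * R)\<close> and applying \<open>L2_bound\<close> to the square both give a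
      multiple of \<open>a\<close>.\<close>
    also have "l * norm (Tf w \<epsilon> x) \<le> a / m / 2 + l\<^sup>2 * m / (2 * a) * (norm (Tf w \<epsilon> x))\<^sup>2"
    proof -
      define t where "t = l * norm (Tf w \<epsilon> x)"
      have "0 \<le> (t - a / m)\<^sup>2" by simp
      then have "2 * t * (a / m) \<le> t\<^sup>2 + (a / m)\<^sup>2" by (simp add: power2_diff)
      then have "t \<le> (t\<^sup>2 + (a / m)\<^sup>2) / (2 * (a / m))" using a m by (simp add: field_simps)
      also have "\<dots> = a / m / 2 + t\<^sup>2 * m / (2 * a)" using a m by (simp add: field_simps power2_eq_square)
      finally show ?thesis by (simp add: t_def power_mult_distrib mult_ac)
    qed
    finally show ?thesis by simp
  qed
  have "(\<integral>\<^sup>+x. indicator (- ball p r) x * ennreal (?b x) \<partial>\<mu>) \<le>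
    (\<integral>\<^sup>+x. ennreal (a * C1 * R) * ?I1 x + (ennreal (a * C0) * ?I2 x + (ennreal (a / m / 2) * ?I3 x + ennreal (l\<^sup>2 * m / (2 * a)) * ?I4 x)) \<partial>\<mu>)"
  proof (intro nn_integral_mono)
    fix x
    consider "dist p x < r" | "2 * R \<le> dist p x" | "r \<le> dist p x" "dist p x < 2 * R" by linarith
    then show "indicator (- ball p r) x * ennreal (?b x) \<le>
      ennreal (a * C1 * R) * ?I1 x + (ennreal (a * C0) * ?I2 x + (ennreal (a / m / 2) * ?I3 x + ennreal (l\<^sup>2 * m / (2 * a)) * ?I4 x))"
    proof cases
      case 1
      then show ?thesis by simp
    next
      case 2
      have "indicator (- ball p r) x * ennreal (?b x) \<le> ennreal (a * C1 * R * (1 / dist p x ^ (s + 1)))"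
        using far[OF 2] by (auto simp: indicator_def intro!: ennreal_leI)
      also have "\<dots> = ennreal (a * C1 * R) * ?I1 x"
        using 2 a R C1_pos by (simp add: ennreal_mult[symmetric] del: times_divide_eq_right)
      finally show ?thesis by (rule order_trans) simp
    next
      case 3
      have x: "dist p x < Q * R" using 3 R by simp
      have "indicator (- ball p r) x * ennreal (?b x) \<le> ennreal (a * C0 * (1 / dist p x ^ s) + (a / m / 2 + l\<^sup>2 * m / (2 * a) * (norm (Tf w \<epsilon> x))\<^sup>2))"
        using near[of x] by (auto simp: indicator_def intro!: ennreal_leI)
      also have "\<dots> = ennreal (a * C0) * ennreal (1 / dist p x ^ s) + (ennreal (a / m / 2) + ennreal (l\<^sup>2 * m / (2 * a)) * ?I4 x)"
        using a C0_pos m l by (simp add: ennreal_plus[symmetric] ennreal_mult[symmetric] del: ennreal_plus times_divide_eq_right)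
      also have "\<dots> = ennreal (a * C0) * ?I2 x + (ennreal (a / m / 2) * ?I3 x + ennreal (l\<^sup>2 * m / (2 * a)) * ?I4 x)"
        using 3 x by (simp add: R_def)
      finally show ?thesis by (rule order_trans) simp
    qed
  qed
  also have "\<dots> = ennreal (a * C1 * R) * (\<integral>\<^sup>+x. ?I1 x \<partial>\<mu>) + (ennreal (a * C0) * (\<integral>\<^sup>+x. ?I2 x \<partial>\<mu>) +
      (ennreal (a / m / 2) * (\<integral>\<^sup>+x. ?I3 x \<partial>\<mu>) + ennreal (l\<^sup>2 * m / (2 * a)) * (\<integral>\<^sup>+x. ?I4 x \<partial>\<mu>)))"
  proof -
    show ?thesis by (rule nn_integral_lincomb4) measurable
  qed
  also have "\<dots> \<le> ennreal (a * C1 * R) * ennreal (1 * 2 ^ (s + 1) / (2 * R)) + (ennreal (a * C0) * ennreal (1 * 2 * Q ^ (2 * s + 2)) +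
      (ennreal (a / m / 2) * ennreal (Q ^ (s + 1) * m) + ennreal (l\<^sup>2 * m / (2 * a)) * ennreal (C2 * (2 * (a / l)\<^sup>2 / m))))"
  proof (intro add_mono mult_left_mono)
    show "(\<integral>\<^sup>+x. ?I1 x \<partial>\<mu>) \<le> ennreal (1 * 2 ^ (s + 1) / (2 * R))"
      using R growth by (intro tail_integral) auto
    show "(\<integral>\<^sup>+x. ?I2 x \<partial>\<mu>) \<le> ennreal (1 * 2 * Q ^ (2 * s + 2))"
    proof (rule gap_integral[OF _ r _ dec])
      fix t assume "r \<le> t"
      then show "emeasure \<mu> (ball p t) \<le> ennreal (1 * measure \<mu> (ball p (5 * t)))"
        using r by (simp add: emeasure_ball_eq measure_ball_mono)
    qed auto
    show "(\<integral>\<^sup>+x. ?I3 x \<partial>\<mu>) \<le> ennreal (Q ^ (s + 1) * m)"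
      using doubling by (simp add: emeasure_ball_eq m_def R_def ennreal_leI)
    have "(\<integral>\<^sup>+x. ?I4 x \<partial>\<mu>) \<le> ennreal (C2 * (\<integral>y. (w y)\<^sup>2 \<partial>\<mu>))"
      by (rule L2_bound[OF \<epsilon> w iw iw2])
    also have "\<dots> \<le> ennreal (C2 * (2 * (a / l)\<^sup>2 / m))" using w2 C2_pos by (intro ennreal_leI mult_left_mono) auto
    finally show "(\<integral>\<^sup>+x. ?I4 x \<partial>\<mu>) \<le> ennreal (C2 * (2 * (a / l)\<^sup>2 / m))" .
  qed auto
  also have "\<dots> = ennreal ((a * C1 * R) * (1 * 2 ^ (s + 1) / (2 * R)) + ((a * C0) * (1 * 2 * Q ^ (2 * s + 2)) +
      ((a / m / 2) * (Q ^ (s + 1) * m) + (l\<^sup>2 * m / (2 * a)) * (C2 * (2 * (a / l)\<^sup>2 / m)))))"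
    using a C1_pos C0_pos C2_pos R m l by (simp add: ennreal_plus[symmetric] ennreal_mult[symmetric] del: ennreal_plus)
  also have "(a * C1 * R) * (1 * 2 ^ (s + 1) / (2 * R)) + ((a * C0) * (1 * 2 * Q ^ (2 * s + 2)) +
      ((a / m / 2) * (Q ^ (s + 1) * m) + (l\<^sup>2 * m / (2 * a)) * (C2 * (2 * (a / l)\<^sup>2 / m)))) = Cb * a"
    using a R m l by (simp add: Cb_def field_simps power2_eq_square)
  finally show ?thesis .
qed

text \<open>One unit for the exceptional cover, \<open>2 * Cb\<close> for the atoms at level
  \<open>l / 2\<close>, and the last term for the bounded part by Chebyshev's inequality in
  L^2.\<close>

definition Cw :: real where "Cw = 1 + 2 * Cb + 16 * C2 * Q ^ (s + 1)"

lemma Cb_pos: "Cb > 0"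
  unfolding Cb_def using C0_pos C1_pos C2_pos by (intro add_pos_pos) auto

lemma Cw_pos: "Cw \<ge> 1"
  unfolding Cw_def using Cb_pos C2_pos by simp

text \<open>The counterpart of a maximal Calderon-Zygmund ball for discrete masses. Radii with too
  much point mass exist because tiny balls have little \<mu>-mass, and they are bounded because
  \<mu> has total mass above \<open>(\<Sum>i\<in>I. \<alpha> i) / l\<close>. A radius above half of
  their supremum is taken, hence the opposite inequality from \<open>2 * r\<close> on.\<close>

lemma stopping_radius:
  fixes p :: "'i \<Rightarrow> 'a" and \<alpha> :: "'i \<Rightarrow> real"
  assumes I: "finite I" and \<alpha>: "\<And>i. i \<in> I \<Longrightarrow> \<alpha> i > 0" and l: "l > 0" and i: "i \<in> I"
    and big: "emeasure \<mu> UNIV > ennreal ((\<Sum>i\<in>I. \<alpha> i) / l)"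
  obtains r where "r > 0" "l * measure \<mu> (ball (p i) (5 * r)) \<le> (\<Sum>j\<in>{j\<in>I. dist (p i) (p j) < r}. \<alpha> j)"
    "\<And>t. t \<ge> 2 * r \<Longrightarrow> (\<Sum>j\<in>{j\<in>I. dist (p i) (p j) < t}. \<alpha> j) \<le> l * measure \<mu> (ball (p i) (5 * t))"
proof -
  define A where "A = (\<Sum>i\<in>I. \<alpha> i)"
  define N where "N t = (\<Sum>j\<in>{j\<in>I. dist (p i) (p j) < t}. \<alpha> j)" for t
  define m where "m t = measure \<mu> (ball (p i) t)" for t
  define S where "S = {t. 0 < t \<and> l * m (5 * t) < N t}"
  have NA: "N t \<le> A" for t unfolding N_def A_def using I \<alpha> by (intro sum_mono2) (auto intro: less_imp_le)
  have Ni: "\<alpha> i \<le> N t" if "t > 0" for t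
    unfolding N_def using I \<alpha> i that by (intro member_le_sum) (auto intro: less_imp_le)
  \<comment> \<open>\<open>5 * t0 \<le> 1\<close> allows \<open>(5 * t0) ^ s\<close> to be replaced
    by \<open>5 * t0\<close>, which lies below \<open>\<alpha> i / l\<close>.\<close>
  define t0 where "t0 = min 1 (\<alpha> i / (2 * l)) / 5"
  have t0: "t0 > 0" "5 * t0 \<le> 1" "5 * t0 \<le> \<alpha> i / (2 * l)" using \<alpha>[OF i] l by (auto simp: t0_def)
  have "t0 \<in> S"
  proof -
    have "m (5 * t0) \<le> (5 * t0) ^ s" unfolding m_def using t0 by (intro measure_ball_le) auto
    also have "\<dots> \<le> 5 * t0" using t0 s_pos power_decreasing[of 1 s "5 * t0"] by simp
    also have "\<dots> < \<alpha> i / l" using t0 \<alpha>[OF i] l by (intro le_less_trans[OF t0(3)]) (simp add: field_simps)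
    finally have "l * m (5 * t0) < \<alpha> i" using l by (simp add: field_simps)
    then show ?thesis using Ni[of t0] t0 by (simp add: S_def)
  qed
  have "\<exists>n::nat. A / l < m (real n)"
  proof (rule ccontr)
    assume "\<nexists>n::nat. A / l < m (real n)"
    then have le: "emeasure \<mu> (ball (p i) (real n)) \<le> ennreal (A / l)" for n
      by (auto simp: emeasure_ball_eq m_def not_less intro!: ennreal_leI)
    have "emeasure \<mu> UNIV = emeasure \<mu> (\<Union>n. ball (p i) (real n))"
      by (intro arg_cong[where f="emeasure \<mu>"]) (auto simp: reals_Archimedean2)
    also have "\<dots> = (SUP n. emeasure \<mu> (ball (p i) (real n)))"
      by (intro SUP_emeasure_incseq[symmetric]) (auto simp: incseq_def)
    also have "\<dots> \<le> ennreal (A / l)" by (intro SUP_least le)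
    finally show False using big by (simp add: A_def)
  qed
  then obtain n :: nat where n: "A / l < m (real n)" by blast
  have "t \<le> real n" if "t \<in> S" for t
  proof (rule ccontr)
    assume "\<not> t \<le> real n"
    then have "m (real n) \<le> m (5 * t)" unfolding m_def by (intro measure_ball_mono) auto
    then have "A / l < m (5 * t)" using n by simp
    then have "A < l * m (5 * t)" using l by (simp add: field_simps)
    then show False using that NA[of t] by (simp add: S_def)
  qed
  then have bdd: "bdd_above S" by (auto simp: bdd_above_def)
  have "t0 \<le> Sup S" by (rule cSup_upper[OF \<open>t0 \<in> S\<close> bdd])
  then have "Sup S / 2 < Sup S" using t0 by simp
  then obtain r where r: "r \<in> S" "Sup S / 2 < r" using less_cSup_iff[of S "Sup S / 2"] bdd \<open>t0 \<in> S\<close> by blast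
  show ?thesis
  proof (rule that[of r])
    show "r > 0" "l * measure \<mu> (ball (p i) (5 * r)) \<le> (\<Sum>j\<in>{j\<in>I. dist (p i) (p j) < r}. \<alpha> j)"
      using r(1) by (auto simp: S_def N_def m_def)
    fix t assume t: "t \<ge> 2 * r"
    then have "t \<notin> S" using r cSup_upper[OF _ bdd, of t] by (auto simp: S_def)
    then show "(\<Sum>j\<in>{j\<in>I. dist (p i) (p j) < t}. \<alpha> j) \<le> l * measure \<mu> (ball (p i) (5 * t))"
      using t \<open>r > 0\<close> by (auto simp: S_def N_def m_def not_less)
  qed
qed

text \<open>The sum is decomposed into one atom per mass plus the truncation of the bounded density
  \<open>l * W\<close>. Off a cover of the stopping balls the atoms are small in L^1 and the bounded
  part in L^2. With point masses there are finitely many balls, so the spreading can proceed by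
  induction.\<close>

lemma weak_type_points:
  fixes p :: "'i \<Rightarrow> 'a" and \<alpha> :: "'i \<Rightarrow> real"
  assumes I: "finite I" and \<alpha>: "\<And>i. i \<in> I \<Longrightarrow> \<alpha> i > 0" and l: "l > 0" and \<epsilon>: "\<epsilon> > 0"
  shows "emeasure \<mu> {x. l < norm (\<Sum>i\<in>I. \<alpha> i *\<^sub>R kr \<epsilon> (x - p i))} \<le> ennreal (Cw * (\<Sum>i\<in>I. \<alpha> i) / l)"
\<comment> \<open>If \<mu> is too small for stopping radii to exist, the claim is trivial because
  \<open>Cw \<ge> 1\<close>.\<close>
proof (cases "emeasure \<mu> UNIV > ennreal ((\<Sum>i\<in>I. \<alpha> i) / l)")
  case False
  have "emeasure \<mu> {x. l < norm (\<Sum>i\<in>I. \<alpha> i *\<^sub>R kr \<epsilon> (x - p i))} \<le> emeasure \<mu> UNIV"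
    by (intro emeasure_mono) auto
  also have "\<dots> \<le> ennreal ((\<Sum>i\<in>I. \<alpha> i) / l)" using False by simp
  also have "\<dots> \<le> ennreal (Cw * (\<Sum>i\<in>I. \<alpha> i) / l)"
  proof (intro ennreal_leI divide_right_mono)
    have "0 \<le> (\<Sum>i\<in>I. \<alpha> i)" using \<alpha> by (intro sum_nonneg) (auto intro: less_imp_le)
    then show "(\<Sum>i\<in>I. \<alpha> i) \<le> Cw * (\<Sum>i\<in>I. \<alpha> i)" using Cw_pos mult_right_mono[of 1 Cw] by simp
  qed (use l in simp)
  finally show ?thesis .
next
  case big: True
  define A where "A = (\<Sum>i\<in>I. \<alpha> i)"
  define D where "D = Q ^ (s + 1)"
  have A0: "A \<ge> 0" unfolding A_def using \<alpha> by (intro sum_nonneg) (auto intro: less_imp_le)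
  have D0: "D > 0" by (simp add: D_def)
  let ?N = "\<lambda>i t. \<Sum>j\<in>{j\<in>I. dist (p i) (p j) < t}. \<alpha> j"
  have "\<exists>r. \<forall>i\<in>I. r i > 0 \<and> l * measure \<mu> (ball (p i) (5 * r i)) \<le> ?N i (r i) \<and>
    (\<forall>t \<ge> 2 * r i. ?N i t \<le> l * measure \<mu> (ball (p i) (5 * t)))"
    by (rule bchoice, rule ballI, rule stopping_radius[OF I \<alpha> l _ big]) auto
  then obtain r where r: "\<And>i. i \<in> I \<Longrightarrow> r i > 0" "\<And>i. i \<in> I \<Longrightarrow> l * measure \<mu> (ball (p i) (5 * r i)) \<le> ?N i (r i)"
    "\<And>i t. i \<in> I \<Longrightarrow> t \<ge> 2 * r i \<Longrightarrow> ?N i t \<le> l * measure \<mu> (ball (p i) (5 * t))"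
    by blast
  have pos: "measure \<mu> (ball (p i) (10 * r i)) > 0" if i: "i \<in> I" for i
  proof -
    have "\<alpha> i \<le> ?N i (2 * r i)" using I \<alpha> i r(1)[OF i] by (intro member_le_sum) (auto intro: less_imp_le)
    also have "\<dots> \<le> l * measure \<mu> (ball (p i) (5 * (2 * r i)))" by (rule r(3)[OF i order_refl])
    finally have "0 < l * measure \<mu> (ball (p i) (10 * r i))" using \<alpha>[OF i] by simp
    then show ?thesis using l by (simp add: zero_less_mult_iff)
  qed
  have "\<exists>k. \<forall>i\<in>I. measure \<mu> (ball (p i) (Q * (Q ^ k i * r i))) \<le> D * measure \<mu> (ball (p i) (Q ^ k i * r i)) \<and>
     measure \<mu> (ball (p i) (Q ^ k i * r i)) > 0 \<and>
     (\<forall>j \<le> k i. measure \<mu> (ball (p i) (Q ^ j * r i)) \<le> (1/Q) ^ (k i - j) * (Q ^ j * r i) ^ s)"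
    unfolding D_def by (rule bchoice, rule ballI, rule doubling_radius[OF r(1) pos]) auto
  then obtain k where k: "\<And>i. i \<in> I \<Longrightarrow> measure \<mu> (ball (p i) (Q * (Q ^ k i * r i))) \<le> D * measure \<mu> (ball (p i) (Q ^ k i * r i))"
     "\<And>i. i \<in> I \<Longrightarrow> measure \<mu> (ball (p i) (Q ^ k i * r i)) > 0"
     "\<And>i j. i \<in> I \<Longrightarrow> j \<le> k i \<Longrightarrow> measure \<mu> (ball (p i) (Q ^ j * r i)) \<le> (1/Q) ^ (k i - j) * (Q ^ j * r i) ^ s"
    by blast
  define R where "R i = Q ^ k i * r i" for i
  have R: "R i > 0" "r i \<le> R i" if "i \<in> I" for i using r(1)[OF that] by (auto simp: R_def mult_ge1_I)
  have "\<exists>w :: 'i \<Rightarrow> 'a \<Rightarrow> real.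
    (\<forall>i\<in>I. w i \<in> borel_measurable borel \<and>
       (\<forall>y. 0 \<le> w i y \<and> w i y \<le> 2 * (\<alpha> i / l) / measure \<mu> (ball (p i) (R i))) \<and>
       (\<forall>y. w i y \<noteq> 0 \<longrightarrow> y \<in> ball (p i) (R i)) \<and> (\<integral>y. w i y \<partial>\<mu>) = \<alpha> i / l) \<and>
    (\<forall>y. (\<Sum>i\<in>I. w i y) \<le> 4 * D)"
  proof (rule spread_masses[OF I])
    fix i assume i: "i \<in> I"
    \<comment> \<open>\<open>3 * R i\<close> is at least \<open>2 * r i\<close>, and the dilation 5
      * 3 = 15 is below \<open>Q\<close>, so doubling brings the mass back to
      \<open>ball (p i) (R i)\<close>. The resulting factor \<open>D\<close> is the \<open>L\<close>
      of \<open>spread_masses\<close>.\<close>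
    have "?N i (3 * R i) \<le> l * measure \<mu> (ball (p i) (5 * (3 * R i)))"
      using R[OF i] by (intro r(3)[OF i]) auto
    also have "\<dots> \<le> l * measure \<mu> (ball (p i) (Q * R i))"
      using R[OF i] l by (intro mult_left_mono measure_ball_mono) auto
    also have "\<dots> \<le> l * (D * measure \<mu> (ball (p i) (R i)))"
      using k(1)[OF i] l by (intro mult_left_mono) (auto simp: R_def)
    finally show "(\<Sum>j\<in>{j\<in>I. dist (p i) (p j) < 3 * R i}. \<alpha> j / l) \<le> D * measure \<mu> (ball (p i) (R i))"
      using l by (simp add: sum_divide_distrib[symmetric] field_simps)
    show "\<alpha> i / l \<ge> 0" using \<alpha>[OF i] l by simp
    show "measure \<mu> (ball (p i) (R i)) > 0" using k(2)[OF i] by (simp add: R_def)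
  qed (use R D0 in auto)
  then obtain w :: "'i \<Rightarrow> 'a \<Rightarrow> real" where W:
    "\<forall>i\<in>I. w i \<in> borel_measurable borel \<and>
       (\<forall>y. 0 \<le> w i y \<and> w i y \<le> 2 * (\<alpha> i / l) / measure \<mu> (ball (p i) (R i))) \<and>
       (\<forall>y. w i y \<noteq> 0 \<longrightarrow> y \<in> ball (p i) (R i)) \<and> (\<integral>y. w i y \<partial>\<mu>) = \<alpha> i / l"
    "\<forall>y. (\<Sum>i\<in>I. w i y) \<le> 4 * D" by blast
  have w: "\<And>i. i \<in> I \<Longrightarrow> w i \<in> borel_measurable borel"
         "\<And>i y. i \<in> I \<Longrightarrow> 0 \<le> w i y" "\<And>i y. i \<in> I \<Longrightarrow> w i y \<le> 2 * (\<alpha> i / l) / measure \<mu> (ball (p i) (R i))"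
         "\<And>i y. i \<in> I \<Longrightarrow> w i y \<noteq> 0 \<Longrightarrow> y \<in> ball (p i) (R i)"
         "\<And>i. i \<in> I \<Longrightarrow> (\<integral>y. w i y \<partial>\<mu>) = \<alpha> i / l"
         "\<And>y. (\<Sum>i\<in>I. w i y) \<le> 4 * D"
      using W by blast+
  have iw: "integrable \<mu> (w i)" if "i \<in> I" for i
    by (rule integrable_bounded_support[where B="2 * (\<alpha> i / l) / measure \<mu> (ball (p i) (R i))" and x="p i" and r="R i"])
       (use w that in auto)
  define W where "W y = (\<Sum>i\<in>I. w i y)" for y
  have mW [measurable]: "W \<in> borel_measurable borel" unfolding W_def[abs_def] using w by (intro borel_measurable_sum) auto
  have iW: "integrable \<mu> W" unfolding W_def[abs_def] using iw by (intro Bochner_Integration.integrable_sum) auto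
  have W0: "0 \<le> W y" "W y \<le> 4 * D" for y unfolding W_def using w by (auto intro: sum_nonneg)
  have W2: "(W y)\<^sup>2 \<le> 4 * D * W y" for y unfolding power2_eq_square using W0 by (intro mult_right_mono) auto
  have iW2: "integrable \<mu> (\<lambda>y. (W y)\<^sup>2)"
    by (rule Bochner_Integration.integrable_bound[where f="\<lambda>y. 4 * D * W y"])
       (use iW in \<open>simp, simp, auto simp only: real_norm_def abs_power2 intro!: order_trans[OF W2 abs_ge_self]\<close>)
  have intW2: "(\<integral>y. (W y)\<^sup>2 \<partial>\<mu>) \<le> 4 * D * (A / l)"
  proof -
    have "(\<integral>y. (W y)\<^sup>2 \<partial>\<mu>) \<le> (\<integral>y. 4 * D * W y \<partial>\<mu>)" using iW iW2 W2 by (intro integral_mono) auto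
    also have "\<dots> = 4 * D * (\<integral>y. W y \<partial>\<mu>)" by simp
    also have "(\<integral>y. W y \<partial>\<mu>) = A / l"
      unfolding W_def A_def using iw w by (subst Bochner_Integration.integral_sum) (auto simp: sum_divide_distrib)
    finally show ?thesis .
  qed
  have TW: "Tf W \<epsilon> x = (\<Sum>i\<in>I. Tf (w i) \<epsilon> x)" for x
    unfolding Tf_def W_def scaleR_sum_left by (intro Bochner_Integration.integral_sum integrable_Tf \<epsilon> iw)
  define b where "b i x = \<alpha> i *\<^sub>R kr \<epsilon> (x - p i) - l *\<^sub>R Tf (w i) \<epsilon> x" for i x
  have [measurable]: "kr \<epsilon> \<in> borel_measurable borel" using \<epsilon> by simp
  have mTw: "Tf (w i) \<epsilon> \<in> borel_measurable borel" if "i \<in> I" for i using \<epsilon> w(1)[OF that] by measurable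
  have [measurable]: "Tf W \<epsilon> \<in> borel_measurable borel" using \<epsilon> by measurable
  have mb [measurable]: "b i \<in> borel_measurable borel" if "i \<in> I" for i
    unfolding b_def[abs_def] using mTw[OF that] by measurable
  define F where "F = (\<Union>i\<in>I. ball (p i) (r i))"
  have [measurable]: "F \<in> sets borel" unfolding F_def by (intro borel_open open_UN) auto
  obtain U where U: "U \<in> sets borel" "F \<subseteq> U" "emeasure \<mu> U \<le> ennreal (A / l)"
  proof -
    define \<sigma> where "\<sigma> = distr (point_measure I (\<lambda>i. ennreal (\<alpha> i))) borel p"
    have em: "emeasure \<sigma> B = ennreal (\<Sum>i\<in>{i\<in>I. p i \<in> B}. \<alpha> i)" if "B \<in> sets borel" for B
    proof -
      have eq: "p -` B \<inter> space (point_measure I (\<lambda>i. ennreal (\<alpha> i))) = {i\<in>I. p i \<in> B}"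
        by (auto simp: space_point_measure)
      have "p \<in> measurable (point_measure I (\<lambda>i. ennreal (\<alpha> i))) borel" by simp
      then have "emeasure \<sigma> B = emeasure (point_measure I (\<lambda>i. ennreal (\<alpha> i))) {i\<in>I. p i \<in> B}"
        unfolding \<sigma>_def eq[symmetric] using that by (rule emeasure_distr)
      also have "\<dots> = (\<Sum>i\<in>{i\<in>I. p i \<in> B}. ennreal (\<alpha> i))"
        using I by (intro emeasure_point_measure_finite) auto
      also have "\<dots> = ennreal (\<Sum>i\<in>{i\<in>I. p i \<in> B}. \<alpha> i)"
        using \<alpha> by (intro sum_ennreal) (auto intro: less_imp_le)
      finally show ?thesis .
    qed
    \<comment> \<open>Several indices may share a position, whereas the covering lemma assigns one
      radius to each point; the largest is taken.\<close>
    define rr where "rr x = Max (r ` {i\<in>I. p i = x})" for x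
    have rrI: "\<exists>i\<in>I. p i = x \<and> rr x = r i" if "x \<in> p ` I" for x
    proof -
      have "rr x \<in> r ` {i\<in>I. p i = x}" unfolding rr_def using I that by (intro Max_in) auto
      then show ?thesis by auto
    qed
    have "\<exists>U\<in>sets borel. (\<Union>x\<in>p ` I. ball x (rr x)) \<subseteq> U \<and> ennreal l * emeasure \<mu> U \<le> emeasure \<sigma> UNIV"
    proof (rule maximal_cover_balls)
      show "sets \<sigma> = sets borel" by (simp add: \<sigma>_def)
      show "bounded (p ` I)" using I by (intro finite_imp_bounded) auto
      fix x assume "x \<in> p ` I"
      from rrI[OF this] obtain i where i: "i \<in> I" "x = p i" "rr x = r i" by auto
      show "0 < rr x" using r(1)[OF i(1)] i(3) by simp
      have "ennreal l * emeasure \<mu> (ball x (5 * rr x)) = ennreal (l * measure \<mu> (ball (p i) (5 * r i)))"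
        unfolding i(3) unfolding i(2) using l by (simp add: emeasure_ball_eq ennreal_mult)
      also have "\<dots> \<le> ennreal (?N i (r i))" by (intro ennreal_leI r(2) i(1))
      also have "\<dots> = emeasure \<sigma> (ball x (rr x))" unfolding i(3) unfolding i(2) by (subst em) auto
      finally show "ennreal l * emeasure \<mu> (ball x (5 * rr x)) \<le> emeasure \<sigma> (ball x (rr x))" .
    qed (use l in auto)
    then obtain U where U: "U \<in> sets borel" "(\<Union>x\<in>p ` I. ball x (rr x)) \<subseteq> U" "ennreal l * emeasure \<mu> U \<le> emeasure \<sigma> UNIV"
      by blast
    show ?thesis
    proof (rule that)
      show "U \<in> sets borel" by fact
      have "r i \<le> rr (p i)" if "i \<in> I" for i unfolding rr_def using I that by (intro Max_ge) auto
      then have "ball (p i) (r i) \<subseteq> ball (p i) (rr (p i))" if "i \<in> I" for i using that by (intro subset_ball) auto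
      then show "F \<subseteq> U" unfolding F_def using U(2) by blast
      have "ennreal (1 / l) * (ennreal l * emeasure \<mu> U) \<le> ennreal (1 / l) * ennreal A"
        using U(3) by (intro mult_left_mono) (auto simp: em A_def)
      then show "emeasure \<mu> U \<le> ennreal (A / l)"
        using l A0 by (simp add: mult.assoc[symmetric] ennreal_mult[symmetric])
    qed
  qed
  let ?B1 = "{x \<in> space \<mu>. 1 \<le> ennreal (2 / l) * (indicator (- F) x * (\<Sum>i\<in>I. ennreal (norm (b i x))))}"
  let ?B2 = "{x \<in> space \<mu>. 1 \<le> 4 * ennreal ((norm (Tf W \<epsilon> x))\<^sup>2)}"
  have [measurable]: "(\<lambda>x. \<Sum>i\<in>I. ennreal (norm (b i x))) \<in> borel_measurable borel"
    using mb by (intro borel_measurable_sum) auto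
  have "{x. l < norm (\<Sum>i\<in>I. \<alpha> i *\<^sub>R kr \<epsilon> (x - p i))} \<subseteq> U \<union> (?B1 \<union> ?B2)"
  proof
    fix x assume "x \<in> {x. l < norm (\<Sum>i\<in>I. \<alpha> i *\<^sub>R kr \<epsilon> (x - p i))}"
    then have x: "l < norm (\<Sum>i\<in>I. \<alpha> i *\<^sub>R kr \<epsilon> (x - p i))" by simp
    have "(\<Sum>i\<in>I. \<alpha> i *\<^sub>R kr \<epsilon> (x - p i)) = (\<Sum>i\<in>I. b i x) + l *\<^sub>R Tf W \<epsilon> x"
      by (simp add: b_def TW sum_subtractf scaleR_sum_right)
    then have "l < norm (\<Sum>i\<in>I. b i x) + l * norm (Tf W \<epsilon> x)"
      using x norm_triangle_ineq[of "\<Sum>i\<in>I. b i x" "l *\<^sub>R Tf W \<epsilon> x"] l by simp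
    then have x': "l < (\<Sum>i\<in>I. norm (b i x)) + l * norm (Tf W \<epsilon> x)"
      using norm_sum[of "\<lambda>i. b i x" I] by linarith
    show "x \<in> U \<union> (?B1 \<union> ?B2)"
    proof (cases "x \<in> F \<or> 1/2 \<le> norm (Tf W \<epsilon> x)")
      case True
      then show ?thesis
      proof
        assume "1/2 \<le> norm (Tf W \<epsilon> x)"
        then have "(1/2)\<^sup>2 \<le> (norm (Tf W \<epsilon> x))\<^sup>2" by (intro power_mono) auto
        then have "ennreal 1 \<le> ennreal (4 * (norm (Tf W \<epsilon> x))\<^sup>2)" by (intro ennreal_leI) (simp add: power2_eq_square)
        then show ?thesis by (simp add: ennreal_mult)
      qed (use U in blast)
    next
      case False
      then have "l * norm (Tf W \<epsilon> x) \<le> l * (1/2)" using l by (intro mult_left_mono) auto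
      then have "l \<le> 2 * (\<Sum>i\<in>I. norm (b i x))" using x' by linarith
      then have "1 \<le> 2 / l * (\<Sum>i\<in>I. norm (b i x))" using l by (simp add: field_simps)
      then have "ennreal 1 \<le> ennreal (2 / l * (\<Sum>i\<in>I. norm (b i x)))" by (intro ennreal_leI)
      also have "\<dots> = ennreal (2 / l) * ennreal (\<Sum>i\<in>I. norm (b i x))"
        using l by (intro ennreal_mult) (auto intro: sum_nonneg)
      also have "\<dots> = ennreal (2 / l) * (indicator (- F) x * (\<Sum>i\<in>I. ennreal (norm (b i x))))"
        using False by simp
      finally show ?thesis by simp
    qed
  qed
  then have "emeasure \<mu> {x. l < norm (\<Sum>i\<in>I. \<alpha> i *\<^sub>R kr \<epsilon> (x - p i))} \<le> emeasure \<mu> (U \<union> (?B1 \<union> ?B2))"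
    using U(1) by (intro emeasure_mono) auto
  also have "\<dots> \<le> emeasure \<mu> U + (emeasure \<mu> ?B1 + emeasure \<mu> ?B2)"
    using U(1) by (intro order_trans[OF emeasure_subadditive] add_left_mono emeasure_subadditive) auto
  also have "\<dots> \<le> ennreal (A / l) + (ennreal (2 / l * (Cb * A)) + ennreal (4 * (C2 * (4 * D * (A / l)))))"
  proof (intro add_mono U(3))
    have "emeasure \<mu> (?B1 \<inter> space \<mu>) \<le> ennreal (2 / l) * (\<integral>\<^sup>+x. (indicator (- F) x * (\<Sum>i\<in>I. ennreal (norm (b i x)))) * indicator (space \<mu>) x \<partial>\<mu>)"
      by (rule order_trans[OF _ nn_integral_Markov_inequality]) auto
    also have "(\<integral>\<^sup>+x. (indicator (- F) x * (\<Sum>i\<in>I. ennreal (norm (b i x)))) * indicator (space \<mu>) x \<partial>\<mu>) =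
       (\<Sum>i\<in>I. (\<integral>\<^sup>+x. indicator (- F) x * ennreal (norm (b i x)) \<partial>\<mu>))"
      by (simp add: sum_distrib_left nn_integral_sum mb del: sum_ennreal)
    also have "\<dots> \<le> (\<Sum>i\<in>I. ennreal (Cb * \<alpha> i))"
    proof (intro sum_mono)
      fix i assume i: "i \<in> I"
      have "(\<integral>\<^sup>+x. indicator (- F) x * ennreal (norm (b i x)) \<partial>\<mu>) \<le> (\<integral>\<^sup>+x. indicator (- ball (p i) (r i)) x * ennreal (norm (b i x)) \<partial>\<mu>)"
        using i by (intro nn_integral_mono mult_right_mono) (auto simp: F_def indicator_def)
      also have "\<dots> \<le> ennreal (Cb * \<alpha> i)"
        unfolding b_def
      proof (rule cz_atom[OF \<epsilon> r(1)[OF i] \<alpha>[OF i] l, where k="k i"])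
        fix y
        show "w i y \<le> 2 * (\<alpha> i / l) / measure \<mu> (ball (p i) (Q ^ k i * r i))"
          using w(3)[OF i] by (simp add: R_def)
        show "w i y \<noteq> 0 \<Longrightarrow> y \<in> ball (p i) (Q ^ k i * r i)" using w(4)[OF i] by (simp add: R_def)
        show "measure \<mu> (ball (p i) (Q * (Q ^ k i * r i))) \<le> Q ^ (s + 1) * measure \<mu> (ball (p i) (Q ^ k i * r i))"
          using k(1)[OF i] by (simp add: D_def)
      qed (use i w k in auto)
      finally show "(\<integral>\<^sup>+x. indicator (- F) x * ennreal (norm (b i x)) \<partial>\<mu>) \<le> ennreal (Cb * \<alpha> i)" .
    qed
    also have "\<dots> = ennreal (Cb * A)"
      unfolding A_def sum_distrib_left using \<alpha> Cb_pos by (intro sum_ennreal) (auto intro!: mult_nonneg_nonneg less_imp_le)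
    finally have "emeasure \<mu> (?B1 \<inter> space \<mu>) \<le> ennreal (2 / l) * ennreal (Cb * A)"
      by (simp add: mult_left_mono)
    also have "\<dots> = ennreal (2 / l * (Cb * A))" using l Cb_pos A0 by (intro ennreal_mult[symmetric]) auto
    also have "?B1 \<inter> space \<mu> = ?B1" by auto
    finally show "emeasure \<mu> ?B1 \<le> ennreal (2 / l * (Cb * A))" .
    have "emeasure \<mu> (?B2 \<inter> space \<mu>) \<le> 4 * (\<integral>\<^sup>+x. ennreal ((norm (Tf W \<epsilon> x))\<^sup>2) * indicator (space \<mu>) x \<partial>\<mu>)"
      by (rule order_trans[OF _ nn_integral_Markov_inequality]) auto
    also have "\<dots> \<le> 4 * ennreal (C2 * (\<integral>y. (W y)\<^sup>2 \<partial>\<mu>))"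
      using L2_bound[OF \<epsilon> mW iW iW2] by (intro mult_left_mono) auto
    also have "\<dots> \<le> 4 * ennreal (C2 * (4 * D * (A / l)))"
      using intW2 C2_pos by (intro mult_left_mono ennreal_leI) auto
    also have "\<dots> = ennreal (4 * (C2 * (4 * D * (A / l))))"
      using C2_pos D0 A0 l by (subst (2) ennreal_mult) auto
    also have "?B2 \<inter> space \<mu> = ?B2" by auto
    finally show "emeasure \<mu> ?B2 \<le> ennreal (4 * (C2 * (4 * D * (A / l))))" .
  qed
  also have "\<dots> = ennreal (A / l + (2 / l * (Cb * A) + 4 * (C2 * (4 * D * (A / l)))))"
    using A0 l Cb_pos C2_pos D0 by (simp add: ennreal_plus[symmetric] del: ennreal_plus)
  also have "A / l + (2 / l * (Cb * A) + 4 * (C2 * (4 * D * (A / l)))) = Cw * A / l"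
    using l by (simp add: Cw_def D_def field_simps)
  finally show ?thesis by (simp add: A_def)
qed

end

section \<open>Maximal truncations\<close>

context cz
begin

lemma integrable_kr:
  assumes "finite_measure \<nu>" "sets \<nu> = sets borel" "r > 0"
  shows "integrable \<nu> (\<lambda>y. kr r (x - y))"
proof -
  interpret finite_measure \<nu> by fact
  note assms(2)[measurable_cong]
  have [measurable]: "kr r \<in> borel_measurable borel" using assms by simp
  show ?thesis
    by (rule integrable_const_bound[where B="C0 / r ^ s"]) (use kr_bounded[OF assms(3)] in auto)
qed

text \<open>\<open>Tm \<nu> r\<close> inherits Lipschitz continuity from \<open>kr r\<close>.
  Openness is recorded, rather than measurability, so that unions over uncountably many radii stay
  Borel.\<close>

lemma open_Tm_superlevel:
  assumes \<nu>: "finite_measure \<nu>" "sets \<nu> = sets borel" and r: "r > 0"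
  shows "open {x. l < norm (Tm \<nu> r x)}"
proof -
  interpret finite_measure \<nu> by fact
  let ?L = "C0 * (2 ^ s + 4) / r ^ (s + 1)"
  have L0: "?L \<ge> 0" using C0_pos r by simp
  have "(?L * measure \<nu> (space \<nu>))-lipschitz_on UNIV (Tm \<nu> r)"
    unfolding lipschitz_on_def
  proof (intro conjI ballI)
    fix x z
    have "dist (Tm \<nu> r x) (Tm \<nu> r z) = norm (\<integral>y. kr r (x - y) - kr r (z - y) \<partial>\<nu>)"
      unfolding Tm_def dist_norm by (intro arg_cong[where f=norm] Bochner_Integration.integral_diff[symmetric] integrable_kr \<nu> r)
    also have "\<dots> \<le> (\<integral>y. ?L * dist x z \<partial>\<nu>)"
    proof (rule Bochner_Integration.integral_norm_bound_integral)
      show "integrable \<nu> (\<lambda>y. kr r (x - y) - kr r (z - y))"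
        by (intro Bochner_Integration.integrable_diff integrable_kr \<nu> r)
      show "norm (kr r (x - y) - kr r (z - y)) \<le> ?L * dist x z" for y
        using kr_lipschitz[OF r, of "x - y" "z - y"] by (simp add: dist_norm)
    qed simp
    also have "\<dots> = ?L * measure \<nu> (space \<nu>) * dist x z" by simp
    finally show "dist (Tm \<nu> r x) (Tm \<nu> r z) \<le> ?L * measure \<nu> (space \<nu>) * dist x z" .
  qed (intro mult_nonneg_nonneg L0 measure_nonneg)
  then have "continuous_on UNIV (Tm \<nu> r)" by (rule lipschitz_on_continuous_on)
  then show ?thesis by (intro open_Collect_less continuous_intros)
qed

end

lemma emeasure_density_indicator:
  assumes "A \<in> sets M" "B \<in> sets M"
  shows "emeasure (density M (indicator A)) B = emeasure M (A \<inter> B)"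
proof -
  have "emeasure (density M (indicator A)) B = (\<integral>\<^sup>+x. indicator A x * indicator B x \<partial>M)"
    using assms by (intro emeasure_density) auto
  also have "\<dots> = (\<integral>\<^sup>+x. indicator (A \<inter> B) x \<partial>M)" by (simp add: indicator_inter_arith)
  also have "\<dots> = emeasure M (A \<inter> B)" using assms by simp
  finally show ?thesis .
qed

text \<open>Fatou's lemma for indicators. It carries a uniform bound from approximating superlevel
  sets to the limiting one, since a strict inequality for the limit holds eventually along the
  sequence.\<close>

lemma emeasure_le_liminf:
  assumes [measurable]: "G \<in> sets M" "\<And>n::nat. A n \<in> sets M"
    and ev: "\<And>x. x \<in> G \<Longrightarrow> eventually (\<lambda>n. x \<in> A n) sequentially"
    and le: "\<And>n. emeasure M (A n) \<le> c"
  shows "emeasure M G \<le> c"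
proof -
  have "emeasure M G = (\<integral>\<^sup>+x. indicator G x \<partial>M)" by simp
  also have "\<dots> \<le> (\<integral>\<^sup>+x. liminf (\<lambda>n. indicator (A n) x) \<partial>M)"
  proof (intro nn_integral_mono)
    fix x
    show "indicator G x \<le> liminf (\<lambda>n. indicator (A n) x :: ennreal)"
    proof (cases "x \<in> G")
      case True
      from ev[OF this] have "eventually (\<lambda>n. (1::ennreal) \<le> indicator (A n) x) sequentially"
        by eventually_elim simp
      then have "1 \<le> liminf (\<lambda>n. indicator (A n) x :: ennreal)" by (rule Liminf_bounded)
      then show ?thesis using True by simp
    qed simp
  qed
  also have "\<dots> \<le> liminf (\<lambda>n. \<integral>\<^sup>+x. indicator (A n) x \<partial>M)" by (intro nn_integral_liminf) auto
  also have "\<dots> \<le> c" using le by (simp add: Liminf_le)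
  finally show ?thesis .
qed

context cz_L2
begin

text \<open>The image of \<nu> under a simple function is a finite sum of point masses with the same
  total mass. As the simple functions tend to the identity, continuity and boundedness of
  \<open>kr \<epsilon>\<close> make the truncations converge at every point.\<close>

lemma weak_type_measure:
  assumes \<nu>: "finite_measure \<nu>" "sets \<nu> = sets borel" and l: "l > 0" and \<epsilon>: "\<epsilon> > 0"
  shows "emeasure \<mu> {x. l < norm (Tm \<nu> \<epsilon> x)} \<le> ennreal (Cw * measure \<nu> UNIV / l)"
proof -
  interpret finite_measure \<nu> by fact
  note \<nu>(2)[measurable_cong]
  have [simp]: "space \<nu> = UNIV" using sets_eq_imp_space_eq[OF \<nu>(2)] by simp
  have [measurable]: "kr \<epsilon> \<in> borel_measurable borel" using \<epsilon> by simp
  have "\<exists>F. (\<forall>i. simple_function \<nu> (F i)) \<and> (\<forall>x\<in>space \<nu>. (\<lambda>i. F i x) \<longlonglongrightarrow> x) \<and>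
    (\<forall>i. \<forall>x\<in>space \<nu>. dist (F i x) 0 \<le> 2 * dist x (0::'a))"
    by (rule borel_measurable_implies_sequence_metric) simp
  then obtain F where F: "\<And>n. simple_function \<nu> (F n)" "\<And>y. (\<lambda>n. F n y) \<longlonglongrightarrow> (y::'a)" by auto
  have [measurable]: "F n \<in> borel_measurable \<nu>" for n using F(1) by (rule borel_measurable_simple_function)
  have fin: "finite (range (F n))" for n using simple_functionD(1)[OF F(1)[of n]] by simp
  have vim [measurable]: "F n -` {v} \<in> sets \<nu>" for n v
    using simple_functionD(2)[OF F(1)[of n], of "{v}"] by simp
  define \<alpha> where "\<alpha> n v = measure \<nu> (F n -` {v})" for n v
  \<comment> \<open>Values with mass 0 are dropped because \<open>weak_type_points\<close> asks for
    positive weights.\<close>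
  define I where "I n = {v \<in> range (F n). \<alpha> n v > 0}" for n
  define u where "u n x = (\<Sum>v\<in>I n. \<alpha> n v *\<^sub>R kr \<epsilon> (x - v))" for n x
  have ueq: "u n x = (\<integral>y. kr \<epsilon> (x - F n y) \<partial>\<nu>)" for n x
  proof -
    have "(\<integral>y. kr \<epsilon> (x - F n y) \<partial>\<nu>) = (\<integral>y. (\<Sum>v\<in>range (F n). indicator (F n -` {v}) y *\<^sub>R kr \<epsilon> (x - v)) \<partial>\<nu>)"
    proof (rule Bochner_Integration.integral_cong)
      fix y
      have "(\<Sum>v\<in>range (F n). indicator (F n -` {v}) y *\<^sub>R kr \<epsilon> (x - v)) = (\<Sum>v\<in>range (F n). if F n y = v then kr \<epsilon> (x - v) else 0)"
        by (intro sum.cong) auto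
      also have "\<dots> = kr \<epsilon> (x - F n y)" using fin[of n] by (simp add: sum.delta')
      finally show "kr \<epsilon> (x - F n y) = (\<Sum>v\<in>range (F n). indicator (F n -` {v}) y *\<^sub>R kr \<epsilon> (x - v))" by simp
    qed simp
    also have "\<dots> = (\<Sum>v\<in>range (F n). \<alpha> n v *\<^sub>R kr \<epsilon> (x - v))"
      unfolding \<alpha>_def by (subst Bochner_Integration.integral_sum) (auto simp: less_top[symmetric] emeasure_finite)
    also have "\<dots> = u n x"
      unfolding u_def I_def using fin[of n] by (intro sum.mono_neutral_right) (auto simp: \<alpha>_def zero_less_measure_iff)
    finally show ?thesis by simp
  qed
  have usum: "(\<Sum>v\<in>I n. \<alpha> n v) = measure \<nu> UNIV" for n
  proof -
    have "(\<Sum>v\<in>I n. \<alpha> n v) = (\<Sum>v\<in>range (F n). \<alpha> n v)"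
      unfolding I_def using fin[of n] by (intro sum.mono_neutral_left) (auto simp: \<alpha>_def zero_less_measure_iff)
    also have "\<dots> = measure \<nu> (\<Union>v\<in>range (F n). F n -` {v})"
      unfolding \<alpha>_def using fin[of n] vim by (intro finite_measure_finite_Union[symmetric]) (auto simp: disjoint_family_on_def)
    also have "(\<Union>v\<in>range (F n). F n -` {v}) = UNIV" by auto
    finally show ?thesis .
  qed
  have lim: "(\<lambda>n. u n x) \<longlonglongrightarrow> Tm \<nu> \<epsilon> x" for x
    unfolding ueq Tm_def
  proof (rule integral_dominated_convergence[where w="\<lambda>_. C0 / \<epsilon> ^ s"])
    show "AE y in \<nu>. (\<lambda>n. kr \<epsilon> (x - F n y)) \<longlonglongrightarrow> kr \<epsilon> (x - y)"
      by (intro AE_I2 continuous_on_tendsto_compose[OF continuous_kr[OF \<epsilon>]] tendsto_intros F(2)) auto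
  qed (use kr_bounded[OF \<epsilon>] in auto)
  have mu: "(\<lambda>x. u n x) \<in> borel_measurable borel" for n unfolding u_def by measurable
  show ?thesis
  proof (rule emeasure_le_liminf[where A="\<lambda>n. {x. l < norm (u n x)}"])
    show "{x. l < norm (Tm \<nu> \<epsilon> x)} \<in> sets \<mu>" using open_Tm_superlevel[OF \<nu> \<epsilon>] by simp
    show "{x. l < norm (u n x)} \<in> sets \<mu>" for n using mu[of n] by measurable
    show "\<forall>\<^sub>F n in sequentially. x \<in> {x. l < norm (u n x)}" if "x \<in> {x. l < norm (Tm \<nu> \<epsilon> x)}" for x
      using order_tendstoD(1)[OF tendsto_norm[OF lim[of x]], of l] that by simp
    show "emeasure \<mu> {x. l < norm (u n x)} \<le> ennreal (Cw * measure \<nu> UNIV / l)" for n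
      unfolding u_def usum[symmetric, of n] using fin[of n] l \<epsilon>
      by (intro weak_type_points) (auto simp: I_def)
  qed
qed

section \<open>Cotlar's inequality and the maximal smooth truncation\<close>

definition Ce :: real where "Ce = C0 * 2 * Q ^ (2 * s + 2) + C0 * 20 ^ s + C1 * 5 ^ s * 2 ^ (s + 1) / 4"

text \<open>The smallness asked of the maximal function of \<nu>: the first bound keeps the total
  change of truncation at most \<open>l / 2\<close>, the second makes the near part of \<nu> exceed
  \<open>l / 8\<close> on at most half of a doubling ball.\<close>

definition \<delta>0 :: real where "\<delta>0 = min (1 / (2 * Ce)) (1 / (16 * Cw * Q ^ (s + 1)))"

lemma \<delta>0: "\<delta>0 > 0" "\<delta>0 * Ce \<le> 1/2" "16 * Cw * Q ^ (s + 1) * \<delta>0 \<le> 1"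
proof -
  have Ce: "Ce > 0" unfolding Ce_def using C0_pos C1_pos by (intro add_pos_pos) auto
  have W: "16 * Cw * Q ^ (s + 1) > 0" using Cw_pos by simp
  show "\<delta>0 > 0" using Ce W by (simp add: \<delta>0_def)
  have "\<delta>0 \<le> 1 / (2 * Ce)" by (simp add: \<delta>0_def)
  then show "\<delta>0 * Ce \<le> 1/2" using Ce by (simp add: field_simps)
  have "\<delta>0 \<le> 1 / (16 * Cw * Q ^ (s + 1))" unfolding \<delta>0_def by (rule min.cobounded2)
  then show "16 * Cw * Q ^ (s + 1) * \<delta>0 \<le> 1" using W by (simp only: pos_le_divide_eq mult.commute)
qed

text \<open>At the first doubling scale \<open>R\<close> above \<open>r\<close> the truncation at
  \<open>x\<close> has changed little, by \<open>gap_integral\<close>. The part of \<nu> outside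
  \<open>ball x (4 * R)\<close> acts almost constantly on \<open>ball x R\<close>, and by the weak
  type bound the part inside is small on at least half of that ball. Thus the supremum over all
  radii is reduced to the maximal function of the superlevel set at the single scale
  \<epsilon>.\<close>

lemma cotlar_point:
  assumes \<nu>: "finite_measure \<nu>" "sets \<nu> = sets borel" and l: "l > 0" and \<epsilon>: "\<epsilon> > 0" "\<epsilon> \<le> r"
    and big: "l < norm (Tm \<nu> r x)"
    and M: "\<And>t. t > 0 \<Longrightarrow> emeasure \<nu> (ball x t) \<le> ennreal (\<delta>0 * l * measure \<mu> (ball x (5 * t)))"
  shows "\<exists>R>0. ennreal (1 / (2 * Q ^ (s + 1))) * emeasure \<mu> (ball x (5 * R)) \<le>
    emeasure \<mu> ({z. l / 8 < norm (Tm \<nu> \<epsilon> z)} \<inter> ball x R)"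
proof -
  interpret finite_measure \<nu> by fact
  note \<nu>(2)[measurable_cong]
  have [simp]: "space \<nu> = UNIV" using sets_eq_imp_space_eq[OF \<nu>(2)] by simp
  have [measurable]: "ball x a \<in> sets \<nu>" for a x using \<nu>(2) by simp
  define D where "D = Q ^ (s + 1)"
  have D0: "D > 0" by (simp add: D_def)
  have r: "r > 0" using \<epsilon> by simp
  have mkr: "kr a \<in> borel_measurable borel" if "a > 0" for a using that by simp
  \<comment> \<open>If all balls about \<open>x\<close> were null, \<open>M\<close> would force
    \<nu> = 0 and the truncation at \<open>x\<close> would vanish.\<close>
  obtain t0 where t0: "measure \<mu> (ball x t0) > 0"
  proof (rule ccontr)
    assume "\<not> thesis"
    then have z: "measure \<mu> (ball x t) = 0" for t using that by (metis measure_nonneg order_le_less)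
    have "emeasure \<nu> (ball x (real (Suc n))) = 0" for n using M[of "real (Suc n)"] z by simp
    then have "emeasure \<nu> (\<Union>n. ball x (real (Suc n))) = 0" by (intro emeasure_UN_eq_0) auto
    moreover have "(\<Union>n. ball x (real (Suc n))) = UNIV"
    proof -
      have "\<exists>n. dist x y < real (Suc n)" for y
        using reals_Archimedean2[of "dist x y"] by (metis less_trans of_nat_Suc less_add_one add.commute)
      then show ?thesis by auto
    qed
    ultimately have "emeasure \<nu> UNIV = 0" by simp
    then have "AE y in \<nu>. kr r (x - y) = 0" by (intro AE_I[of _ _ UNIV]) auto
    then have "Tm \<nu> r x = 0" unfolding Tm_def by (intro integral_eq_zero_AE)
    then show False using big l by simp
  qed
  obtain k where k: "measure \<mu> (ball x (Q * (Q ^ k * r))) \<le> D * measure \<mu> (ball x (Q ^ k * r))"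
    "measure \<mu> (ball x (Q ^ k * r)) > 0"
    "\<And>i. i \<le> k \<Longrightarrow> measure \<mu> (ball x (Q ^ i * r)) \<le> (1/Q) ^ (k - i) * (Q ^ i * r) ^ s"
    using doubling_radius[OF r t0] unfolding D_def by metis
  define R where "R = Q ^ k * r"
  have R: "R > 0" "r \<le> R" using r by (auto simp: R_def mult_ge1_I)
  have c0: "\<delta>0 * l \<ge> 0" using \<delta>0 l by simp
  have M': "emeasure \<nu> (ball x t) \<le> ennreal (\<delta>0 * l * 5 ^ s * t ^ s)" if "t > 0" for t
  proof -
    have "\<delta>0 * l * measure \<mu> (ball x (5 * t)) \<le> \<delta>0 * l * (5 * t) ^ s"
      using that c0 by (intro mult_left_mono measure_ball_le) auto
    then show ?thesis using M[OF that] by (simp add: power_mult_distrib mult.assoc) (meson ennreal_leI order_trans)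
  qed
  \<comment> \<open>passing from scale \<open>r\<close> to the doubling scale \<open>R\<close>\<close>
  have e1: "norm (Tm \<nu> r x - Tm \<nu> R x) \<le> C0 * (\<delta>0 * l * 2 * Q ^ (2 * s + 2))"
  proof -
    have "Tm \<nu> r x - Tm \<nu> R x = (\<integral>y. kr r (x - y) - kr R (x - y) \<partial>\<nu>)"
      unfolding Tm_def by (intro Bochner_Integration.integral_diff[symmetric] integrable_kr \<nu> r R)
    also have "ennreal (norm \<dots>) \<le> (\<integral>\<^sup>+y. ennreal (norm (kr r (x - y) - kr R (x - y))) \<partial>\<nu>)"
      by (rule integral_norm_bound_ennreal) (intro Bochner_Integration.integrable_diff integrable_kr \<nu> r R)
    also have "\<dots> \<le> (\<integral>\<^sup>+y. ennreal C0 * (indicator {y. r \<le> dist x y \<and> dist x y < Q * (Q ^ k * r)} y * ennreal (1 / dist x y ^ s)) \<partial>\<nu>)"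
    proof (intro nn_integral_mono)
      fix y
      consider "dist x y < r" | "Q * R \<le> dist x y" | "r \<le> dist x y" "dist x y < Q * R" by linarith
      then show "ennreal (norm (kr r (x - y) - kr R (x - y))) \<le>
        ennreal C0 * (indicator {y. r \<le> dist x y \<and> dist x y < Q * (Q ^ k * r)} y * ennreal (1 / dist x y ^ s))"
      proof cases
        case 1
        then show ?thesis using r R by (simp add: kr_eq_0 dist_norm)
      next
        case 2
        then have "2 * R \<le> norm (x - y)" "2 * r \<le> norm (x - y)" using R by (auto simp: dist_norm)
        then show ?thesis using r R by (simp add: kr_eq_K)
      next
        case 3
        have "norm (x - y) / R \<le> norm (x - y) / r" using R r by (intro divide_left_mono) auto
        then have c: "\<bar>ramp (norm (x - y) / r) - ramp (norm (x - y) / R)\<bar> \<le> 1"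
          by (auto simp: ramp_def max_def min_def)
        have "x - y \<noteq> 0" using 3 r by auto
        have "norm (kr r (x - y) - kr R (x - y)) = \<bar>ramp (norm (x - y) / r) - ramp (norm (x - y) / R)\<bar> * norm (K (x - y))"
          by (simp add: kr_def scaleR_left_diff_distrib[symmetric])
        also have "\<dots> \<le> 1 * (C0 / norm (x - y) ^ s)"
          using c K_bound[OF \<open>x - y \<noteq> 0\<close>] by (intro mult_mono) auto
        finally have "ennreal (norm (kr r (x - y) - kr R (x - y))) \<le> ennreal (C0 * (1 / dist x y ^ s))"
          by (intro ennreal_leI) (simp add: dist_norm)
        then show ?thesis using 3 C0_pos by (simp add: R_def ennreal_mult[symmetric])
      qed
    qed
    also have "\<dots> = ennreal C0 * (\<integral>\<^sup>+y. indicator {y. r \<le> dist x y \<and> dist x y < Q * (Q ^ k * r)} y * ennreal (1 / dist x y ^ s) \<partial>\<nu>)"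
      by (intro nn_integral_cmult) auto
    also have "\<dots> \<le> ennreal C0 * ennreal (\<delta>0 * l * 2 * Q ^ (2 * s + 2))"
      using M r by (intro mult_left_mono gap_integral[OF \<nu>(2) r c0 k(3)]) auto
    also have "\<dots> = ennreal (C0 * (\<delta>0 * l * 2 * Q ^ (2 * s + 2)))"
      using C0_pos \<delta>0(1) l by (intro ennreal_mult[symmetric]) auto
    finally show ?thesis using C0_pos \<delta>0(1) l by (subst (asm) ennreal_le_iff) auto
  qed
  \<comment> \<open>Outside this ball \<open>norm (x - y)\<close> is at least twice the distance
    from \<open>x\<close> to any \<open>z\<close> in \<open>ball x R\<close>, as
    \<open>kr_smooth\<close> demands, and both \<open>kr R\<close> and \<open>kr \<epsilon>\<close>
    equal \<open>K\<close> at \<open>x - y\<close>.\<close>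
  let ?B = "ball x (4 * R)"
  define \<nu>n where "\<nu>n = density \<nu> (indicator ?B)"
  have sn: "sets \<nu>n = sets borel" by (simp add: \<nu>n_def \<nu>(2))
  have emn: "emeasure \<nu>n UNIV = emeasure \<nu> ?B"
    unfolding \<nu>n_def using \<nu>(2) by (subst emeasure_density) auto
  have fn: "finite_measure \<nu>n"
    by (rule finite_measureI) (simp add: emn sets_eq_imp_space_eq[OF sn] emeasure_finite)
  have Tmn: "Tm \<nu>n \<epsilon> z = (\<integral>y. indicator ?B y *\<^sub>R kr \<epsilon> (z - y) \<partial>\<nu>)" for z
    unfolding Tm_def \<nu>n_def using mkr[OF \<epsilon>(1)]
    by (subst integral_density[where f="\<lambda>y. kr \<epsilon> (z - y)" and g="indicator ?B", symmetric]) (auto simp: ennreal_indicator)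
  have split: "Tm \<nu> \<epsilon> z = Tm \<nu>n \<epsilon> z + (\<integral>y. indicator (- ?B) y *\<^sub>R kr \<epsilon> (z - y) \<partial>\<nu>)" for z
  proof -
    have "Tm \<nu> \<epsilon> z = (\<integral>y. indicator ?B y *\<^sub>R kr \<epsilon> (z - y) + indicator (- ?B) y *\<^sub>R kr \<epsilon> (z - y) \<partial>\<nu>)"
      unfolding Tm_def by (intro Bochner_Integration.integral_cong) (auto simp: indicator_def)
    also have "\<dots> = Tm \<nu>n \<epsilon> z + (\<integral>y. indicator (- ?B) y *\<^sub>R kr \<epsilon> (z - y) \<partial>\<nu>)"
      unfolding Tmn using \<nu> \<epsilon> by (intro Bochner_Integration.integral_add integrable_mult_indicator integrable_kr) auto
    finally show ?thesis .
  qed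
  have e2: "norm (Tm \<nu> R x - (\<integral>y. indicator (- ?B) y *\<^sub>R kr \<epsilon> (z - y) \<partial>\<nu>)) \<le>
     C0 * 20 ^ s * (\<delta>0 * l) + C1 * (\<delta>0 * l * 5 ^ s) * 2 ^ (s + 1) / 4" if z: "z \<in> ball x R" for z
  proof -
    let ?g = "\<lambda>y. kr R (x - y) - indicator (- ?B) y *\<^sub>R kr \<epsilon> (z - y)"
    have ig: "integrable \<nu> ?g"
      using \<nu> \<epsilon> R by (intro Bochner_Integration.integrable_diff integrable_mult_indicator integrable_kr) auto
    have "Tm \<nu> R x - (\<integral>y. indicator (- ?B) y *\<^sub>R kr \<epsilon> (z - y) \<partial>\<nu>) = (\<integral>y. ?g y \<partial>\<nu>)"
      unfolding Tm_def using \<nu> \<epsilon> R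
      by (intro Bochner_Integration.integral_diff[symmetric] integrable_mult_indicator integrable_kr) auto
    also have "ennreal (norm \<dots>) \<le> (\<integral>\<^sup>+y. ennreal (norm (?g y)) \<partial>\<nu>)"
      by (rule integral_norm_bound_ennreal[OF ig])
    also have "\<dots> \<le> (\<integral>\<^sup>+y. ennreal (C0 / R ^ s) * indicator ?B y + ennreal (C1 * R) * (indicator {y. 4 * R \<le> dist x y} y * ennreal (1 / dist x y ^ (s + 1))) \<partial>\<nu>)"
    proof (intro nn_integral_mono)
      fix y
      show "ennreal (norm (?g y)) \<le> ennreal (C0 / R ^ s) * indicator ?B y + ennreal (C1 * R) * (indicator {y. 4 * R \<le> dist x y} y * ennreal (1 / dist x y ^ (s + 1)))"
      proof (cases "y \<in> ?B")
        case True
        then show ?thesis using kr_bounded[OF R(1), of "x - y"] by (auto intro: ennreal_leI)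
      next
        case False
        then have y: "4 * R \<le> norm (x - y)" by (simp add: dist_norm)
        have "kr R (x - y) = kr \<epsilon> (x - y)" using y \<epsilon> R by (simp add: kr_eq_K)
        then have "norm (?g y) = norm (kr \<epsilon> (x - y) - kr \<epsilon> (z - y))" using False by simp
        also have "\<dots> \<le> C1 * norm ((x - y) - (z - y)) / norm (x - y) ^ (s + 1)"
          using z y R by (intro kr_smooth \<epsilon>) (auto simp: dist_norm)
        also have "\<dots> \<le> C1 * R / norm (x - y) ^ (s + 1)"
          using z C1_pos by (intro divide_right_mono mult_left_mono) (auto simp: dist_norm)
        finally have "ennreal (norm (?g y)) \<le> ennreal (C1 * R * (1 / dist x y ^ (s + 1)))"
          by (intro ennreal_leI) (simp add: dist_norm)
        also have "\<dots> = ennreal (C1 * R) * ennreal (1 / dist x y ^ (s + 1))"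
          using C1_pos R by (intro ennreal_mult) auto
        finally show ?thesis using False by simp
      qed
    qed
    also have "\<dots> = ennreal (C0 / R ^ s) * emeasure \<nu> ?B + ennreal (C1 * R) * (\<integral>\<^sup>+y. indicator {y. 4 * R \<le> dist x y} y * ennreal (1 / dist x y ^ (s + 1)) \<partial>\<nu>)"
      by (subst nn_integral_add) (auto simp: nn_integral_cmult)
    also have "\<dots> \<le> ennreal (C0 / R ^ s) * ennreal (\<delta>0 * l * 5 ^ s * (4 * R) ^ s) + ennreal (C1 * R) * ennreal (\<delta>0 * l * 5 ^ s * 2 ^ (s + 1) / (4 * R))"
      using R \<delta>0(1) l by (intro add_mono mult_left_mono tail_integral \<nu>(2) M') auto
    also have "\<dots> = ennreal (C0 / R ^ s * (\<delta>0 * l * 5 ^ s * (4 * R) ^ s) + C1 * R * (\<delta>0 * l * 5 ^ s * 2 ^ (s + 1) / (4 * R)))"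
      using R c0 C0_pos C1_pos \<delta>0(1) l by (simp add: ennreal_plus[symmetric] ennreal_mult[symmetric] del: ennreal_plus)
    also have "C0 / R ^ s * (\<delta>0 * l * 5 ^ s * (4 * R) ^ s) + C1 * R * (\<delta>0 * l * 5 ^ s * 2 ^ (s + 1) / (4 * R)) =
       C0 * 20 ^ s * (\<delta>0 * l) + C1 * (\<delta>0 * l * 5 ^ s) * 2 ^ (s + 1) / 4"
    proof -
      have "5 ^ s * (4 * R) ^ s = (5 * (4 * R)) ^ s" by (simp only: power_mult_distrib)
      also have "5 * (4 * R) = 20 * R" by simp
      also have "(20 * R) ^ s = 20 ^ s * R ^ s" by (rule power_mult_distrib)
      finally have "5 ^ s * (4 * R) ^ s = 20 ^ s * R ^ s" .
      then have "C0 / R ^ s * (\<delta>0 * l * 5 ^ s * (4 * R) ^ s) = C0 / R ^ s * (\<delta>0 * l * (20 ^ s * R ^ s))"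
        by (simp only: mult.assoc)
      also have "\<dots> = C0 * 20 ^ s * (\<delta>0 * l)" using R by simp
      finally have eq: "C0 / R ^ s * (\<delta>0 * l * 5 ^ s * (4 * R) ^ s) = C0 * 20 ^ s * (\<delta>0 * l)" .
      show ?thesis unfolding eq using R by simp
    qed
    finally show ?thesis using \<delta>0(1) l C0_pos C1_pos by (subst (asm) ennreal_le_iff) auto
  qed
  have far: "l / 2 < norm (\<integral>y. indicator (- ?B) y *\<^sub>R kr \<epsilon> (z - y) \<partial>\<nu>)" if "z \<in> ball x R" for z
  proof -
    let ?f = "\<integral>y. indicator (- ?B) y *\<^sub>R kr \<epsilon> (z - y) \<partial>\<nu>"
    have "norm (Tm \<nu> r x) \<le> norm (Tm \<nu> r x - Tm \<nu> R x) + norm (Tm \<nu> R x - ?f) + norm ?f"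
      using norm_triangle_ineq[of "Tm \<nu> r x - Tm \<nu> R x" "Tm \<nu> R x - ?f"] norm_triangle_sub[of "Tm \<nu> r x" ?f] by simp
    also have "\<dots> \<le> C0 * (\<delta>0 * l * 2 * Q ^ (2 * s + 2)) + (C0 * 20 ^ s * (\<delta>0 * l) + C1 * (\<delta>0 * l * 5 ^ s) * 2 ^ (s + 1) / 4) + norm ?f"
      using e1 e2[OF that] by (intro add_mono) auto
    also have "C0 * (\<delta>0 * l * 2 * Q ^ (2 * s + 2)) + (C0 * 20 ^ s * (\<delta>0 * l) + C1 * (\<delta>0 * l * 5 ^ s) * 2 ^ (s + 1) / 4) = (\<delta>0 * Ce) * l"
      by (simp add: Ce_def algebra_simps)
    also have "(\<delta>0 * Ce) * l \<le> 1/2 * l" using \<delta>0 l by (intro mult_right_mono) auto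
    finally show ?thesis using big by simp
  qed
  let ?m = "measure \<mu> (ball x R)"
  let ?N = "{z. l / 8 < norm (Tm \<nu>n \<epsilon> z)}"
  let ?G = "{z. l / 8 < norm (Tm \<nu> \<epsilon> z)}"
  have [measurable]: "?N \<in> sets borel" "?G \<in> sets borel"
    by (intro borel_open open_Tm_superlevel[OF fn sn \<epsilon>(1)] open_Tm_superlevel[OF \<nu> \<epsilon>(1)])+
  have "emeasure \<mu> ?N \<le> ennreal (Cw * measure \<nu>n UNIV / (l / 8))"
    using l by (intro weak_type_measure[OF fn sn _ \<epsilon>(1)]) auto
  also have "\<dots> \<le> ennreal (?m / 2)"
  proof (rule ennreal_leI)
    have "measure \<nu>n UNIV \<le> \<delta>0 * l * measure \<mu> (ball x (5 * (4 * R)))"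
      using M[of "4 * R"] R emn c0 by (simp add: Sigma_Algebra.measure_def enn2real_leI)
    also have "\<dots> \<le> \<delta>0 * l * measure \<mu> (ball x (Q * R))"
      using R c0 by (intro mult_left_mono measure_ball_mono) auto
    also have "\<dots> \<le> \<delta>0 * l * (D * ?m)" using k(1) c0 by (intro mult_left_mono) (auto simp: R_def)
    finally have "Cw * measure \<nu>n UNIV / (l / 8) \<le> Cw * (\<delta>0 * l * (D * ?m)) / (l / 8)"
      using Cw_pos l by (intro divide_right_mono mult_left_mono) auto
    also have "\<dots> = (16 * Cw * Q ^ (s + 1) * \<delta>0) * (?m / 2)" using l by (simp add: D_def field_simps)
    also have "\<dots> \<le> 1 * (?m / 2)" by (intro mult_right_mono \<delta>0(3)) auto
    finally show "Cw * measure \<nu>n UNIV / (l / 8) \<le> ?m / 2" by simp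
  qed
  finally have Nle: "emeasure \<mu> ?N \<le> ennreal (?m / 2)" .
  have sub: "ball x R \<subseteq> ?N \<union> (?G \<inter> ball x R)"
  proof
    fix z assume z: "z \<in> ball x R"
    have "norm (Tm \<nu> \<epsilon> z) \<ge> norm (\<integral>y. indicator (- ?B) y *\<^sub>R kr \<epsilon> (z - y) \<partial>\<nu>) - norm (Tm \<nu>n \<epsilon> z)"
      unfolding split[of z]
      using norm_diff_ineq[of "\<integral>y. indicator (- ?B) y *\<^sub>R kr \<epsilon> (z - y) \<partial>\<nu>" "Tm \<nu>n \<epsilon> z"] by (simp only: add.commute)
    then show "z \<in> ?N \<union> (?G \<inter> ball x R)" using far[OF z] z l by auto
  qed
  have "ennreal ?m = emeasure \<mu> (ball x R)" by (simp add: emeasure_ball_eq)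
  also have "\<dots> \<le> emeasure \<mu> ?N + emeasure \<mu> (?G \<inter> ball x R)"
    by (rule order_trans[OF emeasure_mono[OF sub] emeasure_subadditive]; unfold sets_mu; intro sets.Un sets.Int borel_open open_ball open_Tm_superlevel[OF fn sn \<epsilon>(1)] open_Tm_superlevel[OF \<nu> \<epsilon>(1)])
  also have "\<dots> \<le> ennreal (?m / 2) + emeasure \<mu> (?G \<inter> ball x R)" by (intro add_right_mono Nle)
  finally have half: "ennreal (?m / 2) \<le> emeasure \<mu> (?G \<inter> ball x R)"
  proof -
    assume a: "ennreal ?m \<le> ennreal (?m / 2) + emeasure \<mu> (?G \<inter> ball x R)"
    have "ennreal ?m = ennreal (?m / 2) + ennreal (?m / 2)" by (simp flip: ennreal_plus)
    with a show ?thesis by (simp add: ennreal_add_left_cancel_le)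
  qed
  have "ennreal (1 / (2 * Q ^ (s + 1))) * emeasure \<mu> (ball x (5 * R)) = ennreal (1 / (2 * D) * measure \<mu> (ball x (5 * R)))"
    by (simp add: emeasure_ball_eq ennreal_mult[symmetric] D_def)
  also have "\<dots> \<le> ennreal (?m / 2)"
  proof (rule ennreal_leI)
    have "measure \<mu> (ball x (5 * R)) \<le> measure \<mu> (ball x (Q * R))" using R by (intro measure_ball_mono) auto
    also have "\<dots> \<le> D * ?m" using k(1) by (simp add: R_def)
    finally show "1 / (2 * D) * measure \<mu> (ball x (5 * R)) \<le> ?m / 2" using D0 by (simp add: field_simps)
  qed
  also note half
  finally show ?thesis using R by blast
qed

definition Cs :: real where "Cs = 1 / \<delta>0 + 16 * Q ^ (s + 1) * Cw"

lemma Cs_pos: "Cs > 0" unfolding Cs_def using \<delta>0(1) Cw_pos by (intro add_pos_pos) auto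

text \<open>Points are sorted by the maximal function of \<nu>. Where it is large,
  \<open>maximal_cover\<close> is applied to \<nu>; elsewhere \<open>cotlar_point\<close> lets it be
  applied to \<mu> restricted to the superlevel set at scale \<epsilon>, whose mass
  \<open>weak_type_measure\<close> bounds.\<close>

lemma weak_type_max:
  assumes \<nu>: "finite_measure \<nu>" "sets \<nu> = sets borel" and l: "l > 0"
  shows "emeasure \<mu> {x. \<exists>r>0. l < norm (Tm \<nu> r x)} \<le> ennreal (Cs * measure \<nu> UNIV / l)"
proof -
  interpret finite_measure \<nu> by fact
  have [simp]: "space \<nu> = UNIV" using sets_eq_imp_space_eq[OF \<nu>(2)] by simp
  have em\<nu>: "emeasure \<nu> UNIV = ennreal (measure \<nu> UNIV)" by (simp add: emeasure_eq_measure)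
  \<comment> \<open>The covering lemma needs a bounded set of centres, and a lower bound on the
    radii provides the common scale \<epsilon>. The sets increase to the full superlevel
    set.\<close>
  define V where "V n = ball 0 (real n) \<inter> (\<Union>r\<in>{1 / real (Suc n)..}. {x. l < norm (Tm \<nu> r x)})" for n
  have open_V: "open (V n)" for n
  proof -
    have "0 < r" if "r \<in> {1 / real (Suc n)..}" for r using that
      by (metis atLeast_iff divide_pos_pos less_le_trans of_nat_0_less_iff zero_less_Suc zero_less_one)
    then show ?thesis unfolding V_def by (intro open_Int open_UN ballI open_Tm_superlevel[OF \<nu>]) auto
  qed
  have VU: "(\<Union>n. V n) = {x. \<exists>r>0. l < norm (Tm \<nu> r x)}"
  proof (intro equalityI subsetI)
    fix x assume "x \<in> (\<Union>n. V n)"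
    then obtain n r where n: "r \<ge> 1 / real (Suc n)" "l < norm (Tm \<nu> r x)" by (auto simp: V_def)
    moreover have "1 / real (Suc n) > 0" by simp
    ultimately have "r > 0" by linarith
    then show "x \<in> {x. \<exists>r>0. l < norm (Tm \<nu> r x)}" using n by blast
  next
    fix x assume "x \<in> {x. \<exists>r>0. l < norm (Tm \<nu> r x)}"
    then obtain r where r: "r > 0" "l < norm (Tm \<nu> r x)" by blast
    obtain m where m: "norm x < real m" using reals_Archimedean2 by blast
    obtain n where n: "1 / real (Suc n) < r" using nat_approx_posE r(1) by blast
    have "x \<in> V (max m n)"
    proof -
      have "1 / real (Suc (max m n)) \<le> 1 / real (Suc n)" by (intro divide_left_mono) auto
      then show ?thesis using m n r by (auto simp: V_def intro!: bexI[of _ r])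
    qed
    then show "x \<in> (\<Union>n. V n)" by blast
  qed
  have inc: "incseq V"
  proof (rule incseq_SucI)
    fix n
    have "1 / real (Suc (Suc n)) \<le> 1 / real (Suc n)" by (intro divide_left_mono) auto
    then show "V n \<subseteq> V (Suc n)" by (fastforce simp: V_def)
  qed
  have "emeasure \<mu> (V n) \<le> ennreal (Cs * measure \<nu> UNIV / l)" for n
  proof -
    define \<epsilon> where "\<epsilon> = 1 / real (Suc n)"
    have \<epsilon>: "\<epsilon> > 0" by (simp add: \<epsilon>_def)
    let ?G = "{z. l / 8 < norm (Tm \<nu> \<epsilon> z)}"
    have [measurable]: "?G \<in> sets borel" by (intro borel_open open_Tm_superlevel[OF \<nu> \<epsilon>])
    have mG: "?G \<in> sets \<mu>" unfolding sets_mu by fact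
    define bad where "bad x \<longleftrightarrow> (\<exists>t>0. ennreal (\<delta>0 * l) * emeasure \<mu> (ball x (5 * t)) \<le> emeasure \<nu> (ball x t))" for x
    obtain U1 where U1: "U1 \<in> sets borel" "{x \<in> V n. bad x} \<subseteq> U1" "ennreal (\<delta>0 * l) * emeasure \<mu> U1 \<le> emeasure \<nu> UNIV"
    proof -
      have "\<exists>U\<in>sets borel. {x \<in> V n. bad x} \<subseteq> U \<and> ennreal (\<delta>0 * l) * emeasure \<mu> U \<le> emeasure \<nu> UNIV"
      proof (rule maximal_cover[OF \<nu>(2)])
        show "bounded {x \<in> V n. bad x}" by (rule bounded_subset[OF bounded_ball[of 0 "real n"]]) (auto simp: V_def)
      qed (use \<delta>0(1) l in \<open>auto simp: bad_def\<close>)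
      then show ?thesis using that by blast
    qed
    have s2: "sets (density \<mu> (indicator ?G)) = sets borel" by simp
    obtain U2 where U2: "U2 \<in> sets borel" "{x \<in> V n. \<not> bad x} \<subseteq> U2"
      "ennreal (1 / (2 * Q ^ (s + 1))) * emeasure \<mu> U2 \<le> emeasure (density \<mu> (indicator ?G)) UNIV"
    proof -
      have "\<exists>U\<in>sets borel. {x \<in> V n. \<not> bad x} \<subseteq> U \<and> ennreal (1 / (2 * Q ^ (s + 1))) * emeasure \<mu> U \<le> emeasure (density \<mu> (indicator ?G)) UNIV"
      proof (rule maximal_cover[OF s2])
        show "bounded {x \<in> V n. \<not> bad x}" by (rule bounded_subset[OF bounded_ball[of 0 "real n"]]) (auto simp: V_def)
        fix x assume x: "x \<in> {x \<in> V n. \<not> bad x}"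
        then obtain r where r: "\<epsilon> \<le> r" "l < norm (Tm \<nu> r x)" by (auto simp: V_def \<epsilon>_def)
        have "emeasure \<nu> (ball x t) \<le> ennreal (\<delta>0 * l * measure \<mu> (ball x (5 * t)))" if "t > 0" for t
        proof -
          have "emeasure \<nu> (ball x t) < ennreal (\<delta>0 * l) * emeasure \<mu> (ball x (5 * t))"
            using x that by (auto simp: bad_def not_le)
          also have "\<dots> = ennreal (\<delta>0 * l * measure \<mu> (ball x (5 * t)))"
            using \<delta>0 l by (simp add: emeasure_ball_eq ennreal_mult)
          finally show ?thesis by simp
        qed
        from cotlar_point[OF \<nu> l \<epsilon> r this] obtain R where "R > 0"
          "ennreal (1 / (2 * Q ^ (s + 1))) * emeasure \<mu> (ball x (5 * R)) \<le> emeasure \<mu> (?G \<inter> ball x R)" by blast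
        moreover have "emeasure (density \<mu> (indicator ?G)) (ball x R) = emeasure \<mu> (?G \<inter> ball x R)"
          by (rule emeasure_density_indicator[OF mG]) simp
        ultimately show "\<exists>R>0. ennreal (1 / (2 * Q ^ (s + 1))) * emeasure \<mu> (ball x (5 * R)) \<le> emeasure (density \<mu> (indicator ?G)) (ball x R)"
          by auto
      qed auto
      then show ?thesis using that by blast
    qed
    have a1: "emeasure \<mu> U1 \<le> ennreal (measure \<nu> UNIV / (\<delta>0 * l))"
    proof -
      have "ennreal (1 / (\<delta>0 * l)) * (ennreal (\<delta>0 * l) * emeasure \<mu> U1) \<le> ennreal (1 / (\<delta>0 * l)) * ennreal (measure \<nu> UNIV)"
        using U1(3) by (intro mult_left_mono) (auto simp: em\<nu>)
      then show ?thesis using \<delta>0(1) l by (simp add: mult.assoc[symmetric] ennreal_mult[symmetric])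
    qed
    have a2: "emeasure \<mu> U2 \<le> ennreal (16 * Q ^ (s + 1) * Cw * measure \<nu> UNIV / l)"
    proof -
      have "emeasure (density \<mu> (indicator ?G)) UNIV = emeasure \<mu> ?G"
        using emeasure_density_indicator[OF mG, of UNIV] by (simp only: sets_mu Int_UNIV_right) simp
      also have "\<dots> \<le> ennreal (Cw * measure \<nu> UNIV / (l / 8))"
        using l by (intro weak_type_measure[OF \<nu> _ \<epsilon>]) auto
      finally have "ennreal (2 * Q ^ (s + 1)) * (ennreal (1 / (2 * Q ^ (s + 1))) * emeasure \<mu> U2) \<le> ennreal (2 * Q ^ (s + 1)) * ennreal (Cw * measure \<nu> UNIV / (l / 8))"
        using U2(3) by (intro mult_left_mono) (auto intro: order_trans)
      also have "\<dots> = ennreal (2 * Q ^ (s + 1) * (Cw * measure \<nu> UNIV / (l / 8)))"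
        using Cw_pos l by (intro ennreal_mult[symmetric]) auto
      also have "2 * Q ^ (s + 1) * (Cw * measure \<nu> UNIV / (l / 8)) = 16 * Q ^ (s + 1) * Cw * measure \<nu> UNIV / l" using l by simp
      also have "ennreal (2 * Q ^ (s + 1)) * (ennreal (1 / (2 * Q ^ (s + 1))) * emeasure \<mu> U2) = emeasure \<mu> U2"
        by (subst mult.assoc[symmetric], subst ennreal_mult[symmetric]) auto
      finally show ?thesis .
    qed
    have "emeasure \<mu> (V n) \<le> emeasure \<mu> (U1 \<union> U2)" using U1 U2 by (intro emeasure_mono) auto
    also have "\<dots> \<le> emeasure \<mu> U1 + emeasure \<mu> U2" using U1 U2 by (intro emeasure_subadditive) auto
    also have "\<dots> \<le> ennreal (measure \<nu> UNIV / (\<delta>0 * l)) + ennreal (16 * Q ^ (s + 1) * Cw * measure \<nu> UNIV / l)"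
      by (intro add_mono a1 a2)
    also have "\<dots> = ennreal (measure \<nu> UNIV / (\<delta>0 * l) + 16 * Q ^ (s + 1) * Cw * measure \<nu> UNIV / l)"
      using \<delta>0(1) l Cw_pos by (intro ennreal_plus[symmetric]) auto
    also have "measure \<nu> UNIV / (\<delta>0 * l) + 16 * Q ^ (s + 1) * Cw * measure \<nu> UNIV / l = Cs * measure \<nu> UNIV / l"
      using \<delta>0(1) l by (simp add: Cs_def field_simps)
    finally show ?thesis .
  qed
  moreover
  have "(SUP n. emeasure \<mu> (V n)) = emeasure \<mu> (\<Union>n. V n)"
    using inc open_V by (intro SUP_emeasure_incseq) auto
  then
  have "emeasure \<mu> {x. \<exists>r>0. l < norm (Tm \<nu> r x)} = (SUP n. emeasure \<mu> (V n))" by (simp only: VU)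
  ultimately show ?thesis by (auto intro: SUP_least)
qed

section \<open>Maximal sharp truncations\<close>

definition Ts :: "'a measure \<Rightarrow> real \<Rightarrow> 'a \<Rightarrow> 'b" where
  "Ts \<nu> r x = (\<integral>y. indicator {y. norm (x - y) > r} y *\<^sub>R K (x - y) \<partial>\<nu>)"

text \<open>Exchanges \<open>K\<close> for a continuous bounded kernel, from which measurability and
  integrability of the sharp truncations are obtained.\<close>

lemma sharp_kernel_eq:
  "r > 0 \<Longrightarrow> indicator {y. norm (x - y) > r} y *\<^sub>R K (x - y) = indicator {y. norm (x - y) > r} y *\<^sub>R kr (r / 2) (x - y)"
  using kr_eq_K[of "r/2" "x - y"] by (auto simp: indicator_def)

lemma integrable_sharp:
  assumes \<nu>: "finite_measure \<nu>" "sets \<nu> = sets borel" and r: "r > 0"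
  shows "integrable \<nu> (\<lambda>y. indicator {y. norm (x - y) > r} y *\<^sub>R K (x - y))"
  unfolding sharp_kernel_eq[OF r] using \<nu> r by (intro integrable_mult_indicator integrable_kr) auto

lemma sharp_kernel_diff:
  assumes r: "r > 0"
  shows "norm (indicator {y. norm (x - y) > r} y *\<^sub>R K (x - y) - kr r (x - y)) \<le> C0 / r ^ s * indicator (ball x (2 * r)) y"
proof -
  consider "norm (x - y) \<le> r" | "2 * r \<le> norm (x - y)" | "r < norm (x - y)" "norm (x - y) < 2 * r" by linarith
  then show ?thesis
  proof cases
    case 3
    have z: "x - y \<noteq> 0" using 3 r by auto
    have "K (x - y) - kr r (x - y) = (1 - ramp (norm (x - y) / r)) *\<^sub>R K (x - y)"
      by (simp add: kr_def scaleR_left_diff_distrib)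
    then have "norm (K (x - y) - kr r (x - y)) = \<bar>1 - ramp (norm (x - y) / r)\<bar> * norm (K (x - y))" by simp
    also have "\<dots> \<le> 1 * (C0 / norm (x - y) ^ s)"
      using ramp_bounds[of "norm (x - y) / r"] K_bound[OF z] by (intro mult_mono) auto
    also have "\<dots> \<le> C0 / r ^ s" using 3 r z C0_pos by (auto intro!: divide_left_mono power_mono mult_pos_pos)
    finally show ?thesis using 3 by (simp add: dist_norm)
  qed (use r C0_pos in \<open>auto simp: kr_eq_0 kr_eq_K\<close>)
qed

definition Cx :: real where "Cx = 2 * Cs + 2 * C0 * 10 ^ s"

text \<open>Sharp and smooth truncations at \<open>r\<close> differ by at most
  \<open>C0 / r ^ s\<close> times the \<nu>-mass of \<open>ball x (2 * r)\<close>. If this reaches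
  \<open>l / 2\<close>, growth of \<mu> on the 5-fold ball, of radius \<open>10 * r\<close>, shows
  that the maximal function of \<nu> is large at \<open>x\<close>; such points are covered
  separately.\<close>

lemma weak_type_max_sharp:
  assumes \<nu>: "finite_measure \<nu>" "sets \<nu> = sets borel" and l: "l > 0"
  shows "\<exists>U\<in>sets borel. {x \<in> ball 0 P. \<exists>r>0. l < norm (Ts \<nu> r x)} \<subseteq> U \<and> emeasure \<mu> U \<le> ennreal (Cx * measure \<nu> UNIV / l)"
proof -
  interpret finite_measure \<nu> by fact
  have [simp]: "space \<nu> = UNIV" using sets_eq_imp_space_eq[OF \<nu>(2)] by simp
  have em\<nu>: "emeasure \<nu> UNIV = ennreal (measure \<nu> UNIV)" by (simp add: emeasure_eq_measure)
  let ?c = "l / (2 * C0 * 10 ^ s)"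
  have c: "?c > 0" using l C0_pos by simp
  define V where "V = {x. \<exists>r>0. l / 2 < norm (Tm \<nu> r x)}"
  have "V = (\<Union>r\<in>{0<..}. {x. l / 2 < norm (Tm \<nu> r x)})" by (auto simp: V_def)
  then have oV: "open V" by (simp only:) (intro open_UN ballI open_Tm_superlevel[OF \<nu>], simp)
  have mV: "emeasure \<mu> V \<le> ennreal (Cs * measure \<nu> UNIV / (l / 2))"
    unfolding V_def using l by (intro weak_type_max[OF \<nu>]) auto
  define S where "S = {x \<in> ball 0 P. \<exists>R>0. ennreal ?c * emeasure \<mu> (ball x (5 * R)) \<le> emeasure \<nu> (ball x R)}"
  have "\<exists>U\<in>sets borel. S \<subseteq> U \<and> ennreal ?c * emeasure \<mu> U \<le> emeasure \<nu> UNIV"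
  proof (rule maximal_cover[OF \<nu>(2) c])
    show "bounded S" by (rule bounded_subset[OF bounded_ball[of 0 P]]) (auto simp: S_def)
  qed (auto simp: S_def)
  then obtain U where U: "U \<in> sets borel" "S \<subseteq> U" "ennreal ?c * emeasure \<mu> U \<le> emeasure \<nu> UNIV" by blast
  have mU: "emeasure \<mu> U \<le> ennreal (2 * C0 * 10 ^ s * measure \<nu> UNIV / l)"
  proof -
    have "ennreal (1 / ?c) * (ennreal ?c * emeasure \<mu> U) \<le> ennreal (1 / ?c) * ennreal (measure \<nu> UNIV)"
      using U(3) by (intro mult_left_mono) (auto simp: em\<nu>)
    also have "ennreal (1 / ?c) * (ennreal ?c * emeasure \<mu> U) = emeasure \<mu> U"
      using l C0_pos by (subst mult.assoc[symmetric], subst ennreal_mult[symmetric]) auto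
    also have "ennreal (1 / ?c) * ennreal (measure \<nu> UNIV) = ennreal (1 / ?c * measure \<nu> UNIV)"
      using l C0_pos by (intro ennreal_mult[symmetric]) auto
    finally show ?thesis by simp
  qed
  show ?thesis
  proof (intro bexI[of _ "V \<union> U"] conjI)
    show "{x \<in> ball 0 P. \<exists>r>0. l < norm (Ts \<nu> r x)} \<subseteq> V \<union> U"
    proof
      fix x assume "x \<in> {x \<in> ball 0 P. \<exists>r>0. l < norm (Ts \<nu> r x)}"
      then obtain r where x: "x \<in> ball 0 P" and r: "r > 0" and big: "l < norm (Ts \<nu> r x)" by blast
      have "norm (Ts \<nu> r x - Tm \<nu> r x) \<le> C0 / r ^ s * measure \<nu> (ball x (2 * r))"
      proof -
        have "Ts \<nu> r x - Tm \<nu> r x = (\<integral>y. indicator {y. norm (x - y) > r} y *\<^sub>R K (x - y) - kr r (x - y) \<partial>\<nu>)"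
          unfolding Ts_def Tm_def by (intro Bochner_Integration.integral_diff[symmetric] integrable_sharp integrable_kr \<nu> r)
        also have "norm \<dots> \<le> (\<integral>y. C0 / r ^ s * indicator (ball x (2 * r)) y \<partial>\<nu>)"
          using \<nu> r by (intro Bochner_Integration.integral_norm_bound_integral sharp_kernel_diff Bochner_Integration.integrable_diff integrable_sharp integrable_kr integrable_mult_right integrable_real_indicator)
            (auto simp: less_top[symmetric] emeasure_finite)
        also have "\<dots> = C0 / r ^ s * measure \<nu> (ball x (2 * r))" using \<nu>(2) by simp
        finally show ?thesis .
      qed
      then have alt: "l < norm (Tm \<nu> r x) + C0 / r ^ s * measure \<nu> (ball x (2 * r))"
        using big norm_triangle_sub[of "Ts \<nu> r x" "Tm \<nu> r x"] by linarith
      show "x \<in> V \<union> U"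
      proof (cases "l / 2 < norm (Tm \<nu> r x)")
        case True
        then show ?thesis using r by (auto simp: V_def)
      next
        case False
        then have "l / 2 \<le> C0 / r ^ s * measure \<nu> (ball x (2 * r))" using alt by linarith
        then have ge: "l * r ^ s / (2 * C0) \<le> measure \<nu> (ball x (2 * r))" using r C0_pos by (simp add: field_simps)
        have "ennreal ?c * emeasure \<mu> (ball x (5 * (2 * r))) \<le> ennreal ?c * ennreal ((5 * (2 * r)) ^ s)"
          using r by (intro mult_left_mono growth) auto
        also have "\<dots> = ennreal (?c * (5 * (2 * r)) ^ s)" using c r by (intro ennreal_mult[symmetric]) auto
        also have "?c * (5 * (2 * r)) ^ s = l * r ^ s / (2 * C0)" by (simp add: power_mult_distrib)
        also have "ennreal (l * r ^ s / (2 * C0)) \<le> emeasure \<nu> (ball x (2 * r))"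
          using ge by (simp add: emeasure_eq_measure ennreal_leI)
        finally have "x \<in> S" using x r by (auto simp: S_def intro!: exI[of _ "2 * r"])
        then show ?thesis using U by blast
      qed
    qed
    have "emeasure \<mu> (V \<union> U) \<le> emeasure \<mu> V + emeasure \<mu> U" using oV U by (intro emeasure_subadditive) auto
    also have "\<dots> \<le> ennreal (Cs * measure \<nu> UNIV / (l / 2)) + ennreal (2 * C0 * 10 ^ s * measure \<nu> UNIV / l)"
      by (intro add_mono mV mU)
    also have "\<dots> = ennreal (Cs * measure \<nu> UNIV / (l / 2) + 2 * C0 * 10 ^ s * measure \<nu> UNIV / l)"
      using Cs_pos C0_pos l by (intro ennreal_plus[symmetric]) auto
    also have "Cs * measure \<nu> UNIV / (l / 2) + 2 * C0 * 10 ^ s * measure \<nu> UNIV / l = Cx * measure \<nu> UNIV / l"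
      using l by (simp add: Cx_def field_simps)
    finally show "emeasure \<mu> (V \<union> U) \<le> ennreal (Cx * measure \<nu> UNIV / l)" .
    show "V \<union> U \<in> sets borel" using oV U by auto
  qed
qed

end

section \<open>Approximation by Lipschitz functions and differentiation\<close>

context growth_measure
begin

text \<open>\<open>S\<close> lies in the intersection of covers whose measures tend to 0, hence in a
  Borel null set, even if \<open>S\<close> itself is not Borel.\<close>

lemma AE_notin_if_small_covers:
  assumes "\<And>e. e > 0 \<Longrightarrow> \<exists>U\<in>sets borel. S \<subseteq> U \<and> emeasure \<mu> U \<le> ennreal e"
  shows "AE x in \<mu>. x \<notin> S"
proof -
  have "\<exists>U. \<forall>n::nat. U n \<in> sets borel \<and> S \<subseteq> U n \<and> emeasure \<mu> (U n) \<le> ennreal (1 / real (Suc n))"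
    using assms[of "1 / real (Suc n)" for n] by (intro choice) auto
  then obtain U where U: "\<And>n::nat. U n \<in> sets borel" "\<And>n. S \<subseteq> U n" "\<And>n. emeasure \<mu> (U n) \<le> ennreal (1 / real (Suc n))"
    by blast
  let ?N = "\<Inter>n. U n"
  have N: "?N \<in> sets borel" using U(1) by auto
  have "emeasure \<mu> ?N \<le> ennreal (1 / real (Suc n))" for n
  proof -
    have "emeasure \<mu> ?N \<le> emeasure \<mu> (U n)" using U(1) by (intro emeasure_mono) auto
    then show ?thesis using U(3)[of n] by simp
  qed
  moreover have "(\<lambda>n. ennreal (1 / real (Suc n))) \<longlonglongrightarrow> ennreal 0"
    by (intro tendsto_ennrealI) (use LIMSEQ_inverse_real_of_nat in \<open>simp add: inverse_eq_divide\<close>)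
  ultimately have "emeasure \<mu> ?N \<le> ennreal 0"
    by (intro LIMSEQ_le_const) auto
  then have "?N \<in> null_sets \<mu>" using N by auto
  moreover have "{x \<in> space \<mu>. \<not> x \<notin> S} \<subseteq> ?N" using U(2) by auto
  ultimately show ?thesis by (rule AE_I')
qed

end

text \<open>Inner regularity is applied to the restriction of \<open>M\<close> to \<open>A\<close>,
  which is finite even if \<open>M\<close> is not.\<close>

lemma inner_regular_emeasure:
  fixes M :: "'a::euclidean_space measure"
  assumes M: "sets M = sets borel" and A: "A \<in> sets borel" "emeasure M A < \<infinity>" and e: "e > 0"
  shows "\<exists>C. compact C \<and> C \<subseteq> A \<and> emeasure M (A - C) < ennreal e"
proof -
  define N where "N = density M (indicator A)"
  have sN: "sets N = sets borel" and spN: "space N = UNIV"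
    using M sets_eq_imp_space_eq[OF M] by (simp_all add: N_def)
  have emN: "emeasure N B = emeasure M (A \<inter> B)" if "B \<in> sets borel" for B
    unfolding N_def using A M that by (intro emeasure_density_indicator) auto
  have fin: "emeasure N (space N) \<noteq> \<infinity>" unfolding spN using emN[of UNIV] A(2) by simp
  have "emeasure N A = (SUP K \<in> {K. K \<subseteq> A \<and> compact K}. emeasure N K)"
    by (rule inner_regular[OF sN fin A(1)])
  then have sup: "emeasure M A = (SUP K \<in> {K. K \<subseteq> A \<and> compact K}. emeasure N K)"
    using emN[OF A(1)] by simp
  show ?thesis
  proof (cases "emeasure M A = 0")
    case True
    then show ?thesis using e by (intro exI[of _ "{}"]) auto
  next
    case False
    then have "emeasure M A - ennreal e < emeasure M A"
      using A(2) e by (intro ennreal_between) (auto simp: zero_less_iff_neq_zero)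
    then obtain C where C: "C \<subseteq> A" "compact C" "emeasure M A - ennreal e < emeasure N C"
      unfolding sup less_SUP_iff by auto
    have mC: "C \<in> sets borel" using C(2) by (simp add: borel_compact)
    have "emeasure N C = emeasure M C" using emN[OF mC] C(1) by (simp add: Int_absorb1)
    then have "emeasure M A - ennreal e < emeasure M C" using C(3) by simp
    moreover have CA: "emeasure M C \<le> emeasure M A" using C(1) A(1) M by (intro emeasure_mono) auto
    moreover have Cf: "emeasure M C < \<infinity>" using CA A(2) by (rule order.strict_trans1)
    moreover have "emeasure M (A - C) = emeasure M A - emeasure M C"
      using A C(1) Cf mC M by (intro emeasure_Diff) auto
    moreover have lt: "a < b" if "ennreal a < ennreal b" for a b using that by (metis ennreal_leI not_le)
    ultimately have "emeasure M (A - C) < ennreal e"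
      using A(2) e
      by (cases "emeasure M A"; cases "emeasure M C") (auto simp: ennreal_minus ennreal_less_iff top_unique dest!: lt)
    then show ?thesis using C by blast
  qed
qed

section \<open>Density of compactly supported Lipschitz functions in L^1\<close>

definition lipschitz_compact :: "('a::euclidean_space \<Rightarrow> 'c::euclidean_space) \<Rightarrow> bool" where
  "lipschitz_compact f \<longleftrightarrow> (\<exists>L. L-lipschitz_on UNIV f) \<and> (\<exists>r. \<forall>y. f y \<noteq> 0 \<longrightarrow> y \<in> ball 0 r)"

lemma lipschitz_compact_continuous: "lipschitz_compact f \<Longrightarrow> continuous_on UNIV f"
  unfolding lipschitz_compact_def using lipschitz_on_continuous_on by blast

lemma lipschitz_compact_measurable: "lipschitz_compact f \<Longrightarrow> f \<in> borel_measurable borel"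
  by (intro borel_measurable_continuous_onI lipschitz_compact_continuous)

lemma lipschitz_compact_bounded:
  assumes "lipschitz_compact f"
  obtains M where "M > 0" "\<And>y. norm (f y) \<le> M"
proof -
  obtain r where r: "\<And>y. f y \<noteq> 0 \<Longrightarrow> y \<in> ball 0 r" using assms by (auto simp: lipschitz_compact_def)
  have "compact (f ` cball 0 r)"
    using continuous_on_subset[OF lipschitz_compact_continuous[OF assms]] by (intro compact_continuous_image) auto
  then have "bounded (f ` cball 0 r)" by (rule compact_imp_bounded)
  then obtain M where M: "M > 0" "\<And>y. y \<in> cball 0 r \<Longrightarrow> norm (f y) \<le> M" by (auto simp: bounded_pos)
  have "norm (f y) \<le> M" for y
    using M r[of y] by (cases "f y = 0") (auto simp: less_imp_le)
  then show ?thesis using that M(1) by blast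
qed

lemma lipschitz_compact_add:
  assumes "lipschitz_compact f" "lipschitz_compact g"
  shows "lipschitz_compact (\<lambda>x. f x + g x)"
proof -
  obtain L r L' r' where *: "L-lipschitz_on UNIV f" "\<And>y. f y \<noteq> 0 \<Longrightarrow> y \<in> ball 0 r"
     "L'-lipschitz_on UNIV g" "\<And>y. g y \<noteq> 0 \<Longrightarrow> y \<in> ball 0 r'"
    using assms by (auto simp: lipschitz_compact_def)
  have "(L + L')-lipschitz_on UNIV (\<lambda>x. f x + g x)" by (rule lipschitz_on_add[OF *(1,3)])
  moreover have "f y + g y \<noteq> 0 \<longrightarrow> y \<in> ball 0 (max r r')" for y
    using *(2)[of y] *(4)[of y] by (cases "f y = 0") auto
  ultimately show ?thesis unfolding lipschitz_compact_def by blast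
qed

lemma lipschitz_compact_zero: "lipschitz_compact (\<lambda>x. 0)"
  unfolding lipschitz_compact_def by (auto intro!: exI[of _ 0] simp: lipschitz_on_def)

context growth_measure
begin

lemma lipschitz_compact_integrable:
  assumes "lipschitz_compact f" shows "integrable \<mu> f"
proof -
  obtain M where "\<And>y. norm (f y) \<le> M" using lipschitz_compact_bounded[OF assms] by blast
  moreover obtain r where "\<And>y. f y \<noteq> 0 \<Longrightarrow> y \<in> ball 0 r" using assms by (auto simp: lipschitz_compact_def)
  ultimately show ?thesis
    using lipschitz_compact_measurable[OF assms] by (intro integrable_bounded_support)
qed

text \<open>The functions \<open>g k\<close> fall linearly, with slope proportional to
  \<open>Suc k\<close>, in the distance to \<open>C\<close>. They converge to the indicator and live
  in one fixed ball, so dominated convergence applies.\<close>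

lemma compact_indicator_approx:
  fixes c :: "'c::euclidean_space"
  assumes C: "compact C" and e: "e > 0"
  shows "\<exists>g. lipschitz_compact g \<and> (\<integral>x. norm (indicator C x *\<^sub>R c - g x) \<partial>\<mu>) < e"
proof (cases "C = {}")
  case True
  then show ?thesis using lipschitz_compact_zero[where 'a='a and 'b='c] e by (intro exI[of _ "\<lambda>x. 0"]) auto
next
  case False
  obtain r where r: "r > 0" "C \<subseteq> ball 0 r"
    using compact_imp_bounded[OF C] by (metis bounded_subset_ballD)
  have [measurable]: "C \<in> sets borel" using C by (simp add: borel_compact)
  define g where "g k x = max 0 (1 - real (Suc k) * infdist x C) *\<^sub>R c" for k x
  have lc: "lipschitz_compact (g k)" for k
  proof -
    have "(real (Suc k) * norm c)-lipschitz_on UNIV (g k)"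
      unfolding lipschitz_on_def
    proof (intro conjI ballI)
      fix x y
      have d: "\<bar>infdist x C - infdist y C\<bar> \<le> dist x y"
        using infdist_triangle[of x C y] infdist_triangle[of y C x] by (simp add: dist_commute)
      have "\<bar>max 0 (1 - real (Suc k) * infdist x C) - max 0 (1 - real (Suc k) * infdist y C)\<bar> \<le> \<bar>real (Suc k) * infdist x C - real (Suc k) * infdist y C\<bar>"
        by (auto simp: max_def)
      also have "\<dots> = real (Suc k) * \<bar>infdist x C - infdist y C\<bar>"
        by (simp only: right_diff_distrib[symmetric] abs_mult)
      also have "\<dots> \<le> real (Suc k) * dist x y" using d by (intro mult_left_mono) auto
      finally have "\<bar>max 0 (1 - real (Suc k) * infdist x C) - max 0 (1 - real (Suc k) * infdist y C)\<bar> * norm c \<le> real (Suc k) * dist x y * norm c"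
        by (rule mult_right_mono) simp
      then show "dist (g k x) (g k y) \<le> real (Suc k) * norm c * dist x y"
        by (simp add: g_def dist_norm scaleR_diff_left[symmetric] mult_ac)
    qed simp
    moreover have "g k y \<noteq> 0 \<longrightarrow> y \<in> ball 0 (r + 1)" for y
    proof
      assume "g k y \<noteq> 0"
      then have "0 < 1 - real (Suc k) * infdist y C" by (auto simp: g_def max_def split: if_splits)
      then have "real (Suc k) * infdist y C < 1" by simp
      moreover have "1 * infdist y C \<le> real (Suc k) * infdist y C"
        by (intro mult_right_mono) (auto simp: infdist_nonneg)
      ultimately have "infdist y C < 1" by linarith
      moreover obtain z where "z \<in> C" "infdist y C = dist y z"
        using infdist_attains_inf[OF compact_imp_closed[OF C] False] by blast
      ultimately show "y \<in> ball 0 (r + 1)" using r norm_triangle_ineq[of z "y - z"] by (auto simp: dist_norm)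
    qed
    ultimately show ?thesis unfolding lipschitz_compact_def by blast
  qed
  have ptw: "(\<lambda>k. g k x) \<longlonglongrightarrow> indicator C x *\<^sub>R c" for x
  proof (cases "x \<in> C")
    case True
    then show ?thesis by (simp add: g_def)
  next
    case f: False
    then have d: "infdist x C > 0" using infdist_pos_not_in_closed[OF compact_imp_closed[OF C] False] by blast
    obtain n where n: "1 / real (Suc n) < infdist x C" using nat_approx_posE[OF d] by blast
    have "g k x = 0" if "k \<ge> n" for k
    proof -
      have "1 = real (Suc n) * (1 / real (Suc n))" by simp
      also have "\<dots> \<le> real (Suc k) * infdist x C" using n that d by (intro mult_mono) auto
      finally show ?thesis by (simp add: g_def)
    qed
    then have "eventually (\<lambda>k. g k x = indicator C x *\<^sub>R c) sequentially"
      using f by (auto simp: eventually_sequentially intro!: exI[of _ n])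
    then show ?thesis by (rule tendsto_eventually)
  qed
  have "(\<lambda>k. \<integral>x. norm (indicator C x *\<^sub>R c - g k x) \<partial>\<mu>) \<longlonglongrightarrow> (\<integral>x. 0 \<partial>\<mu>)"
  proof (rule integral_dominated_convergence[where w="\<lambda>x. 2 * norm c * indicator (ball 0 (r + 1)) x"])
    have [measurable]: "g k \<in> borel_measurable borel" for k by (rule lipschitz_compact_measurable[OF lc])
    show "(\<lambda>x. norm (indicator C x *\<^sub>R c - g k x)) \<in> borel_measurable \<mu>" for k by measurable
    show "integrable \<mu> (\<lambda>x. 2 * norm c * indicator (ball 0 (r + 1)) x)"
      using emeasure_bounded_finite[of "ball 0 (r + 1)"] by simp
    have "(\<lambda>k. norm (indicator C x *\<^sub>R c - g k x)) \<longlonglongrightarrow> norm (indicator C x *\<^sub>R c - indicator C x *\<^sub>R c)" for x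
      by (intro tendsto_intros ptw)
    then show "AE x in \<mu>. (\<lambda>k. norm (indicator C x *\<^sub>R c - g k x)) \<longlonglongrightarrow> 0" by simp
    show "AE x in \<mu>. norm (norm (indicator C x *\<^sub>R c - g k x)) \<le> 2 * norm c * indicator (ball 0 (r + 1)) x" for k
    proof (intro AE_I2)
      fix x
      show "norm (norm (indicator C x *\<^sub>R c - g k x)) \<le> 2 * norm c * indicator (ball 0 (r + 1)) x"
      proof (cases "g k x = 0 \<and> x \<notin> C")
        case f: False
        have "x \<in> ball 0 (r + 1)" if "g k x \<noteq> 0"
        proof -
          have "0 < 1 - real (Suc k) * infdist x C" using that by (auto simp: g_def max_def split: if_splits)
          then have "real (Suc k) * infdist x C < 1" by simp
          moreover have "1 * infdist x C \<le> real (Suc k) * infdist x C"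
            by (intro mult_right_mono) (auto simp: infdist_nonneg)
          ultimately have "infdist x C < 1" by linarith
          moreover obtain z where "z \<in> C" "infdist x C = dist x z"
            using infdist_attains_inf[OF compact_imp_closed[OF C] False] by blast
          ultimately show ?thesis using r norm_triangle_ineq[of z "x - z"] by (auto simp: dist_norm)
        qed
        then have x: "x \<in> ball 0 (r + 1)" using f r by auto
        have "max 0 (1 - real (Suc k) * infdist x C) \<le> 1" using infdist_nonneg[of x C] by (simp add: max_def)
        then have "norm (g k x) \<le> 1 * norm c" unfolding g_def norm_scaleR by (intro mult_right_mono) auto
        moreover have "norm (indicator C x *\<^sub>R c) \<le> norm c" by (auto simp: indicator_def)
        ultimately show ?thesis using x norm_triangle_ineq4[of "indicator C x *\<^sub>R c" "g k x"] by simp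
      qed auto
    qed
  qed simp
  then have "eventually (\<lambda>k. (\<integral>x. norm (indicator C x *\<^sub>R c - g k x) \<partial>\<mu>) < e) sequentially"
    using e by (intro order_tendstoD(2)) auto
  then obtain k where "(\<integral>x. norm (indicator C x *\<^sub>R c - g k x) \<partial>\<mu>) < e" by (auto simp: eventually_sequentially)
  then show ?thesis using lc by blast
qed

lemma lipschitz_compact_dense:
  fixes f :: "'a \<Rightarrow> 'c::euclidean_space"
  assumes "integrable \<mu> f" "e > 0"
  shows "\<exists>g. lipschitz_compact g \<and> (\<integral>x. norm (f x - g x) \<partial>\<mu>) < e"
  using assms
proof (induction arbitrary: e rule: integrable_induct)
  case (base A c)
  then have A: "A \<in> sets borel" "emeasure \<mu> A < \<infinity>" by auto
  have "e / 2 / (norm c + 1) > 0" using base by (intro divide_pos_pos) (auto intro: add_nonneg_pos)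
  from inner_regular_emeasure[OF sets_mu A this] obtain C where C: "compact C" "C \<subseteq> A" "emeasure \<mu> (A - C) < ennreal (e / 2 / (norm c + 1))" by blast
  have [measurable]: "C \<in> sets borel" using C(1) by (simp add: borel_compact)
  have [measurable]: "A \<in> sets borel" by fact
  obtain g where g: "lipschitz_compact g" "(\<integral>x. norm (indicator C x *\<^sub>R c - g x) \<partial>\<mu>) < e / 2"
    using compact_indicator_approx[OF C(1), of "e / 2" c] base by auto
  have finAC: "emeasure \<mu> (A - C) < \<infinity>" using C(3) by (rule order.strict_trans) simp
  have mAC: "measure \<mu> (A - C) \<le> e / 2 / (norm c + 1)"
    using C(3) base by (simp add: Sigma_Algebra.measure_def enn2real_leI less_imp_le)
  have finC: "emeasure \<mu> C < \<infinity>" using compact_imp_bounded[OF C(1)] by (rule emeasure_bounded_finite)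
  have ig: "integrable \<mu> g" by (rule lipschitz_compact_integrable[OF g(1)])
  have iC: "integrable \<mu> (\<lambda>x. indicator C x *\<^sub>R c)" "integrable \<mu> (\<lambda>x. indicator A x *\<^sub>R c)"
    using finC A by (auto simp: integrable_indicator_iff)
  have "(\<integral>x. norm (indicator A x *\<^sub>R c - g x) \<partial>\<mu>) \<le> (\<integral>x. norm c * indicator (A - C) x + norm (indicator C x *\<^sub>R c - g x) \<partial>\<mu>)"
  proof (intro integral_mono)
    show "integrable \<mu> (\<lambda>x. norm (indicator A x *\<^sub>R c - g x))" using iC ig by auto
    show "integrable \<mu> (\<lambda>x. norm c * indicator (A - C) x + norm (indicator C x *\<^sub>R c - g x))"
      using iC ig finAC by (intro Bochner_Integration.integrable_add integrable_norm Bochner_Integration.integrable_diff) auto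
    fix x
    show "norm (indicator A x *\<^sub>R c - g x) \<le> norm c * indicator (A - C) x + norm (indicator C x *\<^sub>R c - g x)"
      using C(2) norm_triangle_ineq4[of c "g x"] by (cases "x \<in> A"; cases "x \<in> C") auto
  qed
  also have "\<dots> = norm c * measure \<mu> (A - C) + (\<integral>x. norm (indicator C x *\<^sub>R c - g x) \<partial>\<mu>)"
    using iC ig finAC by (subst Bochner_Integration.integral_add) auto
  also have "norm c * measure \<mu> (A - C) \<le> (norm c + 1) * (e / 2 / (norm c + 1))"
    using mAC base by (intro mult_mono) auto
  also have "(norm c + 1) * (e / 2 / (norm c + 1)) = e / 2"
  proof -
    have "norm c + 1 \<noteq> 0" using norm_ge_zero[of c] by linarith
    moreover have "k * (e / 2 / k) = e / 2" if "k \<noteq> 0" for k using that by simp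
    ultimately show ?thesis by blast
  qed
  finally show ?case using g by (intro exI[of _ g]) simp
next
  case (add f1 f2)
  obtain g1 where g1: "lipschitz_compact g1" "(\<integral>x. norm (f1 x - g1 x) \<partial>\<mu>) < e / 2"
    using add.IH(1)[of "e/2"] add.prems by auto
  obtain g2 where g2: "lipschitz_compact g2" "(\<integral>x. norm (f2 x - g2 x) \<partial>\<mu>) < e / 2"
    using add.IH(2)[of "e/2"] add.prems by auto
  have i: "integrable \<mu> g1" "integrable \<mu> g2" using g1 g2 lipschitz_compact_integrable by auto
  have "(\<integral>x. norm (f1 x + f2 x - (g1 x + g2 x)) \<partial>\<mu>) \<le> (\<integral>x. norm (f1 x - g1 x) + norm (f2 x - g2 x) \<partial>\<mu>)"
    using add.hyps i by (intro integral_mono Bochner_Integration.integrable_add integrable_norm Bochner_Integration.integrable_diff norm_diff_triangle_ineq)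
  also have "\<dots> < e"
    using add.hyps i g1 g2 by (subst Bochner_Integration.integral_add) auto
  finally show ?case using lipschitz_compact_add[OF g1(1) g2(1)] by blast
next
  case (lim f sq)
  have "(\<lambda>i. \<integral>x. norm (f x - sq i x) \<partial>\<mu>) \<longlonglongrightarrow> (\<integral>x. 0 \<partial>\<mu>)"
  proof (rule integral_dominated_convergence[where w="\<lambda>x. 3 * norm (f x)"])
    show "AE x in \<mu>. (\<lambda>i. norm (f x - sq i x)) \<longlonglongrightarrow> 0"
    proof (intro AE_I2)
      fix x
      have "(\<lambda>i. norm (f x - sq i x)) \<longlonglongrightarrow> norm (f x - f x)"
        using lim.hyps by (intro tendsto_intros) auto
      then show "(\<lambda>i. norm (f x - sq i x)) \<longlonglongrightarrow> 0" by simp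
    qed
    show "AE x in \<mu>. norm (norm (f x - sq i x)) \<le> 3 * norm (f x)" for i
    proof (intro AE_I2)
      fix x assume "x \<in> space \<mu>"
      then have "norm (sq i x) \<le> 2 * norm (f x)" using lim.hyps by auto
      then show "norm (norm (f x - sq i x)) \<le> 3 * norm (f x)" using norm_triangle_ineq4[of "f x" "sq i x"] by simp
    qed
  qed (use lim.hyps in \<open>auto intro!: borel_measurable_integrable\<close>)
  then have "eventually (\<lambda>i. (\<integral>x. norm (f x - sq i x) \<partial>\<mu>) < e / 2) sequentially"
    using lim.prems by (intro order_tendstoD(2)) auto
  then obtain i where i: "(\<integral>x. norm (f x - sq i x) \<partial>\<mu>) < e / 2" by (auto simp: eventually_sequentially)
  obtain g where g: "lipschitz_compact g" "(\<integral>x. norm (sq i x - g x) \<partial>\<mu>) < e / 2"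
    using lim.IH[of "e/2" i] lim.prems by auto
  have ig: "integrable \<mu> g" by (rule lipschitz_compact_integrable[OF g(1)])
  have "(\<integral>x. norm (f x - g x) \<partial>\<mu>) \<le> (\<integral>x. norm (f x - sq i x) + norm (sq i x - g x) \<partial>\<mu>)"
    using lim.hyps ig by (intro integral_mono Bochner_Integration.integrable_add integrable_norm Bochner_Integration.integrable_diff)
      (auto intro: norm_triangle_le_diff simp: norm_diff_triangle_ineq order_trans[OF _ norm_triangle_ineq])
  also have "\<dots> < e"
    using lim.hyps ig g i by (subst Bochner_Integration.integral_add) auto
  finally show ?case using g by blast
qed

text \<open>The maximal inequality comes with the 5-fold ball on the side of \<mu>, and this
  normalisation is kept; at doubling radii it is comparable to an average. The proof is by density:
  for a Lipschitz \<open>g\<close> the oscillation is explicit, and the points where the maximal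
  function of \<open>h - g\<close>, or \<open>h - g\<close> itself, reaches \<eta>/3 are covered by
  a small set.\<close>

lemma lebesgue_differentiation:
  fixes h :: "'a \<Rightarrow> 'c::euclidean_space"
  assumes h: "integrable \<mu> h"
  shows "AE x in \<mu>. \<forall>\<eta>>0. \<exists>R0>0. \<forall>R. 0 < R \<longrightarrow> R < R0 \<longrightarrow>
    (\<integral>y. indicator (ball x R) y * norm (h y - h x) \<partial>\<mu>) \<le> \<eta> * measure \<mu> (ball x (5 * R))"
proof -
  have [measurable]: "h \<in> borel_measurable borel" using borel_measurable_integrable[OF h] by simp
  define P where "P \<eta> x \<longleftrightarrow> (\<exists>R0>0. \<forall>R. 0 < R \<longrightarrow> R < R0 \<longrightarrow>
    (\<integral>y. indicator (ball x R) y * norm (h y - h x) \<partial>\<mu>) \<le> \<eta> * measure \<mu> (ball x (5 * R)))" for \<eta> x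
  have *: "AE x in \<mu>. x \<notin> {x \<in> ball 0 p. \<not> P \<eta> x}" if \<eta>: "\<eta> > 0" for p \<eta>
  proof (rule AE_notin_if_small_covers)
    fix e :: real assume e: "e > 0"
    define e' where "e' = e * \<eta> / 6"
    have e': "e' > 0" using e \<eta> by (simp add: e'_def)
    obtain g where g: "lipschitz_compact g" "(\<integral>x. norm (h x - g x) \<partial>\<mu>) < e'"
      using lipschitz_compact_dense[OF h e'] by blast
    have ig: "integrable \<mu> g" by (rule lipschitz_compact_integrable[OF g(1)])
    have [measurable]: "g \<in> borel_measurable borel" by (rule lipschitz_compact_measurable[OF g(1)])
    obtain L where L: "L-lipschitz_on UNIV g" using g(1) by (auto simp: lipschitz_compact_def)
    have L0: "L \<ge> 0" using L by (rule lipschitz_on_nonneg)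
    define \<sigma> where "\<sigma> = density \<mu> (\<lambda>y. ennreal (norm (h y - g y)))"
    have s\<sigma>: "sets \<sigma> = sets borel" by (simp add: \<sigma>_def)
    have i\<sigma>: "integrable \<mu> (\<lambda>y. norm (h y - g y))" using h ig by auto
    have em\<sigma>: "emeasure \<sigma> B = ennreal (\<integral>y. indicator B y * norm (h y - g y) \<partial>\<mu>)" if "B \<in> sets borel" for B
    proof -
      have "emeasure \<sigma> B = (\<integral>\<^sup>+y. ennreal (indicator B y * norm (h y - g y)) \<partial>\<mu>)"
        unfolding \<sigma>_def using that by (subst emeasure_density) (auto intro!: nn_integral_cong simp: indicator_def)
      also have "\<dots> = ennreal (\<integral>y. indicator B y * norm (h y - g y) \<partial>\<mu>)"
        using integrable_mult_indicator[OF _ i\<sigma>, of B] that by (intro nn_integral_eq_integral) auto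
      finally show ?thesis .
    qed
    have em\<sigma>U: "emeasure \<sigma> UNIV \<le> ennreal e'" using em\<sigma>[of UNIV] g(2) by (simp add: ennreal_leI)
    define S1 where "S1 = {x \<in> ball 0 p. \<exists>R>0. ennreal (\<eta> / 3) * emeasure \<mu> (ball x (5 * R)) \<le> emeasure \<sigma> (ball x R)}"
    have "\<exists>U\<in>sets borel. S1 \<subseteq> U \<and> ennreal (\<eta> / 3) * emeasure \<mu> U \<le> emeasure \<sigma> UNIV"
    proof (rule maximal_cover[OF s\<sigma>])
      show "bounded S1" by (rule bounded_subset[OF bounded_ball[of 0 p]]) (auto simp: S1_def)
    qed (use \<eta> in \<open>auto simp: S1_def\<close>)
    then obtain U1 where U1: "U1 \<in> sets borel" "S1 \<subseteq> U1" "ennreal (\<eta> / 3) * emeasure \<mu> U1 \<le> emeasure \<sigma> UNIV" by blast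
    have c: "ennreal (3 / \<eta>) * ennreal e' = ennreal (e / 2)"
      using \<eta> e by (simp add: ennreal_mult[symmetric] e'_def)
    have mU1: "emeasure \<mu> U1 \<le> ennreal (e / 2)"
    proof -
      have "ennreal (3 / \<eta>) * (ennreal (\<eta> / 3) * emeasure \<mu> U1) \<le> ennreal (3 / \<eta>) * ennreal e'"
        using U1(3) em\<sigma>U by (intro mult_left_mono) auto
      moreover have "ennreal (3 / \<eta>) * (ennreal (\<eta> / 3) * emeasure \<mu> U1) = emeasure \<mu> U1"
        using \<eta> by (simp add: mult.assoc[symmetric] ennreal_mult[symmetric])
      ultimately show ?thesis using c by simp
    qed
    let ?U2 = "{x \<in> space \<mu>. \<eta> / 3 \<le> norm (h x - g x)}"
    have mU2: "emeasure \<mu> ?U2 \<le> ennreal (e / 2)"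
    proof -
      have "emeasure \<mu> ?U2 \<le> ennreal (1 / (\<eta> / 3) * (\<integral>x. norm (h x - g x) \<partial>\<mu>))"
        using \<eta> by (intro integral_Markov_inequality i\<sigma>) auto
      also have "\<dots> \<le> ennreal (1 / (\<eta> / 3) * e')" using g(2) \<eta> by (intro ennreal_leI mult_left_mono) auto
      finally show ?thesis using \<eta> by (simp add: e'_def)
    qed
    show "\<exists>U\<in>sets borel. {x \<in> ball 0 p. \<not> P \<eta> x} \<subseteq> U \<and> emeasure \<mu> U \<le> ennreal e"
    proof (intro bexI[of _ "U1 \<union> ?U2"] conjI subsetI)
      fix x assume x: "x \<in> {x \<in> ball 0 p. \<not> P \<eta> x}"
      show "x \<in> U1 \<union> ?U2"
      proof (rule ccontr)
        assume nx: "x \<notin> U1 \<union> ?U2"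
        have nS: "x \<notin> S1" using nx U1 by blast
        have d: "norm (g x - h x) \<le> \<eta> / 3" using nx by (simp add: norm_minus_commute)
        have "P \<eta> x"
          unfolding P_def
        \<comment> \<open>Below this radius \<open>g\<close> oscillates by at most \<eta>/3; adding
          1 keeps the quotient meaningful for \<open>L = 0\<close>.\<close>
        proof (intro exI[of _ "\<eta> / 3 / (L + 1)"] conjI allI impI)
          show "0 < \<eta> / 3 / (L + 1)" using \<eta> L0 by simp
          fix R assume R: "0 < R" "R < \<eta> / 3 / (L + 1)"
          let ?i = "indicator (ball x R) :: 'a \<Rightarrow> real"
          let ?m = "measure \<mu> (ball x R)" and ?m5 = "measure \<mu> (ball x (5 * R))"
          have fin: "emeasure \<mu> (ball x R) < \<infinity>" by (rule emeasure_bounded_finite) simp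
          have "R * (L + 1) < \<eta> / 3" using R L0 by (simp add: field_simps)
          then have LR: "L * R \<le> \<eta> / 3" using R by (simp add: algebra_simps)
          have mm: "?m \<le> ?m5" using R by (intro measure_ball_mono) auto
          have i1: "integrable \<mu> (\<lambda>y. ?i y * norm (h y - g y))"
            using integrable_mult_indicator[OF _ i\<sigma>, of "ball x R"] by simp
          have "(\<integral>y. ?i y * norm (h y - h x) \<partial>\<mu>) \<le> (\<integral>y. ?i y * norm (h y - g y) + (\<eta> / 3 + \<eta> / 3) * ?i y \<partial>\<mu>)"
          proof (rule Bochner_Integration.integral_mono')
            show "integrable \<mu> (\<lambda>y. ?i y * norm (h y - g y) + (\<eta> / 3 + \<eta> / 3) * ?i y)"
              using i1 fin by auto
            fix y
            show "?i y * norm (h y - h x) \<le> ?i y * norm (h y - g y) + (\<eta> / 3 + \<eta> / 3) * ?i y"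
            proof (cases "y \<in> ball x R")
              case True
              have "norm (g y - g x) \<le> L * dist y x" using lipschitz_onD[OF L, of y x] by (simp add: dist_norm)
              also have "\<dots> \<le> L * R" using True L0 by (intro mult_left_mono) (auto simp: dist_commute)
              finally have "norm (g y - g x) \<le> \<eta> / 3" using LR by simp
              moreover have "norm (h y - h x) \<le> norm (h y - g y) + norm (g y - g x) + norm (g x - h x)"
                using norm_triangle_ineq[of "h y - g y" "g y - g x"] norm_triangle_ineq[of "h y - g x" "g x - h x"] by simp
              ultimately show ?thesis using True d by simp
            qed simp
            show "0 \<le> ?i y * norm (h y - g y) + (\<eta> / 3 + \<eta> / 3) * ?i y" using \<eta> by simp
          qed
          also have "\<dots> = (\<integral>y. ?i y * norm (h y - g y) \<partial>\<mu>) + (\<eta> / 3 + \<eta> / 3) * ?m"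
            using i1 fin by (subst Bochner_Integration.integral_add) auto
          also have "(\<integral>y. ?i y * norm (h y - g y) \<partial>\<mu>) \<le> \<eta> / 3 * ?m5"
          proof -
            have "emeasure \<sigma> (ball x R) < ennreal (\<eta> / 3) * emeasure \<mu> (ball x (5 * R))"
              using nS x R by (auto simp: S1_def not_le)
            then have "ennreal (\<integral>y. ?i y * norm (h y - g y) \<partial>\<mu>) < ennreal (\<eta> / 3 * ?m5)"
              using \<eta> by (simp add: em\<sigma> emeasure_ball_eq ennreal_mult[symmetric])
            from less_imp_le[OF this] show ?thesis using \<eta> by (subst (asm) ennreal_le_iff) auto
          qed
          also have "\<eta> / 3 * ?m5 + (\<eta> / 3 + \<eta> / 3) * ?m \<le> \<eta> / 3 * ?m5 + (\<eta> / 3 + \<eta> / 3) * ?m5"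
            using mm \<eta> by (intro add_left_mono mult_left_mono) auto
          finally show "(\<integral>y. ?i y * norm (h y - h x) \<partial>\<mu>) \<le> \<eta> * ?m5" by (simp add: algebra_simps)
        qed
        then show False using x by simp
      qed
    next
      have "emeasure \<mu> (U1 \<union> ?U2) \<le> emeasure \<mu> U1 + emeasure \<mu> ?U2" using U1 by (intro emeasure_subadditive) auto
      also have "\<dots> \<le> ennreal (e / 2) + ennreal (e / 2)" by (intro add_mono mU1 mU2)
      also have "\<dots> = ennreal e" using e by (simp flip: ennreal_plus)
      finally show "emeasure \<mu> (U1 \<union> ?U2) \<le> ennreal e" .
      show "U1 \<union> ?U2 \<in> sets borel"
      proof (rule sets.Un[OF U1(1)])
        show "?U2 \<in> sets borel" by simp
      qed
    qed
  qed
  have "AE x in \<mu>. \<forall>n k::nat. x \<notin> {x \<in> ball 0 (real n). \<not> P (1 / real (Suc k)) x}"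
    unfolding AE_all_countable using * by auto
  then show ?thesis
  proof eventually_elim
    case (elim x)
    show ?case
    proof (intro allI impI)
      fix \<eta> :: real assume \<eta>: "\<eta> > 0"
      obtain n where n: "norm x < real n" using reals_Archimedean2 by blast
      obtain k where k: "1 / real (Suc k) < \<eta>" using nat_approx_posE[OF \<eta>] by blast
      have "P (1 / real (Suc k)) x" using elim n by auto
      then obtain R0 where R0: "R0 > 0" "\<And>R. 0 < R \<Longrightarrow> R < R0 \<Longrightarrow>
         (\<integral>y. indicator (ball x R) y * norm (h y - h x) \<partial>\<mu>) \<le> 1 / real (Suc k) * measure \<mu> (ball x (5 * R))"
        unfolding P_def by blast
      have "1 / real (Suc k) * measure \<mu> (ball x (5 * R)) \<le> \<eta> * measure \<mu> (ball x (5 * R))" for R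
        using k by (intro mult_right_mono) auto
      then show "\<exists>R0>0. \<forall>R. 0 < R \<longrightarrow> R < R0 \<longrightarrow>
         (\<integral>y. indicator (ball x R) y * norm (h y - h x) \<partial>\<mu>) \<le> \<eta> * measure \<mu> (ball x (5 * R))"
        using R0 order_trans by blast
    qed
  qed
qed

end

section \<open>Weak limits\<close>

context growth_measure
begin

lemma integrable_test_function_mult:
  fixes w :: "'a \<Rightarrow> 'c::euclidean_space" and g :: "'a \<Rightarrow> real"
  assumes [measurable]: "w \<in> borel_measurable borel" "g \<in> borel_measurable borel"
    and w: "integrable \<mu> (\<lambda>y. (norm (w y))\<^sup>2)"
    and g: "\<And>y. \<bar>g y\<bar> \<le> M" "\<And>y. g y \<noteq> 0 \<Longrightarrow> y \<in> ball 0 r"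
  shows "integrable \<mu> (\<lambda>y. g y *\<^sub>R w y)"
proof (rule Bochner_Integration.integrable_bound)
  show "integrable \<mu> (\<lambda>y. M\<^sup>2 * indicator (ball 0 r) y + (norm (w y))\<^sup>2)"
    using w emeasure_bounded_finite[of "ball 0 r"] by (intro Bochner_Integration.integrable_add) auto
  show "AE y in \<mu>. norm (g y *\<^sub>R w y) \<le> norm (M\<^sup>2 * indicator (ball 0 r) y + (norm (w y))\<^sup>2)"
  proof (intro AE_I2)
    fix y
    show "norm (g y *\<^sub>R w y) \<le> norm (M\<^sup>2 * indicator (ball 0 r) y + (norm (w y))\<^sup>2)"
    proof (cases "g y = 0")
      case False
      have "(\<bar>g y\<bar>)\<^sup>2 \<le> M\<^sup>2" using g(1)[of y] by (intro power_mono) auto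
      moreover have "2 * \<bar>g y\<bar> * norm (w y) \<le> (\<bar>g y\<bar>)\<^sup>2 + (norm (w y))\<^sup>2"
        by (rule sum_squares_bound)
      moreover have "0 \<le> \<bar>g y\<bar> * norm (w y)" by simp
      ultimately have "\<bar>g y\<bar> * norm (w y) \<le> M\<^sup>2 + (norm (w y))\<^sup>2" by linarith
      then show ?thesis using g(2)[OF False] by simp
    qed simp
  qed
qed simp

text \<open>
  A bounded sequence in \<open>L\<^sup>2\<close> has a weak limit point, described here only through closed balls that
  eventually contain the averages against a test function. The limit is the element of minimal norm
  in the weakly closed convex hulls of the tails, so that no duality for \<open>L\<^sup>2\<close> is needed.
\<close>

lemma weak_limit_point:
  fixes u :: "nat \<Rightarrow> 'a \<Rightarrow> 'c::euclidean_space"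
  assumes mu [measurable]: "\<And>i. u i \<in> borel_measurable borel"
    and iu: "\<And>i. integrable \<mu> (\<lambda>y. (norm (u i y))\<^sup>2)"
    and B: "\<And>i. (\<integral>y. (norm (u i y))\<^sup>2 \<partial>\<mu>) \<le> B"
  shows "\<exists>h. h \<in> borel_measurable borel \<and> (\<forall>r. integrable \<mu> (\<lambda>y. indicator (ball 0 r) y *\<^sub>R h y)) \<and>
    (\<forall>g M r v b n. g \<in> borel_measurable borel \<longrightarrow> (\<forall>y. \<bar>g y\<bar> \<le> M) \<longrightarrow> (\<forall>y. g y \<noteq> 0 \<longrightarrow> y \<in> ball 0 r) \<longrightarrow>
       (\<forall>i\<ge>n. norm ((\<integral>y. g y *\<^sub>R u i y \<partial>\<mu>) - v) \<le> b) \<longrightarrow> norm ((\<integral>y. g y *\<^sub>R h y \<partial>\<mu>) - v) \<le> b)"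
proof -
  define test where "test g \<longleftrightarrow> g \<in> borel_measurable borel \<and> (\<exists>M. \<forall>y. \<bar>g y\<bar> \<le> M) \<and> (\<exists>r. \<forall>y. g y \<noteq> 0 \<longrightarrow> y \<in> ball 0 r)"
    for g :: "'a \<Rightarrow> real"
  define L where "L = {w :: 'a \<Rightarrow> 'c. w \<in> borel_measurable borel \<and> integrable \<mu> (\<lambda>y. (norm (w y))\<^sup>2)}"
  have itest: "integrable \<mu> (\<lambda>y. g y *\<^sub>R w y)" if "test g" "w \<in> L" for g w
    using that integrable_test_function_mult[of w g] by (auto simp: test_def L_def)
  define N where "N w = (\<integral>y. (norm (w y))\<^sup>2 \<partial>\<mu>)" for w :: "'a \<Rightarrow> 'c"
  \<comment> \<open>A weakly closed convex set containing the tail from \<open>n\<close> on: every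
    closed ball that holds all tail averages against \<open>g\<close> must hold the average of
    \<open>w\<close>. The conditions survive midpoints because balls are convex.\<close>
  define C where "C n = {w \<in> L. \<forall>g v b. test g \<longrightarrow> (\<forall>i\<ge>n. norm ((\<integral>y. g y *\<^sub>R u i y \<partial>\<mu>) - v) \<le> b) \<longrightarrow>
       norm ((\<integral>y. g y *\<^sub>R w y \<partial>\<mu>) - v) \<le> b}" for n
  have CL: "C n \<subseteq> L" for n by (auto simp: C_def)
  have uC: "u n \<in> C n" for n using mu iu by (auto simp: C_def L_def)
  have Cdec: "C n' \<subseteq> C n" if "n \<le> n'" for n n' using that by (auto simp: C_def)
  have N0: "N w \<ge> 0" for w by (simp add: N_def)
  have L_lin: "(\<lambda>y. a *\<^sub>R w y + b *\<^sub>R w' y) \<in> L" if w: "w \<in> L" "w' \<in> L" for w w' and a b :: real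
  proof -
    have [measurable]: "w \<in> borel_measurable borel" "w' \<in> borel_measurable borel" using w by (auto simp: L_def)
    have "integrable \<mu> (\<lambda>y. (norm (a *\<^sub>R w y + b *\<^sub>R w' y))\<^sup>2)"
    proof (rule Bochner_Integration.integrable_bound)
      show "integrable \<mu> (\<lambda>y. 2 * a\<^sup>2 * (norm (w y))\<^sup>2 + 2 * b\<^sup>2 * (norm (w' y))\<^sup>2)"
        using w by (auto simp: L_def)
      show "AE y in \<mu>. norm ((norm (a *\<^sub>R w y + b *\<^sub>R w' y))\<^sup>2) \<le> norm (2 * a\<^sup>2 * (norm (w y))\<^sup>2 + 2 * b\<^sup>2 * (norm (w' y))\<^sup>2)"
      proof (intro AE_I2)
        fix y
        have "(norm (a *\<^sub>R w y + b *\<^sub>R w' y))\<^sup>2 \<le> (\<bar>a\<bar> * norm (w y) + \<bar>b\<bar> * norm (w' y))\<^sup>2"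
          using norm_triangle_ineq[of "a *\<^sub>R w y" "b *\<^sub>R w' y"] by (intro power_mono) auto
        also have "\<dots> \<le> 2 * (\<bar>a\<bar> * norm (w y))\<^sup>2 + 2 * (\<bar>b\<bar> * norm (w' y))\<^sup>2"
          using sum_squares_bound[of "\<bar>a\<bar> * norm (w y)" "\<bar>b\<bar> * norm (w' y)"] by (simp add: power2_sum)
        finally show "norm ((norm (a *\<^sub>R w y + b *\<^sub>R w' y))\<^sup>2) \<le> norm (2 * a\<^sup>2 * (norm (w y))\<^sup>2 + 2 * b\<^sup>2 * (norm (w' y))\<^sup>2)"
          by (simp add: power_mult_distrib)
      qed
    qed simp
    then show ?thesis by (simp add: L_def)
  qed
  have mid: "(\<lambda>y. (1/2) *\<^sub>R w y + (1/2) *\<^sub>R w' y) \<in> C n" if w: "w \<in> C n" "w' \<in> C n" for w w' n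
    unfolding C_def
  proof (intro CollectI conjI allI impI)
    show "(\<lambda>y. (1/2) *\<^sub>R w y + (1/2) *\<^sub>R w' y) \<in> L" using w CL by (intro L_lin) auto
    fix g v b assume g: "test g" and le: "\<forall>i\<ge>n. norm ((\<integral>y. g y *\<^sub>R u i y \<partial>\<mu>) - v) \<le> b"
    have i: "integrable \<mu> (\<lambda>y. g y *\<^sub>R w y)" "integrable \<mu> (\<lambda>y. g y *\<^sub>R w' y)" using w CL g by (auto intro!: itest)
    have a: "norm ((\<integral>y. g y *\<^sub>R w y \<partial>\<mu>) - v) \<le> b" "norm ((\<integral>y. g y *\<^sub>R w' y \<partial>\<mu>) - v) \<le> b"
      using w g le by (auto simp: C_def)
    have "(\<integral>y. g y *\<^sub>R ((1/2) *\<^sub>R w y + (1/2) *\<^sub>R w' y) \<partial>\<mu>) = (\<integral>y. (1/2) *\<^sub>R (g y *\<^sub>R w y) + (1/2) *\<^sub>R (g y *\<^sub>R w' y) \<partial>\<mu>)"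
      by (intro Bochner_Integration.integral_cong) (auto simp: algebra_simps)
    also have "\<dots> = (1/2) *\<^sub>R (\<integral>y. g y *\<^sub>R w y \<partial>\<mu>) + (1/2) *\<^sub>R (\<integral>y. g y *\<^sub>R w' y \<partial>\<mu>)"
      by (simp only: Bochner_Integration.integral_add[OF integrable_scaleR_right integrable_scaleR_right, OF i] integral_scaleR_right)
    finally have "(\<integral>y. g y *\<^sub>R ((1/2) *\<^sub>R w y + (1/2) *\<^sub>R w' y) \<partial>\<mu>) - v =
       (1/2) *\<^sub>R ((\<integral>y. g y *\<^sub>R w y \<partial>\<mu>) - v) + (1/2) *\<^sub>R ((\<integral>y. g y *\<^sub>R w' y \<partial>\<mu>) - v)"
      by (simp add: algebra_simps flip: scaleR_add_left)
    also have "norm \<dots> \<le> 1/2 * b + 1/2 * b"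
      using a by (intro norm_triangle_le) (auto intro!: add_mono)
    finally show "norm ((\<integral>y. g y *\<^sub>R ((1/2) *\<^sub>R w y + (1/2) *\<^sub>R w' y) \<partial>\<mu>) - v) \<le> b" by simp
  qed
  \<comment> \<open>Parallelogram law: two near-minimisers of \<open>N\<close> on a set closed under
    midpoints are close to each other.\<close>
  have par: "N (\<lambda>y. w y - w' y) = 2 * N w + 2 * N w' - 4 * N (\<lambda>y. (1/2) *\<^sub>R w y + (1/2) *\<^sub>R w' y)"
    if w: "w \<in> L" "w' \<in> L" for w w'
  proof -
    have i: "integrable \<mu> (\<lambda>y. (norm (w y))\<^sup>2)" "integrable \<mu> (\<lambda>y. (norm (w' y))\<^sup>2)"
       "integrable \<mu> (\<lambda>y. (norm ((1/2) *\<^sub>R w y + (1/2) *\<^sub>R w' y))\<^sup>2)"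
      using w L_lin[OF w, of "1/2" "1/2"] by (auto simp: L_def)
    have "(norm (a - b))\<^sup>2 = 2 * (norm a)\<^sup>2 + 2 * (norm b)\<^sup>2 - 4 * (norm ((1/2) *\<^sub>R a + (1/2) *\<^sub>R b))\<^sup>2" for a b :: 'c
      unfolding power2_norm_eq_inner by (simp add: algebra_simps inner_commute)
    then have "N (\<lambda>y. w y - w' y) = (\<integral>y. 2 * (norm (w y))\<^sup>2 + 2 * (norm (w' y))\<^sup>2 - 4 * (norm ((1/2) *\<^sub>R w y + (1/2) *\<^sub>R w' y))\<^sup>2 \<partial>\<mu>)"
      unfolding N_def by simp
    then show ?thesis unfolding N_def using i by simp
  qed
  \<comment> \<open>The minimal energies increase with \<open>n\<close>, as the sets shrink, and
    \<open>B\<close> bounds them; their convergence makes near-minimisers for different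
    \<open>n\<close> Cauchy.\<close>
  define m where "m n = Inf (N ` C n)" for n
  have bdd: "bdd_below (N ` C n)" for n using N0 by (auto simp: bdd_below_def)
  have mle: "m n \<le> N w" if "w \<in> C n" for n w unfolding m_def using that bdd by (intro cINF_lower) auto
  have mmono: "m n \<le> m n'" if "n \<le> n'" for n n'
    unfolding m_def using Cdec[OF that] uC[of n'] bdd by (intro cInf_superset_mono) auto
  have mB: "m n \<le> B" for n using mle[OF uC[of n]] B[of n] by (simp add: N_def)
  have "\<exists>h. \<forall>n. h n \<in> C n \<and> N (h n) < m n + 1 / real (Suc n)"
  proof (intro choice allI)
    fix n
    have "Inf (N ` C n) < m n + 1 / real (Suc n)" by (simp add: m_def)
    then show "\<exists>h. h \<in> C n \<and> N h < m n + 1 / real (Suc n)"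
      using uC[of n] bdd by (subst (asm) cInf_less_iff) auto
  qed
  then obtain h where h: "\<And>n. h n \<in> C n" "\<And>n. N (h n) < m n + 1 / real (Suc n)" by blast
  have hL: "h n \<in> L" for n using h(1) CL by blast
  have diff: "N (\<lambda>y. h n' y - h n y) \<le> 2 * (m n' - m n) + 4 / real (Suc n)" if "n \<le> n'" for n n'
  proof -
    have "h n' \<in> C n" using h(1) Cdec[OF that] by blast
    from mle[OF mid[OF this h(1)]] have "m n \<le> N (\<lambda>y. (1/2) *\<^sub>R h n' y + (1/2) *\<^sub>R h n y)" .
    moreover have "1 / real (Suc n') \<le> 1 / real (Suc n)" using that by (intro divide_left_mono) auto
    ultimately show ?thesis using par[OF hL hL, of n' n] h(2)[of n] h(2)[of n'] by simp
  qed
  have "\<exists>k. \<forall>n'\<ge>k. \<forall>n\<ge>k. n \<le> n' \<longrightarrow> N (\<lambda>y. h n' y - h n y) \<le> e" if e: "e > 0" for e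
  proof -
    have "convergent m"
    proof (rule Bseq_mono_convergent)
      have "norm (m n) \<le> \<bar>B\<bar> + \<bar>m 0\<bar>" for n using mmono[of 0 n] mB[of n] by simp
      then show "Bseq m" by (rule BseqI')
    qed (use mmono in blast)
    then have "Cauchy m" by (rule convergent_Cauchy)
    then obtain k1 where k1: "\<And>n n'. n \<ge> k1 \<Longrightarrow> n' \<ge> k1 \<Longrightarrow> \<bar>m n' - m n\<bar> < e / 4"
      using e unfolding Cauchy_def dist_real_def by (metis zero_less_divide_iff zero_less_numeral)
    obtain k2 where k2: "1 / real (Suc k2) < e / 8" using nat_approx_posE[of "e / 8"] e by auto
    have "N (\<lambda>y. h n' y - h n y) \<le> e" if "n' \<ge> max k1 k2" "n \<ge> max k1 k2" "n \<le> n'" for n n'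
    proof -
      have "1 / real (Suc n) \<le> 1 / real (Suc k2)" using that by (intro divide_left_mono) auto
      then have a: "1 / real (Suc n) \<le> e / 8" using k2 by linarith
      have b: "m n' - m n \<le> e / 4" using k1[of n n'] abs_ge_self[of "m n' - m n"] that by auto
      have "N (\<lambda>y. h n' y - h n y) \<le> 2 * (m n' - m n) + 4 * (1 / real (Suc n))" using diff[OF that(3)] by simp
      also have "\<dots> \<le> 2 * (e / 4) + 4 * (e / 8)" by (intro add_mono mult_left_mono a b) auto
      also have "\<dots> = e" by simp
      finally show ?thesis .
    qed
    then show ?thesis by blast
  qed
  then have "\<exists>k. \<forall>j::nat. \<forall>n'\<ge>k j. \<forall>n\<ge>k j. n \<le> n' \<longrightarrow> N (\<lambda>y. h n' y - h n y) \<le> (1/4) ^ j"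
    by (intro choice allI) auto
  then obtain k where k: "\<And>j n n'. n' \<ge> k j \<Longrightarrow> n \<ge> k j \<Longrightarrow> n \<le> n' \<Longrightarrow> N (\<lambda>y. h n' y - h n y) \<le> (1/4) ^ j"
    by blast
  \<comment> \<open>The sum makes \<open>r\<close> increasing, at least \<open>j\<close>, and at
    least every \<open>k i\<close> with \<open>i \<le> j\<close>; consecutive terms of
    \<open>w\<close> then differ by at most \<open>(1/4) ^ j\<close> in squared norm.\<close>
  define r where "r j = (\<Sum>i\<le>j. k i) + j" for j
  have rk: "k j \<le> r j" "j \<le> r j" "r j \<le> r (Suc j)" for j
    by (auto simp: r_def intro: order_trans[OF member_le_sum[of j "{..j}" k]])
  define w where "w j = h (r j)" for j
  have wL: "w j \<in> L" for j using hL by (simp add: w_def)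
  have [measurable]: "w j \<in> borel_measurable borel" for j using wL by (simp add: L_def)
  have Nw: "N (\<lambda>y. w (Suc j) y - w j y) \<le> (1/4) ^ j" for j
    unfolding w_def using rk[of j] by (intro k) auto
  have dL: "(\<lambda>y. w (Suc j) y - w j y) \<in> L" for j
    using L_lin[OF wL wL, of 1 "Suc j" "-1" j] by simp
  \<comment> \<open>L^2 smallness becomes summable local L^1 smallness through
    \<open>t \<le> (1/2) ^ j + 2 ^ j * t ^ 2\<close>, so that the limit exists pointwise almost
    everywhere with a majorant integrable on balls.\<close>
  have dint: "(\<integral>\<^sup>+y. indicator (ball 0 p) y * ennreal (norm (w (Suc j) y - w j y)) \<partial>\<mu>) \<le> ennreal ((1/2) ^ j * (measure \<mu> (ball 0 p) + 1))" for j p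
  proof -
    let ?t = "\<lambda>y. norm (w (Suc j) y - w j y)"
    have it: "integrable \<mu> (\<lambda>y. (?t y)\<^sup>2)" using dL[of j] by (simp add: L_def)
    have "(\<integral>\<^sup>+y. indicator (ball 0 p) y * ennreal (?t y) \<partial>\<mu>) \<le> (\<integral>\<^sup>+y. ennreal ((1/2) ^ j) * indicator (ball 0 p) y + ennreal (2 ^ j * (?t y)\<^sup>2) \<partial>\<mu>)"
    proof (intro nn_integral_mono)
      fix y
      have "0 \<le> (2 ^ j * ?t y - 1)\<^sup>2" by simp
      then have "2 * (2 ^ j * ?t y) \<le> (2 ^ j * ?t y)\<^sup>2 + 1" by (simp add: power2_diff)
      moreover have "0 \<le> 2 ^ j * ?t y" by simp
      ultimately have "2 ^ j * ?t y \<le> (2 ^ j * ?t y)\<^sup>2 + 1" by linarith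
      then have "(1/2) ^ j * (2 ^ j * ?t y) \<le> (1/2) ^ j * ((2 ^ j * ?t y)\<^sup>2 + 1)" by (intro mult_left_mono) auto
      then have "?t y \<le> (1/2) ^ j + 2 ^ j * (?t y)\<^sup>2"
        by (simp add: power2_eq_square power_divide field_simps)
      then have "ennreal (?t y) \<le> ennreal ((1/2) ^ j) + ennreal (2 ^ j * (?t y)\<^sup>2)"
        by (simp add: ennreal_plus[symmetric] ennreal_leI del: ennreal_plus)
      then show "indicator (ball 0 p) y * ennreal (?t y) \<le> ennreal ((1/2) ^ j) * indicator (ball 0 p) y + ennreal (2 ^ j * (?t y)\<^sup>2)"
        by (auto simp: indicator_def)
    qed
    also have "\<dots> = ennreal ((1/2) ^ j) * emeasure \<mu> (ball 0 p) + (\<integral>\<^sup>+y. ennreal (2 ^ j * (?t y)\<^sup>2) \<partial>\<mu>)"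
      by (subst nn_integral_add) (auto simp: nn_integral_cmult)
    also have "(\<integral>\<^sup>+y. ennreal (2 ^ j * (?t y)\<^sup>2) \<partial>\<mu>) = ennreal (2 ^ j * N (\<lambda>y. w (Suc j) y - w j y))"
      unfolding N_def using it by (subst nn_integral_eq_integral) auto
    also have "\<dots> \<le> ennreal (2 ^ j * (1/4) ^ j)" using Nw by (intro ennreal_leI mult_left_mono) auto
    also have "(2::real) ^ j * (1/4) ^ j = (1/2) ^ j" by (simp flip: power_mult_distrib)
    also have "ennreal ((1/2) ^ j) * emeasure \<mu> (ball 0 p) + ennreal ((1/2) ^ j) = ennreal ((1/2) ^ j * (measure \<mu> (ball 0 p) + 1))"
      by (simp add: emeasure_ball_eq ennreal_mult[symmetric] ennreal_plus[symmetric] distrib_left del: ennreal_plus)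
    finally show ?thesis by (simp add: add_left_mono)
  qed
  define S where "S y = (\<Sum>j. ennreal (norm (w (Suc j) y - w j y)))" for y
  have [measurable]: "S \<in> borel_measurable borel" unfolding S_def[abs_def] by measurable
  have Sint: "(\<integral>\<^sup>+y. indicator (ball 0 p) y * S y \<partial>\<mu>) < \<infinity>" for p
  proof -
    have "(\<integral>\<^sup>+y. indicator (ball 0 p) y * S y \<partial>\<mu>) = (\<Sum>j. (\<integral>\<^sup>+y. indicator (ball 0 p) y * ennreal (norm (w (Suc j) y - w j y)) \<partial>\<mu>))"
      unfolding S_def by (simp add: ennreal_suminf_cmult[symmetric] nn_integral_suminf del: ennreal_suminf_cmult)
    also have "\<dots> \<le> (\<Sum>j. ennreal ((1/2) ^ j * (measure \<mu> (ball 0 p) + 1)))"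
      by (intro suminf_le dint) auto
    also have "\<dots> = ennreal (2 * (measure \<mu> (ball 0 p) + 1))"
      using half_sums by (intro suminf_ennreal_eq sums_mult2) auto
    finally show ?thesis by (simp add: le_less_trans)
  qed
  have AES: "AE y in \<mu>. S y < \<infinity>"
  proof -
    have "AE y in \<mu>. indicator (ball 0 (real p)) y * S y \<noteq> \<infinity>" for p :: nat
      using Sint[of "real p"] by (intro nn_integral_noteq_infinite) auto
    then have "AE y in \<mu>. \<forall>p::nat. indicator (ball 0 (real p)) y * S y \<noteq> \<infinity>" by (subst AE_all_countable) auto
    then show ?thesis
    proof eventually_elim
      case (elim y)
      obtain p where "norm y < real p" using reals_Archimedean2 by blast
      then show ?case using elim[rule_format, of p] by (simp add: less_top)
    qed
  qed
  define hl where "hl y = lim (\<lambda>j. w j y)" for y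
  have mhl [measurable]: "hl \<in> borel_measurable borel" unfolding hl_def[abs_def] by measurable
  have conv: "(\<lambda>j. w j y) \<longlonglongrightarrow> hl y \<and> (\<forall>j. ennreal (norm (w j y)) \<le> ennreal (norm (w 0 y)) + S y)" if "S y < \<infinity>" for y
  proof -
    have "summable (\<lambda>j. norm (w (Suc j) y - w j y))"
      using that unfolding S_def by (intro summable_suminf_not_top) auto
    then have "summable (\<lambda>j. w (Suc j) y - w j y)" by (rule summable_norm_cancel)
    then have "convergent (\<lambda>n. \<Sum>j<n. w (Suc j) y - w j y)" by (simp add: summable_iff_convergent)
    moreover have tel: "(\<Sum>j<n. w (Suc j) y - w j y) = w n y - w 0 y" for n by (rule sum_lessThan_telescope)
    ultimately have "convergent (\<lambda>n. w n y - w 0 y)" by simp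
    then have "convergent (\<lambda>n. (w n y - w 0 y) + w 0 y)" by (intro convergent_add convergent_const)
    then have "convergent (\<lambda>n. w n y)" by simp
    then have "(\<lambda>j. w j y) \<longlonglongrightarrow> hl y" unfolding hl_def by (simp add: convergent_LIMSEQ_iff)
    moreover have "ennreal (norm (w j y)) \<le> ennreal (norm (w 0 y)) + S y" for j
    proof -
      have "norm (w j y) \<le> norm (w 0 y) + norm (w j y - w 0 y)" by (metis add.commute norm_triangle_sub)
      also have "norm (w j y - w 0 y) \<le> (\<Sum>i<j. norm (w (Suc i) y - w i y))"
        unfolding tel[symmetric] by (rule norm_sum)
      finally have "ennreal (norm (w j y)) \<le> ennreal (norm (w 0 y)) + (\<Sum>i<j. ennreal (norm (w (Suc i) y - w i y)))"
        by (simp add: sum_nonneg ennreal_plus[symmetric] ennreal_leI del: ennreal_plus)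
      also have "\<dots> \<le> ennreal (norm (w 0 y)) + S y" unfolding S_def by (intro add_left_mono sum_le_suminf) auto
      finally show ?thesis .
    qed
    ultimately show ?thesis by blast
  qed
  define D where "D y = norm (w 0 y) + enn2real (S y)" for y
  have [measurable]: "D \<in> borel_measurable borel" unfolding D_def[abs_def] by measurable
  have AED: "AE y in \<mu>. (\<lambda>j. w j y) \<longlonglongrightarrow> hl y \<and> (\<forall>j. norm (w j y) \<le> D y)"
    using AES
  proof eventually_elim
    case (elim y)
    have "norm (w j y) \<le> D y" for j
    proof -
      have "ennreal (norm (w j y)) \<le> ennreal (D y)"
        using conv[OF elim] elim unfolding D_def by (simp add: ennreal_enn2real_if less_top)
      then show ?thesis by (subst (asm) ennreal_le_iff) (auto simp: D_def)
    qed
    then show ?case using conv[OF elim] by blast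
  qed
  have iD: "integrable \<mu> (\<lambda>y. indicator (ball 0 p) y * D y)" for p
  proof -
    have "test (indicator (ball 0 p))"
      unfolding test_def
    proof (intro conjI)
      show "\<exists>M. \<forall>y. \<bar>indicator (ball (0::'a) p) y\<bar> \<le> (M::real)" by (rule exI[of _ 1]) (auto simp: indicator_def)
      show "\<exists>r. \<forall>y. indicator (ball (0::'a) p) y \<noteq> (0::real) \<longrightarrow> y \<in> ball 0 r" by (rule exI[of _ p]) (auto simp: indicator_def)
    qed simp
    from integrable_norm[OF itest[OF this wL[of 0]]] have "integrable \<mu> (\<lambda>y. indicator (ball 0 p) y * norm (w 0 y))" by simp
    moreover have "integrable \<mu> (\<lambda>y. indicator (ball 0 p) y * enn2real (S y))"
    proof (rule integrableI_bounded)
      have "(\<integral>\<^sup>+y. ennreal (norm (indicator (ball 0 p) y * enn2real (S y))) \<partial>\<mu>) \<le> (\<integral>\<^sup>+y. indicator (ball 0 p) y * S y \<partial>\<mu>)"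
        by (intro nn_integral_mono) (auto simp: indicator_def ennreal_enn2real_if)
      then show "(\<integral>\<^sup>+y. ennreal (norm (indicator (ball 0 p) y * enn2real (S y))) \<partial>\<mu>) < \<infinity>"
        using Sint[of p] by (rule le_less_trans)
    qed simp
    ultimately show ?thesis by (simp add: D_def distrib_left)
  qed
  show ?thesis
  proof (intro exI[of _ hl] conjI allI impI mhl)
    fix p
    show "integrable \<mu> (\<lambda>y. indicator (ball 0 p) y *\<^sub>R hl y)"
    proof (rule Bochner_Integration.integrable_bound[OF iD[of p]])
      show "AE y in \<mu>. norm (indicator (ball 0 p) y *\<^sub>R hl y) \<le> norm (indicator (ball 0 p) y * D y)"
        using AED
      proof eventually_elim
        case (elim y)
        have "norm (hl y) \<le> D y"
          using elim by (intro LIMSEQ_le_const2[OF tendsto_norm]) auto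
        then show ?case by (auto simp: indicator_def)
      qed
    qed simp
  next
    fix g M p v b n
    assume g: "g \<in> borel_measurable borel" "\<forall>y. \<bar>g y\<bar> \<le> M" "\<forall>y. g y \<noteq> 0 \<longrightarrow> y \<in> ball 0 p"
      and le: "\<forall>i\<ge>n. norm ((\<integral>y. g y *\<^sub>R u i y \<partial>\<mu>) - v) \<le> b"
    note [measurable] = g(1)
    have tg: "test g" using g by (auto simp: test_def)
    have lim: "(\<lambda>j. \<integral>y. g y *\<^sub>R w j y \<partial>\<mu>) \<longlonglongrightarrow> (\<integral>y. g y *\<^sub>R hl y \<partial>\<mu>)"
    proof (rule integral_dominated_convergence[where w="\<lambda>y. M * (indicator (ball 0 p) y * D y)"])
      show "integrable \<mu> (\<lambda>y. M * (indicator (ball 0 p) y * D y))" using iD by simp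
      show "AE y in \<mu>. (\<lambda>j. g y *\<^sub>R w j y) \<longlonglongrightarrow> g y *\<^sub>R hl y"
        using AED by eventually_elim (auto intro!: tendsto_intros)
      show "AE y in \<mu>. norm (g y *\<^sub>R w j y) \<le> M * (indicator (ball 0 p) y * D y)" for j
        using AED
      proof eventually_elim
        case (elim y)
        show ?case
        proof (cases "g y = 0")
          case True
          have "M \<ge> 0" using g(2) by (meson abs_ge_zero order_trans)
          moreover have "D y \<ge> 0" by (simp add: D_def)
          ultimately show ?thesis using True by simp
        next
          case False
          have "\<bar>g y\<bar> * norm (w j y) \<le> M * D y" using elim g(2) by (intro mult_mono) (auto intro: order_trans[OF abs_ge_zero])
          then show ?thesis using False g(3) by simp
        qed
      qed
    qed auto
    have "norm ((\<integral>y. g y *\<^sub>R w j y \<partial>\<mu>) - v) \<le> b" if "j \<ge> n" for j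
    proof -
      have "w j \<in> C n" unfolding w_def using h(1)[of "r j"] Cdec[of n "r j"] rk(2)[of j] that by auto
      then show ?thesis using tg le by (auto simp: C_def)
    qed
    moreover have "(\<lambda>j. norm ((\<integral>y. g y *\<^sub>R w j y \<partial>\<mu>) - v)) \<longlonglongrightarrow> norm ((\<integral>y. g y *\<^sub>R hl y \<partial>\<mu>) - v)"
      by (intro tendsto_intros lim)
    ultimately show "norm ((\<integral>y. g y *\<^sub>R hl y \<partial>\<mu>) - v) \<le> b"
      by (intro LIMSEQ_le_const2) auto
  qed
qed

end

section \<open>Convergence of smooth truncations\<close>

text \<open>For a non-integrable \<open>f\<close> the left side is 0 by convention, so estimates may
  start before integrability is discussed.\<close>

lemma norm_integral_le_nn_integral: "ennreal (norm (\<integral>x. f x \<partial>M)) \<le> (\<integral>\<^sup>+x. ennreal (norm (f x)) \<partial>M)"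
  for f :: "'a \<Rightarrow> 'b::{banach, second_countable_topology}"
  by (cases "integrable M f") (auto intro: integral_norm_bound_ennreal simp: not_integrable_integral_eq)

text \<open>
  Between consecutive doubling scales the masses \<open>m\<close> decay geometrically, so the increments of \<open>u\<close>
  there are summable with a uniform tail.
\<close>

lemma scale_sequence_convergent:
  fixes u :: "nat \<Rightarrow> 'b::banach" and m :: "nat \<Rightarrow> real"
  assumes d0: "(\<lambda>i. u (Suc i) - u i) \<longlonglongrightarrow> 0" and c: "c \<ge> 0"
    and d: "\<And>i. norm (u (Suc (Suc i)) - u (Suc i)) \<le> c * Q ^ (Suc i * s) * m i"
    and m: "\<And>i. m i \<le> (1/Q) ^ (i * s)"
    and h: "\<And>e. e > 0 \<Longrightarrow> \<exists>N. \<forall>i\<ge>N. m i \<le> Q ^ (s + 1) * m (Suc i) \<longrightarrow> norm (u (Suc i) - h) \<le> e"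
  shows "convergent u"
proof -
  define doub where "doub i \<longleftrightarrow> m i \<le> Q ^ (s + 1) * m (Suc i)" for i
  define c' where "c' = c * Q ^ (s + 1)"
  have c': "c' \<ge> 0" using c by (simp add: c'_def)
  have mdec: "m (l + n) \<le> (1 / Q ^ (s + 1)) ^ n * m l" if "\<And>j. l \<le> j \<Longrightarrow> j < l + n \<Longrightarrow> \<not> doub j" for l n
    using that
  proof (induction n)
    case (Suc n)
    have "m (l + Suc n) \<le> 1 / Q ^ (s + 1) * m (l + n)"
      using Suc.prems[of "l + n"] by (simp add: doub_def not_le field_simps)
    also have "\<dots> \<le> 1 / Q ^ (s + 1) * ((1 / Q ^ (s + 1)) ^ n * m l)"
      using Suc by (intro mult_left_mono) auto
    finally show ?case by simp
  qed simp
  \<comment> \<open>After \<open>l\<close>, a run of \<open>n\<close> non-doubling steps shrinks the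
    mass by \<open>Q ^ ((s + 1) * n)\<close>, whereas the kernel grows by
    \<open>Q ^ (s * n)\<close>; the surplus \<open>(1/Q) ^ n\<close> is uniform in
    \<open>l\<close>.\<close>
  have ddec: "norm (u (Suc (Suc (l + n))) - u (Suc (l + n))) \<le> c' * (1/Q) ^ n" if "\<And>j. l \<le> j \<Longrightarrow> j < l + n \<Longrightarrow> \<not> doub j" for l n
  proof -
    have "norm (u (Suc (Suc (l + n))) - u (Suc (l + n))) \<le> c * Q ^ (Suc (l + n) * s) * m (l + n)" by (rule d)
    also have "\<dots> \<le> c * Q ^ (Suc (l + n) * s) * ((1 / Q ^ (s + 1)) ^ n * (1/Q) ^ (l * s))"
      using c by (intro mult_left_mono order_trans[OF mdec[OF that]] m) auto
    also have "\<dots> = c * Q ^ s * (1/Q) ^ n"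
    proof -
      have e1: "Q ^ (Suc (l + n) * s) = Q ^ s * Q ^ (l * s) * Q ^ (n * s)"
        by (simp only: mult_Suc add_mult_distrib power_add mult.assoc)
      have "(1 / Q ^ (s + 1)) ^ n = (1/Q) ^ ((s + 1) * n)" by (simp only: power_mult power_one_over)
      also have "(s + 1) * n = n * s + n" by simp
      finally have e2: "(1 / Q ^ (s + 1)) ^ n = (1/Q) ^ (n * s) * (1/Q) ^ n" by (simp only: power_add)
      have e3: "Q ^ k * (1/Q) ^ k = 1" for k by (simp flip: power_mult_distrib)
      have "c * Q ^ (Suc (l + n) * s) * ((1 / Q ^ (s + 1)) ^ n * (1/Q) ^ (l * s)) =
        c * Q ^ s * (1/Q) ^ n * (Q ^ (l * s) * (1/Q) ^ (l * s)) * (Q ^ (n * s) * (1/Q) ^ (n * s))"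
        unfolding e1 e2 by (simp only: mult_ac)
      then show ?thesis by (simp only: e3 mult_1_right)
    qed
    also have "\<dots> \<le> c' * (1/Q) ^ n"
      unfolding c'_def using c by (intro mult_right_mono mult_left_mono power_increasing) auto
    finally show ?thesis .
  qed
  \<comment> \<open>The run may be arbitrarily long. Its first \<open>P\<close> increments are small
    because all increments tend to 0, and the others are bounded by a geometric tail;
    \<open>P\<close> is fixed before \<open>N\<close>.\<close>
  have gap: "\<exists>N. \<forall>l\<ge>N. \<forall>n. (\<forall>j. l \<le> j \<longrightarrow> j < l + n \<longrightarrow> \<not> doub j) \<longrightarrow> norm (u (Suc (l + n)) - u (Suc l)) \<le> e" if e: "e > 0" for e
  proof -
    have "(\<lambda>P. 2 * c' * (1/Q) ^ P) \<longlonglongrightarrow> 2 * c' * 0" by (intro tendsto_intros LIMSEQ_realpow_zero) auto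
    then have "eventually (\<lambda>P. 2 * c' * (1/Q) ^ P < e / 2) sequentially"
      using e by (intro order_tendstoD(2)) auto
    then obtain P where P: "2 * c' * (1/Q) ^ P < e / 2" by (auto simp: eventually_sequentially)
    have "e / (2 * real (Suc P)) > 0" using e by simp
    then obtain N where N: "\<And>i. i \<ge> N \<Longrightarrow> norm (u (Suc i) - u i) < e / (2 * real (Suc P))"
      using LIMSEQ_D[OF d0] by force
    have "norm (u (Suc (l + n)) - u (Suc l)) \<le> e" if l: "l \<ge> N" and nd: "\<forall>j. l \<le> j \<longrightarrow> j < l + n \<longrightarrow> \<not> doub j" for l n
    proof -
      have "u (Suc (l + n)) - u (Suc l) = (\<Sum>i<n. u (Suc (Suc (l + i))) - u (Suc (l + i)))"
        using sum_lessThan_telescope[of "\<lambda>i. u (Suc (l + i))" n] by simp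
      also have "norm \<dots> \<le> (\<Sum>i<n. norm (u (Suc (Suc (l + i))) - u (Suc (l + i))))" by (rule norm_sum)
      also have "\<dots> \<le> (\<Sum>i<n. (if i < P then e / (2 * real (Suc P)) else 0) + (if i < P then 0 else c' * (1/Q) ^ i))"
      proof (intro sum_mono)
        fix i assume i: "i \<in> {..<n}"
        show "norm (u (Suc (Suc (l + i))) - u (Suc (l + i))) \<le> (if i < P then e / (2 * real (Suc P)) else 0) + (if i < P then 0 else c' * (1/Q) ^ i)"
          using N[of "Suc (l + i)"] l ddec[of l i] nd i by (auto intro: less_imp_le)
      qed
      also have "\<dots> = (\<Sum>i<n. if i < P then e / (2 * real (Suc P)) else 0) + (\<Sum>i<n. if i < P then 0 else c' * (1/Q) ^ i)"
        by (rule sum.distrib)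
      also have "(\<Sum>i<n. if i < P then e / (2 * real (Suc P)) else 0) \<le> e / 2"
      proof -
        have "(\<Sum>i<n. if i < P then e / (2 * real (Suc P)) else 0) = (\<Sum>i\<in>{i\<in>{..<n}. i < P}. e / (2 * real (Suc P)))"
          by (rule sum.inter_filter[symmetric]) simp
        also have "\<dots> \<le> real P * (e / (2 * real (Suc P)))"
        proof -
          have "card {i\<in>{..<n}. i < P} \<le> card {..<P}" by (intro card_mono) auto
          then have "real (card {i\<in>{..<n}. i < P}) \<le> real P" by simp
          then show ?thesis using e by (simp only: sum_constant) (intro mult_right_mono; simp)
        qed
        also have "\<dots> \<le> real (Suc P) * (e / (2 * real (Suc P)))" using e by (intro mult_right_mono) auto
        also have "\<dots> = e / 2" by (simp add: field_simps)
        finally show ?thesis .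
      qed
      also have "(\<Sum>i<n. if i < P then 0 else c' * (1/Q) ^ i) \<le> e / 2"
      proof -
        have "(\<Sum>i<n. if i < P then 0 else c' * (1/Q) ^ i) = (\<Sum>i\<in>{P..<n}. c' * (1/Q) ^ i)"
          by (intro sum.mono_neutral_cong_right) auto
        also have "\<dots> = c' * (\<Sum>i\<in>{P..<n}. (1/Q) ^ i)" by (simp add: sum_distrib_left)
        also have "(\<Sum>i\<in>{P..<n}. (1/Q) ^ i) = (\<Sum>i<n - P. (1/Q) ^ (P + i))"
          by (rule sum.reindex_bij_witness[of _ "\<lambda>i. P + i" "\<lambda>i. i - P"]) auto
        also have "\<dots> = (1/Q) ^ P * (\<Sum>i<n - P. (1/Q) ^ i)" by (simp add: power_add sum_distrib_left)
        finally have eq: "(\<Sum>i<n. if i < P then 0 else c' * (1/Q) ^ i) = c' * ((1/Q) ^ P * (\<Sum>i<n - P. (1/Q) ^ i))" .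
        have "(\<Sum>i<n - P. (1/Q) ^ i) \<le> (\<Sum>i. (1/Q) ^ i)" by (intro sum_le_suminf summable_geometric) auto
        also have "(\<Sum>i. (1/Q) ^ i) \<le> 2" by (subst suminf_geometric) auto
        finally have "c' * ((1/Q) ^ P * (\<Sum>i<n - P. (1/Q) ^ i)) \<le> c' * ((1/Q) ^ P * 2)"
          using c' by (intro mult_left_mono) auto
        then show ?thesis unfolding eq using P by simp
      qed
      finally show ?thesis by simp
    qed
    then show ?thesis by blast
  qed
  show ?thesis
  proof (cases "\<forall>N. \<exists>i\<ge>N. doub i")
    case True
    have "u \<longlonglongrightarrow> h"
    proof (rule LIMSEQ_I)
      fix e :: real assume e: "e > 0"
      obtain N1 where N1: "\<And>l n. l \<ge> N1 \<Longrightarrow> (\<forall>j. l \<le> j \<longrightarrow> j < l + n \<longrightarrow> \<not> doub j) \<Longrightarrow> norm (u (Suc (l + n)) - u (Suc l)) \<le> e / 4"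
        using gap[of "e / 4"] e by auto
      obtain N2 where N2: "\<And>i. i \<ge> N2 \<Longrightarrow> doub i \<Longrightarrow> norm (u (Suc i) - h) \<le> e / 4"
        using h[of "e / 4"] e by (auto simp: doub_def)
      obtain N3 where N3: "\<And>i. i \<ge> N3 \<Longrightarrow> norm (u (Suc i) - u i) < e / 4"
        using LIMSEQ_D[OF d0, of "e / 4"] e by auto
      obtain i0 where i0: "i0 \<ge> max N1 (max N2 N3)" "doub i0" using True by blast
      show "\<exists>no. \<forall>n\<ge>no. norm (u n - h) < e"
      proof (intro exI[of _ "i0 + 2"] allI impI)
        fix k assume k: "k \<ge> i0 + 2"
        \<comment> \<open>The last doubling index up to \<open>k\<close>. At \<open>Suc l\<close>
          the sequence is near \<open>h\<close>, and between \<open>Suc l\<close> and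
          \<open>k\<close> no index is doubling; since that run starts at \<open>Suc l\<close>, the
          increment to \<open>Suc (Suc l)\<close> is bridged separately.\<close>
        define l where "l = (GREATEST i. i \<le> k \<and> doub i)"
        have ex: "i0 \<le> k \<and> doub i0" using k i0 by simp
        have l: "l \<le> k \<and> doub l" unfolding l_def by (rule GreatestI_nat[where P="\<lambda>i. i \<le> k \<and> doub i" and k=i0 and b=k]) (use ex in auto)
        have lge: "i0 \<le> l" unfolding l_def by (rule Greatest_le_nat[where P="\<lambda>i. i \<le> k \<and> doub i" and k=i0 and b=k]) (use ex in auto)
        have nd: "\<not> doub j" if "l < j" "j \<le> k" for j
        proof
          assume dj: "doub j"
          have "j \<le> l" unfolding l_def by (rule Greatest_le_nat[where P="\<lambda>i. i \<le> k \<and> doub i" and k=j and b=k]) (use that dj in auto)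
          then show False using that by simp
        qed
        have a: "norm (u (Suc l) - h) \<le> e / 4" using N2[of l] l lge i0 by auto
        have b: "norm (u (Suc (Suc l)) - u (Suc l)) \<le> e / 4" using N3[of "Suc l"] lge i0 by (auto intro: less_imp_le)
        show "norm (u k - h) < e"
        proof (cases "k \<le> Suc l")
          case True
          then have "k = l \<or> k = Suc l" using l by auto
          then show ?thesis
          proof
            assume "k = Suc l" then show ?thesis using a e by simp
          next
            assume kl: "k = l"
            have "norm (u (Suc l) - u l) < e / 4" using N3[of l] lge i0 by auto
            then have "norm (u l - h) \<le> e / 4 + e / 4"
              using norm_triangle_ineq[of "u l - u (Suc l)" "u (Suc l) - h"] a by (simp add: norm_minus_commute)
            then show ?thesis using kl e by simp
          qed
        next
          case False
          define n where "n = k - Suc (Suc l)"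
          have n: "k = Suc (Suc l + n)" using False by (simp add: n_def)
          have "norm (u (Suc (Suc l + n)) - u (Suc (Suc l))) \<le> e / 4"
            using lge i0 nd n by (intro N1) auto
          moreover have "norm (u k - h) \<le> norm (u k - u (Suc (Suc l))) + norm (u (Suc (Suc l)) - u (Suc l)) + norm (u (Suc l) - h)"
            using norm_triangle_ineq[of "u k - u (Suc (Suc l))" "u (Suc (Suc l)) - u (Suc l)"]
              norm_triangle_ineq[of "u k - u (Suc l)" "u (Suc l) - h"] by simp
          ultimately show ?thesis using a b e n by simp
        qed
      qed
    qed
    then show ?thesis by (auto simp: convergent_def)
  next
    \<comment> \<open>From some index on no scale is doubling. Then \<open>h\<close> gives no
      information, but the whole tail is a single run and the sequence is Cauchy.\<close>
    case False
    then obtain N0 where N0: "\<And>i. i \<ge> N0 \<Longrightarrow> \<not> doub i" by blast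
    have "Cauchy u"
    proof (rule CauchyI')
      fix e :: real assume e: "e > 0"
      obtain N1 where N1: "\<And>l n. l \<ge> N1 \<Longrightarrow> (\<forall>j. l \<le> j \<longrightarrow> j < l + n \<longrightarrow> \<not> doub j) \<Longrightarrow> norm (u (Suc (l + n)) - u (Suc l)) \<le> e / 2"
        using gap[of "e / 2"] e by auto
      show "\<exists>M. \<forall>a\<ge>M. \<forall>b>a. dist (u a) (u b) < e"
      proof (intro exI[of _ "Suc (max N0 N1)"] allI impI)
        fix a b :: nat assume "a \<ge> Suc (max N0 N1)" "b > a"
        then obtain l n where "a = Suc l" "b = Suc (l + n)" "l \<ge> max N0 N1"
          by (metis Suc_le_D Suc_le_mono less_imp_add_positive add_Suc)
        then show "dist (u a) (u b) < e" using N1[of l n] N0 e by (simp add: dist_norm norm_minus_commute)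
      qed
    qed
    then show ?thesis by (rule Cauchy_convergent)
  qed
qed

context growth_measure
begin

lemma lebesgue_differentiation_local:
  fixes h :: "'a \<Rightarrow> 'c::euclidean_space"
  assumes h: "\<And>p. integrable \<mu> (\<lambda>y. indicator (ball 0 p) y *\<^sub>R h y)"
  shows "AE x in \<mu>. \<forall>\<eta>>0. \<exists>R0>0. \<forall>R. 0 < R \<longrightarrow> R < R0 \<longrightarrow>
    (\<integral>y. indicator (ball x R) y * norm (h y - h x) \<partial>\<mu>) \<le> \<eta> * measure \<mu> (ball x (5 * R))"
proof -
  define H where "H p y = indicator (ball 0 (real p)) y *\<^sub>R h y" for p :: nat and y
  have "AE x in \<mu>. \<forall>p. \<forall>\<eta>>0. \<exists>R0>0. \<forall>R. 0 < R \<longrightarrow> R < R0 \<longrightarrow>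
    (\<integral>y. indicator (ball x R) y * norm (H p y - H p x) \<partial>\<mu>) \<le> \<eta> * measure \<mu> (ball x (5 * R))"
    unfolding AE_all_countable H_def using h by (intro allI lebesgue_differentiation)
  then show ?thesis
  proof eventually_elim
    case (elim x)
    obtain p where p: "norm x < real p" using reals_Archimedean2 by blast
    show ?case
    proof (intro allI impI)
      fix \<eta> :: real assume "\<eta> > 0"
      then obtain R0 where R0: "R0 > 0" "\<And>R. 0 < R \<Longrightarrow> R < R0 \<Longrightarrow>
        (\<integral>y. indicator (ball x R) y * norm (H p y - H p x) \<partial>\<mu>) \<le> \<eta> * measure \<mu> (ball x (5 * R))"
        using elim by blast
      show "\<exists>R0>0. \<forall>R. 0 < R \<longrightarrow> R < R0 \<longrightarrow>
        (\<integral>y. indicator (ball x R) y * norm (h y - h x) \<partial>\<mu>) \<le> \<eta> * measure \<mu> (ball x (5 * R))"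
      proof (intro exI[of _ "min R0 (real p - norm x)"] conjI allI impI)
        show "0 < min R0 (real p - norm x)" using R0 p by simp
        fix R assume R: "0 < R" "R < min R0 (real p - norm x)"
        have "(\<integral>y. indicator (ball x R) y * norm (h y - h x) \<partial>\<mu>) = (\<integral>y. indicator (ball x R) y * norm (H p y - H p x) \<partial>\<mu>)"
        proof (intro Bochner_Integration.integral_cong refl)
          fix y
          show "indicator (ball x R) y * norm (h y - h x) = indicator (ball x R) y * norm (H p y - H p x)"
          proof (cases "y \<in> ball x R")
            case True
            then have "norm y < real p" using R norm_triangle_ineq[of x "y - x"] by (simp add: dist_norm norm_minus_commute)
            then show ?thesis using p by (simp add: H_def)
          qed simp
        qed
        then show "(\<integral>y. indicator (ball x R) y * norm (h y - h x) \<partial>\<mu>) \<le> \<eta> * measure \<mu> (ball x (5 * R))"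
          using R0(2)[of R] R by simp
      qed
    qed
  qed
qed

end

section \<open>Averages of truncations against bump functions\<close>

definition bump :: "'a::euclidean_space \<Rightarrow> real \<Rightarrow> 'a \<Rightarrow> real" where
  "bump x R y = max 0 (min 1 (2 - dist x y / R))"

lemma bump_bounds: "0 \<le> bump x R y" "bump x R y \<le> 1" "\<bar>bump x R y\<bar> \<le> 1"
  by (auto simp: bump_def)

lemma bump_eq_1: "R > 0 \<Longrightarrow> y \<in> ball x R \<Longrightarrow> bump x R y = 1"
  by (simp add: bump_def field_simps)

lemma bump_eq_0: "R > 0 \<Longrightarrow> y \<notin> ball x (2 * R) \<Longrightarrow> bump x R y = 0"
  by (simp add: bump_def field_simps)

lemma bump_lipschitz: "R > 0 \<Longrightarrow> \<bar>bump x R y - bump x R z\<bar> \<le> dist y z / R"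
proof -
  assume R: "R > 0"
  have "\<bar>bump x R y - bump x R z\<bar> \<le> \<bar>dist x y / R - dist x z / R\<bar>"
    by (auto simp: bump_def max_def min_def)
  also have "\<dots> = \<bar>dist x y - dist x z\<bar> / R" using R by (simp add: diff_divide_distrib[symmetric] abs_divide)
  also have "\<dots> \<le> dist y z / R"
    using R abs_dist_diff_le[of y x z] by (intro divide_right_mono) (auto simp: dist_commute)
  finally show ?thesis .
qed

lemma bump_measurable [measurable]: "bump x R \<in> borel_measurable borel"
  unfolding bump_def[abs_def] by measurable

context cz
begin

text \<open>Exchanging the variables changes the sign of \<open>k (x - y)\<close>, so the weight may
  be antisymmetrised at the price of a factor 2. The new weight vanishes on the diagonal, which for
  Lipschitz \<open>f\<close> and \<open>G\<close> gains one power of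
  \<open>norm (x - y)\<close>.\<close>

lemma antisymmetric_pairing:
  fixes f G :: "'a \<Rightarrow> real" and k :: "'a \<Rightarrow> 'b"
  assumes [measurable]: "f \<in> borel_measurable borel" "G \<in> borel_measurable borel" "k \<in> borel_measurable borel"
    and f: "\<And>y. \<bar>f y\<bar> \<le> Mf" "\<And>y. f y \<noteq> 0 \<Longrightarrow> y \<in> ball a rf"
    and G: "\<And>y. \<bar>G y\<bar> \<le> MG" "\<And>y. G y \<noteq> 0 \<Longrightarrow> y \<in> ball b rG"
    and k: "\<And>z. norm (k z) \<le> Mk" "\<And>z. k (- z) = - k z"
  shows "2 *\<^sub>R (\<integral>x. G x *\<^sub>R (\<integral>y. f y *\<^sub>R k (x - y) \<partial>\<mu>) \<partial>\<mu>) = (\<integral>x. (\<integral>y. (G x * f y - G y * f x) *\<^sub>R k (x - y) \<partial>\<mu>) \<partial>\<mu>)"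
proof -
  interpret P: pair_sigma_finite \<mu> \<mu> ..
  define F1 where "F1 x y = (G x * f y) *\<^sub>R k (x - y)" for x y
  define F2 where "F2 x y = (G y * f x) *\<^sub>R k (x - y)" for x y
  have M0: "Mf \<ge> 0" "MG \<ge> 0" "Mk \<ge> 0" using f(1)[of 0] G(1)[of 0] k(1)[of 0] by (auto intro: order_trans[OF abs_ge_zero] order_trans[OF norm_ge_zero])
  have fin: "integrable (\<mu> \<Otimes>\<^sub>M \<mu>) (\<lambda>p. MG * Mf * Mk * indicator (ball c r \<times> ball c' r') p)" for c c' r r'
  proof -
    have "emeasure (\<mu> \<Otimes>\<^sub>M \<mu>) (ball c r \<times> ball c' r') < \<infinity>"
      using emeasure_bounded_finite[of "ball c r"] emeasure_bounded_finite[of "ball c' r'"]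
      by (subst emeasure_pair_measure_Times) (auto simp: ennreal_mult_less_top)
    then show ?thesis by (intro integrable_mult_right integrable_real_indicator) auto
  qed
  have bd: "norm ((g1 * g2) *\<^sub>R k z) \<le> MG * Mf * Mk" if "\<bar>g1\<bar> \<le> MG" "\<bar>g2\<bar> \<le> Mf" for g1 g2 z
    using that k(1)[of z] M0 unfolding norm_scaleR abs_mult by (intro mult_mono) auto
  have i1: "integrable (\<mu> \<Otimes>\<^sub>M \<mu>) (\<lambda>(x, y). F1 x y)"
  proof (rule Bochner_Integration.integrable_bound[OF fin[of b rG a rf]])
    show "AE p in \<mu> \<Otimes>\<^sub>M \<mu>. norm (case p of (x, y) \<Rightarrow> F1 x y) \<le> norm (MG * Mf * Mk * indicator (ball b rG \<times> ball a rf) p)"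
    proof (intro AE_I2, clarify)
      fix x y
      show "norm (F1 x y) \<le> norm (MG * Mf * Mk * indicator (ball b rG \<times> ball a rf) (x, y))"
      proof (cases "G x * f y = 0")
        case False
        then show ?thesis using f(2)[of y] G(2)[of x] bd[OF G(1) f(1), of x y "x - y"] M0 by (auto simp: F1_def)
      qed (auto simp: F1_def)
    qed
  qed (simp add: F1_def split_def)
  have i2: "integrable (\<mu> \<Otimes>\<^sub>M \<mu>) (\<lambda>(x, y). F2 x y)"
  proof (rule Bochner_Integration.integrable_bound[OF fin[of a rf b rG]])
    show "AE p in \<mu> \<Otimes>\<^sub>M \<mu>. norm (case p of (x, y) \<Rightarrow> F2 x y) \<le> norm (MG * Mf * Mk * indicator (ball a rf \<times> ball b rG) p)"
    proof (intro AE_I2, clarify)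
      fix x y
      show "norm (F2 x y) \<le> norm (MG * Mf * Mk * indicator (ball a rf \<times> ball b rG) (x, y))"
      proof (cases "G y * f x = 0")
        case False
        then show ?thesis using f(2)[of x] G(2)[of y] bd[OF G(1) f(1), of y x "x - y"] M0 by (auto simp: F2_def)
      qed (auto simp: F2_def)
    qed
  qed (simp add: F2_def split_def)
  have swap: "F1 y x = - F2 x y" for x y
    using k(2)[of "x - y"] by (simp add: F1_def F2_def)
  have I: "(\<integral>x. G x *\<^sub>R (\<integral>y. f y *\<^sub>R k (x - y) \<partial>\<mu>) \<partial>\<mu>) = (\<integral>x. (\<integral>y. F1 x y \<partial>\<mu>) \<partial>\<mu>)"
    by (simp add: F1_def flip: integral_scaleR_right)
  have "(\<integral>x. (\<integral>y. F1 x y \<partial>\<mu>) \<partial>\<mu>) = (\<integral>y. (\<integral>x. F1 x y \<partial>\<mu>) \<partial>\<mu>)"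
    by (rule P.Fubini_integral[OF i1, symmetric])
  also have "\<dots> = - (\<integral>x. (\<integral>y. F2 x y \<partial>\<mu>) \<partial>\<mu>)" by (simp add: swap)
  finally have "2 *\<^sub>R (\<integral>x. (\<integral>y. F1 x y \<partial>\<mu>) \<partial>\<mu>) = (\<integral>x. (\<integral>y. F1 x y \<partial>\<mu>) \<partial>\<mu>) - (\<integral>x. (\<integral>y. F2 x y \<partial>\<mu>) \<partial>\<mu>)"
    by (metis scaleR_2 uminus_add_conv_diff add.commute)
  also have "\<dots> = (\<integral>p. (case p of (x, y) \<Rightarrow> F1 x y) \<partial>(\<mu> \<Otimes>\<^sub>M \<mu>)) - (\<integral>p. (case p of (x, y) \<Rightarrow> F2 x y) \<partial>(\<mu> \<Otimes>\<^sub>M \<mu>))"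
    by (simp only: P.integral_fst[OF i1] P.integral_fst[OF i2])
  also have "\<dots> = (\<integral>p. (case p of (x, y) \<Rightarrow> F1 x y) - (case p of (x, y) \<Rightarrow> F2 x y) \<partial>(\<mu> \<Otimes>\<^sub>M \<mu>))"
    by (rule Bochner_Integration.integral_diff[OF i1 i2, symmetric])
  also have "\<dots> = (\<integral>p. (case p of (x, y) \<Rightarrow> F1 x y - F2 x y) \<partial>(\<mu> \<Otimes>\<^sub>M \<mu>))"
    by (simp add: split_def)
  also have "\<dots> = (\<integral>x. (\<integral>y. F1 x y - F2 x y \<partial>\<mu>) \<partial>\<mu>)"
  proof (rule P.integral_fst[symmetric])
    show "integrable (\<mu> \<Otimes>\<^sub>M \<mu>) (\<lambda>(x, y). F1 x y - F2 x y)"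
      using Bochner_Integration.integrable_diff[OF i1 i2] by (simp add: split_def)
  qed
  finally show ?thesis unfolding I unfolding F1_def[abs_def] F2_def[abs_def] by (simp add: scaleR_diff_left)
qed

lemma kr_diff_bound:
  assumes r: "0 < r" "r \<le> R"
  shows "norm (kr r z - kr R z) \<le> C0 / norm z ^ s * indicator (ball 0 (2 * R)) z"
    and "norm (kr r z - kr R z) \<le> C0 / r ^ s * indicator (ball 0 (2 * R)) z"
proof -
  have R: "R > 0" using r by simp
  have le: "norm (kr r z - kr R z) \<le> C0 / norm z ^ s"
  proof (cases "z = 0")
    case False
    have "norm z / R \<le> norm z / r" using r by (intro divide_left_mono) auto
    then have c: "\<bar>ramp (norm z / r) - ramp (norm z / R)\<bar> \<le> 1" by (auto simp: ramp_def max_def min_def)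
    have "norm (kr r z - kr R z) = \<bar>ramp (norm z / r) - ramp (norm z / R)\<bar> * norm (K z)"
      by (simp add: kr_def scaleR_left_diff_distrib[symmetric])
    also have "\<dots> \<le> 1 * (C0 / norm z ^ s)"
      using c K_bound[OF False] by (intro mult_mono) auto
    finally show ?thesis by simp
  qed (use r R C0_pos in \<open>simp add: kr_eq_0\<close>)
  have z: "kr r z - kr R z = 0" if "2 * R \<le> norm z" using that r R by (simp add: kr_eq_K)
  show "norm (kr r z - kr R z) \<le> C0 / norm z ^ s * indicator (ball 0 (2 * R)) z"
    using le z by (cases "norm z < 2 * R") auto
  have "norm (kr r z - kr R z) \<le> C0 / r ^ s"
  proof (cases "norm z \<le> r")
    case True
    then show ?thesis using r R C0_pos by (simp add: kr_eq_0)
  next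
    case False
    have "C0 / norm z ^ s \<le> C0 / r ^ s" using False r C0_pos by (intro divide_left_mono power_mono mult_pos_pos zero_less_power) auto
    then show ?thesis using le by simp
  qed
  then show "norm (kr r z - kr R z) \<le> C0 / r ^ s * indicator (ball 0 (2 * R)) z"
    using z by (cases "norm z < 2 * R") auto
qed

text \<open>After antisymmetrisation the weight is at most \<open>(L + M / R) * dist z y\<close>,
  and \<open>near_integral\<close> makes the interaction within distance \<open>2 * \<rho>\<close>
  of order \<rho>. The bound is uniform in the lower scale \<epsilon>, so it passes to a weak limit.
  As \<open>2 * \<rho> \<le> R\<close>, only \<open>z\<close> in \<open>ball x (4 * R)\<close>
  contribute.\<close>

lemma near_pairing_bound:
  fixes f :: "'a \<Rightarrow> real"
  assumes f [measurable]: "f \<in> borel_measurable borel" and fM: "\<And>y. \<bar>f y\<bar> \<le> M" and fL: "\<And>y z. \<bar>f y - f z\<bar> \<le> L * dist y z"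
    and fs: "\<And>y. f y \<noteq> 0 \<Longrightarrow> y \<in> ball 0 rf"
    and R: "R > 0" and \<epsilon>: "0 < \<epsilon>" "\<epsilon> \<le> \<rho>" and \<rho>: "2 * \<rho> \<le> R"
  shows "norm ((\<integral>z. bump x R z *\<^sub>R Tf f \<epsilon> z \<partial>\<mu>) - (\<integral>z. bump x R z *\<^sub>R Tf f \<rho> z \<partial>\<mu>)) \<le>
     C0 * 2 ^ (s + 1) * \<rho> * (L + M / R) * measure \<mu> (ball x (4 * R))"
proof -
  let ?G = "bump x R"
  have \<rho>0: "\<rho> > 0" using \<epsilon> by simp
  have M0: "M \<ge> 0" using fM[of 0] by (auto intro: order_trans[OF abs_ge_zero])
  have L0: "L \<ge> 0"
  proof -
    obtain b :: 'a where "b \<in> Basis" using nonempty_Basis by blast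
    then have "0 < dist 0 b" by auto
    moreover have "0 \<le> L * dist 0 b" using fL[of 0 b] by (meson abs_ge_zero order_trans)
    ultimately show ?thesis by (simp add: zero_le_mult_iff)
  qed
  have [measurable]: "kr \<epsilon> \<in> borel_measurable borel" "kr \<rho> \<in> borel_measurable borel" using \<epsilon> \<rho>0 by auto
  define k where "k z = kr \<epsilon> z - kr \<rho> z" for z
  have [measurable]: "k \<in> borel_measurable borel" unfolding k_def[abs_def] by measurable
  have iff: "integrable \<mu> f" by (rule integrable_bounded_support[OF f fM[folded real_norm_def] fs])
  have iG: "integrable \<mu> (\<lambda>z. ?G z *\<^sub>R Tf f r z)" if r: "r > 0" for r
  proof (rule integrable_bounded_support[where B="C0 / r ^ s * (\<integral>y. \<bar>f y\<bar> \<partial>\<mu>)" and x=x and r="2 * R"])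
    show "(\<lambda>z. ?G z *\<^sub>R Tf f r z) \<in> borel_measurable borel" using r by measurable
    fix z
    have "norm (Tf f r z) \<le> (\<integral>y. C0 / r ^ s * \<bar>f y\<bar> \<partial>\<mu>)"
      unfolding Tf_def
    proof (rule Bochner_Integration.integral_norm_bound_integral[OF integrable_Tf[OF r iff]])
      fix y
      show "norm (f y *\<^sub>R kr r (z - y)) \<le> C0 / r ^ s * \<bar>f y\<bar>"
        using mult_right_mono[OF kr_bounded[OF r, of "z - y"], of "\<bar>f y\<bar>"] by (simp add: mult.commute)
    qed (use iff in auto)
    then have "norm (Tf f r z) \<le> C0 / r ^ s * (\<integral>y. \<bar>f y\<bar> \<partial>\<mu>)" by simp
    then have "\<bar>?G z\<bar> * norm (Tf f r z) \<le> 1 * (C0 / r ^ s * (\<integral>y. \<bar>f y\<bar> \<partial>\<mu>))"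
      using bump_bounds[of x R z] by (intro mult_mono) auto
    then show "norm (?G z *\<^sub>R Tf f r z) \<le> C0 / r ^ s * (\<integral>y. \<bar>f y\<bar> \<partial>\<mu>)" by simp
    show "?G z *\<^sub>R Tf f r z \<noteq> 0 \<Longrightarrow> z \<in> ball x (2 * R)" using bump_eq_0[OF R, of z x] by auto
  qed
  have "(\<integral>z. ?G z *\<^sub>R Tf f \<epsilon> z \<partial>\<mu>) - (\<integral>z. ?G z *\<^sub>R Tf f \<rho> z \<partial>\<mu>) = (\<integral>z. ?G z *\<^sub>R Tf f \<epsilon> z - ?G z *\<^sub>R Tf f \<rho> z \<partial>\<mu>)"
    using iG \<epsilon> \<rho>0 by (intro Bochner_Integration.integral_diff[symmetric]) auto
  also have "\<dots> = (\<integral>z. ?G z *\<^sub>R (\<integral>y. f y *\<^sub>R k (z - y) \<partial>\<mu>) \<partial>\<mu>)"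
  proof (intro Bochner_Integration.integral_cong refl)
    fix z
    have "(\<integral>y. f y *\<^sub>R k (z - y) \<partial>\<mu>) = Tf f \<epsilon> z - Tf f \<rho> z"
      unfolding Tf_def k_def scaleR_diff_right using \<epsilon> \<rho>0 iff by (intro Bochner_Integration.integral_diff integrable_Tf)
    then show "?G z *\<^sub>R Tf f \<epsilon> z - ?G z *\<^sub>R Tf f \<rho> z = ?G z *\<^sub>R (\<integral>y. f y *\<^sub>R k (z - y) \<partial>\<mu>)" by (simp add: scaleR_diff_right)
  qed
  finally have eq: "(\<integral>z. ?G z *\<^sub>R Tf f \<epsilon> z \<partial>\<mu>) - (\<integral>z. ?G z *\<^sub>R Tf f \<rho> z \<partial>\<mu>) = (\<integral>z. ?G z *\<^sub>R (\<integral>y. f y *\<^sub>R k (z - y) \<partial>\<mu>) \<partial>\<mu>)" (is "?I = _") .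
  have eq2: "2 *\<^sub>R ?I = (\<integral>z. (\<integral>y. (?G z * f y - ?G y * f z) *\<^sub>R k (z - y) \<partial>\<mu>) \<partial>\<mu>)"
    unfolding eq
  proof (rule antisymmetric_pairing[where Mf=M and a=0 and rf=rf and MG=1 and b=x and rG="2 * R" and Mk="C0 / \<epsilon> ^ s"])
    show "norm (k z) \<le> C0 / \<epsilon> ^ s" for z
    proof -
      have "norm (k z) \<le> C0 / \<epsilon> ^ s * indicator (ball 0 (2 * \<rho>)) z" unfolding k_def by (rule kr_diff_bound(2)[OF \<epsilon>])
      also have "\<dots> \<le> C0 / \<epsilon> ^ s * 1" using C0_pos \<epsilon> by (intro mult_left_mono) (auto simp: indicator_def)
      finally show ?thesis by simp
    qed
    show "bump x R y \<noteq> 0 \<Longrightarrow> y \<in> ball x (2 * R)" for y using bump_eq_0[OF R] by blast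
  qed (use fM fs bump_bounds in \<open>auto simp: k_def kr_odd\<close>)
  have "ennreal (norm (2 *\<^sub>R ?I)) \<le> (\<integral>\<^sup>+z. ennreal (norm (\<integral>y. (?G z * f y - ?G y * f z) *\<^sub>R k (z - y) \<partial>\<mu>)) \<partial>\<mu>)"
    unfolding eq2 by (rule norm_integral_le_nn_integral)
  also have "\<dots> \<le> (\<integral>\<^sup>+z. ennreal ((L + M / R) * C0 * (1 * 2 ^ (s + 1) * (2 * \<rho>))) * indicator (ball x (4 * R)) z \<partial>\<mu>)"
  proof (intro nn_integral_mono)
    fix z
    have "ennreal (norm (\<integral>y. (?G z * f y - ?G y * f z) *\<^sub>R k (z - y) \<partial>\<mu>)) \<le> (\<integral>\<^sup>+y. ennreal (norm ((?G z * f y - ?G y * f z) *\<^sub>R k (z - y))) \<partial>\<mu>)"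
      by (rule norm_integral_le_nn_integral)
    also have "\<dots> \<le> (\<integral>\<^sup>+y. ennreal ((L + M / R) * C0) * indicator (ball x (4 * R)) z * (indicator (ball z (2 * \<rho>)) y * ennreal (dist z y / dist z y ^ s)) \<partial>\<mu>)"
    proof (intro nn_integral_mono)
      fix y
      have kb: "norm (k (z - y)) \<le> C0 / norm (z - y) ^ s * indicator (ball 0 (2 * \<rho>)) (z - y)"
        unfolding k_def by (rule kr_diff_bound(1)[OF \<epsilon>])
      show "ennreal (norm ((?G z * f y - ?G y * f z) *\<^sub>R k (z - y))) \<le> ennreal ((L + M / R) * C0) * indicator (ball x (4 * R)) z * (indicator (ball z (2 * \<rho>)) y * ennreal (dist z y / dist z y ^ s))"
      proof (cases "norm (z - y) < 2 * \<rho> \<and> ?G z * f y - ?G y * f z \<noteq> 0")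
        case False
        then have "norm ((?G z * f y - ?G y * f z) *\<^sub>R k (z - y)) = 0" using kb by (auto simp: indicator_def)
        then show ?thesis by (simp only: ennreal_0 zero_le)
      next
        case True
        then have "z \<in> ball x (2 * R) \<or> y \<in> ball x (2 * R)" using bump_eq_0[OF R] by (metis diff_zero mult_zero_left)
        then have zin: "z \<in> ball x (4 * R)"
          using True \<rho> R dist_triangle[of x z y] by (auto simp: dist_norm norm_minus_commute)
        have "?G z * f y - ?G y * f z = ?G z * (f y - f z) + f z * (?G z - ?G y)" by (simp add: algebra_simps)
        also have "\<bar>\<dots>\<bar> \<le> \<bar>?G z\<bar> * \<bar>f y - f z\<bar> + \<bar>f z\<bar> * \<bar>?G z - ?G y\<bar>"
          by (metis abs_mult abs_triangle_ineq)
        also have "\<dots> \<le> 1 * (L * dist y z) + M * (dist z y / R)"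
          using bump_bounds[of x R z] fL[of y z] fM[of z] bump_lipschitz[OF R, of x z y] M0 by (intro add_mono mult_mono) auto
        also have "\<dots> = (L + M / R) * dist z y" by (simp add: dist_commute algebra_simps)
        finally have a: "\<bar>?G z * f y - ?G y * f z\<bar> \<le> (L + M / R) * dist z y" .
        have "norm ((?G z * f y - ?G y * f z) *\<^sub>R k (z - y)) \<le> ((L + M / R) * dist z y) * (C0 / norm (z - y) ^ s)"
          unfolding norm_scaleR using a kb True M0 L0 R C0_pos by (intro mult_mono) auto
        also have "\<dots> = ((L + M / R) * C0) * (dist z y / dist z y ^ s)" by (simp add: dist_norm)
        finally have "ennreal (norm ((?G z * f y - ?G y * f z) *\<^sub>R k (z - y))) \<le> ennreal (((L + M / R) * C0) * (dist z y / dist z y ^ s))"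
          by (rule ennreal_leI)
        also have "\<dots> = ennreal ((L + M / R) * C0) * ennreal (dist z y / dist z y ^ s)"
          using M0 L0 R C0_pos by (intro ennreal_mult) auto
        finally show ?thesis using zin True by (simp add: dist_norm)
      qed
    qed
    also have "\<dots> = ennreal ((L + M / R) * C0) * indicator (ball x (4 * R)) z * (\<integral>\<^sup>+y. indicator (ball z (2 * \<rho>)) y * ennreal (dist z y / dist z y ^ s) \<partial>\<mu>)"
      by (intro nn_integral_cmult) auto
    also have "\<dots> \<le> ennreal ((L + M / R) * C0) * indicator (ball x (4 * R)) z * ennreal (1 * 2 ^ (s + 1) * (2 * \<rho>))"
      using \<rho>0 growth by (intro mult_left_mono near_integral) auto
    also have "\<dots> = ennreal ((L + M / R) * C0 * (1 * 2 ^ (s + 1) * (2 * \<rho>))) * indicator (ball x (4 * R)) z"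
      using M0 L0 R C0_pos \<rho>0 by (subst (2) ennreal_mult) (auto simp: mult_ac)
    finally show "ennreal (norm (\<integral>y. (?G z * f y - ?G y * f z) *\<^sub>R k (z - y) \<partial>\<mu>)) \<le> ennreal ((L + M / R) * C0 * (1 * 2 ^ (s + 1) * (2 * \<rho>))) * indicator (ball x (4 * R)) z" .
  qed
  also have "\<dots> = ennreal ((L + M / R) * C0 * (1 * 2 ^ (s + 1) * (2 * \<rho>)) * measure \<mu> (ball x (4 * R)))"
    using M0 L0 R C0_pos \<rho>0 by (simp add: nn_integral_cmult emeasure_ball_eq ennreal_mult)
  finally have "norm (2 *\<^sub>R ?I) \<le> (L + M / R) * C0 * (1 * 2 ^ (s + 1) * (2 * \<rho>)) * measure \<mu> (ball x (4 * R))"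
    using M0 L0 R C0_pos \<rho>0 by (subst (asm) ennreal_le_iff) auto
  then show ?thesis by (simp add: mult_ac)
qed

text \<open>Both kernels vanish for \<open>y\<close> within \<open>\<rho> / 2\<close> of
  \<open>x\<close>; beyond that, the shift of at most \<open>2 * R\<close> is at most half of the
  distance, and \<open>kr_smooth\<close> with \<open>tail_integral\<close> gives the factor
  \<open>R / \<rho>\<close>.\<close>

lemma far_oscillation:
  fixes f :: "'a \<Rightarrow> real"
  assumes f [measurable]: "f \<in> borel_measurable borel" and fM: "\<And>y. \<bar>f y\<bar> \<le> M" and i: "integrable \<mu> f"
    and R: "R > 0" "8 * R \<le> \<rho>" and z: "dist x z \<le> 2 * R"
  shows "norm (Tf f \<rho> z - Tf f \<rho> x) \<le> M * C1 * 2 ^ (s + 3) * R / \<rho>"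
proof -
  have \<rho>: "\<rho> > 0" using R by simp
  have M0: "M \<ge> 0" using fM[of 0] by (auto intro: order_trans[OF abs_ge_zero])
  have eq: "Tf f \<rho> z - Tf f \<rho> x = (\<integral>y. f y *\<^sub>R kr \<rho> (z - y) - f y *\<^sub>R kr \<rho> (x - y) \<partial>\<mu>)"
    unfolding Tf_def using \<rho> i by (intro Bochner_Integration.integral_diff[symmetric] integrable_Tf)
  have "ennreal (norm (Tf f \<rho> z - Tf f \<rho> x)) \<le> (\<integral>\<^sup>+y. ennreal (norm (f y *\<^sub>R kr \<rho> (z - y) - f y *\<^sub>R kr \<rho> (x - y))) \<partial>\<mu>)"
    unfolding eq by (rule norm_integral_le_nn_integral)
  also have "\<dots> \<le> (\<integral>\<^sup>+y. ennreal (M * C1 * (2 * R)) * (indicator {y. \<rho> / 2 \<le> dist x y} y * ennreal (1 / dist x y ^ (s + 1))) \<partial>\<mu>)"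
  proof (intro nn_integral_mono)
    fix y
    show "ennreal (norm (f y *\<^sub>R kr \<rho> (z - y) - f y *\<^sub>R kr \<rho> (x - y))) \<le> ennreal (M * C1 * (2 * R)) * (indicator {y. \<rho> / 2 \<le> dist x y} y * ennreal (1 / dist x y ^ (s + 1)))"
    proof (cases "\<rho> / 2 \<le> dist x y")
      case False
      then have "norm (x - y) \<le> \<rho>" "norm (z - y) \<le> \<rho>"
        using R z dist_triangle[of z y x] by (auto simp: dist_norm norm_minus_commute)
      then show ?thesis using \<rho> by (simp add: kr_eq_0)
    next
      case True
      have "norm (kr \<rho> (x - y) - kr \<rho> (z - y)) \<le> C1 * norm ((x - y) - (z - y)) / norm (x - y) ^ (s + 1)"
        using True z R by (intro kr_smooth \<rho>) (auto simp: dist_norm)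
      also have "\<dots> \<le> C1 * (2 * R) / norm (x - y) ^ (s + 1)"
        using z C1_pos by (intro divide_right_mono mult_left_mono) (auto simp: dist_norm)
      finally have kd: "norm (kr \<rho> (z - y) - kr \<rho> (x - y)) \<le> C1 * (2 * R) / norm (x - y) ^ (s + 1)" by (simp add: norm_minus_commute)
      have "norm (f y *\<^sub>R kr \<rho> (z - y) - f y *\<^sub>R kr \<rho> (x - y)) = \<bar>f y\<bar> * norm (kr \<rho> (z - y) - kr \<rho> (x - y))"
        by (simp flip: scaleR_diff_right)
      also have "\<dots> \<le> M * (C1 * (2 * R) / norm (x - y) ^ (s + 1))" using fM kd M0 by (intro mult_mono) auto
      also have "\<dots> = M * C1 * (2 * R) * (1 / dist x y ^ (s + 1))" by (simp add: dist_norm)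
      finally have "ennreal (norm (f y *\<^sub>R kr \<rho> (z - y) - f y *\<^sub>R kr \<rho> (x - y))) \<le> ennreal (M * C1 * (2 * R) * (1 / dist x y ^ (s + 1)))"
        by (rule ennreal_leI)
      also have "\<dots> = ennreal (M * C1 * (2 * R)) * ennreal (1 / dist x y ^ (s + 1))"
        using M0 C1_pos R by (intro ennreal_mult) auto
      finally show ?thesis using True by simp
    qed
  qed
  also have "\<dots> = ennreal (M * C1 * (2 * R)) * (\<integral>\<^sup>+y. indicator {y. \<rho> / 2 \<le> dist x y} y * ennreal (1 / dist x y ^ (s + 1)) \<partial>\<mu>)"
    by (intro nn_integral_cmult) auto
  also have "\<dots> \<le> ennreal (M * C1 * (2 * R)) * ennreal (1 * 2 ^ (s + 1) / (\<rho> / 2))"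
    using \<rho> growth by (intro mult_left_mono tail_integral) auto
  also have "\<dots> = ennreal (M * C1 * (2 * R) * (1 * 2 ^ (s + 1) / (\<rho> / 2)))"
    using M0 C1_pos R \<rho> by (intro ennreal_mult[symmetric]) auto
  finally have "norm (Tf f \<rho> z - Tf f \<rho> x) \<le> M * C1 * (2 * R) * (1 * 2 ^ (s + 1) / (\<rho> / 2))"
    using M0 C1_pos R \<rho> by (subst (asm) ennreal_le_iff) auto
  also have "\<dots> = M * C1 * 2 ^ (s + 3) * R / \<rho>" by (simp add: power_add field_simps)
  finally show ?thesis .
qed

lemma Tf_diff_bound:
  fixes f :: "'a \<Rightarrow> real"
  assumes f [measurable]: "f \<in> borel_measurable borel" and fM: "\<And>y. \<bar>f y\<bar> \<le> M" and i: "integrable \<mu> f"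
    and r: "0 < r" "r \<le> R"
  shows "norm (Tf f r x - Tf f R x) \<le> M * C0 / r ^ s * measure \<mu> (ball x (2 * R))"
proof -
  have M0: "M \<ge> 0" using fM[of 0] by (auto intro: order_trans[OF abs_ge_zero])
  have "Tf f r x - Tf f R x = (\<integral>y. f y *\<^sub>R kr r (x - y) - f y *\<^sub>R kr R (x - y) \<partial>\<mu>)"
    unfolding Tf_def using r i by (intro Bochner_Integration.integral_diff[symmetric] integrable_Tf) auto
  also have "norm \<dots> \<le> (\<integral>y. M * C0 / r ^ s * indicator (ball x (2 * R)) y \<partial>\<mu>)"
  proof (rule Bochner_Integration.integral_norm_bound_integral)
    show "integrable \<mu> (\<lambda>y. f y *\<^sub>R kr r (x - y) - f y *\<^sub>R kr R (x - y))"
      using r i by (intro Bochner_Integration.integrable_diff integrable_Tf) auto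
    show "integrable \<mu> (\<lambda>y. M * C0 / r ^ s * indicator (ball x (2 * R)) y)"
      using emeasure_bounded_finite[of "ball x (2 * R)"] by simp
    fix y
    have "norm (f y *\<^sub>R kr r (x - y) - f y *\<^sub>R kr R (x - y)) = \<bar>f y\<bar> * norm (kr r (x - y) - kr R (x - y))"
      by (simp flip: scaleR_diff_right)
    also have "\<dots> \<le> M * (C0 / r ^ s * indicator (ball 0 (2 * R)) (x - y))"
      using fM kr_diff_bound(2)[OF r] M0 by (intro mult_mono) auto
    also have "\<dots> = M * C0 / r ^ s * indicator (ball x (2 * R)) y" by (simp add: indicator_def dist_norm norm_minus_commute)
    finally show "norm (f y *\<^sub>R kr r (x - y) - f y *\<^sub>R kr R (x - y)) \<le> M * C0 / r ^ s * indicator (ball x (2 * R)) y" .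
  qed
  also have "\<dots> = M * C0 / r ^ s * measure \<mu> (ball x (2 * R))" by simp
  finally show ?thesis .
qed

end

context growth_measure
begin

lemma integrable_bump: "R > 0 \<Longrightarrow> integrable \<mu> (bump x R)"
proof (rule integrable_bounded_support[where B=1 and x=x and r="2 * R"])
  show "y \<in> ball x (2 * R)" if "R > 0" "bump x R y \<noteq> 0" for y using bump_eq_0 that by blast
qed (auto simp: bump_bounds)

lemma bump_average_diff:
  fixes w :: "'a \<Rightarrow> 'c::euclidean_space"
  assumes [measurable]: "w \<in> borel_measurable borel" and w: "\<And>p. integrable \<mu> (\<lambda>y. indicator (ball 0 p) y *\<^sub>R w y)"
    and R: "R > 0"
  shows "integrable \<mu> (\<lambda>y. bump x R y *\<^sub>R w y)"
    and "integrable \<mu> (\<lambda>y. indicator (ball x (2 * R)) y * norm (w y - c))"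
    and "norm ((\<integral>y. bump x R y *\<^sub>R w y \<partial>\<mu>) - (\<integral>y. bump x R y \<partial>\<mu>) *\<^sub>R c) \<le> (\<integral>y. indicator (ball x (2 * R)) y * norm (w y - c) \<partial>\<mu>)"
proof -
  define p where "p = norm x + 2 * R"
  have sub: "y \<in> ball 0 p" if "y \<in> ball x (2 * R)" for y
    using that norm_triangle_ineq[of x "y - x"] by (auto simp: p_def dist_norm norm_minus_commute)
  show i1: "integrable \<mu> (\<lambda>y. bump x R y *\<^sub>R w y)"
  proof (rule Bochner_Integration.integrable_bound[OF w[of p]])
    show "AE y in \<mu>. norm (bump x R y *\<^sub>R w y) \<le> norm (indicator (ball 0 p) y *\<^sub>R w y)"
    proof (intro AE_I2)
      fix y
      show "norm (bump x R y *\<^sub>R w y) \<le> norm (indicator (ball 0 p) y *\<^sub>R w y)"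
        using bump_bounds[of x R y] bump_eq_0[OF R, of y x] sub[of y]
        by (cases "y \<in> ball x (2 * R)") (auto simp: mult_left_le_one_le simp del: mem_ball)
    qed
  qed simp
  have "integrable \<mu> (\<lambda>y. indicator (ball x (2 * R)) y *\<^sub>R (w y - c))"
  proof (rule Bochner_Integration.integrable_bound)
    show "integrable \<mu> (\<lambda>y. norm (indicator (ball 0 p) y *\<^sub>R w y) + norm c * indicator (ball 0 p) y)"
      using w[of p] emeasure_bounded_finite[of "ball 0 p"]
      by (intro Bochner_Integration.integrable_add integrable_norm integrable_mult_right integrable_real_indicator) auto
    show "AE y in \<mu>. norm (indicator (ball x (2 * R)) y *\<^sub>R (w y - c)) \<le> norm (norm (indicator (ball 0 p) y *\<^sub>R w y) + norm c * indicator (ball 0 p) y)"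
    proof (intro AE_I2)
      fix y
      show "norm (indicator (ball x (2 * R)) y *\<^sub>R (w y - c)) \<le> norm (norm (indicator (ball 0 p) y *\<^sub>R w y) + norm c * indicator (ball 0 p) y)"
        using sub[of y] norm_triangle_ineq4[of "w y" c]
        by (cases "y \<in> ball x (2 * R)") (auto simp del: mem_ball)
    qed
  qed simp
  from integrable_norm[OF this] show i2: "integrable \<mu> (\<lambda>y. indicator (ball x (2 * R)) y * norm (w y - c))"
    by simp
  have i3: "integrable \<mu> (\<lambda>y. bump x R y *\<^sub>R c)" using integrable_bump[OF R] by (rule integrable_scaleR_left)
  have "(\<integral>y. bump x R y *\<^sub>R w y \<partial>\<mu>) - (\<integral>y. bump x R y \<partial>\<mu>) *\<^sub>R c = (\<integral>y. bump x R y *\<^sub>R w y - bump x R y *\<^sub>R c \<partial>\<mu>)"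
    using i1 i3 integrable_bump[OF R] by (subst Bochner_Integration.integral_diff) auto
  also have "norm \<dots> \<le> (\<integral>y. indicator (ball x (2 * R)) y * norm (w y - c) \<partial>\<mu>)"
  proof (rule Bochner_Integration.integral_norm_bound_integral[OF Bochner_Integration.integrable_diff[OF i1 i3] i2])
    fix y
    show "norm (bump x R y *\<^sub>R w y - bump x R y *\<^sub>R c) \<le> indicator (ball x (2 * R)) y * norm (w y - c)"
      using bump_bounds[of x R y] bump_eq_0[OF R, of y x]
      by (cases "y \<in> ball x (2 * R)") (auto simp: scaleR_diff_right[symmetric] mult_left_le_one_le simp del: mem_ball)
  qed
  finally show "norm ((\<integral>y. bump x R y *\<^sub>R w y \<partial>\<mu>) - (\<integral>y. bump x R y \<partial>\<mu>) *\<^sub>R c) \<le> (\<integral>y. indicator (ball x (2 * R)) y * norm (w y - c) \<partial>\<mu>)" .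
qed

end

section \<open>Convergence along geometric scales for a Lipschitz density\<close>

context cz_L2
begin

abbreviation q :: "nat \<Rightarrow> real" where "q i \<equiv> (1/Q) ^ i"

lemma q_simps: "q i > 0" "q i \<le> 1" "i \<le> j \<Longrightarrow> q j \<le> q i" "q i = Q * q (Suc i)" "q (i + p) = q i * q p"
  by (auto simp: power_add power_le_one intro: power_decreasing)

text \<open>At a doubling radius \<open>R\<close> of index \<open>Suc (i + p)\<close>, the weak
  limit at \<open>x\<close> is compared with \<open>u i x\<close> in four steps: from its value to
  its average, by differentiation; to the average of \<open>u (i + p + p)\<close>, whose scale is
  far below \<open>R\<close>, by antisymmetry; to the average of \<open>u i\<close>, by the
  smallness of increments; and to the value of \<open>u i\<close>, whose scale is far above
  \<open>R\<close>, by \<open>far_oscillation\<close>. The first and third errors tend to 0 for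
  fixed \<open>p\<close>; the others are small for large \<open>p\<close>.\<close>

lemma smooth_truncations_convergent:
  fixes f :: "'a \<Rightarrow> real"
  assumes f: "lipschitz_compact f"
    and inc: "AE x in \<mu>. (\<lambda>i. Tf f (q (Suc i)) x - Tf f (q i) x) \<longlonglongrightarrow> 0"
  shows "AE x in \<mu>. convergent (\<lambda>i. Tf f (q i) x)"
proof -
  define u where "u i = Tf f (q i)" for i
  have mf [measurable]: "f \<in> borel_measurable borel" by (rule lipschitz_compact_measurable[OF f])
  obtain M where M: "M > 0" "\<And>y. \<bar>f y\<bar> \<le> M" using lipschitz_compact_bounded[OF f] by (auto simp: real_norm_def)
  obtain L rf where L: "L-lipschitz_on UNIV f" and fs: "\<And>y. f y \<noteq> 0 \<Longrightarrow> y \<in> ball 0 rf" using f by (auto simp: lipschitz_compact_def)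
  have L0: "L \<ge> 0" using L by (rule lipschitz_on_nonneg)
  have fL: "\<bar>f y - f z\<bar> \<le> L * dist y z" for y z using lipschitz_onD[OF L, of y z] by (simp add: dist_real_def)
  have intf: "integrable \<mu> f" by (rule lipschitz_compact_integrable[OF f])
  have intf2: "integrable \<mu> (\<lambda>y. (f y)\<^sup>2)"
  proof (rule integrable_bounded_support[where B="M\<^sup>2" and x=0 and r=rf])
    show "norm ((f y)\<^sup>2) \<le> M\<^sup>2" for y using power_mono[OF M(2)[of y], of 2] by simp
  qed (use fs in auto)
  have mu [measurable]: "u i \<in> borel_measurable borel" for i unfolding u_def using q_simps(1) by measurable
  define D where "D = Q ^ (s + 1)"
  have D1: "D \<ge> 1" unfolding D_def by (rule one_le_power) simp
  have nn: "(\<integral>\<^sup>+y. ennreal ((norm (u i y))\<^sup>2) \<partial>\<mu>) \<le> ennreal (C2 * (\<integral>y. (f y)\<^sup>2 \<partial>\<mu>))" for i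
    unfolding u_def by (rule L2_bound[OF q_simps(1) mf intf intf2])
  have iu: "integrable \<mu> (\<lambda>y. (norm (u i y))\<^sup>2)" for i
    by (rule integrableI_bounded) (use nn[of i] in \<open>auto simp: le_less_trans\<close>)
  have uB: "(\<integral>y. (norm (u i y))\<^sup>2 \<partial>\<mu>) \<le> C2 * (\<integral>y. (f y)\<^sup>2 \<partial>\<mu>)" for i
    using nn[of i] iu[of i] C2_pos by (subst (asm) nn_integral_eq_integral) auto
  from weak_limit_point[OF mu iu uB] obtain h where
    H: "h \<in> borel_measurable borel \<and> (\<forall>r. integrable \<mu> (\<lambda>y. indicator (ball 0 r) y *\<^sub>R h y)) \<and>
      (\<forall>g M r v b n. g \<in> borel_measurable borel \<longrightarrow> (\<forall>y. \<bar>g y\<bar> \<le> M) \<longrightarrow> (\<forall>y. g y \<noteq> 0 \<longrightarrow> y \<in> ball 0 r) \<longrightarrow>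
       (\<forall>i\<ge>n. norm ((\<integral>y. g y *\<^sub>R u i y \<partial>\<mu>) - v) \<le> b) \<longrightarrow> norm ((\<integral>y. g y *\<^sub>R h y \<partial>\<mu>) - v) \<le> b)"
    by (rule exE)
  have h: "h \<in> borel_measurable borel" "\<And>r. integrable \<mu> (\<lambda>y. indicator (ball 0 r) y *\<^sub>R h y)" using H by blast+
  note hw = H[THEN conjunct2, THEN conjunct2, rule_format]
  note [measurable] = h(1)
  \<comment> \<open>\<open>p\<close> is the ratio, on the logarithmic scale, of the comparison scales to the doubling scale\<close>
  define e where "e p j y = norm (u (j + p + p) y - u j y)" for p j y
  \<comment> \<open>For fixed \<open>p\<close> the increments are bounded uniformly in
    \<open>j\<close> and \<open>y\<close>, which makes the suprema below finite and integrable on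
    balls.\<close>
  have eB: "e p j y \<le> M * C0 * (2 * Q ^ (p + p)) ^ s" for p j y
  proof -
    have "e p j y \<le> M * C0 / q (j + p + p) ^ s * measure \<mu> (ball y (2 * q j))"
      unfolding e_def u_def using M(2) by (intro Tf_diff_bound[OF mf _ intf]) (auto intro: power_decreasing)
    also have "\<dots> \<le> M * C0 / q (j + p + p) ^ s * (2 * q j) ^ s"
      using M C0_pos by (intro mult_left_mono measure_ball_le) auto
    also have "\<dots> = M * C0 * (2 * q j / q (j + p + p)) ^ s" by (simp add: power_divide)
    also have "2 * q j / q (j + p + p) = 2 * Q ^ (p + p)" by (simp add: power_add power_divide field_simps)
    finally show ?thesis .
  qed
  have e0: "0 \<le> e p j y" for p j y by (simp add: e_def)
  have [measurable]: "e p j \<in> borel_measurable borel" for p j unfolding e_def[abs_def] by measurable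
  \<comment> \<open>Increments tend to 0 at \<open>x\<close>, but their average over a ball around
    \<open>x\<close> is wanted. The tail supremum is small at \<open>x\<close> for large
    \<open>n\<close> and dominates all later increments at once, so a single differentiation
    statement for \<open>v p n\<close> serves every \<open>j \<ge> n\<close>.\<close>
  define v where "v p n y = (SUP j\<in>{n..}. e p j y)" for p n y
  have bdd: "bdd_above ((\<lambda>j. e p j y) ` {n..})" for p n y using eB by (auto simp: bdd_above_def)
  have ev: "e p j y \<le> v p n y" if "j \<ge> n" for p n j y unfolding v_def using that bdd by (intro cSUP_upper) auto
  have v0: "0 \<le> v p n y" for p n y using e0[of p n y] ev[of n n p y] by simp
  have vB: "v p n y \<le> M * C0 * (2 * Q ^ (p + p)) ^ s" for p n y unfolding v_def using eB by (intro cSUP_least) auto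
  have mv [measurable]: "v p n \<in> borel_measurable borel" for p n
    unfolding v_def[abs_def] using bdd by (intro borel_measurable_cSUP) auto
  have iv: "integrable \<mu> (\<lambda>y. indicator (ball 0 r) y *\<^sub>R v p n y)" for r p n
    by (rule integrable_bounded_support[where B="M * C0 * (2 * Q ^ (p + p)) ^ s" and x=0 and r=r])
       (use v0[of p n] vB[of p n] M(1) C0_pos in \<open>auto simp: indicator_def\<close>)
  have "AE x in \<mu>. \<forall>p n. \<forall>\<eta>>0. \<exists>R0>0. \<forall>R. 0 < R \<longrightarrow> R < R0 \<longrightarrow>
    (\<integral>y. indicator (ball x R) y * norm (v p n y - v p n x) \<partial>\<mu>) \<le> \<eta> * measure \<mu> (ball x (5 * R))"
    unfolding AE_all_countable by (intro allI lebesgue_differentiation_local iv)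
  then show ?thesis
    using inc lebesgue_differentiation_local[OF h(2)]
  proof eventually_elim
    case (elim x)
    have inc0: "(\<lambda>i. u (Suc i) x - u i x) \<longlonglongrightarrow> 0" using elim(2) by (simp add: u_def)
    define m where "m i = measure \<mu> (ball x (q i))" for i
    have gap0: "(\<lambda>i. u (i + p) x - u i x) \<longlonglongrightarrow> 0" for p
    proof (induction p)
      case (Suc p)
      have "(\<lambda>i. (u (Suc (i + p)) x - u (i + p) x) + (u (i + p) x - u i x)) \<longlonglongrightarrow> 0 + 0"
        by (intro tendsto_add Suc LIMSEQ_ignore_initial_segment[OF inc0])
      then show ?case by simp
    qed simp
    have v_lim: "\<exists>n. v p n x \<le> \<eta>" if \<eta>: "\<eta> > 0" for p and \<eta> :: real
    proof -
      have "(\<lambda>j. u (j + (p + p)) x - u j x) \<longlonglongrightarrow> 0" by (rule gap0)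
      then obtain n where "\<And>j. j \<ge> n \<Longrightarrow> norm (u (j + (p + p)) x - u j x - 0) < \<eta>" using LIMSEQ_D[OF _ \<eta>] by blast
      then have "e p j x \<le> \<eta>" if "j \<ge> n" for j using that by (auto simp: e_def add.assoc less_imp_le)
      then have "v p n x \<le> \<eta>" unfolding v_def by (intro cSUP_least) auto
      then show ?thesis by blast
    qed
    define Cst where "Cst = (L + M) * C0 * 2 ^ (s + 1) + M * C1 * 2 ^ (s + 3)"
    have Cst: "Cst \<ge> 0" unfolding Cst_def using L0 M C0_pos C1_pos by simp
    have key: "norm (u i x - h x) \<le> D * (3 * \<eta> + Cst * Q * q p)"
      if \<eta>: "\<eta> > 0" and p: "p \<ge> 2" and n: "v p n x \<le> \<eta>" "n \<le> i" and pos: "m (Suc (i + p)) > 0"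
        and doub: "m (i + p) \<le> D * m (Suc (i + p))"
        and R1: "(\<integral>y. indicator (ball x (2 * q (Suc (i + p)))) y * norm (v p n y - v p n x) \<partial>\<mu>) \<le> \<eta> * measure \<mu> (ball x (5 * (2 * q (Suc (i + p)))))"
        and R2: "(\<integral>y. indicator (ball x (2 * q (Suc (i + p)))) y * norm (h y - h x) \<partial>\<mu>) \<le> \<eta> * measure \<mu> (ball x (5 * (2 * q (Suc (i + p)))))"
      for i p n \<eta>
    proof -
      define R where "R = q (Suc (i + p))"
      have R: "R > 0" "R \<le> 1" using q_simps(1,2) by (auto simp: R_def simp del: power_Suc)
      have QR: "Q * R = q (i + p)" by (simp add: R_def)
      let ?G = "bump x R"
      define mR where "mR = measure \<mu> (ball x R)"
      have mR: "mR > 0" using pos by (simp add: mR_def m_def R_def)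
      have mle: "measure \<mu> (ball x t) \<le> D * mR" if "t \<le> Q * R" for t
      proof -
        have "measure \<mu> (ball x t) \<le> measure \<mu> (ball x (Q * R))" using that by (rule measure_ball_mono)
        also have "\<dots> \<le> D * mR" using doub by (simp add: QR m_def mR_def R_def)
        finally show ?thesis .
      qed
      define I where "I = (\<integral>y. ?G y \<partial>\<mu>)"
      have I: "mR \<le> I"
      proof -
        have "mR = (\<integral>y. indicator (ball x R) y \<partial>\<mu>)" by (simp add: mR_def)
        also have "\<dots> \<le> I" unfolding I_def
        proof (rule integral_mono)
          show "integrable \<mu> (indicator (ball x R) :: 'a \<Rightarrow> real)" using emeasure_bounded_finite[of "ball x R"] by simp
          show "indicator (ball x R) y \<le> ?G y" for y using bump_bounds[of x R y] bump_eq_1[OF R(1), of y x] by (auto simp: indicator_def)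
        qed (rule integrable_bump[OF R(1)])
        finally show ?thesis .
      qed
      have ui: "integrable \<mu> (\<lambda>y. indicator (ball 0 r) y *\<^sub>R u j y)" for r j
        by (rule integrable_test_function_mult[OF mu _ iu, where M=1 and r=r]) (auto simp: indicator_def)
      note avh = bump_average_diff[OF h R(1), of x]
      note avu = bump_average_diff[OF mu ui R(1), of x]
      have A: "norm ((\<integral>y. ?G y *\<^sub>R h y \<partial>\<mu>) - I *\<^sub>R h x) \<le> \<eta> * (D * mR)"
      proof -
        have "norm ((\<integral>y. ?G y *\<^sub>R h y \<partial>\<mu>) - I *\<^sub>R h x) \<le> (\<integral>y. indicator (ball x (2 * R)) y * norm (h y - h x) \<partial>\<mu>)"
          unfolding I_def by (rule avh(3))
        also have "\<dots> \<le> \<eta> * measure \<mu> (ball x (5 * (2 * R)))" using R2 by (simp add: R_def)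
        also have "\<dots> \<le> \<eta> * (D * mR)" using \<eta> R by (intro mult_left_mono mle) auto
        finally show ?thesis .
      qed
      have B: "norm ((\<integral>y. ?G y *\<^sub>R h y \<partial>\<mu>) - (\<integral>y. ?G y *\<^sub>R u (i + p + p) y \<partial>\<mu>)) \<le> C0 * 2 ^ (s + 1) * ((L + M) * (Q * q p)) * (D * mR)"
      \<comment> \<open>The estimate holds for all \<open>u j\<close> with
        \<open>j \<ge> i + p + p\<close>, uniformly in \<open>j\<close>, and is therefore inherited
        by \<open>h\<close>.\<close>
      proof (rule hw[where M=1 and r="norm x + 2 * R" and n="i + p + p"])
        show "y \<in> ball 0 (norm x + 2 * R)" if "?G y \<noteq> 0" for y
        proof -
          have "y \<in> ball x (2 * R)" using bump_eq_0[OF R(1)] that by blast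
          then show "y \<in> ball 0 (norm x + 2 * R)"
            using norm_triangle_ineq[of x "y - x"] by (auto simp: dist_norm norm_minus_commute)
        qed
        show "norm ((\<integral>y. ?G y *\<^sub>R u j y \<partial>\<mu>) - (\<integral>y. ?G y *\<^sub>R u (i + p + p) y \<partial>\<mu>)) \<le> C0 * 2 ^ (s + 1) * ((L + M) * (Q * q p)) * (D * mR)"
          if j: "i + p + p \<le> j" for j
        proof -
          have \<rho>: "q (i + p + p) = R * (Q * q p)" by (simp add: R_def power_add)
          have Qq: "2 * (Q * q p) \<le> 1"
          proof -
            have "q p \<le> q 2" using p by (intro power_decreasing) auto
            then show ?thesis by (simp add: power2_eq_square)
          qed
          have \<rho>R: "2 * q (i + p + p) \<le> R" unfolding \<rho> using mult_left_mono[OF Qq, of R] R by simp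
          have "norm ((\<integral>y. ?G y *\<^sub>R u j y \<partial>\<mu>) - (\<integral>y. ?G y *\<^sub>R u (i + p + p) y \<partial>\<mu>)) \<le> C0 * 2 ^ (s + 1) * q (i + p + p) * (L + M / R) * measure \<mu> (ball x (4 * R))"
            unfolding u_def using j by (intro near_pairing_bound[OF mf M(2) fL fs R(1) _ _ \<rho>R]) (auto intro: power_decreasing)
          also have "\<dots> \<le> C0 * 2 ^ (s + 1) * q (i + p + p) * (L + M / R) * (D * mR)"
            using C0_pos L0 M R by (intro mult_left_mono mle mult_nonneg_nonneg add_nonneg_nonneg) auto
          also have "C0 * 2 ^ (s + 1) * q (i + p + p) * (L + M / R) = C0 * 2 ^ (s + 1) * ((L * R + M) * (Q * q p))"
            unfolding \<rho> using R by (simp add: field_simps)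
          also have "C0 * 2 ^ (s + 1) * ((L * R + M) * (Q * q p)) * (D * mR) \<le> C0 * 2 ^ (s + 1) * ((L + M) * (Q * q p)) * (D * mR)"
          proof (intro mult_right_mono mult_left_mono)
            show "L * R + M \<le> L + M" using L0 R mult_left_mono[of R 1 L] by simp
          qed (use C0_pos D1 mR in auto)
          finally show "norm ((\<integral>y. ?G y *\<^sub>R u j y \<partial>\<mu>) - (\<integral>y. ?G y *\<^sub>R u (i + p + p) y \<partial>\<mu>)) \<le> C0 * 2 ^ (s + 1) * ((L + M) * (Q * q p)) * (D * mR)" .
        qed
      qed (auto simp: bump_bounds)
      have C: "norm ((\<integral>y. ?G y *\<^sub>R u (i + p + p) y \<partial>\<mu>) - (\<integral>y. ?G y *\<^sub>R u i y \<partial>\<mu>)) \<le> 2 * \<eta> * (D * mR)"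
      proof -
        have iV: "integrable \<mu> (\<lambda>y. indicator (ball x (2 * R)) y * norm (v p n y - v p n x))"
          by (rule bump_average_diff(2)[OF mv iv R(1)])
        have "(\<integral>y. ?G y *\<^sub>R u (i + p + p) y \<partial>\<mu>) - (\<integral>y. ?G y *\<^sub>R u i y \<partial>\<mu>) = (\<integral>y. ?G y *\<^sub>R u (i + p + p) y - ?G y *\<^sub>R u i y \<partial>\<mu>)"
          by (rule Bochner_Integration.integral_diff[OF avu(1) avu(1), symmetric])
        also have "norm \<dots> \<le> (\<integral>y. indicator (ball x (2 * R)) y * norm (v p n y - v p n x) + \<eta> * indicator (ball x (2 * R)) y \<partial>\<mu>)"
        proof (rule Bochner_Integration.integral_norm_bound_integral[OF Bochner_Integration.integrable_diff[OF avu(1) avu(1)]])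
          show "integrable \<mu> (\<lambda>y. indicator (ball x (2 * R)) y * norm (v p n y - v p n x) + \<eta> * indicator (ball x (2 * R)) y)"
            using iV emeasure_bounded_finite[of "ball x (2 * R)"] by (intro Bochner_Integration.integrable_add) auto
          fix y
          show "norm (?G y *\<^sub>R u (i + p + p) y - ?G y *\<^sub>R u i y) \<le> indicator (ball x (2 * R)) y * norm (v p n y - v p n x) + \<eta> * indicator (ball x (2 * R)) y"
          proof (cases "y \<in> ball x (2 * R)")
            case True
            have "norm (?G y *\<^sub>R u (i + p + p) y - ?G y *\<^sub>R u i y) = ?G y * e p i y"
              using bump_bounds[of x R y] by (simp add: e_def flip: scaleR_diff_right)
            also have "\<dots> \<le> 1 * e p i y" using bump_bounds[of x R y] e0 by (intro mult_right_mono) auto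
            also have "\<dots> \<le> v p n y" using ev[OF n(2)] by simp
            also have "\<dots> \<le> norm (v p n y - v p n x) + \<eta>" using n(1) by simp
            finally show ?thesis using True by simp
          next
            case False
            then show ?thesis using bump_eq_0[OF R(1) False] by simp
          qed
        qed
        also have "\<dots> = (\<integral>y. indicator (ball x (2 * R)) y * norm (v p n y - v p n x) \<partial>\<mu>) + \<eta> * measure \<mu> (ball x (2 * R))"
          using iV emeasure_bounded_finite[of "ball x (2 * R)"] by (subst Bochner_Integration.integral_add) auto
        also have "\<dots> \<le> \<eta> * measure \<mu> (ball x (5 * (2 * R))) + \<eta> * measure \<mu> (ball x (2 * R))"
          using R1 by (simp add: R_def)
        also have "\<dots> \<le> \<eta> * (D * mR) + \<eta> * (D * mR)" using \<eta> R by (intro add_mono mult_left_mono mle) auto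
        finally show ?thesis by (simp add: algebra_simps)
      qed
      have Dd: "norm ((\<integral>y. ?G y *\<^sub>R u i y \<partial>\<mu>) - I *\<^sub>R u i x) \<le> (M * C1 * 2 ^ (s + 3) * (Q * q p)) * (D * mR)"
      proof -
        define Kf where "Kf = M * C1 * 2 ^ (s + 3) * R / q i"
        have Rq: "R / q i = q (Suc p)" by (simp add: R_def power_add)
        have Kf: "Kf = M * C1 * 2 ^ (s + 3) * q (Suc p)" unfolding Kf_def Rq[symmetric] by simp
        have "8 * R \<le> q i"
        proof -
          have "8 * q (Suc p) \<le> 1" using q_simps(2)[of p] by simp
          then show ?thesis unfolding Rq[symmetric] by (simp add: field_simps)
        qed
        then have osc: "norm (u i y - u i x) \<le> Kf" if "y \<in> ball x (2 * R)" for y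
          unfolding u_def Kf_def using that by (intro far_oscillation[OF mf M(2) intf R(1)]) auto
        have "norm ((\<integral>y. ?G y *\<^sub>R u i y \<partial>\<mu>) - I *\<^sub>R u i x) \<le> (\<integral>y. indicator (ball x (2 * R)) y * norm (u i y - u i x) \<partial>\<mu>)"
          unfolding I_def by (rule avu(3))
        also have "\<dots> \<le> (\<integral>y. Kf * indicator (ball x (2 * R)) y \<partial>\<mu>)"
        proof (rule integral_mono[OF avu(2)])
          show "integrable \<mu> (\<lambda>y. Kf * indicator (ball x (2 * R)) y)"
            using emeasure_bounded_finite[of "ball x (2 * R)"] by simp
          show "indicator (ball x (2 * R)) y * norm (u i y - u i x) \<le> Kf * indicator (ball x (2 * R)) y" for y
            using osc[of y] by (auto simp: indicator_def)
        qed
        also have "\<dots> = Kf * measure \<mu> (ball x (2 * R))" by simp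
        also have "\<dots> \<le> (M * C1 * 2 ^ (s + 3) * (Q * q p)) * (D * mR)"
        proof (intro mult_mono)
          have "q (Suc p) \<le> Q * q p" by simp
          then show "Kf \<le> M * C1 * 2 ^ (s + 3) * (Q * q p)" unfolding Kf using M C1_pos by (intro mult_left_mono) auto
          show "measure \<mu> (ball x (2 * R)) \<le> D * mR" using R by (intro mle) auto
        qed (use M C1_pos in auto)
        finally show ?thesis .
      qed
      define a1 a2 a3 where "a1 = (\<integral>y. ?G y *\<^sub>R h y \<partial>\<mu>)" and "a2 = (\<integral>y. ?G y *\<^sub>R u (i + p + p) y \<partial>\<mu>)" and "a3 = (\<integral>y. ?G y *\<^sub>R u i y \<partial>\<mu>)"
      have "I *\<^sub>R (u i x - h x) = (a1 - I *\<^sub>R h x) - (a1 - a2) - (a2 - a3) - (a3 - I *\<^sub>R u i x)"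
        by (simp add: scaleR_diff_right)
      then have "norm (I *\<^sub>R (u i x - h x)) \<le> norm (a1 - I *\<^sub>R h x) + norm (a1 - a2) + norm (a2 - a3) + norm (a3 - I *\<^sub>R u i x)"
        by (simp only:) (intro order_trans[OF norm_triangle_ineq4] add_right_mono order_refl)
      also have "\<dots> \<le> \<eta> * (D * mR) + C0 * 2 ^ (s + 1) * ((L + M) * (Q * q p)) * (D * mR) + 2 * \<eta> * (D * mR) + (M * C1 * 2 ^ (s + 3) * (Q * q p)) * (D * mR)"
        unfolding a1_def a2_def a3_def by (intro add_mono A B C Dd)
      also have "\<dots> = mR * (D * (3 * \<eta> + Cst * Q * q p))" by (simp add: Cst_def algebra_simps)
      finally have "I * norm (u i x - h x) \<le> mR * (D * (3 * \<eta> + Cst * Q * q p))" using I mR by simp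
      moreover have "mR * norm (u i x - h x) \<le> I * norm (u i x - h x)" using I by (intro mult_right_mono) auto
      ultimately have "mR * norm (u i x - h x) \<le> mR * (D * (3 * \<eta> + Cst * Q * q p))" by linarith
      then show ?thesis using mR by simp
    qed
    define c where "c = M * C0 * Q ^ s"
    have c0: "c \<ge> 0" using M C0_pos by (simp add: c_def)
    have dm: "norm (u (Suc (Suc i)) x - u (Suc i) x) \<le> c * Q ^ (Suc i * s) * m i" for i
    proof -
      have "norm (u (Suc (Suc i)) x - u (Suc i) x) \<le> M * C0 / q (Suc (Suc i)) ^ s * measure \<mu> (ball x (2 * q (Suc i)))"
        unfolding u_def using M(2) by (intro Tf_diff_bound[OF mf _ intf]) (auto intro: power_decreasing)
      also have "\<dots> \<le> M * C0 / q (Suc (Suc i)) ^ s * m i"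
        unfolding m_def using M C0_pos by (intro mult_left_mono measure_ball_mono) auto
      also have "M * C0 / q (Suc (Suc i)) ^ s = c * Q ^ (Suc i * s)"
      proof -
        have "1 / q (Suc (Suc i)) ^ s = (Q ^ Suc (Suc i)) ^ s" by (simp add: power_one_over)
        also have "\<dots> = Q ^ s * Q ^ (Suc i * s)" by (simp only: power_Suc[of Q "Suc i"] power_mult_distrib power_mult)
        finally have "M * C0 * (1 / q (Suc (Suc i)) ^ s) = M * C0 * (Q ^ s * Q ^ (Suc i * s))" by (simp only:)
        then show ?thesis by (simp only: c_def mult.assoc times_divide_eq_right mult_1_right)
      qed
      finally show ?thesis .
    qed
    have mm: "m i \<le> (1/Q) ^ (i * s)" for i
      using measure_ball_le[of "q i" x] by (simp add: m_def power_mult)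
    have "convergent (\<lambda>i. u i x)"
    \<comment> \<open>If some ball about \<open>x\<close> is null, the later increments vanish by
      \<open>dm\<close>. Otherwise all masses are positive, as the division at the end of
      \<open>key\<close> requires.\<close>
    proof (cases "\<exists>i. m i = 0")
      case True
      then obtain i0 where i0: "m i0 = 0" by blast
      have "u (Suc (Suc (i0 + j))) x - u (Suc (i0 + j)) x = 0" for j
      proof -
        have "m (i0 + j) \<le> m i0" unfolding m_def by (intro measure_ball_mono power_decreasing) auto
        then have "m (i0 + j) = 0" using i0 by (simp add: m_def measure_le_0_iff)
        then show ?thesis using dm[of "i0 + j"] by simp
      qed
      then have "u (Suc (i0 + j)) x = u (Suc i0) x" for j by (induction j) auto
      then have "(\<lambda>j. u (j + Suc i0) x) \<longlonglongrightarrow> u (Suc i0) x" by (simp add: add.commute)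
      then have "(\<lambda>j. u j x) \<longlonglongrightarrow> u (Suc i0) x" by (rule LIMSEQ_offset)
      then show ?thesis by (auto simp: convergent_def)
    next
      case False
      then have mpos: "m i > 0" for i using measure_nonneg[of \<mu> "ball x (q i)"] by (simp add: m_def order_less_le)
      show ?thesis
      proof (rule scale_sequence_convergent[OF inc0 c0 dm mm])
        fix \<epsilon> :: real assume \<epsilon>: "\<epsilon> > 0"
        \<comment> \<open>Order of choice: \<open>p\<close> for the terms governed by the separation
          of scales, then \<eta> with \<open>D * (3 * \<eta>) = \<epsilon> / 3\<close>, then
          \<open>n\<close> and the radii of differentiation, which depend on
          \<open>p\<close>.\<close>
        have "(\<lambda>p. D * (Cst * Q * q p)) \<longlonglongrightarrow> D * (Cst * Q * 0)" by (intro tendsto_intros LIMSEQ_realpow_zero) auto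
        then have "eventually (\<lambda>p. D * (Cst * Q * q p) < \<epsilon> / 3) sequentially"
          using \<epsilon> by (intro order_tendstoD(2)) auto
        then obtain p0 where "\<And>p. p \<ge> p0 \<Longrightarrow> D * (Cst * Q * q p) < \<epsilon> / 3" by (auto simp: eventually_sequentially)
        then obtain p where p: "p \<ge> 2" "D * (Cst * Q * q p) < \<epsilon> / 3" by (meson max.cobounded1 max.cobounded2)
        define \<eta> where "\<eta> = \<epsilon> / (9 * D)"
        have \<eta>: "\<eta> > 0" using \<epsilon> D1 by (simp add: \<eta>_def)
        obtain n where n: "v p n x \<le> \<eta>" using v_lim[OF \<eta>] by blast
        obtain r1 where r1: "r1 > 0" "\<And>R. 0 < R \<Longrightarrow> R < r1 \<Longrightarrow>
           (\<integral>y. indicator (ball x R) y * norm (v p n y - v p n x) \<partial>\<mu>) \<le> \<eta> * measure \<mu> (ball x (5 * R))"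
          using elim(1) \<eta> by meson
        obtain r2 where r2: "r2 > 0" "\<And>R. 0 < R \<Longrightarrow> R < r2 \<Longrightarrow>
           (\<integral>y. indicator (ball x R) y * norm (h y - h x) \<partial>\<mu>) \<le> \<eta> * measure \<mu> (ball x (5 * R))"
          using elim(3) \<eta> by meson
        have "(\<lambda>i. 2 * q i) \<longlonglongrightarrow> 2 * 0" by (intro tendsto_intros LIMSEQ_realpow_zero) auto
        then have "eventually (\<lambda>i. 2 * q i < min r1 r2) sequentially"
          using r1(1) r2(1) by (intro order_tendstoD(2)) auto
        then obtain N1 where N1: "\<And>i. i \<ge> N1 \<Longrightarrow> 2 * q i < min r1 r2" by (auto simp: eventually_sequentially)
        obtain N2 where N2: "\<And>i. i \<ge> N2 \<Longrightarrow> norm (u (i + Suc p) x - u i x - 0) < \<epsilon> / 3"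
          using LIMSEQ_D[OF gap0[of "Suc p"], of "\<epsilon> / 3"] \<epsilon> by auto
        show "\<exists>N. \<forall>i\<ge>N. m i \<le> Q ^ (s + 1) * m (Suc i) \<longrightarrow> norm (u (Suc i) x - h x) \<le> \<epsilon>"
        proof (intro exI[of _ "n + N1 + N2 + p"] allI impI)
          fix k assume k: "n + N1 + N2 + p \<le> k" and doub: "m k \<le> Q ^ (s + 1) * m (Suc k)"
          \<comment> \<open>The doubling index \<open>k\<close> plays the role of
            \<open>i + p\<close> in \<open>key\<close>; the \<open>Suc p\<close> increments from
            \<open>i\<close> to \<open>Suc k\<close> are covered by \<open>N2\<close>.\<close>
          define i where "i = k - p"
          have ik: "k = i + p" "n \<le> i" "N2 \<le> i" using k by (auto simp: i_def)
          have small: "2 * q (Suc (i + p)) < min r1 r2" using k ik by (intro N1) auto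
          have qp: "0 < 2 * q (Suc (i + p))" using q_simps(1)[of "Suc (i + p)"] by (simp del: power_Suc)
          have sm: "2 * q (Suc (i + p)) < r1" "2 * q (Suc (i + p)) < r2" using small by auto
          have "norm (u i x - h x) \<le> D * (3 * \<eta> + Cst * Q * q p)"
            by (rule key[OF \<eta> p(1) n ik(2) mpos _ r1(2)[OF qp sm(1)] r2(2)[OF qp sm(2)]]) (use doub in \<open>simp add: ik(1) D_def\<close>)
          also have "\<dots> = \<epsilon> / 3 + D * (Cst * Q * q p)" using D1 by (simp add: \<eta>_def field_simps)
          finally have "norm (u i x - h x) \<le> \<epsilon> / 3 + \<epsilon> / 3" using p(2) by linarith
          moreover have "norm (u (Suc k) x - u i x) < \<epsilon> / 3" using N2[OF ik(3)] by (simp add: ik(1))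
          ultimately show "norm (u (Suc k) x - h x) \<le> \<epsilon>"
            using norm_triangle_ineq[of "u (Suc k) x - u i x" "u i x - h x"] by simp
        qed
      qed
    qed
    then show "convergent (\<lambda>i. Tf f (q i) x)" by (simp add: u_def)
  qed
qed

end

section \<open>Flatness\<close>

lemma ennreal_cancel:
  assumes "c > 0"
  shows "ennreal (1 / c) * (ennreal c * y) = y" "ennreal c * (ennreal (1 / c) * y) = y"
  using assms by (simp_all add: mult.assoc[symmetric] ennreal_mult[symmetric])

section \<open>Homotheties and the Hausdorff measure of a plane\<close>

definition homothety :: "'a::euclidean_space \<Rightarrow> real \<Rightarrow> 'a \<Rightarrow> 'a" where
  "homothety x c y = x + c *\<^sub>R (y - x)"

lemma homothety_inverse: "c \<noteq> 0 \<Longrightarrow> homothety x c (homothety x (1 / c) y) = y"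
  by (simp add: homothety_def)

lemma dist_homothety: "dist (homothety x c y) (homothety x c z) = \<bar>c\<bar> * dist y z"
proof -
  have "homothety x c y - homothety x c z = c *\<^sub>R (y - z)" by (simp add: homothety_def algebra_simps)
  then show ?thesis by (simp add: dist_norm)
qed

text \<open>A cover is transported by the homothety, which multiplies diameters by at most
  \<open>\<bar>c\<bar>\<close>. Equality for the outer measure follows later by applying the
  inequality to the inverse homothety.\<close>

lemma hausdorff_content_homothety_le:
  fixes A :: "'a::euclidean_space set"
  assumes c: "c \<noteq> 0" and \<delta>: "\<delta> > 0"
  shows "hausdorff_content s (\<bar>c\<bar> * \<delta>) (homothety x c ` A) \<le> ennreal (\<bar>c\<bar> ^ s) * hausdorff_content s \<delta> A"
proof -
  let ?g = "homothety x c"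
  have c0: "\<bar>c\<bar> ^ s > 0" using c by simp
  \<comment> \<open>The factor is moved to the left, so that the infimum over covers can be taken on
    the right.\<close>
  have *: "ennreal (1 / \<bar>c\<bar> ^ s) * hausdorff_content s (\<bar>c\<bar> * \<delta>) (?g ` A) \<le> (\<Sum>i. ennreal (diameter (E i) ^ s))"
    if E: "A \<subseteq> (\<Union>i. E i)" "\<And>i. bounded (E i)" "\<And>i. diameter (E i) \<le> \<delta>" for E :: "nat \<Rightarrow> 'a set"
  proof -
    have d: "diameter (?g ` E i) \<le> \<bar>c\<bar> * diameter (E i)" for i
    proof (rule diameter_le)
      show "?g ` E i \<noteq> {} \<or> 0 \<le> \<bar>c\<bar> * diameter (E i)" using diameter_ge_0[OF E(2)] by simp
      fix y z assume "y \<in> ?g ` E i" "z \<in> ?g ` E i"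
      then obtain y' z' where "y = ?g y'" "z = ?g z'" "y' \<in> E i" "z' \<in> E i" by blast
      then show "norm (y - z) \<le> \<bar>c\<bar> * diameter (E i)"
        using diameter_bounded_bound[OF E(2)] by (simp add: dist_homothety[unfolded dist_norm] mult_left_mono dist_norm)
    qed
    have b: "bounded (?g ` E i)" for i
    proof -
      have "?g ` E i = (\<lambda>y. (x - c *\<^sub>R x) + y) ` (\<lambda>y. c *\<^sub>R y) ` E i"
        by (simp add: image_image homothety_def algebra_simps)
      then show ?thesis using bounded_translation[OF bounded_scaling[OF E(2)]] by simp
    qed
    have "hausdorff_content s (\<bar>c\<bar> * \<delta>) (?g ` A) \<le> (\<Sum>i. ennreal (diameter (?g ` E i) ^ s))"
      unfolding hausdorff_content_def
    proof (rule INF_lower, intro CollectI conjI allI)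
      show "?g ` A \<subseteq> (\<Union>i. ?g ` E i)" using E(1) by blast
      show "diameter (?g ` E i) \<le> \<bar>c\<bar> * \<delta>" for i using d[of i] mult_left_mono[OF E(3)[of i], of "\<bar>c\<bar>"] by simp
    qed (rule b)
    also have "\<dots> \<le> (\<Sum>i. ennreal (\<bar>c\<bar> ^ s) * ennreal (diameter (E i) ^ s))"
    proof (intro suminf_le)
      fix i
      have "diameter (?g ` E i) ^ s \<le> (\<bar>c\<bar> * diameter (E i)) ^ s"
        using d[of i] diameter_ge_0[OF b] by (intro power_mono)
      then show "ennreal (diameter (?g ` E i) ^ s) \<le> ennreal (\<bar>c\<bar> ^ s) * ennreal (diameter (E i) ^ s)"
        using diameter_ge_0[OF E(2)] by (simp add: ennreal_mult[symmetric] power_mult_distrib ennreal_leI)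
    qed auto
    also have "\<dots> = ennreal (\<bar>c\<bar> ^ s) * (\<Sum>i. ennreal (diameter (E i) ^ s))" by simp
    finally have "ennreal (1 / \<bar>c\<bar> ^ s) * hausdorff_content s (\<bar>c\<bar> * \<delta>) (?g ` A) \<le> ennreal (1 / \<bar>c\<bar> ^ s) * (ennreal (\<bar>c\<bar> ^ s) * (\<Sum>i. ennreal (diameter (E i) ^ s)))"
      by (rule mult_left_mono) simp
    also have "\<dots> = (\<Sum>i. ennreal (diameter (E i) ^ s))"
      by (rule ennreal_cancel(1)[OF c0])
    finally show ?thesis .
  qed
  have "ennreal (1 / \<bar>c\<bar> ^ s) * hausdorff_content s (\<bar>c\<bar> * \<delta>) (?g ` A) \<le> hausdorff_content s \<delta> A"
    unfolding hausdorff_content_def[of s \<delta> A] by (rule INF_greatest) (use * in auto)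
  then have "ennreal (\<bar>c\<bar> ^ s) * (ennreal (1 / \<bar>c\<bar> ^ s) * hausdorff_content s (\<bar>c\<bar> * \<delta>) (?g ` A)) \<le> ennreal (\<bar>c\<bar> ^ s) * hausdorff_content s \<delta> A"
    by (rule mult_left_mono) simp
  moreover have "ennreal (\<bar>c\<bar> ^ s) * (ennreal (1 / \<bar>c\<bar> ^ s) * y) = y" for y
    by (rule ennreal_cancel(2)[OF c0])
  ultimately show ?thesis by simp
qed

lemma hausdorff_outer_homothety_le:
  fixes A :: "'a::euclidean_space set"
  assumes c: "c \<noteq> 0"
  shows "hausdorff_outer s (homothety x c ` A) \<le> ennreal (\<bar>c\<bar> ^ s) * hausdorff_outer s A"
  unfolding hausdorff_outer_def[of s "homothety x c ` A"]
proof (rule SUP_least)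
  fix \<delta> :: real assume "\<delta> \<in> {0<..}"
  then have \<delta>: "\<delta> / \<bar>c\<bar> > 0" using c by simp
  have "hausdorff_content s \<delta> (homothety x c ` A) \<le> ennreal (\<bar>c\<bar> ^ s) * hausdorff_content s (\<delta> / \<bar>c\<bar>) A"
    using hausdorff_content_homothety_le[OF c \<delta>, of s x A] c by simp
  also have "\<dots> \<le> ennreal (\<bar>c\<bar> ^ s) * hausdorff_outer s A"
    by (intro mult_left_mono hausdorff_content_le_outer \<delta>) simp
  finally show "hausdorff_content s \<delta> (homothety x c ` A) \<le> ennreal (\<bar>c\<bar> ^ s) * hausdorff_outer s A" .
qed

lemma hausdorff_outer_homothety:
  fixes A :: "'a::euclidean_space set"
  assumes c: "c \<noteq> 0"
  shows "hausdorff_outer s (homothety x c ` A) = ennreal (\<bar>c\<bar> ^ s) * hausdorff_outer s A"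
proof (rule antisym[OF hausdorff_outer_homothety_le[OF c]])
  have "homothety x (1 / c) ` (homothety x c ` A) = A"
    using c by (simp add: image_image homothety_def)
  then have "hausdorff_outer s A \<le> ennreal (\<bar>1 / c\<bar> ^ s) * hausdorff_outer s (homothety x c ` A)"
    using hausdorff_outer_homothety_le[of "1 / c" s x "homothety x c ` A"] c by simp
  then have "ennreal (\<bar>c\<bar> ^ s) * hausdorff_outer s A \<le> ennreal (\<bar>c\<bar> ^ s) * (ennreal (\<bar>1 / c\<bar> ^ s) * hausdorff_outer s (homothety x c ` A))"
    by (rule mult_left_mono) simp
  also have "\<dots> = hausdorff_outer s (homothety x c ` A)"
  proof -
    have "\<bar>c\<bar> ^ s * \<bar>1 / c\<bar> ^ s = 1" using c by (simp flip: power_mult_distrib abs_mult)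
    then have "ennreal (\<bar>c\<bar> ^ s) * ennreal (\<bar>1 / c\<bar> ^ s) = 1" by (subst ennreal_mult[symmetric]) auto
    then show ?thesis by (simp only: mult.assoc[symmetric] mult_1)
  qed
  finally show "ennreal (\<bar>c\<bar> ^ s) * hausdorff_outer s A \<le> hausdorff_outer s (homothety x c ` A)" .
qed

lemma sets_hausdorff_measure [simp, measurable_cong]: "sets (hausdorff_measure s :: 'a::euclidean_space measure) = sets borel"
proof -
  have "sigma_sets UNIV (sets (borel :: 'a measure)) = sets (borel :: 'a measure)"
    using sets.sigma_sets_eq[of "borel :: 'a measure"] by simp
  then show ?thesis by (simp add: hausdorff_measure_def)
qed

lemma sets_hausdorff_on [simp, measurable_cong]: "sets (hausdorff_on s A) = sets borel"
  by (simp add: hausdorff_on_def)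

lemma space_hausdorff_on [simp]: "space (hausdorff_on s A) = UNIV"
  using sets_eq_imp_space_eq[OF sets_hausdorff_on, of s A] by simp

locale plane_measure =
  fixes s :: nat and x :: "'a::euclidean_space" and L :: "'a set"
  assumes s: "0 < s" and L: "subspace L"
begin

abbreviation H :: "'a measure" where "H \<equiv> hausdorff_on s ((+) x ` L)"

lemma plane_borel [measurable]: "(+) x ` L \<in> sets borel"
  using closed_translation[OF closed_subspace[OF L]] by (intro borel_closed)

lemma emeasure_H: "B \<in> sets borel \<Longrightarrow> emeasure H B = hausdorff_outer s ((+) x ` L \<inter> B)"
proof -
  assume B: "B \<in> sets borel"
  have "emeasure H B = emeasure (hausdorff_measure s) ((+) x ` L \<inter> B)"
    unfolding hausdorff_on_def using B plane_borel by (intro emeasure_density_indicator) auto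
  also have "\<dots> = hausdorff_outer s ((+) x ` L \<inter> B)"
    using B plane_borel s by (intro emeasure_hausdorff_measure) auto
  finally show ?thesis .
qed

lemma homothety_plane: "c \<noteq> 0 \<Longrightarrow> homothety x c y \<in> (+) x ` L \<longleftrightarrow> y \<in> (+) x ` L"
proof
  assume c: "c \<noteq> 0"
  have mem: "y \<in> (+) x ` L \<longleftrightarrow> y - x \<in> L" for y by (force simp: image_iff)
  show "y \<in> (+) x ` L" if "homothety x c y \<in> (+) x ` L"
  proof -
    have "c *\<^sub>R (y - x) \<in> L" using that by (simp add: mem homothety_def)
    then have "(1 / c) *\<^sub>R (c *\<^sub>R (y - x)) \<in> L" using subspace_scale[OF L] by blast
    then show ?thesis using c by (simp add: mem)
  qed
  show "homothety x c y \<in> (+) x ` L" if "y \<in> (+) x ` L"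
    using that subspace_scale[OF L, of "y - x" c] by (simp add: mem homothety_def)
qed

lemma homothety_image_plane_Int:
  assumes c: "c \<noteq> 0"
  shows "homothety x c ` ((+) x ` L \<inter> homothety x c -` B) = (+) x ` L \<inter> B"
proof (intro equalityI subsetI)
  fix z assume z: "z \<in> (+) x ` L \<inter> B"
  have "z = homothety x c (homothety x (1 / c) z)" by (rule homothety_inverse[OF c, symmetric])
  moreover have "homothety x (1 / c) z \<in> (+) x ` L" using z c homothety_plane[of "1 / c" z] by simp
  ultimately show "z \<in> homothety x c ` ((+) x ` L \<inter> homothety x c -` B)" using z by auto
qed (use homothety_plane[OF c] in auto)

lemma measurable_homothety [measurable]: "homothety x c \<in> borel_measurable borel"
  unfolding homothety_def[abs_def] by measurable

text \<open>The plane passes through the centre \<open>x\<close> and is invariant. One statement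
  yields both properties of \<open>H\<close> that matter: homogeneity for \<open>c > 0\<close> and
  symmetry for \<open>c = -1\<close>.\<close>

lemma emeasure_H_homothety:
  assumes c: "c \<noteq> 0" and B: "B \<in> sets borel"
  shows "emeasure H B = ennreal (\<bar>c\<bar> ^ s) * emeasure H (homothety x c -` B)"
proof -
  have "homothety x c -` B \<in> sets borel" using measurable_sets[OF measurable_homothety B] by simp
  then show ?thesis
    using hausdorff_outer_homothety[OF c, of s x "(+) x ` L \<inter> homothety x c -` B"] B
    by (simp add: emeasure_H homothety_image_plane_Int[OF c])
qed

lemma emeasure_H_ball:
  assumes t: "t > 0"
  shows "emeasure H (ball x t) = ennreal (t ^ s) * emeasure H (ball x 1)"
proof -
  have "homothety x t -` ball x t = ball x 1"
    using t by (auto simp: homothety_def dist_norm norm_minus_commute)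
  then show ?thesis using emeasure_H_homothety[of t "ball x t"] t by simp
qed

text \<open>The reflection in \<open>x\<close> preserves \<open>H\<close>, since its ratio has
  modulus 1, while it changes the sign of the integrand.\<close>

lemma integral_odd_H:
  fixes f :: "'a \<Rightarrow> real"
  assumes f [measurable]: "f \<in> borel_measurable borel" and odd: "\<And>y. f (homothety x (-1) y) = - f y"
  shows "(\<integral>y. f y \<partial>H) = 0"
proof -
  have d: "distr H borel (homothety x (-1)) = H"
  proof (rule measure_eqI)
    fix B assume "B \<in> sets (distr H borel (homothety x (-1)))"
    then have B: "B \<in> sets borel" by simp
    have "emeasure (distr H borel (homothety x (-1))) B = emeasure H (homothety x (-1) -` B)"
      using B by (subst emeasure_distr) auto
    then show "emeasure (distr H borel (homothety x (-1))) B = emeasure H B"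
      using emeasure_H_homothety[of "-1" B] B by simp
  qed simp
  have "(\<integral>y. f y \<partial>H) = (\<integral>y. f y \<partial>distr H borel (homothety x (-1)))" by (simp only: d)
  also have "\<dots> = (\<integral>y. f (homothety x (-1) y) \<partial>H)" by (rule integral_distr) auto
  also have "\<dots> = - (\<integral>y. f y \<partial>H)" by (simp add: odd)
  finally show ?thesis by simp
qed

end

section \<open>Testing flatness with Lipschitz functions\<close>

locale cutoff =
  fixes \<phi> :: "real \<Rightarrow> real"
  assumes cutoff: "smooth_cutoff \<phi>"
begin

lemma \<phi>_nonneg: "t \<ge> 0 \<Longrightarrow> \<phi> t \<ge> 0" and \<phi>_one: "0 \<le> t \<Longrightarrow> t < 3 \<Longrightarrow> \<phi> t = 1"
  using cutoff by (auto simp: smooth_cutoff_def)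

lemma \<phi>_zero: "4 \<le> t \<Longrightarrow> \<phi> t = 0"
proof (rule ccontr)
  assume t: "4 \<le> t" "\<phi> t \<noteq> 0"
  then have "t \<in> {t. 0 \<le> t \<and> \<phi> t \<noteq> 0}" by simp
  then have "t \<in> closure {t. 0 \<le> t \<and> \<phi> t \<noteq> 0}" by (rule subsetD[OF closure_subset])
  moreover have "closure {t. 0 \<le> t \<and> \<phi> t \<noteq> 0} \<subseteq> {0..<4}" using cutoff unfolding smooth_cutoff_def by (elim conjE)
  ultimately have "t \<in> {0..<4}" by (rule subsetD[rotated])
  then show False using t by simp
qed

lemma continuous_\<phi>: "continuous_on {0..} \<phi>"
proof -
  obtain D :: "nat \<Rightarrow> real \<Rightarrow> real" where D: "\<forall>t\<ge>0. D 0 t = \<phi> t" "\<forall>n. \<forall>t\<ge>0. (D n has_real_derivative D (Suc n) t) (at t within {0..})"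
    using cutoff by (auto simp: smooth_cutoff_def)
  have "continuous_on {0..} (D 0)"
    using D(2) by (intro DERIV_continuous_on[of _ _ "D (Suc 0)"]) auto
  then show ?thesis using D(1) by (subst continuous_on_cong[of "{0..}" "{0..}" \<phi> "D 0"]) auto
qed

lemma \<phi>_bounded: obtains F where "F > 0" "\<And>t. t \<ge> 0 \<Longrightarrow> \<phi> t \<le> F"
proof -
  have "compact (\<phi> ` {0..4})" using continuous_on_subset[OF continuous_\<phi>] by (intro compact_continuous_image) auto
  then have "bounded (\<phi> ` {0..4})" by (rule compact_imp_bounded)
  then obtain F where F: "F > 0" "\<And>t. t \<in> {0..4} \<Longrightarrow> norm (\<phi> t) \<le> F" by (auto simp: bounded_pos)
  have "\<phi> t \<le> F" if "t \<ge> 0" for t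
    using F(2)[of t] F(1) \<phi>_zero[of t] that by (cases "t \<le> 4") auto
  then show ?thesis using that F(1) by blast
qed

lemma measurable_\<phi>_norm [measurable]: "r > 0 \<Longrightarrow> (\<lambda>y. \<phi> (norm (y - x) / r)) \<in> borel_measurable borel"
proof (rule borel_measurable_continuous_onI)
  assume r: "r > 0"
  have "continuous_on UNIV (\<lambda>y. norm (y - x) / r)" using r by (intro continuous_intros) auto
  then show "continuous_on UNIV (\<lambda>y. \<phi> (norm (y - x) / r))"
    using r by (intro continuous_on_compose2[OF continuous_\<phi>]) auto
qed

text \<open>The infimum over planes need not be attained; the strict bound \<open>a\<close> provides
  one plane, fixed before the test function. On the support, within distance \<open>2 * r\<close> of
  \<open>x\<close>, the cutoff \<phi> equals 1 and disappears from both integrals.\<close>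

lemma alpha_flat_test:
  fixes \<mu> :: "'a::euclidean_space measure"
  assumes r: "r > 0" and a: "alpha_flat \<phi> s \<mu> x r < ennreal a"
  obtains P where "subspace P"
    "\<And>f. (1 / r)-lipschitz_on UNIV f \<Longrightarrow> (\<And>y. f y \<noteq> 0 \<Longrightarrow> dist x y \<le> 2 * r) \<Longrightarrow>
       \<bar>(\<integral>y. f y \<partial>\<mu>) - flat_density \<phi> s \<mu> P x r * (\<integral>y. f y \<partial>hausdorff_on s ((+) x ` P))\<bar> \<le> a * r ^ s"
proof -
  obtain P where P: "P \<in> grassmannian s" "alpha_plane \<phi> s \<mu> P x r < ennreal a"
    using a unfolding alpha_flat_def INF_less_iff by blast
  show ?thesis
  proof (rule that)
    show "subspace P" using P(1) by (simp add: grassmannian_def)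
    fix f :: "'a \<Rightarrow> real"
    assume l: "(1 / r)-lipschitz_on UNIV f" and supp: "\<And>y. f y \<noteq> 0 \<Longrightarrow> dist x y \<le> 2 * r"
    have cl: "closure {y. f y \<noteq> 0} \<subseteq> cball x (2 * r)"
      using supp by (intro closure_minimal) auto
    have "compact (closure {y. f y \<noteq> 0})"
      using compact_Int_closed[OF compact_cball closed_closure, of x "2 * r" "{y. f y \<noteq> 0}"] cl by (simp add: Int_absorb1 inf.absorb2)
    moreover have "closure {y. f y \<noteq> 0} \<subseteq> ball x (4 * r)" using cl r by force
    ultimately have "f \<in> Lip0 (ball x (4 * r))" using l by (auto simp: Lip0_def)
    moreover have "lip_norm f \<le> 1 / r" using lip_norm_le_iff[OF l] l r by simp
    ultimately have "ennreal \<bar>1 / r ^ s * ((\<integral>y. \<phi> (norm (y - x) / r) * f y \<partial>\<mu>) -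
           flat_density \<phi> s \<mu> P x r * (\<integral>y. \<phi> (norm (y - x) / r) * f y \<partial>hausdorff_on s ((+) x ` P)))\<bar> \<le> alpha_plane \<phi> s \<mu> P x r"
      unfolding alpha_plane_def by (intro SUP_upper) auto
    also have "\<dots> < ennreal a" by fact
    also have "(\<lambda>y. \<phi> (norm (y - x) / r) * f y) = f"
    proof
      fix y
      show "\<phi> (norm (y - x) / r) * f y = f y"
      proof (cases "f y = 0")
        case False
        then have "norm (y - x) / r < 3" using supp[OF False] r by (simp add: dist_norm norm_minus_commute field_simps)
        then show ?thesis using \<phi>_one[of "norm (y - x) / r"] r by simp
      qed simp
    qed
    finally have "\<bar>1 / r ^ s * ((\<integral>y. f y \<partial>\<mu>) - flat_density \<phi> s \<mu> P x r * (\<integral>y. f y \<partial>hausdorff_on s ((+) x ` P)))\<bar> < a"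
      by (simp only: ennreal_less_iff abs_ge_zero)
    then have "\<bar>(\<integral>y. f y \<partial>\<mu>) - flat_density \<phi> s \<mu> P x r * (\<integral>y. f y \<partial>hausdorff_on s ((+) x ` P))\<bar> / r ^ s < a"
      using r by (simp add: abs_mult abs_divide)
    then show "\<bar>(\<integral>y. f y \<partial>\<mu>) - flat_density \<phi> s \<mu> P x r * (\<integral>y. f y \<partial>hausdorff_on s ((+) x ` P))\<bar> \<le> a * r ^ s"
      using r by (simp add: divide_less_eq)
  qed
qed

end

locale flat_growth = growth_measure \<mu> s + cutoff \<phi> for \<mu> :: "'a::euclidean_space measure" and s :: nat and \<phi> :: "real \<Rightarrow> real"
begin

text \<open>Each component of \<open>k (x - y)\<close>, divided by \<open>B * r\<close>, is an
  admissible test function and odd about \<open>x\<close>, so the flat measure contributes 0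
  whatever its density is. The dimension comes from summing over components.\<close>

lemma odd_kernel_test:
  fixes k :: "'a \<Rightarrow> 'c::euclidean_space"
  assumes r: "r > 0" and a: "alpha_flat \<phi> s \<mu> x r < ennreal a"
    and k: "\<And>z z'. norm (k z - k z') \<le> B * norm (z - z')" and B: "B > 0"
    and odd: "\<And>z. k (- z) = - k z" and supp: "\<And>z. k z \<noteq> 0 \<Longrightarrow> norm z \<le> 2 * r"
  shows "norm (\<integral>y. k (x - y) \<partial>\<mu>) \<le> real DIM('c) * (B * r * a * r ^ s)"
proof -
  have lk: "B-lipschitz_on UNIV k" using k B by (auto simp: lipschitz_on_def dist_norm)
  have [measurable]: "k \<in> borel_measurable borel"
    by (intro borel_measurable_continuous_onI lipschitz_on_continuous_on[OF lk])
  have "lipschitz_compact k"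
    unfolding lipschitz_compact_def using lk supp r by (intro conjI exI[of _ B] exI[of _ "3 * r"]) force+
  then obtain Mk where Mk: "\<And>z. norm (k z) \<le> Mk" using lipschitz_compact_bounded by blast
  have ik: "integrable \<mu> (\<lambda>y. k (x - y))"
  proof (rule integrable_bounded_support[where B=Mk and x=x and r="3 * r"])
    fix y assume "k (x - y) \<noteq> 0"
    then have "norm (x - y) \<le> 2 * r" by (rule supp)
    then show "y \<in> ball x (3 * r)" using r by (simp add: dist_norm)
  qed (auto simp: Mk)
  obtain P where P: "subspace P"
    "\<And>f. (1 / r)-lipschitz_on UNIV f \<Longrightarrow> (\<And>y. f y \<noteq> 0 \<Longrightarrow> dist x y \<le> 2 * r) \<Longrightarrow>
       \<bar>(\<integral>y. f y \<partial>\<mu>) - flat_density \<phi> s \<mu> P x r * (\<integral>y. f y \<partial>hausdorff_on s ((+) x ` P))\<bar> \<le> a * r ^ s"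
    using alpha_flat_test[OF r a] by blast
  interpret plane_measure s x P using s_pos P(1) by unfold_locales
  have *: "\<bar>(\<integral>y. k (x - y) \<partial>\<mu>) \<bullet> b\<bar> \<le> B * r * a * r ^ s" if b: "b \<in> Basis" for b
  proof -
    define f where "f y = (k (x - y) \<bullet> b) / (B * r)" for y
    have [measurable]: "f \<in> borel_measurable borel" unfolding f_def[abs_def] by measurable
    have "(1 / r)-lipschitz_on UNIV f"
      unfolding lipschitz_on_def
    proof (intro conjI ballI)
      fix y z
      have "dist (f y) (f z) = \<bar>(k (x - y) - k (x - z)) \<bullet> b\<bar> / (B * r)"
        using B r by (simp add: f_def dist_real_def inner_diff_left diff_divide_distrib[symmetric] abs_divide)
      also have "\<dots> \<le> (B * dist y z) / (B * r)"
      proof (intro divide_right_mono)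
        have "\<bar>(k (x - y) - k (x - z)) \<bullet> b\<bar> \<le> norm (k (x - y) - k (x - z))" by (rule Basis_le_norm[OF b])
        also have "\<dots> \<le> B * norm ((x - y) - (x - z))" by (rule k)
        finally show "\<bar>(k (x - y) - k (x - z)) \<bullet> b\<bar> \<le> B * dist y z" by (simp add: dist_norm norm_minus_commute)
      qed (use B r in simp)
      also have "\<dots> = 1 / r * dist y z" using B by simp
      finally show "dist (f y) (f z) \<le> 1 / r * dist y z" .
    qed (use r in simp)
    moreover have "f y \<noteq> 0 \<Longrightarrow> dist x y \<le> 2 * r" for y using supp[of "x - y"] by (cases "k (x - y) = 0") (auto simp: f_def dist_norm)
    ultimately have "\<bar>(\<integral>y. f y \<partial>\<mu>) - flat_density \<phi> s \<mu> P x r * (\<integral>y. f y \<partial>H)\<bar> \<le> a * r ^ s" by (rule P(2))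
    moreover have "(\<integral>y. f y \<partial>H) = 0"
    proof (rule integral_odd_H)
      fix y
      have "x - homothety x (-1) y = - (x - y)" by (simp add: homothety_def)
      then show "f (homothety x (-1) y) = - f y" using odd[of "x - y"] by (simp add: f_def)
    qed simp
    moreover have "(\<integral>y. f y \<partial>\<mu>) = ((\<integral>y. k (x - y) \<partial>\<mu>) \<bullet> b) / (B * r)"
      unfolding f_def using ik by simp
    ultimately show ?thesis using B r by (simp add: abs_divide abs_mult field_simps)
  qed
  have "norm (\<integral>y. k (x - y) \<partial>\<mu>) \<le> (\<Sum>b\<in>Basis. \<bar>(\<integral>y. k (x - y) \<partial>\<mu>) \<bullet> b\<bar>)" by (rule norm_le_l1)
  also have "\<dots> \<le> (\<Sum>b\<in>(Basis :: 'c set). B * r * a * r ^ s)" by (intro sum_mono *)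
  also have "\<dots> = real DIM('c) * (B * r * a * r ^ s)" by simp
  finally show ?thesis .
qed

text \<open>The annulus is dominated by a Lipschitz layer. By homogeneity the flat mass of that
  layer carries the factor \<open>(1 + 2 * \<kappa>) ^ s - (1 - \<kappa>) ^ s\<close>, small for
  thin layers, and the plane's mass of the unit ball cancels against the denominator of
  \<open>flat_density\<close>. The error of the test is divided by the width, whence
  \<open>Q / \<kappa> * a\<close>.\<close>

lemma thin_annulus:
  assumes r: "r > 0" and a: "alpha_flat \<phi> s \<mu> x r < ennreal a" and a0: "a > 0"
    and \<rho>: "r / Q \<le> \<rho>" "\<rho> \<le> r" and \<kappa>: "0 < \<kappa>" "\<kappa> \<le> 1/2"
    and F: "\<And>t. t \<ge> 0 \<Longrightarrow> \<phi> t \<le> F"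
  shows "measure \<mu> {y. \<rho> < dist x y \<and> dist x y < (1 + \<kappa>) * \<rho>} \<le> (F * 4 ^ s * ((1 + 2 * \<kappa>) ^ s - (1 - \<kappa>) ^ s) + Q / \<kappa> * a) * r ^ s"
proof -
  have \<rho>0: "\<rho> > 0" using \<rho> r by (auto intro: less_le_trans)
  have F0: "F > 0" using F[of 0] \<phi>_one[of 0] by simp
  \<comment> \<open>A trapezoid: 1 on the annulus, supported between
    \<open>(1 - \<kappa>) * \<rho>\<close> and \<open>(1 + 2 * \<kappa>) * \<rho>\<close>, with
    slopes of modulus \<open>1 / (\<kappa> * \<rho>)\<close>.\<close>
  define e where "e t = max 0 (min 1 (min ((t - (1 - \<kappa>) * \<rho>) / (\<kappa> * \<rho>)) (((1 + 2 * \<kappa>) * \<rho> - t) / (\<kappa> * \<rho>))))" for t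
  have e01: "0 \<le> e t" "e t \<le> 1" for t by (auto simp: e_def)
  have kr0: "\<kappa> * \<rho> > 0" using \<kappa> \<rho>0 by simp
  have e1: "e t = 1" if "\<rho> < t" "t < (1 + \<kappa>) * \<rho>" for t
  proof -
    have "1 \<le> (t - (1 - \<kappa>) * \<rho>) / (\<kappa> * \<rho>)" "1 \<le> ((1 + 2 * \<kappa>) * \<rho> - t) / (\<kappa> * \<rho>)"
      using that kr0 by (simp_all add: le_divide_eq algebra_simps)
    then show ?thesis by (simp add: e_def)
  qed
  have e0: "(1 - \<kappa>) * \<rho> < t \<and> t < (1 + 2 * \<kappa>) * \<rho>" if "e t \<noteq> 0" for t
  proof -
    have *: "0 < a \<and> 0 < b" if "max 0 (min 1 (min a b)) \<noteq> 0" for a b :: real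
      using that by (auto simp: max_def min_def split: if_splits)
    have "0 < (t - (1 - \<kappa>) * \<rho>) / (\<kappa> * \<rho>) \<and> 0 < ((1 + 2 * \<kappa>) * \<rho> - t) / (\<kappa> * \<rho>)"
      by (rule *) (rule that[unfolded e_def])
    then show ?thesis using kr0 by (simp add: zero_less_divide_iff)
  qed
  have el: "\<bar>e t - e u\<bar> \<le> \<bar>t - u\<bar> / (\<kappa> * \<rho>)" for t u
  proof -
    have "\<bar>e t - e u\<bar> \<le> max \<bar>(t - (1 - \<kappa>) * \<rho>) / (\<kappa> * \<rho>) - (u - (1 - \<kappa>) * \<rho>) / (\<kappa> * \<rho>)\<bar> \<bar>((1 + 2 * \<kappa>) * \<rho> - t) / (\<kappa> * \<rho>) - ((1 + 2 * \<kappa>) * \<rho> - u) / (\<kappa> * \<rho>)\<bar>"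
    proof -
      have 1: "\<bar>max 0 (min 1 c) - max 0 (min 1 c')\<bar> \<le> \<bar>c - c'\<bar>" for c c' :: real
        by (auto simp: max_def min_def)
      have 2: "\<bar>min a b - min a' b'\<bar> \<le> max \<bar>a - a'\<bar> \<bar>b - b'\<bar>" for a b a' b' :: real
        by (auto simp: max_def min_def)
      show ?thesis unfolding e_def by (rule order_trans[OF 1 2])
    qed
    also have "\<dots> = \<bar>t - u\<bar> / (\<kappa> * \<rho>)"
      using kr0 by (simp add: diff_divide_distrib[symmetric] abs_divide abs_minus_commute)
    finally show ?thesis .
  qed
  have [measurable]: "e \<in> borel_measurable borel" unfolding e_def[abs_def] by measurable
  have e2: "dist x y \<le> 2 * r" "dist x y < 2 * r" if "e (dist x y) \<noteq> 0" for y
  proof -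
    have "(1 + 2 * \<kappa>) * \<rho> \<le> 2 * r" using \<kappa> \<rho> \<rho>0 by (intro mult_mono) auto
    then show "dist x y < 2 * r" "dist x y \<le> 2 * r" using e0[OF that] by linarith+
  qed
  define f where "f y = \<kappa> * \<rho> / r * e (dist x y)" for y
  have fl: "(1 / r)-lipschitz_on UNIV f"
    unfolding lipschitz_on_def
  proof (intro conjI ballI)
    fix y z
    have c: "\<kappa> * \<rho> / r > 0" using kr0 r by simp
    have "dist (f y) (f z) = \<bar>\<kappa> * \<rho> / r * (e (dist x y) - e (dist x z))\<bar>"
      by (simp only: f_def dist_real_def right_diff_distrib)
    also have "\<dots> = \<kappa> * \<rho> / r * \<bar>e (dist x y) - e (dist x z)\<bar>"
      using c by (simp only: abs_mult abs_of_pos)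
    also have "\<dots> \<le> \<kappa> * \<rho> / r * (dist y z / (\<kappa> * \<rho>))"
    proof (intro mult_left_mono order_trans[OF el] divide_right_mono)
      show "\<bar>dist x y - dist x z\<bar> \<le> dist y z" using abs_dist_diff_le[of y x z] by (simp add: dist_commute)
    qed (use kr0 r in auto)
    also have "\<dots> = 1 / r * dist y z" using \<kappa>(1) \<rho>0 by simp
    finally show "dist (f y) (f z) \<le> 1 / r * dist y z" .
  qed (use r in simp)
  obtain P where P: "subspace P"
    "\<And>f. (1 / r)-lipschitz_on UNIV f \<Longrightarrow> (\<And>y. f y \<noteq> 0 \<Longrightarrow> dist x y \<le> 2 * r) \<Longrightarrow>
       \<bar>(\<integral>y. f y \<partial>\<mu>) - flat_density \<phi> s \<mu> P x r * (\<integral>y. f y \<partial>hausdorff_on s ((+) x ` P))\<bar> \<le> a * r ^ s"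
    using alpha_flat_test[OF r a] by blast
  interpret plane_measure s x P using s_pos P(1) by unfold_locales
  define w where "w = (1 + 2 * \<kappa>) ^ s - (1 - \<kappa>) ^ s"
  have w0: "w \<ge> 0" unfolding w_def using \<kappa> by (simp add: power_mono)
  let ?d = "flat_density \<phi> s \<mu> P x r"
  let ?E = "\<integral>y. e (dist x y) \<partial>H"
  have ed: "?d * ?E \<le> F * 4 ^ s * w * r ^ s"
  proof -
    \<comment> \<open>By homogeneity the mass of the unit ball decides that of all balls about
      \<open>x\<close>: all are null, all are infinite, or all are positive and finite.\<close>
    consider "emeasure H (ball x 1) = 0" | "emeasure H (ball x 1) = \<infinity>" | "0 < emeasure H (ball x 1)" "emeasure H (ball x 1) < \<infinity>"
      by (metis infinity_ennreal_def less_top zero_less_iff_neq_zero)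
    then show ?thesis
    proof cases
      case 1
      have "emeasure H (ball x (2 * r)) = 0" using emeasure_H_ball[of "2 * r"] r 1 by simp
      then have "AE y in H. e (dist x y) = 0"
        by (intro AE_I[of _ _ "ball x (2 * r)"]) (use e2(2) in auto)
      then have "?E = 0" by (rule integral_eq_zero_AE)
      then show ?thesis using F0 w0 r by simp
    next
      case 2
      \<comment> \<open>the denominator of \<open>flat_density\<close> is then the junk value \<open>0\<close>, and so is the quotient\<close>
      have "\<not> integrable H (\<lambda>y. \<phi> (norm (y - x) / r))"
      proof
        assume i: "integrable H (\<lambda>y. \<phi> (norm (y - x) / r))"
        have "emeasure H (ball x (3 * r)) = (\<integral>\<^sup>+y. indicator (ball x (3 * r)) y \<partial>H)" by simp
        also have "\<dots> \<le> (\<integral>\<^sup>+y. ennreal (norm (\<phi> (norm (y - x) / r))) \<partial>H)"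
        proof (intro nn_integral_mono)
          fix y
          show "indicator (ball x (3 * r)) y \<le> ennreal (norm (\<phi> (norm (y - x) / r)))"
            using \<phi>_one[of "norm (y - x) / r"] r by (auto simp: indicator_def dist_norm norm_minus_commute field_simps)
        qed
        also have "\<dots> < \<infinity>" using i by (simp add: integrable_iff_bounded)
        finally show False using emeasure_H_ball[of "3 * r"] r 2 by (simp add: ennreal_mult_top)
      qed
      then have "?d = 0" by (simp add: flat_density_def not_integrable_integral_eq)
      then show ?thesis using F0 w0 r by simp
    next
      case 3
      define h where "h = measure H (ball x 1)"
      have emh: "emeasure H (ball x 1) = ennreal h" using 3 by (simp add: h_def emeasure_eq_ennreal_measure)
      have h: "h > 0" using 3 unfolding emh by simp
      have emb: "emeasure H (ball x t) = ennreal (t ^ s * h)" if "t > 0" for t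
        using emeasure_H_ball[OF that] emh that h by (simp add: ennreal_mult)
      have mb: "measure H (ball x t) = t ^ s * h" if "t > 0" for t
        using emb[OF that] that h by (simp add: Sigma_Algebra.measure_def)
      have fin: "emeasure H (ball x t) < \<infinity>" if "t > 0" for t using emb[OF that] by simp
      have i\<phi>: "integrable H (\<lambda>y. \<phi> (norm (y - x) / r))"
      proof (rule Bochner_Integration.integrable_bound[where f="\<lambda>y. F * indicator (ball x (4 * r)) y"])
        show "integrable H (\<lambda>y. F * indicator (ball x (4 * r)) y)" using fin[of "4 * r"] r by simp
        show "AE y in H. norm (\<phi> (norm (y - x) / r)) \<le> norm (F * indicator (ball x (4 * r)) y)"
        proof (intro AE_I2)
          fix y
          have n: "\<phi> (norm (y - x) / r) \<ge> 0" "\<phi> (norm (y - x) / r) \<le> F" using F \<phi>_nonneg r by auto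
          have "\<phi> (norm (y - x) / r) = 0" if "y \<notin> ball x (4 * r)"
            using that r by (intro \<phi>_zero) (auto simp: dist_norm norm_minus_commute field_simps)
          then show "norm (\<phi> (norm (y - x) / r)) \<le> norm (F * indicator (ball x (4 * r)) y)" using n by (auto simp: indicator_def)
        qed
      qed (use r in measurable)
      have I\<phi>: "h * r ^ s \<le> (\<integral>y. \<phi> (norm (y - x) / r) \<partial>H)"
      proof -
        have "h * r ^ s = (\<integral>y. indicator (ball x r) y \<partial>H)" using mb[OF r] by simp
        also have "\<dots> \<le> (\<integral>y. \<phi> (norm (y - x) / r) \<partial>H)"
        proof (rule integral_mono[OF _ i\<phi>])
          show "integrable H (indicator (ball x r) :: 'a \<Rightarrow> real)" using fin[OF r] by simp
          fix y
          show "indicator (ball x r) y \<le> \<phi> (norm (y - x) / r)"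
            using \<phi>_one[of "norm (y - x) / r"] \<phi>_nonneg[of "norm (y - x) / r"] r
            by (auto simp: indicator_def dist_norm norm_minus_commute field_simps)
        qed
        finally show ?thesis .
      qed
      have "?E \<le> (\<integral>y. indicator (ball x ((1 + 2 * \<kappa>) * \<rho>) - ball x ((1 - \<kappa>) * \<rho>)) y \<partial>H)"
      proof (rule integral_mono)
        have pos: "(1 + 2 * \<kappa>) * \<rho> > 0" using \<kappa> \<rho>0 by simp
        have "emeasure H (ball x ((1 + 2 * \<kappa>) * \<rho>) - ball x ((1 - \<kappa>) * \<rho>)) \<le> emeasure H (ball x ((1 + 2 * \<kappa>) * \<rho>))"
          by (intro emeasure_mono) auto
        then have "emeasure H (ball x ((1 + 2 * \<kappa>) * \<rho>) - ball x ((1 - \<kappa>) * \<rho>)) < \<infinity>" using fin[OF pos] by (rule le_less_trans)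
        then show i2: "integrable H (indicator (ball x ((1 + 2 * \<kappa>) * \<rho>) - ball x ((1 - \<kappa>) * \<rho>)) :: 'a \<Rightarrow> real)" by simp
        show le: "e (dist x y) \<le> indicator (ball x ((1 + 2 * \<kappa>) * \<rho>) - ball x ((1 - \<kappa>) * \<rho>)) y" for y
          using e0[of "dist x y"] e01(2)[of "dist x y"] by (cases "e (dist x y) = 0") (auto simp: indicator_def)
        show "integrable H (\<lambda>y. e (dist x y))"
          by (rule Bochner_Integration.integrable_bound[OF i2]) (use le e01 in \<open>auto intro!: order_trans[OF le abs_ge_self]\<close>)
      qed
      also have "\<dots> = measure H (ball x ((1 + 2 * \<kappa>) * \<rho>) - ball x ((1 - \<kappa>) * \<rho>))" by simp
      also have "\<dots> = measure H (ball x ((1 + 2 * \<kappa>) * \<rho>)) - measure H (ball x ((1 - \<kappa>) * \<rho>))"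
      proof (rule measure_Diff)
        show "emeasure H (ball x ((1 + 2 * \<kappa>) * \<rho>)) \<noteq> \<infinity>" using fin[of "(1 + 2 * \<kappa>) * \<rho>"] \<kappa> \<rho>0 by simp
        show "ball x ((1 - \<kappa>) * \<rho>) \<subseteq> ball x ((1 + 2 * \<kappa>) * \<rho>)" using \<kappa> \<rho>0 by (intro subset_ball mult_right_mono) auto
      qed auto
      also have "\<dots> = h * w * \<rho> ^ s"
      proof -
        have m1: "measure H (ball x ((1 + 2 * \<kappa>) * \<rho>)) = ((1 + 2 * \<kappa>) * \<rho>) ^ s * h"
          by (rule mb) (use \<kappa> \<rho>0 in simp)
        have m2: "measure H (ball x ((1 - \<kappa>) * \<rho>)) = ((1 - \<kappa>) * \<rho>) ^ s * h"
          by (rule mb) (use \<kappa> \<rho>0 in simp)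
        show ?thesis unfolding m1 m2 w_def power_mult_distrib by (simp add: algebra_simps)
      qed
      also have "\<dots> \<le> h * w * r ^ s" using h w0 \<rho> \<rho>0 by (intro mult_left_mono power_mono) auto
      finally have E: "?E \<le> h * w * r ^ s" .
      have E0: "0 \<le> ?E" using e01 by (intro integral_nonneg_AE) auto
      have I\<mu>: "(\<integral>y. \<phi> (norm (y - x) / r) \<partial>\<mu>) \<le> F * 4 ^ s * r ^ s"
      proof -
        have "(\<integral>y. \<phi> (norm (y - x) / r) \<partial>\<mu>) \<le> (\<integral>y. F * indicator (ball x (4 * r)) y \<partial>\<mu>)"
        proof (rule Bochner_Integration.integral_mono')
          show "integrable \<mu> (\<lambda>y. F * indicator (ball x (4 * r)) y)" using emeasure_bounded_finite[of "ball x (4 * r)"] by simp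
          show "0 \<le> F * indicator (ball x (4 * r)) y" for y using F0 by simp
          show "\<phi> (norm (y - x) / r) \<le> F * indicator (ball x (4 * r)) y" for y
          proof (cases "y \<in> ball x (4 * r)")
            case True
            then show ?thesis using F[of "norm (y - x) / r"] r by simp
          next
            case False
            then have "\<phi> (norm (y - x) / r) = 0"
              using r by (intro \<phi>_zero) (auto simp: dist_norm norm_minus_commute field_simps)
            then show ?thesis using False by simp
          qed
        qed
        also have "\<dots> = F * measure \<mu> (ball x (4 * r))" by simp
        also have "\<dots> \<le> F * (4 * r) ^ s" using F0 r by (intro mult_left_mono measure_ball_le) auto
        finally show ?thesis by (simp add: power_mult_distrib)
      qed
      have hr: "h * r ^ s > 0" using h r by simp
      have "?d \<le> (F * 4 ^ s * r ^ s) / (h * r ^ s)"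
        unfolding flat_density_def using I\<mu> I\<phi> hr F0 r by (intro frac_le) auto
      then have "?d * ?E \<le> (F * 4 ^ s * r ^ s) / (h * r ^ s) * (h * w * r ^ s)"
        using E E0 F0 r h by (intro mult_mono) auto
      also have "\<dots> = F * 4 ^ s * w * r ^ s" using h r by simp
      finally show ?thesis .
    qed
  qed
  have emes: "emeasure \<mu> {y. \<rho> < dist x y \<and> dist x y < (1 + \<kappa>) * \<rho>} < \<infinity>"
    by (rule emeasure_bounded_finite, rule bounded_subset[OF bounded_ball[of x "(1 + \<kappa>) * \<rho>"]]) auto
  have ie: "integrable \<mu> (\<lambda>y. e (dist x y))"
    by (rule integrable_bounded_support[where B=1 and x=x and r="2 * r"]) (use e01 e2 in auto)
  have "measure \<mu> {y. \<rho> < dist x y \<and> dist x y < (1 + \<kappa>) * \<rho>} = (\<integral>y. indicator {y. \<rho> < dist x y \<and> dist x y < (1 + \<kappa>) * \<rho>} y \<partial>\<mu>)"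
    by simp
  also have "\<dots> \<le> (\<integral>y. e (dist x y) \<partial>\<mu>)"
  proof (rule integral_mono[OF _ ie])
    show "integrable \<mu> (indicator {y. \<rho> < dist x y \<and> dist x y < (1 + \<kappa>) * \<rho>} :: 'a \<Rightarrow> real)"
      using emes by (intro integrable_real_indicator) auto
    show "indicator {y. \<rho> < dist x y \<and> dist x y < (1 + \<kappa>) * \<rho>} y \<le> e (dist x y)" for y
      using e01(1)[of "dist x y"] e1[of "dist x y"] by (simp add: indicator_def)
  qed
  also have "\<dots> \<le> F * 4 ^ s * w * r ^ s + Q / \<kappa> * a * r ^ s"
  proof -
    have "\<bar>(\<integral>y. f y \<partial>\<mu>) - ?d * (\<integral>y. f y \<partial>H)\<bar> \<le> a * r ^ s"
      using e2(1) by (intro P(2) fl) (auto simp: f_def)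
    moreover have "(\<integral>y. f y \<partial>\<mu>) = \<kappa> * \<rho> / r * (\<integral>y. e (dist x y) \<partial>\<mu>)" "(\<integral>y. f y \<partial>H) = \<kappa> * \<rho> / r * ?E"
      unfolding f_def by simp_all
    ultimately have "\<bar>\<kappa> * \<rho> / r * ((\<integral>y. e (dist x y) \<partial>\<mu>) - ?d * ?E)\<bar> \<le> a * r ^ s" by (simp add: algebra_simps)
    then have "\<kappa> * \<rho> / r * ((\<integral>y. e (dist x y) \<partial>\<mu>) - ?d * ?E) \<le> a * r ^ s" by linarith
    then have "\<kappa> * \<rho> / r * ((\<integral>y. e (dist x y) \<partial>\<mu>) - ?d * ?E) * (r / (\<kappa> * \<rho>)) \<le> a * r ^ s * (r / (\<kappa> * \<rho>))"
      using kr0 r by (intro mult_right_mono) auto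
    then have "(\<integral>y. e (dist x y) \<partial>\<mu>) - ?d * ?E \<le> a * r ^ s * (r / (\<kappa> * \<rho>))"
      using \<kappa>(1) \<rho>0 r by simp
    also have "\<dots> \<le> a * r ^ s * (Q / \<kappa>)"
    proof (intro mult_left_mono)
      have "r \<le> Q * \<rho>" using \<rho> by simp
      then show "r / (\<kappa> * \<rho>) \<le> Q / \<kappa>" using \<kappa> \<rho>0 by (simp add: field_simps)
    qed (use a0 r in auto)
    finally show ?thesis using ed by (simp add: mult_ac)
  qed
  finally show ?thesis by (simp add: w_def algebra_simps)
qed

end

section \<open>Convergence of sharp truncations\<close>

lemma mult_indicator_le: "0 \<le> c \<Longrightarrow> c * indicator A z \<le> (c :: real)"
  by (simp add: indicator_def)

locale flat_cz = cz_L2 \<mu> s K C0 C2 + cutoff \<phi>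
  for \<mu> :: "'a::euclidean_space measure" and s :: nat and K :: "'a \<Rightarrow> 'b::euclidean_space" and C0 C2 :: real and \<phi> :: "real \<Rightarrow> real" +
  assumes flat: "AE x in \<mu>. ((\<lambda>r. alpha_flat \<phi> s \<mu> x r) \<longlongrightarrow> 0) (at_right 0)"
begin

sublocale flat_growth \<mu> s \<phi> ..

lemma alpha_small:
  assumes "((\<lambda>r. alpha_flat \<phi> s \<mu> x r) \<longlongrightarrow> 0) (at_right 0)" "a > 0"
  shows "\<exists>N. \<forall>i\<ge>N. alpha_flat \<phi> s \<mu> x (q i) < ennreal a"
proof -
  have "(\<lambda>i. q i) \<longlonglongrightarrow> 0" by (intro LIMSEQ_realpow_zero) auto
  then have "filterlim (\<lambda>i. q i) (at_right 0) sequentially"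
    by (rule tendsto_imp_filterlim_at_right) auto
  then have "(\<lambda>i. alpha_flat \<phi> s \<mu> x (q i)) \<longlonglongrightarrow> 0" using assms(1) by (rule filterlim_compose[rotated])
  then have "eventually (\<lambda>i. alpha_flat \<phi> s \<mu> x (q i) < ennreal a) sequentially"
    using assms(2) by (intro order_tendstoD(2)) auto
  then show ?thesis by (simp add: eventually_sequentially)
qed

text \<open>The difference of consecutive smooth kernels is odd, vanishes beyond radius
  \<open>2 * q i\<close>, and is Lipschitz with a constant of order
  \<open>1 / q i ^ (s + 1)\<close>. The powers of the scale cancel in
  \<open>odd_kernel_test\<close>, leaving a fixed multiple of the bound on the flat
  coefficient.\<close>

lemma smooth_increments_vanish:
  assumes x: "((\<lambda>r. alpha_flat \<phi> s \<mu> x r) \<longlongrightarrow> 0) (at_right 0)"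
  shows "(\<lambda>i. \<integral>y. kr (q (Suc i)) (x - y) - kr (q i) (x - y) \<partial>\<mu>) \<longlonglongrightarrow> 0"
proof (rule LIMSEQ_I)
  fix e :: real assume e: "e > 0"
  define c where "c = C0 * (2 ^ s + 4) * (Q ^ (s + 1) + 1)"
  have c: "c > 0" unfolding c_def using C0_pos by (intro mult_pos_pos) (auto intro: add_pos_pos)
  define d where "d = real DIM('b) * c"
  have d: "d > 0" using c by (simp add: d_def)
  obtain N where N: "\<And>i. i \<ge> N \<Longrightarrow> alpha_flat \<phi> s \<mu> x (q i) < ennreal (e / (2 * d))"
    using alpha_small[OF x, of "e / (2 * d)"] e d by auto
  show "\<exists>N. \<forall>i\<ge>N. norm ((\<integral>y. kr (q (Suc i)) (x - y) - kr (q i) (x - y) \<partial>\<mu>) - 0) < e"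
  proof (intro exI[of _ N] allI impI)
    fix i assume i: "i \<ge> N"
    define r where "r = q i"
    have r: "r > 0" by (simp add: r_def)
    have qS: "q (Suc i) = r / Q" by (simp add: r_def)
    define k where "k z = kr (q (Suc i)) z - kr (q i) z" for z
    define B where "B = c / r ^ (s + 1)"
    have B: "B > 0" using c r by (simp add: B_def)
    have kl: "norm (k z - k z') \<le> B * norm (z - z')" for z z'
    proof -
      have "k z - k z' = (kr (r / Q) z - kr (r / Q) z') - (kr r z - kr r z')"
        unfolding k_def qS r_def[symmetric] by simp
      then have "norm (k z - k z') \<le> norm (kr (r / Q) z - kr (r / Q) z') + norm (kr r z - kr r z')"
        by (simp only: norm_triangle_ineq4)
      also have "\<dots> \<le> C0 * (2 ^ s + 4) / (r / Q) ^ (s + 1) * norm (z - z') + C0 * (2 ^ s + 4) / r ^ (s + 1) * norm (z - z')"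
        using r by (intro add_mono kr_lipschitz) auto
      also have "\<dots> = B * norm (z - z')"
        using r by (simp add: B_def c_def power_divide field_simps)
      finally show ?thesis .
    qed
    have "norm (\<integral>y. k (x - y) \<partial>\<mu>) \<le> real DIM('b) * (B * r * (e / (2 * d)) * r ^ s)"
    proof (rule odd_kernel_test[OF r _ kl B])
      show "alpha_flat \<phi> s \<mu> x r < ennreal (e / (2 * d))" using N[OF i] by (simp add: r_def)
      show "k (- z) = - k z" for z by (simp add: k_def kr_odd)
      show "norm z \<le> 2 * r" if "k z \<noteq> 0" for z
      proof (rule ccontr)
        assume "\<not> norm z \<le> 2 * r"
        then have "k z = 0" unfolding k_def qS r_def[symmetric] using r by (simp add: kr_eq_K)
        then show False using that by simp
      qed
    qed
    also have "\<dots> = e / 2" using r d c by (simp add: B_def d_def)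
    finally have "norm (\<integral>y. k (x - y) \<partial>\<mu>) \<le> e / 2" .
    then show "norm ((\<integral>y. kr (q (Suc i)) (x - y) - kr (q i) (x - y) \<partial>\<mu>) - 0) < e"
      using e by (simp add: k_def)
  qed
qed

definition sk :: "real \<Rightarrow> real \<Rightarrow> 'a \<Rightarrow> 'b" where
  "sk r \<rho> z = indicator {z. norm z > r} z *\<^sub>R K z - kr \<rho> z"

lemma sk_bounds:
  assumes r: "0 < r" "r \<le> \<rho>"
  shows "norm (sk r \<rho> z) \<le> C0 / norm z ^ s * indicator (ball 0 (2 * \<rho>)) z"
    and "norm (sk r \<rho> z) \<le> C0 / r ^ s * indicator (ball 0 (2 * \<rho>)) z"
proof -
  have z: "sk r \<rho> z = 0" if "2 * \<rho> \<le> norm z" using that r by (simp add: sk_def kr_eq_K)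
  have z': "sk r \<rho> z = 0" if "norm z \<le> r" using that r by (simp add: sk_def kr_eq_0)
  have le: "norm (sk r \<rho> z) \<le> C0 / norm z ^ s"
  proof (cases "norm z \<le> r")
    case True
    then show ?thesis using z' C0_pos by simp
  next
    case False
    then have nz: "z \<noteq> 0" using r by auto
    have "sk r \<rho> z = (1 - ramp (norm z / \<rho>)) *\<^sub>R K z"
      using False by (simp add: sk_def kr_def scaleR_diff_left)
    then have "norm (sk r \<rho> z) = \<bar>1 - ramp (norm z / \<rho>)\<bar> * norm (K z)" by simp
    also have "\<dots> \<le> 1 * (C0 / norm z ^ s)"
      using ramp_bounds[of "norm z / \<rho>"] K_bound[OF nz] by (intro mult_mono) auto
    finally show ?thesis by simp
  qed
  show "norm (sk r \<rho> z) \<le> C0 / norm z ^ s * indicator (ball 0 (2 * \<rho>)) z"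
    using le z by (cases "norm z < 2 * \<rho>") auto
  have "norm (sk r \<rho> z) \<le> C0 / r ^ s"
  proof (cases "norm z \<le> r")
    case True
    then show ?thesis using z' r C0_pos by simp
  next
    case False
    have "C0 / norm z ^ s \<le> C0 / r ^ s" using False r C0_pos by (intro divide_left_mono power_mono mult_pos_pos zero_less_power) auto
    then show ?thesis using le by simp
  qed
  then show "norm (sk r \<rho> z) \<le> C0 / r ^ s * indicator (ball 0 (2 * \<rho>)) z"
    using z by (cases "norm z < 2 * \<rho>") auto
qed

lemma sk_measurable [measurable]:
  assumes "0 < r" "0 < \<rho>" shows "sk r \<rho> \<in> borel_measurable borel"
proof -
  have "sk r \<rho> = (\<lambda>z. indicator {z. norm z > r} z *\<^sub>R kr (r / 2) z - kr \<rho> z)"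
    using kr_eq_K[of "r / 2"] assms by (auto simp: sk_def indicator_def fun_eq_iff)
  moreover have "kr (r / 2) \<in> borel_measurable borel" "kr \<rho> \<in> borel_measurable borel" using assms by auto
  ultimately show ?thesis by simp
qed

text \<open>A sharp cutoff is not Lipschitz. It is replaced by one that rises linearly over a layer
  of relative width \<kappa>: the replacement is odd and Lipschitz, so
  \<open>odd_kernel_test\<close> applies, and the error lives on a thin annulus. Uniformity in
  \<open>r\<close> between consecutive scales is what turns a limit along \<open>q i\<close> into a
  limit in \<open>r\<close>.\<close>

lemma sharp_increments_vanish:
  assumes x: "((\<lambda>r. alpha_flat \<phi> s \<mu> x r) \<longlongrightarrow> 0) (at_right 0)" and e: "e > 0"
  shows "\<exists>N. \<forall>i\<ge>N. \<forall>r. q (Suc i) \<le> r \<longrightarrow> r \<le> q i \<longrightarrow> norm (\<integral>y. sk r (q i) (x - y) \<partial>\<mu>) \<le> e"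
proof -
  obtain F where F: "F > 0" "\<And>t. t \<ge> 0 \<Longrightarrow> \<phi> t \<le> F" using \<phi>_bounded by blast
  \<comment> \<open>first the width \<open>\<kappa>\<close> of the Lipschitz layer is chosen, then the flatness\<close>
  obtain \<kappa> where \<kappa>: "0 < \<kappa>" "\<kappa> \<le> 1/2" "C0 * Q ^ s * (F * 4 ^ s * ((1 + 2 * \<kappa>) ^ s - (1 - \<kappa>) ^ s)) < e / 3"
  proof -
    have "((\<lambda>\<kappa>. C0 * Q ^ s * (F * 4 ^ s * ((1 + 2 * \<kappa>) ^ s - (1 - \<kappa>) ^ s))) \<longlongrightarrow> C0 * Q ^ s * (F * 4 ^ s * ((1 + 2 * 0) ^ s - (1 - 0) ^ s))) (at_right 0)"
      by (intro tendsto_intros)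
    then have "eventually (\<lambda>\<kappa>. C0 * Q ^ s * (F * 4 ^ s * ((1 + 2 * \<kappa>) ^ s - (1 - \<kappa>) ^ s)) < e / 3) (at_right 0)"
      using e by (intro order_tendstoD(2)) auto
    then obtain b where b: "b > 0" "\<And>\<kappa>. 0 < \<kappa> \<Longrightarrow> \<kappa> < b \<Longrightarrow> C0 * Q ^ s * (F * 4 ^ s * ((1 + 2 * \<kappa>) ^ s - (1 - \<kappa>) ^ s)) < e / 3"
      unfolding eventually_at_right_field by blast
    show ?thesis by (rule that[of "min (1/2) (b / 2)"]) (use b in auto)
  qed
  define c where "c = C0 * (2 ^ s / \<kappa> + 4) * Q ^ (s + 1) + C0 * (2 ^ s + 4)"
  have c: "c > 0" unfolding c_def using C0_pos \<kappa> by (intro add_pos_pos mult_pos_pos) (auto intro: add_pos_pos)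
  \<comment> \<open>The first entry serves the odd part, the second the annulus, each for an error
    of \<open>e / 3\<close>; the remaining third was spent on the choice of \<kappa>.\<close>
  define a where "a = min (e / 3 / (real DIM('b) * c)) (e / 3 / (C0 * Q ^ s * (Q / \<kappa>)))"
  have a: "a > 0" using e c C0_pos \<kappa> by (simp add: a_def)
  have a1: "real DIM('b) * c * a \<le> e / 3"
  proof -
    have "a \<le> e / 3 / (real DIM('b) * c)" by (simp add: a_def)
    then show ?thesis using c by (subst (asm) pos_le_divide_eq) (auto simp: mult_ac)
  qed
  have a2: "C0 * Q ^ s * (Q / \<kappa> * a) \<le> e / 3"
  proof -
    have "a \<le> e / 3 / (C0 * Q ^ s * (Q / \<kappa>))" unfolding a_def by (rule min.cobounded2)
    then have "a * (C0 * Q ^ s * (Q / \<kappa>)) \<le> e / 3" using C0_pos \<kappa> by (subst (asm) pos_le_divide_eq) auto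
    then show ?thesis by (simp only: mult_ac)
  qed
  obtain N where N: "\<And>i. i \<ge> N \<Longrightarrow> alpha_flat \<phi> s \<mu> x (q i) < ennreal a"
    using alpha_small[OF x a] by blast
  show ?thesis
  proof (intro exI[of _ N] allI impI)
    fix i r assume i: "i \<ge> N" and r: "q (Suc i) \<le> r" "r \<le> q i"
    define R where "R = q i"
    have R: "R > 0" by (simp add: R_def)
    have qS: "q (Suc i) = R / Q" by (simp add: R_def)
    have rR: "R / Q \<le> r" "r \<le> R" using r by (auto simp: qS R_def)
    have r0: "r > 0" using rR R by (auto intro: less_le_trans)
    define ch where "ch t = max 0 (min 1 ((t - r) / (\<kappa> * r)))" for t
    have ch01: "0 \<le> ch t" "ch t \<le> 1" "\<bar>ch t\<bar> \<le> 1" for t by (auto simp: ch_def)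
    have kr0: "\<kappa> * r > 0" using \<kappa> r0 by simp
    have chz: "ch t = 0" if "t \<le> r" for t using that kr0 by (simp add: ch_def divide_nonpos_pos min_def)
    have cho: "ch t = 1" if "(1 + \<kappa>) * r \<le> t" for t
    proof -
      have "1 \<le> (t - r) / (\<kappa> * r)" using that kr0 by (simp add: le_divide_eq algebra_simps)
      then show ?thesis by (simp add: ch_def)
    qed
    have chl: "\<bar>ch t - ch u\<bar> \<le> 1 / (\<kappa> * r) * \<bar>t - u\<bar>" for t u
    proof -
      have "\<bar>max 0 (min 1 b) - max 0 (min 1 b')\<bar> \<le> \<bar>b - b'\<bar>" for b b' :: real by (auto simp: max_def min_def)
      then have "\<bar>ch t - ch u\<bar> \<le> \<bar>(t - r) / (\<kappa> * r) - (u - r) / (\<kappa> * r)\<bar>" unfolding ch_def .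
      also have "\<dots> = 1 / (\<kappa> * r) * \<bar>t - u\<bar>" using kr0 by (simp add: diff_divide_distrib[symmetric] abs_divide)
      finally show ?thesis .
    qed
    have [measurable]: "kr R \<in> borel_measurable borel" using R by simp
    define k where "k z = ch (norm z) *\<^sub>R K z - kr R z" for z
    define B where "B = c / R ^ (s + 1)"
    have B: "B > 0" using c R by (simp add: B_def)
    have kl: "norm (k z - k z') \<le> B * norm (z - z')" for z z'
    proof -
      have "k z - k z' = (ch (norm z) *\<^sub>R K z - ch (norm z') *\<^sub>R K z') - (kr R z - kr R z')" by (simp add: k_def)
      then have "norm (k z - k z') \<le> norm (ch (norm z) *\<^sub>R K z - ch (norm z') *\<^sub>R K z') + norm (kr R z - kr R z')"
        by (simp only: norm_triangle_ineq4)
      also have "\<dots> \<le> C0 * (2 ^ s * (1 / (\<kappa> * r)) / r ^ s + 4 / r ^ (s + 1)) * norm (z - z') + C0 * (2 ^ s + 4) / R ^ (s + 1) * norm (z - z')"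
        using ch01 chz chl kr0 r0 R by (intro add_mono kr_lipschitz radial_lipschitz) auto
      also have "C0 * (2 ^ s * (1 / (\<kappa> * r)) / r ^ s + 4 / r ^ (s + 1)) = C0 * (2 ^ s / \<kappa> + 4) * (1 / r ^ (s + 1))"
        using \<kappa> r0 by (simp add: field_simps)
      also have "C0 * (2 ^ s / \<kappa> + 4) * (1 / r ^ (s + 1)) * norm (z - z') \<le> C0 * (2 ^ s / \<kappa> + 4) * (Q ^ (s + 1) / R ^ (s + 1)) * norm (z - z')"
      proof (intro mult_right_mono mult_left_mono)
        have "1 / r ^ (s + 1) \<le> 1 / (R / Q) ^ (s + 1)"
          using rR R r0 by (intro divide_left_mono power_mono mult_pos_pos zero_less_power) auto
        then show "1 / r ^ (s + 1) \<le> Q ^ (s + 1) / R ^ (s + 1)" by (simp add: power_divide)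
      qed (use C0_pos \<kappa> in auto)
      also have "C0 * (2 ^ s / \<kappa> + 4) * (Q ^ (s + 1) / R ^ (s + 1)) * norm (z - z') + C0 * (2 ^ s + 4) / R ^ (s + 1) * norm (z - z') = B * norm (z - z')"
        by (simp only: B_def c_def add_divide_distrib distrib_right times_divide_eq_right times_divide_eq_left)
      finally show ?thesis by simp
    qed
    have lk: "B-lipschitz_on UNIV k" using kl B by (auto simp: lipschitz_on_def dist_norm)
    have [measurable]: "k \<in> borel_measurable borel"
      by (intro borel_measurable_continuous_onI lipschitz_on_continuous_on[OF lk])
    have [measurable]: "sk r R \<in> borel_measurable borel" using r0 R by simp
    have ksupp: "norm z \<le> 2 * R" if "k z \<noteq> 0" for z
    proof (rule ccontr)
      assume n: "\<not> norm z \<le> 2 * R"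
      have "(1 + \<kappa>) * r \<le> 2 * R" using \<kappa> rR r0 by (intro mult_mono) auto
      then have "k z = 0" unfolding k_def using n R cho[of "norm z"] by (simp add: kr_eq_K)
      then show False using that by simp
    qed
    have I1: "norm (\<integral>y. k (x - y) \<partial>\<mu>) \<le> e / 3"
    proof -
      have "norm (\<integral>y. k (x - y) \<partial>\<mu>) \<le> real DIM('b) * (B * R * a * R ^ s)"
      proof (rule odd_kernel_test[OF R _ kl B])
        show "alpha_flat \<phi> s \<mu> x R < ennreal a" using N[OF i] by (simp add: R_def)
        show "k (- z) = - k z" for z
          by (cases "z = 0") (simp_all add: k_def kr_odd K_odd chz r0 less_imp_le kr_eq_0 R)
      qed (rule ksupp)
      also have "\<dots> = real DIM('b) * c * a" using R by (simp add: B_def)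
      also note a1
      finally show ?thesis .
    qed
    let ?A = "{y. r < dist x y \<and> dist x y < (1 + \<kappa>) * r}"
    have fA: "emeasure \<mu> ?A < \<infinity>"
      by (rule emeasure_bounded_finite, rule bounded_subset[OF bounded_ball[of x "(1 + \<kappa>) * r"]]) auto
    have ik: "integrable \<mu> (\<lambda>y. k (x - y))"
    proof -
      have "lipschitz_compact k"
        unfolding lipschitz_compact_def using lk ksupp R by (intro conjI exI[of _ B] exI[of _ "3 * R"]) force+
      then obtain Mk where Mk: "\<And>z. norm (k z) \<le> Mk" using lipschitz_compact_bounded by blast
      show ?thesis
      proof (rule integrable_bounded_support[where B=Mk and x=x and r="3 * R"])
        fix y assume "k (x - y) \<noteq> 0"
        then have "norm (x - y) \<le> 2 * R" by (rule ksupp)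
        then show "y \<in> ball x (3 * R)" using R by (simp add: dist_norm)
      qed (auto simp: Mk)
    qed
    have isk: "integrable \<mu> (\<lambda>y. sk r R (x - y))"
    proof (rule integrable_bounded_support[where B="C0 / r ^ s" and x=x and r="2 * R"])
      fix y
      show "norm (sk r R (x - y)) \<le> C0 / r ^ s"
        using C0_pos r0 by (intro order_trans[OF sk_bounds(2)[OF r0 rR(2)] mult_indicator_le]) auto
      show "y \<in> ball x (2 * R)" if "sk r R (x - y) \<noteq> 0"
      proof (rule ccontr)
        assume "y \<notin> ball x (2 * R)"
        then have "indicator (ball 0 (2 * R)) (x - y) = (0::real)" by (simp add: dist_norm norm_minus_commute)
        then show False using sk_bounds(2)[OF r0 rR(2), of "x - y"] that by simp
      qed
    qed simp
    have I2: "norm ((\<integral>y. sk r R (x - y) \<partial>\<mu>) - (\<integral>y. k (x - y) \<partial>\<mu>)) \<le> 2 * e / 3"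
    proof -
      have "(\<integral>y. sk r R (x - y) \<partial>\<mu>) - (\<integral>y. k (x - y) \<partial>\<mu>) = (\<integral>y. sk r R (x - y) - k (x - y) \<partial>\<mu>)"
        by (rule Bochner_Integration.integral_diff[OF isk ik, symmetric])
      also have "norm \<dots> \<le> (\<integral>y. C0 / r ^ s * indicator ?A y \<partial>\<mu>)"
      proof (rule Bochner_Integration.integral_norm_bound_integral[OF Bochner_Integration.integrable_diff[OF isk ik]])
        show "integrable \<mu> (\<lambda>y. C0 / r ^ s * indicator ?A y)" using fA by (intro integrable_mult_right integrable_real_indicator) auto
        fix y
        let ?z = "x - y"
        consider "norm ?z \<le> r" | "(1 + \<kappa>) * r \<le> norm ?z" | "r < norm ?z" "norm ?z < (1 + \<kappa>) * r" by linarith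
        then show "norm (sk r R ?z - k ?z) \<le> C0 / r ^ s * indicator ?A y"
        proof cases
          case 1
          then show ?thesis using C0_pos r0 by (simp add: sk_def k_def chz)
        next
          case 2
          have "r < (1 + \<kappa>) * r" using kr0 by (simp add: algebra_simps)
          then have "r < norm ?z" using 2 by linarith
          then have "sk r R ?z - k ?z = 0" using cho[OF 2] by (simp add: sk_def k_def)
          then show ?thesis using C0_pos r0 by simp
        next
          case 3
          have nz: "?z \<noteq> 0" using 3 r0 by auto
          have "sk r R ?z - k ?z = (1 - ch (norm ?z)) *\<^sub>R K ?z" using 3 by (simp add: sk_def k_def scaleR_diff_left)
          then have "norm (sk r R ?z - k ?z) = \<bar>1 - ch (norm ?z)\<bar> * norm (K ?z)" by simp
          also have "\<dots> \<le> 1 * (C0 / norm ?z ^ s)" using ch01(1,2)[of "norm ?z"] K_bound[OF nz] by (intro mult_mono) auto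
          also have "\<dots> \<le> C0 / r ^ s" using 3 r0 nz C0_pos by (auto intro!: divide_left_mono power_mono mult_pos_pos)
          finally show ?thesis using 3 by (simp add: dist_norm)
        qed
      qed
      also have "\<dots> = C0 / r ^ s * measure \<mu> ?A" by simp
      also have "\<dots> \<le> C0 / r ^ s * ((F * 4 ^ s * ((1 + 2 * \<kappa>) ^ s - (1 - \<kappa>) ^ s) + Q / \<kappa> * a) * R ^ s)"
        using N[OF i] C0_pos r0 by (intro mult_left_mono thin_annulus[OF R _ a rR \<kappa>(1,2) F(2)]) (auto simp: R_def)
      also have "\<dots> \<le> C0 * Q ^ s / R ^ s * ((F * 4 ^ s * ((1 + 2 * \<kappa>) ^ s - (1 - \<kappa>) ^ s) + Q / \<kappa> * a) * R ^ s)"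
      proof (intro mult_right_mono)
        have "C0 / r ^ s \<le> C0 / (R / Q) ^ s"
          using rR R r0 C0_pos by (intro divide_left_mono power_mono mult_pos_pos zero_less_power) auto
        then show "C0 / r ^ s \<le> C0 * Q ^ s / R ^ s" by (simp add: power_divide)
        have "(1 - \<kappa>) ^ s \<le> (1 + 2 * \<kappa>) ^ s" using \<kappa> by (intro power_mono) auto
        then show "0 \<le> (F * 4 ^ s * ((1 + 2 * \<kappa>) ^ s - (1 - \<kappa>) ^ s) + Q / \<kappa> * a) * R ^ s"
          using F \<kappa> a R by (intro mult_nonneg_nonneg add_nonneg_nonneg) auto
      qed
      also have "\<dots> = C0 * Q ^ s * (F * 4 ^ s * ((1 + 2 * \<kappa>) ^ s - (1 - \<kappa>) ^ s)) + C0 * Q ^ s * (Q / \<kappa> * a)"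
        using R by (simp only: distrib_left distrib_right) (simp add: algebra_simps)
      also have "\<dots> \<le> e / 3 + e / 3" using \<kappa>(3) a2 by linarith
      finally show ?thesis by simp
    qed
    have "norm (\<integral>y. sk r R (x - y) \<partial>\<mu>) \<le> e / 3 + 2 * e / 3"
      using I1 I2 norm_triangle_sub[of "\<integral>y. sk r R (x - y) \<partial>\<mu>" "\<integral>y. k (x - y) \<partial>\<mu>"] by linarith
    then show "norm (\<integral>y. sk r (q i) (x - y) \<partial>\<mu>) \<le> e" by (simp add: R_def)
  qed
qed

text \<open>Replacing \<open>f y\<close> by \<open>f x\<close> gains a factor
  \<open>dist x y\<close>, which brings the kernel to the order handled by
  \<open>near_integral\<close>; the error is of order \<rho>. Flatness concerns \<mu> itself, and
  this transfers its consequences to the measure with density \<open>f\<close>.\<close>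

lemma lipschitz_localization:
  fixes f :: "'a \<Rightarrow> real" and k :: "'a \<Rightarrow> 'b"
  assumes f [measurable]: "f \<in> borel_measurable borel" and if1: "integrable \<mu> f"
    and fL: "\<And>y z. \<bar>f y - f z\<bar> \<le> L * dist y z" and L0: "L \<ge> 0" and \<rho>: "\<rho> > 0"
    and k [measurable]: "k \<in> borel_measurable borel" and kB: "\<And>z. norm (k z) \<le> B"
    and ks: "\<And>z. norm (k z) \<le> C0 / norm z ^ s * indicator (ball 0 (2 * \<rho>)) z"
  shows "norm ((\<integral>y. f y *\<^sub>R k (x - y) \<partial>\<mu>) - f x *\<^sub>R (\<integral>y. k (x - y) \<partial>\<mu>)) \<le> L * C0 * (2 ^ (s + 1) * (2 * \<rho>))"
proof -
  have ik: "integrable \<mu> (\<lambda>y. k (x - y))"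
  proof (rule integrable_bounded_support[where B=B and x=x and r="2 * \<rho>"])
    show "y \<in> ball x (2 * \<rho>)" if "k (x - y) \<noteq> 0" for y
    proof (rule ccontr)
      assume "y \<notin> ball x (2 * \<rho>)"
      then have "indicator (ball 0 (2 * \<rho>)) (x - y) = (0::real)" by (simp add: dist_norm norm_minus_commute)
      then show False using ks[of "x - y"] that by simp
    qed
  qed (auto simp: kB)
  have ifk: "integrable \<mu> (\<lambda>y. f y *\<^sub>R k (x - y))"
  proof (rule Bochner_Integration.integrable_bound[where f="\<lambda>y. B * f y"])
    have "\<bar>f y\<bar> * norm (k (x - y)) \<le> \<bar>B\<bar> * \<bar>f y\<bar>" for y
      using mult_left_mono[OF order_trans[OF kB abs_ge_self], of "\<bar>f y\<bar>" "x - y"] by (simp add: mult.commute)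
    then show "AE y in \<mu>. norm (f y *\<^sub>R k (x - y)) \<le> norm (B * f y)" by (simp add: abs_mult)
  qed (use if1 in auto)
  have eq: "(\<integral>y. f y *\<^sub>R k (x - y) \<partial>\<mu>) - f x *\<^sub>R (\<integral>y. k (x - y) \<partial>\<mu>) = (\<integral>y. f y *\<^sub>R k (x - y) - f x *\<^sub>R k (x - y) \<partial>\<mu>)"
    using Bochner_Integration.integral_diff[OF ifk integrable_scaleR_right[OF ik, of "f x"]] by simp
  have "ennreal (norm ((\<integral>y. f y *\<^sub>R k (x - y) \<partial>\<mu>) - f x *\<^sub>R (\<integral>y. k (x - y) \<partial>\<mu>))) \<le>
    (\<integral>\<^sup>+y. ennreal (norm (f y *\<^sub>R k (x - y) - f x *\<^sub>R k (x - y))) \<partial>\<mu>)"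
    unfolding eq by (rule norm_integral_le_nn_integral)
  also have "\<dots> \<le> (\<integral>\<^sup>+y. ennreal (L * C0) * (indicator (ball x (2 * \<rho>)) y * ennreal (dist x y / dist x y ^ s)) \<partial>\<mu>)"
  proof (intro nn_integral_mono)
    fix y
    have "norm (f y *\<^sub>R k (x - y) - f x *\<^sub>R k (x - y)) = \<bar>f y - f x\<bar> * norm (k (x - y))" by (simp flip: scaleR_diff_left)
    also have "\<dots> \<le> (L * dist y x) * (C0 / norm (x - y) ^ s * indicator (ball 0 (2 * \<rho>)) (x - y))"
      using fL ks L0 by (intro mult_mono) auto
    also have "\<dots> = L * C0 * (indicator (ball x (2 * \<rho>)) y * (dist x y / dist x y ^ s))"
      by (simp add: dist_norm norm_minus_commute indicator_def)
    finally have "ennreal (norm (f y *\<^sub>R k (x - y) - f x *\<^sub>R k (x - y))) \<le> ennreal (L * C0 * (indicator (ball x (2 * \<rho>)) y * (dist x y / dist x y ^ s)))"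
      by (rule ennreal_leI)
    then show "ennreal (norm (f y *\<^sub>R k (x - y) - f x *\<^sub>R k (x - y))) \<le> ennreal (L * C0) * (indicator (ball x (2 * \<rho>)) y * ennreal (dist x y / dist x y ^ s))"
      using L0 C0_pos by (auto simp: indicator_def ennreal_mult[symmetric] simp del: times_divide_eq_right)
  qed
  also have "\<dots> = ennreal (L * C0) * (\<integral>\<^sup>+y. indicator (ball x (2 * \<rho>)) y * ennreal (dist x y / dist x y ^ s) \<partial>\<mu>)"
    by (intro nn_integral_cmult) auto
  also have "\<dots> \<le> ennreal (L * C0) * ennreal (1 * 2 ^ (s + 1) * (2 * \<rho>))"
    using \<rho> growth by (intro mult_left_mono near_integral) auto
  also have "\<dots> = ennreal (L * C0 * (2 ^ (s + 1) * (2 * \<rho>)))"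
    using L0 C0_pos \<rho> by (subst ennreal_mult[symmetric]) auto
  finally show ?thesis using L0 C0_pos \<rho> by (subst (asm) ennreal_le_iff) auto
qed

lemma sharp_truncations_lipschitz:
  fixes f :: "'a \<Rightarrow> real"
  assumes f: "lipschitz_compact f"
  shows "AE x in \<mu>. \<exists>l. ((\<lambda>r. \<integral>y. f y *\<^sub>R (indicator {y. norm (x - y) > r} y *\<^sub>R K (x - y)) \<partial>\<mu>) \<longlongrightarrow> l) (at_right 0)"
proof -
  have mf [measurable]: "f \<in> borel_measurable borel" by (rule lipschitz_compact_measurable[OF f])
  obtain M where M: "M > 0" "\<And>y. \<bar>f y\<bar> \<le> M" using lipschitz_compact_bounded[OF f] by (auto simp: real_norm_def)
  obtain L where L: "L-lipschitz_on UNIV f" using f by (auto simp: lipschitz_compact_def)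
  have L0: "L \<ge> 0" using L by (rule lipschitz_on_nonneg)
  have fL: "\<bar>f y - f z\<bar> \<le> L * dist y z" for y z using lipschitz_onD[OF L, of y z] by (simp add: dist_real_def)
  have intf: "integrable \<mu> f" by (rule lipschitz_compact_integrable[OF f])
  have q0: "(\<lambda>i. q i) \<longlonglongrightarrow> 0" by (intro LIMSEQ_realpow_zero) auto
  \<comment> \<open>Freezing the density leaves \<open>f x\<close> times an increment for \<mu>,
    which flatness sends to 0.\<close>
  have inc: "AE x in \<mu>. (\<lambda>i. Tf f (q (Suc i)) x - Tf f (q i) x) \<longlonglongrightarrow> 0"
    using flat
  proof eventually_elim
    case (elim x)
    define k where "k i z = kr (q (Suc i)) z - kr (q i) z" for i z
    have Teq: "Tf f (q (Suc i)) x - Tf f (q i) x = (\<integral>y. f y *\<^sub>R k i (x - y) \<partial>\<mu>)" for i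
      unfolding Tf_def k_def scaleR_diff_right using intf
      by (intro Bochner_Integration.integral_diff[symmetric] integrable_Tf) auto
    have loc: "norm ((\<integral>y. f y *\<^sub>R k i (x - y) \<partial>\<mu>) - f x *\<^sub>R (\<integral>y. k i (x - y) \<partial>\<mu>)) \<le> L * C0 * (2 ^ (s + 1) * (2 * q i))" for i
    proof (rule lipschitz_localization[OF mf intf fL L0])
      have [measurable]: "kr (q (Suc i)) \<in> borel_measurable borel" "kr (q i) \<in> borel_measurable borel" by auto
      show "k i \<in> borel_measurable borel" unfolding k_def[abs_def] by measurable
      have le: "0 < q (Suc i)" "q (Suc i) \<le> q i" by auto
      show "norm (k i z) \<le> C0 / norm z ^ s * indicator (ball 0 (2 * q i)) z" for z
        unfolding k_def by (rule kr_diff_bound(1)[OF le])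
      show "norm (k i z) \<le> C0 / q (Suc i) ^ s" for z
        unfolding k_def using C0_pos le by (intro order_trans[OF kr_diff_bound(2)[OF le] mult_indicator_le]) auto
    qed simp
    have "(\<lambda>i. L * C0 * (2 ^ (s + 1) * (2 * q i))) \<longlonglongrightarrow> L * C0 * (2 ^ (s + 1) * (2 * 0))"
      by (intro tendsto_intros q0)
    then have g0: "(\<lambda>i. L * C0 * (2 ^ (s + 1) * (2 * q i))) \<longlonglongrightarrow> 0" by (simp only: mult_zero_right)
    have "(\<lambda>i. (\<integral>y. f y *\<^sub>R k i (x - y) \<partial>\<mu>) - f x *\<^sub>R (\<integral>y. k i (x - y) \<partial>\<mu>)) \<longlonglongrightarrow> 0"
      by (rule Lim_null_comparison[OF always_eventually g0]) (rule allI, rule loc)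
    moreover have "(\<lambda>i. f x *\<^sub>R (\<integral>y. k i (x - y) \<partial>\<mu>)) \<longlonglongrightarrow> f x *\<^sub>R 0"
      unfolding k_def by (intro tendsto_intros smooth_increments_vanish elim)
    ultimately have "(\<lambda>i. ((\<integral>y. f y *\<^sub>R k i (x - y) \<partial>\<mu>) - f x *\<^sub>R (\<integral>y. k i (x - y) \<partial>\<mu>)) + f x *\<^sub>R (\<integral>y. k i (x - y) \<partial>\<mu>)) \<longlonglongrightarrow> 0 + f x *\<^sub>R 0"
      by (rule tendsto_add)
    then show ?case unfolding Teq by simp
  qed
  show ?thesis
    using smooth_truncations_convergent[OF f inc] flat
  proof eventually_elim
    case (elim x)
    then obtain l where l: "(\<lambda>i. Tf f (q i) x) \<longlonglongrightarrow> l" by (auto simp: convergent_def)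
    define S where "S r = (\<integral>y. f y *\<^sub>R (indicator {y. norm (x - y) > r} y *\<^sub>R K (x - y)) \<partial>\<mu>)" for r
    have est: "norm (S r - Tf f (q i) x) \<le> L * C0 * (2 ^ (s + 1) * (2 * q i)) + M * norm (\<integral>y. sk r (q i) (x - y) \<partial>\<mu>)"
      if r: "0 < r" "r \<le> q i" for r i
    proof -
      have [measurable]: "sk r (q i) \<in> borel_measurable borel" using r(1) by simp
      have isS: "integrable \<mu> (\<lambda>y. f y *\<^sub>R (indicator {y. norm (x - y) > r} y *\<^sub>R K (x - y)))"
      proof -
        have "integrable \<mu> (\<lambda>y. indicator {y. norm (x - y) > r} y *\<^sub>R (f y *\<^sub>R kr (r / 2) (x - y)))"
          using r intf by (intro integrable_mult_indicator integrable_Tf) auto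
        then show ?thesis unfolding sharp_kernel_eq[OF r(1)] by (simp add: mult.commute)
      qed
      have "S r - Tf f (q i) x = (\<integral>y. f y *\<^sub>R (indicator {y. norm (x - y) > r} y *\<^sub>R K (x - y)) - f y *\<^sub>R kr (q i) (x - y) \<partial>\<mu>)"
        unfolding S_def Tf_def using intf by (intro Bochner_Integration.integral_diff[symmetric] isS integrable_Tf) auto
      also have "\<dots> = (\<integral>y. f y *\<^sub>R sk r (q i) (x - y) \<partial>\<mu>)"
        by (intro Bochner_Integration.integral_cong) (auto simp: sk_def scaleR_diff_right indicator_def)
      finally have eq: "S r - Tf f (q i) x = (\<integral>y. f y *\<^sub>R sk r (q i) (x - y) \<partial>\<mu>)" .
      have "norm ((\<integral>y. f y *\<^sub>R sk r (q i) (x - y) \<partial>\<mu>) - f x *\<^sub>R (\<integral>y. sk r (q i) (x - y) \<partial>\<mu>)) \<le> L * C0 * (2 ^ (s + 1) * (2 * q i))"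
      proof (rule lipschitz_localization[OF mf intf fL L0])
        show "norm (sk r (q i) z) \<le> C0 / norm z ^ s * indicator (ball 0 (2 * q i)) z" for z by (rule sk_bounds(1)[OF r])
        show "norm (sk r (q i) z) \<le> C0 / r ^ s" for z
          using C0_pos r by (intro order_trans[OF sk_bounds(2)[OF r] mult_indicator_le]) auto
      qed auto
      moreover have "norm (f x *\<^sub>R (\<integral>y. sk r (q i) (x - y) \<partial>\<mu>)) \<le> M * norm (\<integral>y. sk r (q i) (x - y) \<partial>\<mu>)"
        unfolding norm_scaleR by (intro mult_right_mono M) auto
      ultimately show ?thesis unfolding eq
        using norm_triangle_sub[of "\<integral>y. f y *\<^sub>R sk r (q i) (x - y) \<partial>\<mu>" "f x *\<^sub>R (\<integral>y. sk r (q i) (x - y) \<partial>\<mu>)"] by linarith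
    qed
    have "(S \<longlongrightarrow> l) (at_right 0)"
    proof (rule tendstoI)
      fix e :: real assume e: "e > 0"
      obtain N1 where N1: "\<And>i. i \<ge> N1 \<Longrightarrow> norm (Tf f (q i) x - l) < e / 3"
        using LIMSEQ_D[OF l, of "e / 3"] e by auto
      have "(\<lambda>i. L * C0 * (2 ^ (s + 1) * (2 * q i))) \<longlonglongrightarrow> L * C0 * (2 ^ (s + 1) * (2 * 0))"
        by (intro tendsto_intros q0)
      then have "eventually (\<lambda>i. L * C0 * (2 ^ (s + 1) * (2 * q i)) < e / 3) sequentially"
        using e by (intro order_tendstoD(2)) auto
      then obtain N2 where N2: "\<And>i. i \<ge> N2 \<Longrightarrow> L * C0 * (2 ^ (s + 1) * (2 * q i)) < e / 3" by (auto simp: eventually_sequentially)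
      obtain N3 where N3: "\<And>i r. i \<ge> N3 \<Longrightarrow> q (Suc i) \<le> r \<Longrightarrow> r \<le> q i \<Longrightarrow> norm (\<integral>y. sk r (q i) (x - y) \<partial>\<mu>) \<le> e / (3 * M)"
        using sharp_increments_vanish[OF elim(2), of "e / (3 * M)"] e M by auto
      define N where "N = N1 + N2 + N3"
      have "dist (S r) l < e" if r: "0 < r" "r < q N" for r
      proof -
        have "r < 1" using r(2) q_simps(2)[of N] by linarith
        \<comment> \<open>Every small \<open>r\<close> lies between consecutive scales and is
          compared with the smooth truncation at the upper one.\<close>
        then obtain i where i: "q (Suc i) \<le> r" "r < q i"
          using geometric_index_down[of Q r 1] r by auto
        have "N \<le> i"
        proof (rule ccontr)
          assume "\<not> N \<le> i"
          then have "q N \<le> q (Suc i)" by (intro power_decreasing) auto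
          then show False using i r by linarith
        qed
        then have iN: "i \<ge> N1" "i \<ge> N2" "i \<ge> N3" by (auto simp: N_def)
        have "M * norm (\<integral>y. sk r (q i) (x - y) \<partial>\<mu>) \<le> M * (e / (3 * M))"
          using N3[OF iN(3) i(1)] i(2) M by (intro mult_left_mono) auto
        also have "\<dots> = e / 3" using M by simp
        finally have "norm (S r - Tf f (q i) x) < e / 3 + e / 3"
          using est[OF r(1), of i] i(2) N2[OF iN(2)] by linarith
        then show ?thesis
          using N1[OF iN(1)] norm_triangle_ineq[of "S r - Tf f (q i) x" "Tf f (q i) x - l"] by (simp add: dist_norm)
      qed
      then show "eventually (\<lambda>r. dist (S r) l < e) (at_right 0)"
        unfolding eventually_at_right_field using q_simps(1)[of N] by blast
    qed
    then show ?case unfolding S_def by blast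
  qed
qed

end

section \<open>Principal values of finite measures\<close>

lemma at_right_limit_of_Cauchy:
  fixes F :: "real \<Rightarrow> 'b::banach"
  assumes "\<And>e. e > 0 \<Longrightarrow> \<exists>b>0. \<forall>r r'. 0 < r \<longrightarrow> r < b \<longrightarrow> 0 < r' \<longrightarrow> r' < b \<longrightarrow> norm (F r - F r') \<le> e"
  shows "\<exists>l. (F \<longlongrightarrow> l) (at_right 0)"
proof -
  define a where "a n = F (1 / real (Suc n))" for n
  have small: "\<exists>N. \<forall>n\<ge>N. 1 / real (Suc n) < b" if b: "b > 0" for b
  proof -
    obtain N where N: "1 / real (Suc N) < b" using nat_approx_posE[OF b] by blast
    have "1 / real (Suc n) < b" if "n \<ge> N" for n
    proof -
      have "1 / real (Suc n) \<le> 1 / real (Suc N)" using that by (intro divide_left_mono) auto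
      then show ?thesis using N by linarith
    qed
    then show ?thesis by blast
  qed
  have "Cauchy a"
  proof (rule CauchyI)
    fix e :: real assume e: "e > 0"
    obtain b where b: "b > 0" "\<And>r r'. 0 < r \<Longrightarrow> r < b \<Longrightarrow> 0 < r' \<Longrightarrow> r' < b \<Longrightarrow> norm (F r - F r') \<le> e / 2"
      using assms[of "e / 2"] e by auto
    obtain N where N: "\<And>n. n \<ge> N \<Longrightarrow> 1 / real (Suc n) < b" using small[OF b(1)] by blast
    have "norm (a m - a n) < e" if "m \<ge> N" "n \<ge> N" for m n
    proof -
      have "norm (a m - a n) \<le> e / 2" unfolding a_def using N that by (intro b(2)) auto
      then show ?thesis using e by simp
    qed
    then show "\<exists>M. \<forall>m\<ge>M. \<forall>n\<ge>M. norm (a m - a n) < e" by blast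
  qed
  then obtain l where l: "a \<longlonglongrightarrow> l" using Cauchy_convergent by (auto simp: convergent_def)
  have "(F \<longlongrightarrow> l) (at_right 0)"
  proof (rule tendstoI)
    fix e :: real assume e: "e > 0"
    obtain b where b: "b > 0" "\<And>r r'. 0 < r \<Longrightarrow> r < b \<Longrightarrow> 0 < r' \<Longrightarrow> r' < b \<Longrightarrow> norm (F r - F r') \<le> e / 2"
      using assms[of "e / 2"] e by auto
    obtain N where N: "\<And>n. n \<ge> N \<Longrightarrow> 1 / real (Suc n) < b" using small[OF b(1)] by blast
    have "dist (F r) l < e" if r: "0 < r" "r < b" for r
    proof -
      have "(\<lambda>n. norm (F r - a n)) \<longlonglongrightarrow> norm (F r - l)" by (intro tendsto_intros l)
      moreover have "norm (F r - a n) \<le> e / 2" if "n \<ge> N" for n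
        unfolding a_def using N[OF that] r by (intro b(2)) auto
      ultimately have "norm (F r - l) \<le> e / 2" by (intro LIMSEQ_le_const2) auto
      then show ?thesis using e by (simp add: dist_norm)
    qed
    then show "eventually (\<lambda>r. dist (F r) l < e) (at_right 0)"
      unfolding eventually_at_right_field using b(1) by blast
  qed
  then show ?thesis by blast
qed

section \<open>Lebesgue decomposition of a finite measure with respect to \<mu>\<close>

context growth_measure
begin

text \<open>\<open>S\<close> is a \<mu>-null set of largest \<nu>-measure, obtained as a countable
  union of near-maximisers; a null set carrying \<nu>-mass outside \<open>S\<close> would contradict
  maximality.\<close>

lemma lebesgue_decomposition:
  assumes \<nu>: "finite_measure \<nu>" "sets \<nu> = sets borel"
  obtains S where "S \<in> sets borel" "emeasure \<mu> S = 0"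
    "\<And>A. A \<in> sets borel \<Longrightarrow> emeasure \<mu> A = 0 \<Longrightarrow> emeasure \<nu> (A - S) = 0"
proof -
  interpret \<nu>: finite_measure \<nu> by fact
  define Z where "Z = {A \<in> sets borel. emeasure \<mu> A = 0}"
  define m where "m = (SUP A\<in>Z. measure \<nu> A)"
  have Z0: "{} \<in> Z" by (simp add: Z_def)
  have bdd: "bdd_above (measure \<nu> ` Z)"
    using \<nu>.bounded_measure by (auto simp: bdd_above_def)
  have le: "measure \<nu> A \<le> m" if "A \<in> Z" for A unfolding m_def using that bdd by (intro cSUP_upper)
  have "\<exists>A. \<forall>n::nat. A n \<in> Z \<and> m - 1 / real (Suc n) < measure \<nu> (A n)"
  proof (intro choice allI)
    fix n :: nat
    have "m - 1 / real (Suc n) < m" by simp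
    then show "\<exists>A. A \<in> Z \<and> m - 1 / real (Suc n) < measure \<nu> A"
      unfolding m_def using less_cSUP_iff[OF _ bdd] Z0 by blast
  qed
  then obtain A where A: "\<And>n::nat. A n \<in> Z" "\<And>n. m - 1 / real (Suc n) < measure \<nu> (A n)" by blast
  define S where "S = (\<Union>n. A n)"
  have SZ: "S \<in> Z"
    using A(1) unfolding Z_def S_def by (auto intro!: emeasure_UN_eq_0)
  have "m \<le> measure \<nu> S"
  proof (rule field_le_epsilon)
    fix e :: real assume "e > 0"
    then obtain n where n: "1 / real (Suc n) < e" using nat_approx_posE by blast
    have "measure \<nu> (A n) \<le> measure \<nu> S"
      using A(1)[of n] SZ \<nu>(2) by (intro \<nu>.finite_measure_mono) (auto simp: S_def Z_def)
    then show "m \<le> measure \<nu> S + e" using A(2)[of n] n by linarith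
  qed
  show ?thesis
  proof (rule that[of S])
    show "S \<in> sets borel" "emeasure \<mu> S = 0" using SZ by (auto simp: Z_def)
    fix B assume B: "B \<in> sets borel" "emeasure \<mu> B = 0"
    have "S \<union> (B - S) \<in> Z"
    proof -
      have "S \<in> null_sets \<mu>" "B \<in> null_sets \<mu>" using SZ B by (auto simp: Z_def)
      then have "S \<union> (B - S) \<in> null_sets \<mu>" by auto
      then show ?thesis by (auto simp: Z_def null_sets_def)
    qed
    then have "measure \<nu> (S \<union> (B - S)) \<le> measure \<nu> S" using le \<open>m \<le> measure \<nu> S\<close> order_trans by blast
    moreover have "measure \<nu> (S \<union> (B - S)) = measure \<nu> S + measure \<nu> (B - S)"
      using SZ B \<nu>(2) by (intro \<nu>.finite_measure_Union) (auto simp: Z_def)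
    ultimately have "measure \<nu> (B - S) = 0" using measure_nonneg[of \<nu> "B - S"] by linarith
    then show "emeasure \<nu> (B - S) = 0" by (simp add: \<nu>.emeasure_eq_measure)
  qed
qed

lemma absolutely_continuous_density:
  assumes \<nu>: "finite_measure \<nu>" "sets \<nu> = sets borel"
    and ac: "\<And>A. A \<in> sets borel \<Longrightarrow> emeasure \<mu> A = 0 \<Longrightarrow> emeasure \<nu> A = 0"
  obtains g :: "'a \<Rightarrow> real" where "g \<in> borel_measurable borel" "\<And>y. 0 \<le> g y" "integrable \<mu> g" "\<nu> = density \<mu> (\<lambda>y. ennreal (g y))"
proof -
  interpret \<nu>: finite_measure \<nu> by fact
  have "absolutely_continuous \<mu> \<nu>"
    using ac \<nu>(2) by (auto simp: absolutely_continuous_def null_sets_def)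
  from Radon_Nikodym[OF this] \<nu>(2) obtain G where G: "G \<in> borel_measurable \<mu>" "density \<mu> G = \<nu>" by auto
  have [measurable]: "G \<in> borel_measurable borel" using G(1) by simp
  have "(\<integral>\<^sup>+y. G y \<partial>\<mu>) = emeasure (density \<mu> G) UNIV" by (subst emeasure_density) auto
  then have fin: "(\<integral>\<^sup>+y. G y \<partial>\<mu>) < \<infinity>" using \<nu>.emeasure_finite[of UNIV] unfolding G(2) by (simp add: less_top[symmetric])
  then have "AE y in \<mu>. G y \<noteq> \<infinity>" by (intro nn_integral_noteq_infinite) auto
  then have ae: "AE y in \<mu>. G y = ennreal (enn2real (G y))" by eventually_elim (simp add: less_top)
  show ?thesis
  proof (rule that[of "\<lambda>y. enn2real (G y)"])
    have "(\<integral>\<^sup>+y. ennreal (enn2real (G y)) \<partial>\<mu>) = (\<integral>\<^sup>+y. G y \<partial>\<mu>)"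
      using ae by (intro nn_integral_cong_AE) auto
    then show "integrable \<mu> (\<lambda>y. enn2real (G y))" using fin by (intro integrableI_nonneg) auto
    have "density \<mu> G = density \<mu> (\<lambda>y. ennreal (enn2real (G y)))"
      using ae by (intro density_cong) auto
    then show "\<nu> = density \<mu> (\<lambda>y. ennreal (enn2real (G y)))" using G(2) by simp
  qed auto
qed

lemma finite_measure_density:
  assumes "g \<in> borel_measurable borel" "\<And>y. 0 \<le> g y" "integrable \<mu> g"
  shows "finite_measure (density \<mu> (\<lambda>y. ennreal (g y)))" "measure (density \<mu> (\<lambda>y. ennreal (g y))) UNIV = (\<integral>y. g y \<partial>\<mu>)"
proof -
  have [measurable]: "g \<in> borel_measurable \<mu>" using assms by simp
  have e: "emeasure (density \<mu> (\<lambda>y. ennreal (g y))) UNIV = ennreal (\<integral>y. g y \<partial>\<mu>)"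
    using assms by (subst emeasure_density) (auto simp: nn_integral_eq_integral)
  then show "finite_measure (density \<mu> (\<lambda>y. ennreal (g y)))" by (intro finite_measureI) simp
  show "measure (density \<mu> (\<lambda>y. ennreal (g y))) UNIV = (\<integral>y. g y \<partial>\<mu>)"
    using e assms by (simp add: Sigma_Algebra.measure_def integral_nonneg_AE)
qed

end

context flat_cz
begin

lemma Ts_density:
  assumes r: "r > 0" and g: "g \<in> borel_measurable borel" "\<And>y. 0 \<le> g y"
  shows "Ts (density \<mu> (\<lambda>y. ennreal (g y))) r x = (\<integral>y. g y *\<^sub>R (indicator {y. norm (x - y) > r} y *\<^sub>R K (x - y)) \<partial>\<mu>)"
proof -
  have [measurable]: "kr (r / 2) \<in> borel_measurable borel" "g \<in> borel_measurable borel" using r g by auto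
  show ?thesis
    unfolding Ts_def sharp_kernel_eq[OF r] using g by (intro integral_density) auto
qed

lemma Ts_restrict:
  assumes \<nu>: "finite_measure \<nu>" "sets \<nu> = sets borel" and r: "r > 0" and A: "A \<in> sets borel"
  shows "Ts (density \<nu> (indicator A)) r x = (\<integral>y. indicator A y *\<^sub>R (indicator {y. norm (x - y) > r} y *\<^sub>R K (x - y)) \<partial>\<nu>)"
proof -
  note \<nu>(2)[measurable_cong]
  have [measurable]: "kr (r / 2) \<in> borel_measurable borel" "A \<in> sets borel" using r A by auto
  have "density \<nu> (indicator A) = density \<nu> (\<lambda>y. ennreal (indicator A y))" by (simp add: ennreal_indicator)
  then show ?thesis
    unfolding Ts_def sharp_kernel_eq[OF r] by (simp only:) (intro integral_density; measurable; auto)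
qed

lemma finite_measure_restrict:
  assumes \<nu>: "finite_measure \<nu>" "sets \<nu> = sets borel" and A: "A \<in> sets borel"
  shows "finite_measure (density \<nu> (indicator A))" "sets (density \<nu> (indicator A)) = sets borel"
    "measure (density \<nu> (indicator A)) UNIV = measure \<nu> A"
proof -
  interpret finite_measure \<nu> by fact
  have sp: "space \<nu> = UNIV" using sets_eq_imp_space_eq[OF \<nu>(2)] by simp
  have e: "emeasure (density \<nu> (indicator A)) UNIV = emeasure \<nu> A"
    using emeasure_density_indicator[of A \<nu> UNIV] A \<nu>(2) by simp
  show "finite_measure (density \<nu> (indicator A))"
    by (rule finite_measureI) (use e sp in \<open>simp add: emeasure_finite\<close>)
  show "sets (density \<nu> (indicator A)) = sets borel" using \<nu>(2) by simp
  show "measure (density \<nu> (indicator A)) UNIV = measure \<nu> A" using e by (simp add: Sigma_Algebra.measure_def)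
qed

text \<open>\<nu> is split into its restriction to a compact \<mu>-null set, a small remainder of
  the singular part, a Lipschitz density, and a small signed density. By
  \<open>weak_type_max_sharp\<close> the small pieces have small truncations off a small set, and
  the other two converge. The oscillation of the truncations near 0 is estimated, from which the
  limit follows by Cauchy's criterion.\<close>

lemma principal_value_finite_measure:
  assumes \<nu>: "finite_measure \<nu>" "sets \<nu> = sets borel"
  shows "AE x in \<mu>. \<exists>l. ((\<lambda>r. Ts \<nu> r x) \<longlongrightarrow> l) (at_right 0)"
proof -
  interpret \<nu>: finite_measure \<nu> by fact
  obtain S where S: "S \<in> sets borel" "emeasure \<mu> S = 0"
    "\<And>A. A \<in> sets borel \<Longrightarrow> emeasure \<mu> A = 0 \<Longrightarrow> emeasure \<nu> (A - S) = 0"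
    using lebesgue_decomposition[OF \<nu>] by blast
  define \<nu>a where "\<nu>a = density \<nu> (indicator (- S))"
  have mS: "- S \<in> sets borel" using S(1) by auto
  note \<nu>a = finite_measure_restrict[OF \<nu> mS, folded \<nu>a_def]
  obtain g where g: "g \<in> borel_measurable borel" "\<And>y. 0 \<le> g y" "integrable \<mu> g" "\<nu>a = density \<mu> (\<lambda>y. ennreal (g y))"
  proof (rule absolutely_continuous_density[OF \<nu>a(1,2)])
    fix A :: "'a set" assume A: "A \<in> sets borel" "emeasure \<mu> A = 0"
    have "emeasure \<nu>a A = emeasure \<nu> (- S \<inter> A)"
      unfolding \<nu>a_def using A mS \<nu>(2) by (intro emeasure_density_indicator) auto
    also have "- S \<inter> A = A - S" by auto
    finally show "emeasure \<nu>a A = 0" using S(3)[OF A] by simp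
  qed (rule that)
  \<comment> \<open>\<open>7 * \<eta>\<close> is one \<eta> for the Lipschitz density and two, one
    per radius, for each of three small measures.\<close>
  define bad where "bad \<eta> x \<longleftrightarrow> \<not> (\<exists>b>0. \<forall>r r'. 0 < r \<longrightarrow> r < b \<longrightarrow> 0 < r' \<longrightarrow> r' < b \<longrightarrow> norm (Ts \<nu> r x - Ts \<nu> r' x) \<le> 7 * \<eta>)" for \<eta> x
  have *: "AE x in \<mu>. x \<notin> {x \<in> ball 0 p. bad \<eta> x}" if \<eta>: "\<eta> > 0" for \<eta> p
  proof (rule AE_notin_if_small_covers)
    fix e :: real assume e: "e > 0"
    have Cx: "Cx > 0" unfolding Cx_def using Cs_pos C0_pos by (intro add_pos_pos) auto
    define \<delta> where "\<delta> = e * \<eta> / (3 * Cx)"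
    have \<delta>: "\<delta> > 0" using e \<eta> Cx by (simp add: \<delta>_def)
    have cov: "\<exists>U\<in>sets borel. {x \<in> ball 0 p. \<exists>r>0. \<eta> < norm (Ts \<sigma> r x)} \<subseteq> U \<and> emeasure \<mu> U \<le> ennreal (e / 3)"
      if \<sigma>: "finite_measure \<sigma>" "sets \<sigma> = sets borel" "measure \<sigma> UNIV \<le> \<delta>" for \<sigma>
    proof -
      obtain U where U: "U \<in> sets borel" "{x \<in> ball 0 p. \<exists>r>0. \<eta> < norm (Ts \<sigma> r x)} \<subseteq> U" "emeasure \<mu> U \<le> ennreal (Cx * measure \<sigma> UNIV / \<eta>)"
        using weak_type_max_sharp[OF \<sigma>(1,2) \<eta>, of p] by blast
      have "Cx * measure \<sigma> UNIV / \<eta> \<le> Cx * \<delta> / \<eta>" using \<sigma>(3) Cx \<eta> by (intro divide_right_mono mult_left_mono) auto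
      also have "\<dots> = e / 3" using Cx \<eta> by (simp add: \<delta>_def)
      finally have "ennreal (Cx * measure \<sigma> UNIV / \<eta>) \<le> ennreal (e / 3)" by (rule ennreal_leI)
      then show ?thesis using U order_trans by blast
    qed
    \<comment> \<open>at a point outside the compact \<open>C\<close> the truncations of the restriction to \<open>C\<close> are eventually constant\<close>
    obtain C where C: "compact C" "C \<subseteq> S" "measure \<nu> (S - C) \<le> \<delta>"
    proof -
      obtain C where C: "compact C" "C \<subseteq> S" "emeasure \<nu> (S - C) < ennreal \<delta>"
        using inner_regular_emeasure[OF \<nu>(2) S(1) _ \<delta>] by (auto simp: \<nu>.emeasure_eq_measure)
      then have "measure \<nu> (S - C) \<le> \<delta>" using \<delta> by (simp add: \<nu>.emeasure_eq_measure ennreal_less_iff)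
      then show ?thesis using C that by blast
    qed
    have mC [measurable]: "C \<in> sets borel" using C(1) by (simp add: borel_compact)
    have mSC: "S - C \<in> sets borel" using S(1) by auto
    have C0': "emeasure \<mu> C = 0" using S(1,2) C(2) emeasure_mono[of C S \<mu>] by simp
    obtain g0 where g0: "lipschitz_compact g0" "(\<integral>x. norm (g x - g0 x) \<partial>\<mu>) < \<delta>"
      using lipschitz_compact_dense[OF g(3) \<delta>] by blast
    have mg0 [measurable]: "g0 \<in> borel_measurable borel" by (rule lipschitz_compact_measurable[OF g0(1)])
    have ig0: "integrable \<mu> g0" by (rule lipschitz_compact_integrable[OF g0(1)])
    note [measurable] = g(1)
    \<comment> \<open>The difference from the Lipschitz approximation is signed, while the weak type
      bound concerns measures; its positive and negative parts are treated as densities.\<close>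
    define gp where "gp y = max 0 (g y - g0 y)" for y
    define gn where "gn y = max 0 (g0 y - g y)" for y
    have mgp: "gp \<in> borel_measurable borel" "gn \<in> borel_measurable borel" unfolding gp_def[abs_def] gn_def[abs_def] by measurable
    have gp0: "0 \<le> gp y" "0 \<le> gn y" for y by (auto simp: gp_def gn_def)
    have igp: "integrable \<mu> gp" "integrable \<mu> gn"
      using g(3) ig0 unfolding gp_def[abs_def] gn_def[abs_def] by auto
    have le\<delta>: "(\<integral>y. gp y \<partial>\<mu>) \<le> \<delta>" "(\<integral>y. gn y \<partial>\<mu>) \<le> \<delta>"
    proof -
      have "(\<integral>y. gp y \<partial>\<mu>) \<le> (\<integral>x. norm (g x - g0 x) \<partial>\<mu>)" "(\<integral>y. gn y \<partial>\<mu>) \<le> (\<integral>x. norm (g x - g0 x) \<partial>\<mu>)"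
        using igp g(3) ig0 by (auto intro!: integral_mono simp: gp_def gn_def)
      then show "(\<integral>y. gp y \<partial>\<mu>) \<le> \<delta>" "(\<integral>y. gn y \<partial>\<mu>) \<le> \<delta>" using g0(2) by linarith+
    qed
    let ?\<nu>1 = "density \<nu> (indicator (S - C))" and ?\<nu>2 = "density \<mu> (\<lambda>y. ennreal (gp y))" and ?\<nu>3 = "density \<mu> (\<lambda>y. ennreal (gn y))"
    let ?\<nu>C = "density \<nu> (indicator C)"
    obtain U1 where U1: "U1 \<in> sets borel" "{x \<in> ball 0 p. \<exists>r>0. \<eta> < norm (Ts ?\<nu>1 r x)} \<subseteq> U1" "emeasure \<mu> U1 \<le> ennreal (e / 3)"
      using cov[of ?\<nu>1] finite_measure_restrict[OF \<nu> mSC] C(3) by auto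
    obtain U2 where U2: "U2 \<in> sets borel" "{x \<in> ball 0 p. \<exists>r>0. \<eta> < norm (Ts ?\<nu>2 r x)} \<subseteq> U2" "emeasure \<mu> U2 \<le> ennreal (e / 3)"
      using cov[of ?\<nu>2] finite_measure_density[OF mgp(1) gp0(1) igp(1)] le\<delta>(1) by auto
    obtain U3 where U3: "U3 \<in> sets borel" "{x \<in> ball 0 p. \<exists>r>0. \<eta> < norm (Ts ?\<nu>3 r x)} \<subseteq> U3" "emeasure \<mu> U3 \<le> ennreal (e / 3)"
      using cov[of ?\<nu>3] finite_measure_density[OF mgp(2) gp0(2) igp(2)] le\<delta>(2) by auto
    define P where "P r x = (\<integral>y. g0 y *\<^sub>R (indicator {y. norm (x - y) > r} y *\<^sub>R K (x - y)) \<partial>\<mu>)" for r x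
    have aeP: "AE x in \<mu>. \<exists>l. ((\<lambda>r. P r x) \<longlongrightarrow> l) (at_right 0)"
      unfolding P_def by (rule sharp_truncations_lipschitz[OF g0(1)])
    obtain N where N: "\<And>x. x \<in> space \<mu> - N \<Longrightarrow> \<exists>l. ((\<lambda>r. P r x) \<longlongrightarrow> l) (at_right 0)" "N \<in> null_sets \<mu>"
      by (rule AE_E3[OF aeP]) (rule that)
    have dec: "Ts \<nu> r x = Ts ?\<nu>C r x + Ts ?\<nu>1 r x + (P r x + Ts ?\<nu>2 r x - Ts ?\<nu>3 r x)" if r: "r > 0" for r x
    proof -
      let ?k = "\<lambda>y. indicator {y. norm (x - y) > r} y *\<^sub>R K (x - y)"
      have ik: "integrable \<nu> ?k" by (rule integrable_sharp[OF \<nu> r])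
      have iA: "integrable \<nu> (\<lambda>y. indicator A y *\<^sub>R ?k y)" if "A \<in> sets borel" for A
        using that \<nu>(2) by (intro integrable_mult_indicator[OF _ ik]) auto
      have "Ts \<nu> r x = (\<integral>y. indicator C y *\<^sub>R ?k y + indicator (S - C) y *\<^sub>R ?k y + indicator (- S) y *\<^sub>R ?k y \<partial>\<nu>)"
        unfolding Ts_def using C(2) by (intro Bochner_Integration.integral_cong) (auto simp: indicator_def)
      also have "\<dots> = (\<integral>y. indicator C y *\<^sub>R ?k y \<partial>\<nu>) + (\<integral>y. indicator (S - C) y *\<^sub>R ?k y \<partial>\<nu>) + (\<integral>y. indicator (- S) y *\<^sub>R ?k y \<partial>\<nu>)"
        using iA[OF mC] iA[OF mSC] iA[OF mS]
        by (simp only: Bochner_Integration.integral_add Bochner_Integration.integrable_add)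
      also have "\<dots> = Ts ?\<nu>C r x + Ts ?\<nu>1 r x + Ts \<nu>a r x"
        unfolding \<nu>a_def Ts_restrict[OF \<nu> r mC] Ts_restrict[OF \<nu> r mSC] Ts_restrict[OF \<nu> r mS] ..
      also have "Ts \<nu>a r x = P r x + Ts ?\<nu>2 r x - Ts ?\<nu>3 r x"
      proof -
        have kb: "integrable \<mu> (\<lambda>y. h y *\<^sub>R ?k y)" if "integrable \<mu> h" for h :: "'a \<Rightarrow> real"
        proof -
          have "integrable \<mu> (\<lambda>y. indicator {y. norm (x - y) > r} y *\<^sub>R (h y *\<^sub>R kr (r / 2) (x - y)))"
            using r that by (intro integrable_mult_indicator integrable_Tf) auto
          then show ?thesis unfolding sharp_kernel_eq[OF r] by (simp add: mult.commute)
        qed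
        have "Ts \<nu>a r x = (\<integral>y. g y *\<^sub>R ?k y \<partial>\<mu>)" unfolding g(4) by (rule Ts_density[OF r g(1,2)])
        also have "\<dots> = (\<integral>y. g0 y *\<^sub>R ?k y + gp y *\<^sub>R ?k y - gn y *\<^sub>R ?k y \<partial>\<mu>)"
        proof (intro Bochner_Integration.integral_cong refl)
          fix y
          have "g y = g0 y + gp y - gn y" by (simp add: gp_def gn_def)
          then show "g y *\<^sub>R ?k y = g0 y *\<^sub>R ?k y + gp y *\<^sub>R ?k y - gn y *\<^sub>R ?k y"
            by (simp only: scaleR_add_left scaleR_diff_left)
        qed
        also have "\<dots> = (\<integral>y. g0 y *\<^sub>R ?k y \<partial>\<mu>) + (\<integral>y. gp y *\<^sub>R ?k y \<partial>\<mu>) - (\<integral>y. gn y *\<^sub>R ?k y \<partial>\<mu>)"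
          using kb[OF ig0] kb[OF igp(1)] kb[OF igp(2)]
          by (simp only: Bochner_Integration.integral_add Bochner_Integration.integral_diff Bochner_Integration.integrable_add)
        also have "\<dots> = P r x + Ts ?\<nu>2 r x - Ts ?\<nu>3 r x"
          unfolding P_def Ts_density[OF r mgp(1) gp0(1)] Ts_density[OF r mgp(2) gp0(2)] ..
        finally show ?thesis .
      qed
      finally show ?thesis .
    qed
    show "\<exists>U\<in>sets borel. {x \<in> ball 0 p. bad \<eta> x} \<subseteq> U \<and> emeasure \<mu> U \<le> ennreal e"
    proof (intro bexI[of _ "(U1 \<union> (U2 \<union> U3)) \<union> (C \<union> N)"] conjI subsetI)
      fix x assume x: "x \<in> {x \<in> ball 0 p. bad \<eta> x}"
      show "x \<in> (U1 \<union> (U2 \<union> U3)) \<union> (C \<union> N)"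
      proof (rule ccontr)
        assume nx: "x \<notin> (U1 \<union> (U2 \<union> U3)) \<union> (C \<union> N)"
        have s1: "norm (Ts ?\<nu>1 r x) \<le> \<eta>" and s2: "norm (Ts ?\<nu>2 r x) \<le> \<eta>" and s3: "norm (Ts ?\<nu>3 r x) \<le> \<eta>" if "r > 0" for r
          using nx U1(2) U2(2) U3(2) x that by (force simp: not_less[symmetric])+
        obtain l where l: "((\<lambda>r. P r x) \<longlongrightarrow> l) (at_right 0)" using nx N(1)[of x] by auto
        have "eventually (\<lambda>r. dist (P r x) l < \<eta> / 2) (at_right 0)" using l \<eta> by (intro tendstoD) auto
        then obtain b1 where b1: "b1 > 0" "\<And>r. 0 < r \<Longrightarrow> r < b1 \<Longrightarrow> dist (P r x) l < \<eta> / 2"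
          unfolding eventually_at_right_field by blast
        obtain b2 where b2: "b2 > 0" "\<And>y. y \<in> C \<Longrightarrow> b2 \<le> dist x y"
          using separate_point_closed[OF compact_imp_closed[OF C(1)], of x] nx by auto
        have TC: "Ts ?\<nu>C r x = Ts ?\<nu>C r' x" if "0 < r" "r < b2" "0 < r'" "r' < b2" for r r'
        proof -
          have "indicator C y *\<^sub>R (indicator {y. norm (x - y) > r} y *\<^sub>R K (x - y)) = indicator C y *\<^sub>R (indicator {y. norm (x - y) > r'} y *\<^sub>R K (x - y))" for y
            using b2(2)[of y] that by (auto simp: indicator_def dist_norm)
          then show ?thesis unfolding Ts_restrict[OF \<nu> that(1) mC] Ts_restrict[OF \<nu> that(3) mC] by presburger
        qed
        have "norm (Ts \<nu> r x - Ts \<nu> r' x) \<le> 7 * \<eta>" if r: "0 < r" "r < min b1 b2" and r': "0 < r'" "r' < min b1 b2" for r r'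
        proof -
          have c: "Ts ?\<nu>C r x = Ts ?\<nu>C r' x" using r r' by (intro TC) auto
          have d: "norm (P r x - P r' x) \<le> \<eta>"
            using b1(2)[of r] b1(2)[of r'] r r' dist_triangle2[of "P r x" "P r' x" l] by (simp add: dist_norm)
          have "Ts \<nu> r x - Ts \<nu> r' x = (P r x - P r' x) + (Ts ?\<nu>1 r x - Ts ?\<nu>1 r' x) + (Ts ?\<nu>2 r x - Ts ?\<nu>2 r' x) - (Ts ?\<nu>3 r x - Ts ?\<nu>3 r' x)"
            unfolding dec[OF r(1)] dec[OF r'(1)] c by simp
          also have "norm \<dots> \<le> norm (P r x - P r' x) + norm (Ts ?\<nu>1 r x - Ts ?\<nu>1 r' x) + norm (Ts ?\<nu>2 r x - Ts ?\<nu>2 r' x) + norm (Ts ?\<nu>3 r x - Ts ?\<nu>3 r' x)"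
            by (intro order_trans[OF norm_triangle_ineq4] add_right_mono order_trans[OF norm_triangle_ineq] order_refl)
          also have "\<dots> \<le> \<eta> + (\<eta> + \<eta>) + (\<eta> + \<eta>) + (\<eta> + \<eta>)"
            using d s1 s2 s3 r r' by (intro add_mono order_trans[OF norm_triangle_ineq4] d) auto
          finally show ?thesis by simp
        qed
        then have "\<not> bad \<eta> x" unfolding bad_def using b1(1) b2(1) by (auto intro!: exI[of _ "min b1 b2"])
        then show False using x by simp
      qed
    next
      have null: "C \<union> N \<in> null_sets \<mu>" using N(2) C0' mC by (intro null_sets.Un) auto
      have "emeasure \<mu> ((U1 \<union> (U2 \<union> U3)) \<union> (C \<union> N)) = emeasure \<mu> (U1 \<union> (U2 \<union> U3))"
        using null U1 U2 U3 by (intro emeasure_Un_null_set) auto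
      also have "\<dots> \<le> emeasure \<mu> U1 + (emeasure \<mu> U2 + emeasure \<mu> U3)"
        using U1 U2 U3 by (intro order_trans[OF emeasure_subadditive] add_left_mono emeasure_subadditive) auto
      also have "\<dots> \<le> ennreal (e / 3) + (ennreal (e / 3) + ennreal (e / 3))" by (intro add_mono U1 U2 U3)
      also have "\<dots> = ennreal e" using e by (simp flip: ennreal_plus)
      finally show "emeasure \<mu> ((U1 \<union> (U2 \<union> U3)) \<union> (C \<union> N)) \<le> ennreal e" .
      show "(U1 \<union> (U2 \<union> U3)) \<union> (C \<union> N) \<in> sets borel" using U1 U2 U3 null by auto
    qed
  qed
  have "AE x in \<mu>. \<forall>n k::nat. x \<notin> {x \<in> ball 0 (real n). bad (1 / real (Suc k)) x}"
    unfolding AE_all_countable using * by auto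
  then show ?thesis
  proof eventually_elim
    case (elim x)
    show ?case
    proof (rule at_right_limit_of_Cauchy)
      fix e :: real assume e: "e > 0"
      obtain n where n: "norm x < real n" using reals_Archimedean2 by blast
      obtain k where k: "1 / real (Suc k) < e / 7" using nat_approx_posE[of "e / 7"] e by auto
      have "\<not> bad (1 / real (Suc k)) x" using elim n by auto
      then obtain b where b: "b > 0" "\<And>r r'. 0 < r \<Longrightarrow> r < b \<Longrightarrow> 0 < r' \<Longrightarrow> r' < b \<Longrightarrow> norm (Ts \<nu> r x - Ts \<nu> r' x) \<le> 7 * (1 / real (Suc k))"
        unfolding bad_def by blast
      have "7 * (1 / real (Suc k)) \<le> e" using k by linarith
      then show "\<exists>b>0. \<forall>r r'. 0 < r \<longrightarrow> r < b \<longrightarrow> 0 < r' \<longrightarrow> r' < b \<longrightarrow> norm (Ts \<nu> r x - Ts \<nu> r' x) \<le> e"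
        using b order_trans by blast
    qed
  qed
qed

end

section \<open>Principal values of complex measures\<close>

text \<open>A set on whose subsets \<rho> is unbounded splits into two pieces of value at least 1 in
  modulus, one of which is again of this kind. Iteration yields disjoint sets whose values do not
  tend to 0, against countable additivity.\<close>

lemma countably_additive_bounded:
  fixes \<rho> :: "'a::topological_space set \<Rightarrow> real"
  assumes \<rho>0: "\<rho> {} = 0"
    and ca: "\<And>A :: nat \<Rightarrow> 'a set. range A \<subseteq> sets borel \<Longrightarrow> disjoint_family A \<Longrightarrow>
               (\<lambda>i. \<rho> (A i)) sums \<rho> (\<Union>i. A i)"
  shows "\<exists>M. \<forall>A\<in>sets borel. \<bar>\<rho> A\<bar> \<le> M"
proof (rule ccontr)
  assume unbdd: "\<not> (\<exists>M. \<forall>A\<in>sets borel. \<bar>\<rho> A\<bar> \<le> M)"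
  have add: "\<rho> (A \<union> B) = \<rho> A + \<rho> B"
    if "A \<in> sets borel" "B \<in> sets borel" "A \<inter> B = {}" for A B
  proof -
    have "(\<lambda>i. \<rho> (binaryset A B i)) sums \<rho> (\<Union>i. binaryset A B i)"
      using that by (intro ca) (auto simp: binaryset_def disjoint_family_on_def)
    moreover have "(\<lambda>i. \<rho> (binaryset A B i)) sums (\<rho> A + \<rho> B)"
      using \<rho>0 by (intro binaryset_sums) auto
    ultimately show ?thesis by (simp add: sums_unique2 UN_binaryset_eq)
  qed
  have split: "\<rho> A = \<rho> (A \<inter> E) + \<rho> (A - E)" if "A \<in> sets borel" "E \<in> sets borel" for A E
    using add[of "A \<inter> E" "A - E"] that by (simp add: Int_Diff_Un Int_Diff_disjoint)
  define bad where "bad A \<longleftrightarrow> A \<in> sets borel \<and> (\<forall>M. \<exists>B\<in>sets borel. B \<subseteq> A \<and> \<bar>\<rho> B\<bar> > M)" for A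
  have bad_split: "bad (A \<inter> E) \<or> bad (A - E)" if A: "bad A" and E: "E \<in> sets borel" for A E
  proof (rule ccontr)
    assume "\<not> (bad (A \<inter> E) \<or> bad (A - E))"
    then have nb: "\<not> bad (A \<inter> E)" "\<not> bad (A - E)" by auto
    have bd: "\<exists>M. \<forall>B\<in>sets borel. B \<subseteq> X \<longrightarrow> \<bar>\<rho> B\<bar> \<le> M" if "\<not> bad X" "X \<in> sets borel" for X
      using that unfolding bad_def by (auto simp: not_less)
    have mAE: "A \<inter> E \<in> sets borel" "A - E \<in> sets borel" using A E by (auto simp: bad_def)
    obtain M1 where M1: "\<forall>B\<in>sets borel. B \<subseteq> A \<inter> E \<longrightarrow> \<bar>\<rho> B\<bar> \<le> M1" using bd[OF nb(1) mAE(1)] ..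
    obtain M2 where M2: "\<forall>B\<in>sets borel. B \<subseteq> A - E \<longrightarrow> \<bar>\<rho> B\<bar> \<le> M2" using bd[OF nb(2) mAE(2)] ..
    obtain B where B: "B \<in> sets borel" "B \<subseteq> A" "\<bar>\<rho> B\<bar> > M1 + M2" using A unfolding bad_def by blast
    have "B \<inter> E \<in> sets borel" "B - E \<in> sets borel" "B \<inter> E \<subseteq> A \<inter> E" "B - E \<subseteq> A - E" using B E by auto
    then have "\<bar>\<rho> (B \<inter> E)\<bar> \<le> M1" "\<bar>\<rho> (B - E)\<bar> \<le> M2" using M1 M2 by auto
    then show False using split[OF B(1) E] B(3) by linarith
  qed
  have step: "\<exists>B. bad B \<and> (B \<subseteq> A \<and> \<bar>\<rho> (A - B)\<bar> \<ge> 1)" if A: "bad A" for A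
  proof -
    \<comment> \<open>The margin \<open>\<bar>\<rho> A\<bar> + 1\<close> forces the complement of
      \<open>E\<close> in \<open>A\<close> to have value at least 1 in modulus as well.\<close>
    obtain E where E: "E \<in> sets borel" "E \<subseteq> A" "\<bar>\<rho> E\<bar> > \<bar>\<rho> A\<bar> + 1" using A unfolding bad_def by blast
    have AE: "A \<inter> E = E" "A - (A - E) = E" using E(2) by auto
    have "A \<in> sets borel" using A by (simp add: bad_def)
    then have "\<rho> A = \<rho> E + \<rho> (A - E)" using split[of A E] E(1) AE(1) by simp
    then have big: "\<bar>\<rho> E\<bar> \<ge> 1" "\<bar>\<rho> (A - E)\<bar> \<ge> 1" using E(3) by linarith+
    from bad_split[OF A E(1)] show ?thesis
    proof
      assume "bad (A \<inter> E)"
      then show ?thesis using big(2) AE(1) E(2) by (intro exI[of _ E]) simp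
    next
      assume "bad (A - E)"
      then show ?thesis using big(1) AE(2) by (intro exI[of _ "A - E"]) auto
    qed
  qed
  have "bad UNIV" using unbdd unfolding bad_def by (auto simp: not_le)
  then have "\<exists>F. \<forall>n. bad (F n) \<and> (F (Suc n) \<subseteq> F n \<and> \<bar>\<rho> (F n - F (Suc n))\<bar> \<ge> 1)"
    by (intro dependent_nat_choice[of "\<lambda>n. bad" "\<lambda>n A B. B \<subseteq> A \<and> \<bar>\<rho> (A - B)\<bar> \<ge> 1"] step exI)
  then obtain F where "\<forall>n. bad (F n) \<and> (F (Suc n) \<subseteq> F n \<and> \<bar>\<rho> (F n - F (Suc n))\<bar> \<ge> 1)" ..
  then have F: "\<And>n. bad (F n)" "\<And>n. F (Suc n) \<subseteq> F n \<and> \<bar>\<rho> (F n - F (Suc n))\<bar> \<ge> 1" by simp_all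
  have dec: "F n \<subseteq> F m" if "m \<le> n" for m n
    using that by (rule lift_Suc_antimono_le[rotated]) (simp add: F(2))
  have "disjoint_family (\<lambda>n. F n - F (Suc n))"
    unfolding disjoint_family_on_def
  proof (intro ballI impI)
    fix m n :: nat assume "m \<noteq> n"
    then consider "Suc m \<le> n" | "Suc n \<le> m" by linarith
    then show "(F m - F (Suc m)) \<inter> (F n - F (Suc n)) = {}"

    proof cases
      case 1
      then have "F n \<subseteq> F (Suc m)" by (rule dec)
      then show ?thesis by blast
    next
      case 2
      then have "F m \<subseteq> F (Suc n)" by (rule dec)
      then show ?thesis by blast
    qed
  qed
  moreover have "range (\<lambda>n. F n - F (Suc n)) \<subseteq> sets borel" using F(1) unfolding bad_def by auto
  ultimately have "summable (\<lambda>n. \<rho> (F n - F (Suc n)))" using ca sums_summable by blast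
  then have "(\<lambda>n. \<rho> (F n - F (Suc n))) \<longlonglongrightarrow> 0" by (rule summable_LIMSEQ_zero)
  then have "eventually (\<lambda>n. \<bar>\<rho> (F n - F (Suc n))\<bar> < 1) sequentially"
    by (auto simp: dist_norm dest: tendstoD[where e=1])
  then obtain n where "\<bar>\<rho> (F n - F (Suc n))\<bar> < 1" by (auto simp: eventually_sequentially)
  then show False using F(2)[of n] by linarith
qed

lemma finite_positive_variation:
  fixes \<rho> :: "'a::topological_space set \<Rightarrow> real"
  assumes \<rho>0: "\<rho> {} = 0"
    and ca: "\<And>A :: nat \<Rightarrow> 'a set. range A \<subseteq> sets borel \<Longrightarrow> disjoint_family A \<Longrightarrow>
               (\<lambda>i. \<rho> (A i)) sums \<rho> (\<Union>i. A i)"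
  shows "sets (positive_variation \<rho>) = sets borel" "finite_measure (positive_variation \<rho>)"
proof -
  have sp: "space (positive_variation \<rho>) = UNIV"
    unfolding positive_variation_def by (rule space_measure_of) simp
  show "sets (positive_variation \<rho>) = sets borel"
    unfolding positive_variation_def
    using sets.sigma_sets_eq[of "borel :: 'a measure"] by (subst sets_measure_of) auto
  obtain M where M: "\<And>A. A \<in> sets borel \<Longrightarrow> \<bar>\<rho> A\<bar> \<le> M"
    using countably_additive_bounded[OF \<rho>0 ca] by blast
  have "emeasure (positive_variation \<rho>) UNIV \<le> ennreal M"
    using M by (subst emeasure_positive_variation[OF \<rho>0 ca]) (auto intro!: SUP_least ennreal_leI simp: abs_le_iff)
  then show "finite_measure (positive_variation \<rho>)"
    by (intro finite_measureI) (auto simp: sp top_unique)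
qed

lemma tendsto_vector_scalar_mult:
  fixes f :: "'b \<Rightarrow> complex^'n"
  assumes "(f \<longlongrightarrow> l) F"
  shows "((\<lambda>x. c *s f x) \<longlongrightarrow> c *s l) F"
proof (rule vec_tendstoI)
  fix i
  have "((\<lambda>x. f x $ i) \<longlongrightarrow> l $ i) F" using assms by (rule tendsto_vec_nth)
  then show "((\<lambda>x. (c *s f x) $ i) \<longlongrightarrow> (c *s l) $ i) F" by (auto intro: tendsto_intros)
qed

text \<open>By definition of the integral, four finite positive measures have to be treated, and
  their limits are combined linearly.\<close>

lemma principal_value_complex_measure:
  fixes K :: "real^'n \<Rightarrow> complex^'n"
  assumes "flat_cz \<mu> s K C0 C2 \<phi>"
  shows "exists_principal_value K \<mu>"
  unfolding exists_principal_value_def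
proof (intro allI impI)
  fix \<nu> :: "(real^'n) set \<Rightarrow> complex" assume \<nu>: "complex_measure \<nu>"
  interpret flat_cz \<mu> s K C0 C2 \<phi> by fact
  have pv: "AE x in \<mu>. \<exists>l. ((\<lambda>r. \<integral>y. indicator {y. norm (x - y) > r} y *\<^sub>R K (x - y) \<partial>positive_variation \<rho>) \<longlongrightarrow> l) (at_right 0)"
    if "\<rho> {} = 0" "\<And>A :: nat \<Rightarrow> (real^'n) set. range A \<subseteq> sets borel \<Longrightarrow> disjoint_family A \<Longrightarrow> (\<lambda>i. \<rho> (A i)) sums \<rho> (\<Union>i. A i)" for \<rho>
    using principal_value_finite_measure[OF finite_positive_variation(2,1)[OF that]] unfolding Ts_def .
  have \<nu>0: "\<nu> {} = 0" and sums: "\<And>A :: nat \<Rightarrow> (real^'n) set. range A \<subseteq> sets borel \<Longrightarrow> disjoint_family A \<Longrightarrow> (\<lambda>i. \<nu> (A i)) sums \<nu> (\<Union>i. A i)"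
    using \<nu> unfolding complex_measure_def by auto
  have ae: "AE x in \<mu>. \<exists>l. ((\<lambda>r. \<integral>y. indicator {y. norm (x - y) > r} y *\<^sub>R K (x - y) \<partial>positive_variation (\<lambda>A. Re (\<nu> A))) \<longlongrightarrow> l) (at_right 0)"
    "AE x in \<mu>. \<exists>l. ((\<lambda>r. \<integral>y. indicator {y. norm (x - y) > r} y *\<^sub>R K (x - y) \<partial>positive_variation (\<lambda>A. - Re (\<nu> A))) \<longlongrightarrow> l) (at_right 0)"
    "AE x in \<mu>. \<exists>l. ((\<lambda>r. \<integral>y. indicator {y. norm (x - y) > r} y *\<^sub>R K (x - y) \<partial>positive_variation (\<lambda>A. Im (\<nu> A))) \<longlongrightarrow> l) (at_right 0)"
    "AE x in \<mu>. \<exists>l. ((\<lambda>r. \<integral>y. indicator {y. norm (x - y) > r} y *\<^sub>R K (x - y) \<partial>positive_variation (\<lambda>A. - Im (\<nu> A))) \<longlongrightarrow> l) (at_right 0)"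
    using \<nu>0 sums by (auto intro!: pv sums_minus sums_Re sums_Im)
  show "AE x in \<mu>. \<exists>l. ((\<lambda>r. complex_measure_integral \<nu>
             (\<lambda>y. indicator {y. norm (x - y) > r} y *\<^sub>R K (x - y))) \<longlongrightarrow> l) (at_right 0)"
    using ae
  proof eventually_elim
    case (elim x)
    then obtain l1 l2 l3 l4 where "((\<lambda>r. \<integral>y. indicator {y. norm (x - y) > r} y *\<^sub>R K (x - y) \<partial>positive_variation (\<lambda>A. Re (\<nu> A))) \<longlongrightarrow> l1) (at_right 0)"
      "((\<lambda>r. \<integral>y. indicator {y. norm (x - y) > r} y *\<^sub>R K (x - y) \<partial>positive_variation (\<lambda>A. - Re (\<nu> A))) \<longlongrightarrow> l2) (at_right 0)"
      "((\<lambda>r. \<integral>y. indicator {y. norm (x - y) > r} y *\<^sub>R K (x - y) \<partial>positive_variation (\<lambda>A. Im (\<nu> A))) \<longlongrightarrow> l3) (at_right 0)"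
      "((\<lambda>r. \<integral>y. indicator {y. norm (x - y) > r} y *\<^sub>R K (x - y) \<partial>positive_variation (\<lambda>A. - Im (\<nu> A))) \<longlongrightarrow> l4) (at_right 0)"
      by blast
    then have "((\<lambda>r. complex_measure_integral \<nu> (\<lambda>y. indicator {y. norm (x - y) > r} y *\<^sub>R K (x - y))) \<longlongrightarrow> (l1 - l2) + \<i> *s (l3 - l4)) (at_right 0)"
      unfolding complex_measure_integral_def by (intro tendsto_add tendsto_diff tendsto_vector_scalar_mult)
    then show ?case by (rule exI)
  qed
qed

text \<open>The analysis is carried out with real densities and with \<open>complex^'n\<close> as a
  real Euclidean space; a real \<open>f\<close> is tested as a complex function, and sharp
  truncations are exchanged for smooth ones by \<open>smooth_truncation_L2\<close>.\<close>

lemma cz_L2_of_CZ_bounded_in_L2: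
  fixes K :: "real^'n \<Rightarrow> complex^'n"
  assumes s: "0 < s" and \<mu>: "\<mu> \<in> growth_measures s" and K: "CZ_kernel s K" and T: "CZ_bounded_in_L2 K \<mu>"
  obtains C0 C2 where "cz_L2 \<mu> s K C0 C2"
proof -
  obtain C0 where C0: "C0 > 0"
    "\<And>x x'. x \<noteq> 0 \<Longrightarrow> x' \<noteq> 0 \<Longrightarrow> norm (K x) \<le> C0 / norm x ^ s \<and> K (- x) = - K x \<and>
       (norm (x - x') \<le> norm x / 2 \<longrightarrow> norm (K x - K x') \<le> C0 * norm (x - x') / norm x ^ (s + 1))"
    using K unfolding CZ_kernel_def by blast
  interpret cz \<mu> s K C0
  proof
    show "sets \<mu> = sets borel" using \<mu> by (simp add: growth_measures_def locally_finite_borel_measure_def)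
    show "emeasure \<mu> (ball x r) \<le> ennreal (r ^ s)" if "r > 0" for x r
      using \<mu> that by (simp add: growth_measures_def)
    show "norm (K x) \<le> C0 / norm x ^ s" "K (- x) = - K x" if "x \<noteq> 0" for x
      using C0(2)[OF that that] by auto
    show "norm (K x - K x') \<le> C0 * norm (x - x') / norm x ^ (s + 1)"
      if "x \<noteq> 0" "x' \<noteq> 0" "norm (x - x') \<le> norm x / 2" for x x'
      using C0(2)[OF that(1,2)] that(3) by auto
  qed (rule s C0(1))+
  obtain C where C: "C > 0" "\<And>f. f \<in> L2_functions \<mu> \<Longrightarrow>
     (SUP \<epsilon>\<in>{0<..}. \<integral>\<^sup>+x. ennreal ((norm (truncated_CZ K \<mu> \<epsilon> f x))\<^sup>2) \<partial>\<mu>) \<le> ennreal (C * (\<integral>y. (norm (f y))\<^sup>2 \<partial>\<mu>))"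
    using T unfolding CZ_bounded_in_L2_def by blast
  have "cz_L2 \<mu> s K C0 (2 * C + 2 * C0\<^sup>2 * 4 ^ s)"
  proof
    show "0 < 2 * C + 2 * C0\<^sup>2 * 4 ^ s" using C(1) by (intro add_pos_nonneg) auto
    fix r :: real and f :: "real^'n \<Rightarrow> real"
    assume r: "r > 0" and f: "f \<in> borel_measurable borel" "integrable \<mu> f" "integrable \<mu> (\<lambda>y. (f y)\<^sup>2)"
    have eq: "(\<integral>\<^sup>+y. ennreal ((f y)\<^sup>2) \<partial>\<mu>) = ennreal (\<integral>y. (f y)\<^sup>2 \<partial>\<mu>)"
      using f(3) by (intro nn_integral_eq_integral) auto
    have "(\<lambda>y. complex_of_real (f y)) \<in> L2_functions \<mu>"
      using f by (simp add: L2_functions_def)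
    from C(2)[OF this] have "(SUP \<epsilon>\<in>{0<..}. \<integral>\<^sup>+x. ennreal ((norm (truncated_CZ K \<mu> \<epsilon> (\<lambda>y. complex_of_real (f y)) x))\<^sup>2) \<partial>\<mu>) \<le> ennreal (C * (\<integral>y. (f y)\<^sup>2 \<partial>\<mu>))"
      by simp
    then have "(\<integral>\<^sup>+x. ennreal ((norm (truncated_CZ K \<mu> r (\<lambda>y. complex_of_real (f y)) x))\<^sup>2) \<partial>\<mu>) \<le> ennreal (C * (\<integral>y. (f y)\<^sup>2 \<partial>\<mu>))"
      using r by (rule_tac order_trans[OF SUP_upper]) auto
    moreover have "complex_of_real c *s v = c *\<^sub>R v" for c and v :: "complex^'n"
      by (simp add: vec_eq_iff scaleR_conv_of_real[of c "v $ i" for i])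
    then have "truncated_CZ K \<mu> r (\<lambda>y. complex_of_real (f y)) x = (\<integral>y. indicator (- ball x r) y *\<^sub>R (f y *\<^sub>R K (x - y)) \<partial>\<mu>)" for x
      by (simp only: truncated_CZ_def set_lebesgue_integral_def)
    ultimately have "(\<integral>\<^sup>+x. ennreal ((norm (\<integral>y. indicator (- ball x r) y *\<^sub>R (f y *\<^sub>R K (x - y)) \<partial>\<mu>))\<^sup>2) \<partial>\<mu>)
        \<le> ennreal C * (\<integral>\<^sup>+y. ennreal ((f y)\<^sup>2) \<partial>\<mu>)"
      unfolding eq using C(1) by (simp add: ennreal_mult)
    from smooth_truncation_L2[OF f(1,2) r this] C(1)
    show "(\<integral>\<^sup>+x. ennreal ((norm (Tf f r x))\<^sup>2) \<partial>\<mu>) \<le> ennreal ((2 * C + 2 * C0\<^sup>2 * 4 ^ s) * (\<integral>y. (f y)\<^sup>2 \<partial>\<mu>))"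
      unfolding eq by (simp add: ennreal_mult)
  qed
  then show ?thesis by (rule that)
qed

theorem theorem1p4:
  fixes \<phi> :: "real \<Rightarrow> real" and s :: nat
    and \<mu> :: "(real^'n) measure" and K :: "real^'n \<Rightarrow> complex^'n"
  assumes "smooth_cutoff \<phi>"
    and "CARD('n) \<ge> 2"
    and "0 < s" and "s < CARD('n)"
    and "\<mu> \<in> growth_measures s"
    and "CZ_kernel s K"
    and "CZ_bounded_in_L2 K \<mu>"
    and "AE x in \<mu>. ((\<lambda>r. alpha_flat \<phi> s \<mu> x r) \<longlongrightarrow> 0) (at_right 0)"
  shows "exists_principal_value K \<mu>"
proof -
  obtain C0 C2 where cz: "cz_L2 \<mu> s K C0 C2"
    using cz_L2_of_CZ_bounded_in_L2[OF assms(3,5-7)] .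
  have "flat_cz \<mu> s K C0 C2 \<phi>"
    using cz assms(1,8) by (intro flat_cz.intro cutoff.intro flat_cz_axioms.intro)
  then show ?thesis by (rule principal_value_complex_measure)
qed

end
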